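(* Let $K$ be a field of characteristic different from $2$. Let $(A,\sigma)$ be a $K$-algebra with symplectic involution with $\deg(A)=8$, and assume that $\operatorname{ind}(A)\leq 2$. Then the algebraic group $\mathbf{PSim}(A,\sigma)$ is $R$-trivial.
   Context: A $K$-algebra with symplectic involution $(A,\sigma)$ is a central simple (finite-dimensional) $K$-algebra $A$ together with a $K$-linear anti-automorphism $\sigma$ of $A$ with $\sigma^2=\mathrm{id}_A$, of symplectic type (i.e. over a splitting field of $A$ it becomes adjoint to an alternating bilinear form). The degree $\deg(A)$ is $\sqrt{\dim_K A}$, and the index $\operatorname{ind}(A)$ is the degree of the central division $K$-algebra $D$ with $A\simeq M_r(D)$. A similitude of $(A,\sigma)$ is an element $a\in A^\times$ with $\sigma(a)a\in K^\times$; similitudes form a group $\mathrm{Sim}(A,\sigma)$, and $\mathrm{PSim}(A,\sigma)=\mathrm{Sim}(A,\sigma)/K^\times$. For a field extension $K'/K$ let $(A_{K'},\sigma_{K'})=(A\otimes_K K',\sigma\otimes \mathrm{id}_{K'})$. The algebraic group $\mathbf{PSim}(A,\sigma)$ over $K$ is given by $\mathbf{PSim}(A,\sigma)(K')=\mathrm{PSim}(A_{K'},\sigma_{K'})$ for field extensions $K'/K$. For an algebraic group $G$ over $K$ and a field extension $K'/K$, $G(K')/R$ denotes the quotient group of $G(K')$ modulo Manin's $R$-equivalence: the equivalence relation generated by declaring $x,y\in G(K')$ equivalent if there is a rational map $f:\mathbb{A}^1_{K'}\dashrightarrow G_{K'}$, defined at $0$ and $1$, with $f(0)=x$ and $f(1)=y$.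 The group $G$ is called $R$-trivial if $G(K')/R$ is trivial for every field extension $K'/K$. *)

theory Defs
  imports
    Complex_Main
    "HOL-Library.Poly_Mapping"
    "HOL-Library.FuncSet"
    "HOL-Computational_Algebra.Computational_Algebra"
    "HOL-Algebra.Algebra"
    "HOL-Algebra.Algebraic_Closure_Type"
begin

section \<open>Conventions\<close>

text \<open>
  Fields are types of class \<^class>\<open>field\<close>; \<^const>\<open>ring_of_type_algebra\<close> turns such a type into a
  ring record. Algebras are carrier-based, possibly noncommutative, \<^type>\<open>module_ext\<close> records.
  (The library locale \<^locale>\<open>algebra\<close> only covers commutative algebras.)
\<close>

definition field_extension :: "('k::field \<Rightarrow> 'l::field) \<Rightarrow> bool" where
  "field_extension \<iota> \<longleftrightarrow> \<iota> \<in> ring_hom ring_of_type_algebra ring_of_type_algebra"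


section \<open>Central simple algebras\<close>

definition is_algebra :: "('k::field, 'a) module \<Rightarrow> bool" where
  "is_algebra A \<longleftrightarrow>
     ring A \<and> module (ring_of_type_algebra :: 'k ring) A \<and>
     (\<forall>c. \<forall>x\<in>carrier A. \<forall>y\<in>carrier A.
        (c \<odot>\<^bsub>A\<^esub> x) \<otimes>\<^bsub>A\<^esub> y = c \<odot>\<^bsub>A\<^esub> (x \<otimes>\<^bsub>A\<^esub> y) \<and>
        x \<otimes>\<^bsub>A\<^esub> (c \<odot>\<^bsub>A\<^esub> y) = c \<odot>\<^bsub>A\<^esub> (x \<otimes>\<^bsub>A\<^esub> y))"

definition scalars :: "('k::field, 'a) module \<Rightarrow> 'a set" where
  "scalars A = range (\<lambda>c. c \<odot>\<^bsub>A\<^esub> \<one>\<^bsub>A\<^esub>)"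

definition central_simple :: "('k::field, 'a) module \<Rightarrow> bool" where
  "central_simple A \<longleftrightarrow>
     is_algebra A \<and>
     ring.finite_dimension A (scalars A) (carrier A) \<and>
     {z \<in> carrier A. \<forall>x\<in>carrier A. z \<otimes>\<^bsub>A\<^esub> x = x \<otimes>\<^bsub>A\<^esub> z} = scalars A \<and>
     carrier A \<noteq> {\<zero>\<^bsub>A\<^esub>} \<and>
     (\<forall>I. ideal I A \<longrightarrow> I = {\<zero>\<^bsub>A\<^esub>} \<or> I = carrier A)"

definition central_division :: "('k::field, 'a) module \<Rightarrow> bool" where
  "central_division D \<longleftrightarrow> central_simple D \<and> Units D = carrier D - {\<zero>\<^bsub>D\<^esub>}"

definition alg_deg :: "('k::field, 'a) module \<Rightarrow> real" where
  "alg_deg A = sqrt (real (ring.dim A (scalars A) (carrier A)))"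

definition alg_iso :: "('k::field, 'a) module \<Rightarrow> ('k, 'b) module \<Rightarrow> ('a \<Rightarrow> 'b) set" where
  "alg_iso A B =
     {\<phi> \<in> ring_iso A B. \<forall>c. \<forall>x\<in>carrier A. \<phi> (c \<odot>\<^bsub>A\<^esub> x) = c \<odot>\<^bsub>B\<^esub> \<phi> x}"

definition matrix_algebra :: "nat \<Rightarrow> ('k::field, 'a) module \<Rightarrow> ('k, nat \<times> nat \<Rightarrow> 'a) module" where
  "matrix_algebra n D =
     (let J = {..<n} \<times> {..<n} in
      \<lparr>carrier = J \<rightarrow>\<^sub>E carrier D,
       monoid.mult = (\<lambda>M N. \<lambda>(i, j)\<in>J. \<Oplus>\<^bsub>D\<^esub>k\<in>{..<n}. M (i, k) \<otimes>\<^bsub>D\<^esub> N (k, j)),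
       one = (\<lambda>(i, j)\<in>J. if i = j then \<one>\<^bsub>D\<^esub> else \<zero>\<^bsub>D\<^esub>),
       ring.zero = (\<lambda>p\<in>J. \<zero>\<^bsub>D\<^esub>),
       add = (\<lambda>M N. \<lambda>p\<in>J. M p \<oplus>\<^bsub>D\<^esub> N p),
       module.smult = (\<lambda>c M. \<lambda>p\<in>J. c \<odot>\<^bsub>D\<^esub> M p)\<rparr>)"

text \<open>
  The division algebra \<open>D\<close> with \<open>A \<simeq> M\<^sub>r(D)\<close> may be sought with its elements in the type of the
  elements of \<open>A\<close>: it embeds into \<open>A\<close> as the scalar matrices.
\<close>

definition alg_ind :: "('k::field, 'a) module \<Rightarrow> real" where
  "alg_ind A =
     (THE m. \<exists>(D :: ('k, 'a) module) r.
        central_division D \<and> alg_deg D = m \<and> alg_iso A (matrix_algebra r D) \<noteq> {})"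


section \<open>Scalar extension\<close>

text \<open>
  \<open>A \<otimes>\<^sub>K L\<close>, for \<open>L\<close> an extension of \<open>K\<close> along \<open>\<iota>\<close>: the free abelian group on
  \<open>A \<times> L\<close>, with the product extending \<open>(a, l)(b, m) = (ab, lm)\<close>, modulo the
  ideal generated by the relations of additivity in each factor and \<open>K\<close>-balancedness. As the set of
  relations is stable under multiplication by generators, this ideal is the subgroup they generate,
  so the quotient is the usual tensor product.
\<close>

definition formal_tensors :: "('k::field, 'a) module \<Rightarrow> (('a \<times> 'l::field) \<Rightarrow>\<^sub>0 int) ring" where
  "formal_tensors A =
     \<lparr>carrier = {u. Poly_Mapping.keys u \<subseteq> carrier A \<times> UNIV},
      monoid.mult = (\<lambda>u v. frag_extend (\<lambda>(a, l).
                frag_extend (\<lambda>(b, m). frag_of (a \<otimes>\<^bsub>A\<^esub> b, l * m)) v) u),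
      one = frag_of (\<one>\<^bsub>A\<^esub>, 1),
      ring.zero = 0,
      add = (+)\<rparr>"

definition tensor_relations ::
    "('k::field \<Rightarrow> 'l::field) \<Rightarrow> ('k, 'a) module \<Rightarrow> (('a \<times> 'l) \<Rightarrow>\<^sub>0 int) set" where
  "tensor_relations \<iota> A =
     {frag_of (a \<oplus>\<^bsub>A\<^esub> b, l) - frag_of (a, l) - frag_of (b, l) | a b l.
        a \<in> carrier A \<and> b \<in> carrier A} \<union>
     {frag_of (a, l + m) - frag_of (a, l) - frag_of (a, m) | a l m. a \<in> carrier A} \<union>
     {frag_of (c \<odot>\<^bsub>A\<^esub> a, l) - frag_of (a, \<iota> c * l) | c a l. a \<in> carrier A}"

definition tensor_ideal ::
    "('k::field \<Rightarrow> 'l::field) \<Rightarrow> ('k, 'a) module \<Rightarrow> (('a \<times> 'l) \<Rightarrow>\<^sub>0 int) set" where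
  "tensor_ideal \<iota> A = Idl\<^bsub>formal_tensors A\<^esub> (tensor_relations \<iota> A)"

definition tensor_class ::
    "('k::field \<Rightarrow> 'l::field) \<Rightarrow> ('k, 'a) module \<Rightarrow> (('a \<times> 'l) \<Rightarrow>\<^sub>0 int) \<Rightarrow>
     (('a \<times> 'l) \<Rightarrow>\<^sub>0 int) set" where
  "tensor_class \<iota> A u = tensor_ideal \<iota> A +>\<^bsub>formal_tensors A\<^esub> u"

definition pure_tensor ::
    "('k::field \<Rightarrow> 'l::field) \<Rightarrow> ('k, 'a) module \<Rightarrow> 'a \<Rightarrow> 'l \<Rightarrow> (('a \<times> 'l) \<Rightarrow>\<^sub>0 int) set" where
  "pure_tensor \<iota> A a l = tensor_class \<iota> A (frag_of (a, l))"

definition base_change ::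
    "('k::field \<Rightarrow> 'l::field) \<Rightarrow> ('k, 'a) module \<Rightarrow> ('l, (('a \<times> 'l) \<Rightarrow>\<^sub>0 int) set) module" where
  "base_change \<iota> A =
     (let Q = formal_tensors A Quot tensor_ideal \<iota> A in
      \<lparr>carrier = carrier Q,
       monoid.mult = monoid.mult Q,
       one = one Q,
       ring.zero = ring.zero Q,
       add = add Q,
       module.smult = (\<lambda>l x. pure_tensor \<iota> A \<one>\<^bsub>A\<^esub> l \<otimes>\<^bsub>Q\<^esub> x)\<rparr>)"

definition base_change_map ::
    "('k::field \<Rightarrow> 'l::field) \<Rightarrow> ('k, 'a) module \<Rightarrow> ('a \<Rightarrow> 'a) \<Rightarrow>
     (('a \<times> 'l) \<Rightarrow>\<^sub>0 int) set \<Rightarrow> (('a \<times> 'l) \<Rightarrow>\<^sub>0 int) set" where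
  "base_change_map \<iota> A \<sigma> x =
     (\<Union>u\<in>x. tensor_class \<iota> A (frag_extend (\<lambda>(a, l). frag_of (\<sigma> a, l)) u))"


section \<open>Symplectic involutions\<close>

definition involution :: "('k::field, 'a) module \<Rightarrow> ('a \<Rightarrow> 'a) \<Rightarrow> bool" where
  "involution A \<sigma> \<longleftrightarrow>
     \<sigma> \<in> carrier A \<rightarrow> carrier A \<and>
     (\<forall>x\<in>carrier A. \<forall>y\<in>carrier A.
        \<sigma> (x \<oplus>\<^bsub>A\<^esub> y) = \<sigma> x \<oplus>\<^bsub>A\<^esub> \<sigma> y \<and> \<sigma> (x \<otimes>\<^bsub>A\<^esub> y) = \<sigma> y \<otimes>\<^bsub>A\<^esub> \<sigma> x) \<and>
     (\<forall>c. \<forall>x\<in>carrier A. \<sigma> (c \<odot>\<^bsub>A\<^esub> x) = c \<odot>\<^bsub>A\<^esub> \<sigma> x) \<and>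
     (\<forall>x\<in>carrier A. \<sigma> (\<sigma> x) = x)"

definition field_algebra :: "('l::field, 'l) module" where
  "field_algebra = \<lparr>carrier = UNIV, monoid.mult = (*), one = 1, ring.zero = 0, add = (+), module.smult = (*)\<rparr>"

text \<open>
  Vectors of \<open>L\<^sup>n\<close> are functions of which only the values below \<open>n\<close> matter; \<open>gram_form n G\<close> is the
  bilinear form on \<open>L\<^sup>n\<close> with Gram matrix \<open>G\<close>.
\<close>

definition gram_form ::
    "nat \<Rightarrow> (nat \<times> nat \<Rightarrow> 'l::field) \<Rightarrow> (nat \<Rightarrow> 'l) \<Rightarrow> (nat \<Rightarrow> 'l) \<Rightarrow> 'l" where
  "gram_form n G x y = (\<Sum>i<n. \<Sum>j<n. x i * G (i, j) * y j)"

definition mat_vec :: "nat \<Rightarrow> (nat \<times> nat \<Rightarrow> 'l::field) \<Rightarrow> (nat \<Rightarrow> 'l) \<Rightarrow> nat \<Rightarrow> 'l" where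
  "mat_vec n M x = (\<lambda>i. \<Sum>j<n. M (i, j) * x j)"

definition symplectic_over ::
    "('k::field \<Rightarrow> 'm::field) \<Rightarrow> ('k, 'a) module \<Rightarrow> ('a \<Rightarrow> 'a) \<Rightarrow> bool" where
  "symplectic_over \<kappa> A \<sigma> \<longleftrightarrow>
     (\<exists>n \<phi> G.
        \<phi> \<in> alg_iso (base_change \<kappa> A) (matrix_algebra n field_algebra) \<and>
        (\<forall>x. gram_form n G x x = 0) \<and>
        (\<forall>x. (\<forall>y. gram_form n G x y = 0) \<longrightarrow> (\<forall>i<n. x i = 0)) \<and>
        (\<forall>a\<in>carrier (base_change \<kappa> A). \<forall>x y.
           gram_form n G (mat_vec n (\<phi> a) x) y =
           gram_form n G x (mat_vec n (\<phi> (base_change_map \<kappa> A \<sigma> a)) y)))"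

text \<open>
  The splitting field \<open>\<kappa> : K \<rightarrow> M\<close> witnessing symplectic type is an explicit argument, because HOL
  cannot quantify existentially over the type \<open>M\<close>. In the hypotheses of a theorem, with \<open>\<kappa>\<close> and its
  codomain occurring nowhere else, this means that there is such a splitting field.
\<close>

definition algebra_with_symplectic_involution ::
    "('k::field \<Rightarrow> 'm::field) \<Rightarrow> ('k, 'a) module \<Rightarrow> ('a \<Rightarrow> 'a) \<Rightarrow> bool" where
  "algebra_with_symplectic_involution \<kappa> A \<sigma> \<longleftrightarrow>
     central_simple A \<and> involution A \<sigma> \<and> field_extension \<kappa> \<and> symplectic_over \<kappa> A \<sigma>"


section \<open>Similitudes\<close>

definition similitudes :: "('k::field, 'a) module \<Rightarrow> ('a \<Rightarrow> 'a) \<Rightarrow> 'a set" where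
  "similitudes A \<sigma> = {a \<in> Units A. \<exists>c. c \<noteq> 0 \<and> \<sigma> a \<otimes>\<^bsub>A\<^esub> a = c \<odot>\<^bsub>A\<^esub> \<one>\<^bsub>A\<^esub>}"

definition Sim :: "('k::field, 'a) module \<Rightarrow> ('a \<Rightarrow> 'a) \<Rightarrow> 'a monoid" where
  "Sim A \<sigma> = (units_of A)\<lparr>carrier := similitudes A \<sigma>\<rparr>"

definition PSim :: "('k::field, 'a) module \<Rightarrow> ('a \<Rightarrow> 'a) \<Rightarrow> 'a set monoid" where
  "PSim A \<sigma> = Sim A \<sigma> Mod {c \<odot>\<^bsub>A\<^esub> \<one>\<^bsub>A\<^esub> | c. c \<noteq> 0}"

definition PSim_points ::
    "('k::field, 'a) module \<Rightarrow> ('a \<Rightarrow> 'a) \<Rightarrow> ('k \<Rightarrow> 'l::field) \<Rightarrow>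
     (('a \<times> 'l) \<Rightarrow>\<^sub>0 int) set set monoid" where
  "PSim_points A \<sigma> \<iota> = PSim (base_change \<iota> A) (base_change_map \<iota> A \<sigma>)"


section \<open>Rational maps from the affine line and R-equivalence\<close>

text \<open>\<open>ratfun_value r c v\<close>: the rational function \<open>r\<close> is defined at \<open>c\<close>, with value \<open>v\<close>.\<close>

definition ratfun_value :: "'l::field poly fract \<Rightarrow> 'l \<Rightarrow> 'l \<Rightarrow> bool" where
  "ratfun_value r c v \<longleftrightarrow>
     (\<exists>p q. poly q c \<noteq> 0 \<and> r = Fract p q \<and> v = poly p c / poly q c)"

definition ratfun_embedding :: "('k::field \<Rightarrow> 'l::field) \<Rightarrow> 'k \<Rightarrow> 'l poly fract" where
  "ratfun_embedding \<iota> k = Fract [:\<iota> k:] 1"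

text \<open>
  \<open>tensor_value \<iota> A c g h\<close>: \<open>g \<in> A \<otimes>\<^sub>K L(t)\<close> lies in (the image of) \<open>A \<otimes>\<^sub>K \<O>\<close>, where \<open>\<O>\<close> is
  the local ring of the affine line over \<open>L\<close> at \<open>c\<close>, and evaluating at \<open>t = c\<close> gives \<open>h \<in> A \<otimes>\<^sub>K L\<close>.
\<close>

definition tensor_value ::
    "('k::field \<Rightarrow> 'l::field) \<Rightarrow> ('k, 'a) module \<Rightarrow> 'l \<Rightarrow>
     (('a \<times> 'l poly fract) \<Rightarrow>\<^sub>0 int) set \<Rightarrow> (('a \<times> 'l) \<Rightarrow>\<^sub>0 int) set \<Rightarrow> bool" where
  "tensor_value \<iota> A c g h \<longleftrightarrow>
     (\<exists>(n::nat) a r v.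
        (\<forall>i<n. a i \<in> carrier A \<and> ratfun_value (r i) c (v i)) \<and>
        g = (\<Oplus>\<^bsub>base_change (ratfun_embedding \<iota>) A\<^esub>i\<in>{..<n}.
               pure_tensor (ratfun_embedding \<iota>) A (a i) (r i)) \<and>
        h = (\<Oplus>\<^bsub>base_change \<iota> A\<^esub>i\<in>{..<n}. pure_tensor \<iota> A (a i) (v i)))"

text \<open>
  Let \<open>L\<close> be an extension of \<open>K\<close> along \<open>\<iota>\<close>. A rational map from the affine line over \<open>L\<close> to
  \<open>PSim(A, \<sigma>)\<close> is an \<open>L(t)\<close>-point \<open>f\<close> of this variety. As a variety, \<open>PSim(A, \<sigma>)\<close>
  is the image of \<open>Sim(A, \<sigma>)\<close> in the projective space of lines in \<open>A\<close>, and the elements \<open>g\<close> of the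
  class \<open>f\<close> are the homogeneous coordinate vectors of the map. The map is defined at \<open>c\<close> with value
  \<open>x\<close> if one of these is defined at \<open>c\<close> and its value there is a similitude in the class \<open>x\<close>.
\<close>

definition PSim_map_value ::
    "('k::field, 'a) module \<Rightarrow> ('a \<Rightarrow> 'a) \<Rightarrow> ('k \<Rightarrow> 'l::field) \<Rightarrow>
     (('a \<times> 'l poly fract) \<Rightarrow>\<^sub>0 int) set set \<Rightarrow> 'l \<Rightarrow> (('a \<times> 'l) \<Rightarrow>\<^sub>0 int) set set \<Rightarrow> bool" where
  "PSim_map_value A \<sigma> \<iota> f c x \<longleftrightarrow>
     f \<in> carrier (PSim_points A \<sigma> (ratfun_embedding \<iota>)) \<and>
     x \<in> carrier (PSim_points A \<sigma> \<iota>) \<and>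
     (\<exists>g\<in>f. \<exists>h\<in>x. tensor_value \<iota> A c g h)"

definition directly_R_equivalent ::
    "('k::field, 'a) module \<Rightarrow> ('a \<Rightarrow> 'a) \<Rightarrow> ('k \<Rightarrow> 'l::field) \<Rightarrow>
     ((('a \<times> 'l) \<Rightarrow>\<^sub>0 int) set set) rel" where
  "directly_R_equivalent A \<sigma> \<iota> =
     {(x, y). \<exists>f. PSim_map_value A \<sigma> \<iota> f 0 x \<and> PSim_map_value A \<sigma> \<iota> f 1 y}"

definition R_equivalence ::
    "('k::field, 'a) module \<Rightarrow> ('a \<Rightarrow> 'a) \<Rightarrow> ('k \<Rightarrow> 'l::field) \<Rightarrow>
     ((('a \<times> 'l) \<Rightarrow>\<^sub>0 int) set set) rel" where
  "R_equivalence A \<sigma> \<iota> =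
     \<Inter>{E. equiv (carrier (PSim_points A \<sigma> \<iota>)) E \<and> directly_R_equivalent A \<sigma> \<iota> \<subseteq> E}"

text \<open>
  \<open>'l\<close> is the type of the extension fields considered; R-triviality is this property for all \<open>'l\<close>,
  that is, the statement with \<open>'l\<close> a type variable.
\<close>

definition PSim_R_trivial ::
    "'l::field itself \<Rightarrow> ('k::field, 'a) module \<Rightarrow> ('a \<Rightarrow> 'a) \<Rightarrow> bool" where
  "PSim_R_trivial TYPE('l) A \<sigma> \<longleftrightarrow>
     (\<forall>\<iota> :: 'k \<Rightarrow> 'l. field_extension \<iota> \<longrightarrow>
        is_singleton (carrier (PSim_points A \<sigma> \<iota>) // R_equivalence A \<sigma> \<iota>))"

end

theory Submission
  imports Defs
begin

text \<open>
  Let \<open>A\<close> have degree 8 and index at most 2. Then \<open>A\<close> is the algebra of endomorphisms of a module of rank 4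
  over a quaternion algebra \<open>Q\<close>, split or not, and \<open>\<sigma>\<close> is adjoint to a nondegenerate form which is hermitian
  for the canonical involution of \<open>Q\<close>. The form has an orthogonal basis \<open>x\<^sub>1, \<dots>, x\<^sub>4\<close>, which survives every
  extension of scalars. So it suffices to join each similitude of such a form, over any field of
  characteristic not 2, to a scalar by curves that are polynomial in a parameter \<open>t\<close>.

  \<^bold>\<open>Sources of curves.\<close> If \<open>x + \<sigma>(x)\<close> and \<open>\<sigma>(x)x\<close> are scalars then \<open>1 - t + tx\<close> has a scalar multiplier for all
  \<open>t\<close>, so that \<open>x\<close> is joined to 1 (\<open>triv_quadratic\<close>). A quasi-reflection \<open>1 - u q\<^sup>-\<^sup>1 u\<^sup>*\<close> with \<open>q + q\<^sup>* = u\<^sup>* u\<close> is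
  joined to 1 by moving the quaternion \<open>q\<close> along a line to a pure quaternion (\<open>reflection\<close>).

  \<^bold>\<open>Isometries.\<close> Products of at most two quasi-reflections act transitively on the vectors of a given nonzero norm
  (\<open>transport\<close>). Moving the images of \<open>x\<^sub>1, \<dots>, x\<^sub>4\<close> back one after the other shows that isometries are
  joined to 1 (\<open>isometry_triv\<close>). Hence a similitude of multiplier \<open>c\<close> is joined to 1 as soon as one
  similitude of multiplier \<open>c\<close> is (\<open>triv_of_multiplier\<close>).

  \<^bold>\<open>Similitudes.\<close> Write \<open>g x\<^sub>1 = x\<^sub>1 q + v\<close> with \<open>v\<close> orthogonal to \<open>x\<^sub>1\<close>. If \<open>v\<close> is isotropic then \<open>c\<close> is a norm from
  \<open>Q\<close>, and \<open>scalar_triv\<close> gives a similitude of multiplier \<open>c\<close>. Otherwise an isometry brings \<open>g\<close> into a form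
  that preserves the plane of \<open>x\<^sub>1\<close> and \<open>v\<close>, hence also the orthogonal plane. This expresses \<open>c\<close> for both
  planes as \<open>N(p) + n(y')/n(y)\<close>, unless \<open>c\<close> is a norm again. From such an expression one writes down, for every quaternion \<open>z\<close>, an endomorphism
  \<open>M\<close> of the plane with \<open>\<sigma>(M)M = c N(z)\<close> and \<open>M + \<sigma>(M) = Trd(pz)\<close>. A suitable \<open>z\<close> makes the two traces equal; the
  sum over the two planes then is a quadratic element, and division by a similitude of multiplier
  \<open>N(z)\<close> finishes the proof (\<open>simil_triv\<close>). This is where rank 4 enters.

  \<^bold>\<open>Structure of \<open>A\<close>.\<close> A minimal left ideal gives an idempotent \<open>f\<close> with \<open>fAf\<close> a division algebra, and the index
  is \<open>sqrt (dim (fAf))\<close> (\<open>alg_ind_eq\<close>). So there is a noncommutative corner of dimension at most 4. Over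
  the splitting field the form is alternating, and plane symplectic geometry shows that \<open>ts\<close> is
  central in \<open>fAf\<close> for symmetric \<open>s \<in> \<sigma>(f)Af\<close> and \<open>t \<in> fA\<sigma>(f)\<close> (\<open>splitting_symm\<close>). This replaces \<open>f\<close> by a
  symmetric idempotent, makes \<open>\<sigma>\<close> the canonical involution of its corner, and Gram-Schmidt supplies
  the orthogonal basis (\<open>symplectic_frame_exists\<close>).

  \<^bold>\<open>Scalar extension.\<close> All algebras \<open>A\<^sub>L\<close> for a fixed field \<open>L\<close> act faithfully on one space of sequences; the
  computations take place in the ring of operators on it. A quadratic curve in \<open>A\<^sub>L\<close> becomes a
  similitude over \<open>L(t)\<close>, and its values at 0 and 1 are R-equivalent by definition
  (\<open>path_directly_R_equivalent\<close>).
\<close>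

section \<open>Similitudes joined by quadratic curves\<close>

lemma assoc_rule: "a * b = c \<Longrightarrow> a * (b * x) = c * (x::'a::semigroup_mult)"
  by (simp add: mult.assoc[symmetric])

text \<open>
  An algebra with involution as a subset \<open>S\<close> of a ring type on which scalars and the star act totally. Only
  \<open>S\<close> is of interest; the ambient ring makes the arithmetic of the type class available.
\<close>

locale star_algebra = vector_space scale
  for scale :: "'l::field \<Rightarrow> 'b::ring_1 \<Rightarrow> 'b" (infixr "*s" 75) +
  fixes star :: "'b \<Rightarrow> 'b" and S :: "'b set"
  assumes scale_mult [simp]: "(c *s x) * y = c *s (x * y)"
    and mult_scale [simp]: "x * (c *s y) = c *s (x * y)"
    and star_add [simp]: "star (x + y) = star x + star y"
    and star_mult [simp]: "star (x * y) = star y * star x"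
    and star_star [simp]: "star (star x) = x"
    and star_scale [simp]: "star (c *s x) = c *s star x"
    and S_one [simp, intro]: "1 \<in> S"
    and S_add [simp, intro]: "x \<in> S \<Longrightarrow> y \<in> S \<Longrightarrow> x + y \<in> S"
    and S_mult [simp, intro]: "x \<in> S \<Longrightarrow> y \<in> S \<Longrightarrow> x * y \<in> S"
    and S_scale [simp, intro]: "x \<in> S \<Longrightarrow> c *s x \<in> S"
    and S_star [simp, intro]: "x \<in> S \<Longrightarrow> star x \<in> S"
begin

lemma star_zero [simp]: "star 0 = 0"
  by (metis star_scale scale_zero_left)

lemma star_minus [simp]: "star (- x) = - star x"
  by (metis add_eq_0_iff star_add star_zero neg_eq_iff_add_eq_0)

lemma star_diff [simp]: "star (x - y) = star x - star y"
  by (metis diff_conv_add_uminus star_add star_minus)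

lemma star_one [simp]: "star 1 = 1"
  by (metis mult.right_neutral star_mult star_star mult.left_neutral)

lemma star_sum [simp]: "star (sum f I) = (\<Sum>i\<in>I. star (f i))"
  by (induction I rule: infinite_finite_induct) auto

lemma S_zero [simp, intro]: "0 \<in> S"
  by (metis S_one S_scale scale_zero_left)

lemma S_minus [simp, intro]: "x \<in> S \<Longrightarrow> - x \<in> S"
  by (metis S_scale scale_minus_left scale_one)

lemma S_diff [simp, intro]: "x \<in> S \<Longrightarrow> y \<in> S \<Longrightarrow> x - y \<in> S"
  by (metis S_add S_minus diff_conv_add_uminus)

lemma S_sum [simp, intro]: "(\<And>i. i \<in> I \<Longrightarrow> f i \<in> S) \<Longrightarrow> sum f I \<in> S"
  by (induction I rule: infinite_finite_induct) auto

lemma scale_one_inj [simp]: "c *s (1::'b) = d *s 1 \<longleftrightarrow> c = d"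
  by simp

definition simil :: "'b \<Rightarrow> bool" where
  "simil g \<longleftrightarrow> g \<in> S \<and> (\<exists>c. c \<noteq> 0 \<and> star g * g = c *s 1 \<and> g * star g = c *s 1)"

text \<open>
  The product of \<open>f\<^sub>0 + f\<^sub>1 t + f\<^sub>2 t\<^sup>2\<close> and \<open>g\<^sub>0 + g\<^sub>1 t + g\<^sub>2 t\<^sup>2\<close> is the polynomial with the scalar coefficients \<open>m\<close>.
\<close>

definition poly_mult_scalar where
  "poly_mult_scalar f0 f1 f2 g0 g1 g2 m \<longleftrightarrow>
     f0 * g0 = m (0::nat) *s 1 \<and> f0 * g1 + f1 * g0 = m 1 *s 1 \<and>
     f0 * g2 + f1 * g1 + f2 * g0 = m 2 *s 1 \<and> f1 * g2 + f2 * g1 = m 3 *s 1 \<and> f2 * g2 = m 4 *s 1"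

text \<open>
  The curve \<open>f\<^sub>0 + f\<^sub>1 t + f\<^sub>2 t\<^sup>2\<close> is a similitude over the rational function field, and its multiplier does
  not vanish at 0 and 1.
\<close>

definition simil_path where
  "simil_path f0 f1 f2 \<longleftrightarrow> f0 \<in> S \<and> f1 \<in> S \<and> f2 \<in> S \<and>
     (\<exists>m. poly_mult_scalar (star f0) (star f1) (star f2) f0 f1 f2 m \<and>
          poly_mult_scalar f0 f1 f2 (star f0) (star f1) (star f2) m \<and>
          m 0 \<noteq> 0 \<and> m 0 + m 1 + m 2 + m 3 + m 4 \<noteq> 0)"

text \<open>
  The endpoints are compared up to scalars, because only their classes in the projective group matter.
\<close>

definition linked where
  "linked g h \<longleftrightarrow> simil g \<and> simil h \<and>
     (\<exists>f0 f1 f2 s t. simil_path f0 f1 f2 \<and> s \<noteq> 0 \<and> t \<noteq> 0 \<and> f0 = s *s g \<and> f0 + f1 + f2 = t *s h)"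

definition conn :: "'b \<Rightarrow> 'b \<Rightarrow> bool" where
  "conn = (symclp linked)\<^sup>*\<^sup>*"

lemma conn_refl [simp]: "conn g g"
  by (simp add: conn_def)

lemma conn_trans: "conn g h \<Longrightarrow> conn h k \<Longrightarrow> conn g k"
  by (simp add: conn_def)

lemma conn_sym: "conn g h \<Longrightarrow> conn h g"
  unfolding conn_def by (metis symclp_greater sympD symp_rtranclp symp_on_symclp)

lemma conn_linked: "linked g h \<Longrightarrow> conn g h"
  by (simp add: conn_def r_into_rtranclp symclpI1)

lemma similD: "simil g \<Longrightarrow> g \<in> S"
  by (simp add: simil_def)

lemma simil_one [simp]: "simil 1"
  by (auto simp: simil_def intro!: exI[of _ 1])

lemma simil_mult: assumes "simil g" "simil h" shows "simil (g * h)"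
proof -
  obtain c d where c: "c \<noteq> 0" "star g * g = c *s 1" "g * star g = c *s 1"
    and d: "d \<noteq> 0" "star h * h = d *s 1" "h * star h = d *s 1" and S: "g \<in> S" "h \<in> S"
    using assms by (auto simp: simil_def)
  have "star (g * h) * (g * h) = (c * d) *s 1"
    by (simp add: mult.assoc assoc_rule[OF c(2)] d)
  moreover have "(g * h) * star (g * h) = (c * d) *s 1"
    by (simp add: mult.assoc assoc_rule[OF d(3)] c mult.commute)
  ultimately show ?thesis using c d S unfolding simil_def
    by (intro conjI exI[of _ "c * d"]) auto
qed

lemma simil_star: "simil g \<Longrightarrow> simil (star g)"
  by (auto simp: simil_def)

lemma simil_scale: "simil g \<Longrightarrow> r \<noteq> 0 \<Longrightarrow> simil (r *s g)"
  unfolding simil_def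
proof (elim conjE exE, intro conjI)
  fix c assume "r \<noteq> 0" "c \<noteq> 0" "star g * g = c *s 1" "g * star g = c *s 1"
  then show "\<exists>c. c \<noteq> 0 \<and> star (r *s g) * (r *s g) = c *s 1 \<and> (r *s g) * star (r *s g) = c *s 1"
    by (intro exI[of _ "r * (r * c)"]) simp
qed auto

lemma poly_mult_scalar_conj_left:
  assumes "star k * k = c *s 1" "poly_mult_scalar (star f0) (star f1) (star f2) f0 f1 f2 m"
  shows "poly_mult_scalar (star (k*f0)) (star (k*f1)) (star (k*f2)) (k*f0) (k*f1) (k*f2) (\<lambda>r. c * m r)"
proof -
  have *: "star (k * f) * (k * g) = c *s (star f * g)" for f g
    by (simp add: mult.assoc assoc_rule[OF assms(1)])
  show ?thesis using assms(2) unfolding poly_mult_scalar_def * scale_right_distrib[symmetric]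
    by simp
qed

lemma poly_mult_scalar_conj_right:
  assumes "k * star k = c *s 1" "poly_mult_scalar f0 f1 f2 (star f0) (star f1) (star f2) m"
  shows "poly_mult_scalar (k*f0) (k*f1) (k*f2) (star (k*f0)) (star (k*f1)) (star (k*f2)) (\<lambda>r. c * m r)"
proof -
  have *: "(k * f) * star (k * g) = k * (f * star g) * star k" for f g
    by (simp add: mult.assoc)
  show ?thesis using assms(2) unfolding poly_mult_scalar_def * distrib_right[symmetric] distrib_left[symmetric]
    by (simp add: assms(1) mult.commute)
qed

text \<open>
  Translating a curve by a similitude gives a curve again; this makes the component of 1 a subgroup.
\<close>

lemma linked_mult: assumes "simil k" "linked g h" shows "linked (k * g) (k * h)"
proof -
  obtain c where c: "c \<noteq> 0" "star k * k = c *s 1" "k * star k = c *s 1" and k: "k \<in> S"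
    using assms(1) by (auto simp: simil_def)
  obtain f0 f1 f2 s t m where f: "f0 \<in> S" "f1 \<in> S" "f2 \<in> S"
    and l: "poly_mult_scalar (star f0) (star f1) (star f2) f0 f1 f2 m"
    and r: "poly_mult_scalar f0 f1 f2 (star f0) (star f1) (star f2) m"
    and m: "m 0 \<noteq> 0" "m 0 + m 1 + m 2 + m 3 + m 4 \<noteq> 0"
    and st: "s \<noteq> 0" "t \<noteq> 0" "f0 = s *s g" "f0 + f1 + f2 = t *s h"
    using assms(2) by (auto simp: linked_def simil_path_def)
  have "simil_path (k*f0) (k*f1) (k*f2)"
    unfolding simil_path_def
    using poly_mult_scalar_conj_left[OF c(2) l] poly_mult_scalar_conj_right[OF c(3) r] f k c m
    by (auto intro!: exI[of _ "\<lambda>r. c * m r"] simp flip: distrib_left)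
  moreover have "k*f0 + k*f1 + k*f2 = t *s (k * h)"
    by (simp flip: distrib_left add: st(4))
  ultimately show ?thesis using st assms unfolding linked_def
    by (meson mult_scale simil_mult)
qed

lemma conn_mult: assumes "simil k" "conn g h" shows "conn (k * g) (k * h)"
  using assms(2) unfolding conn_def
proof (induction rule: rtranclp_induct)
  case (step y z)
  have "symclp linked (k * y) (k * z)"
    using step(2) linked_mult[OF assms(1)] by (auto simp: symclp_def)
  with step show ?case by simp
qed auto

text \<open>
  The similitudes whose class is R-equivalent to that of 1 by way of quadratic curves.
\<close>

definition triv :: "'b \<Rightarrow> bool" where "triv g \<longleftrightarrow> simil g \<and> conn 1 g"

lemma triv_one [simp]: "triv 1" by (simp add: triv_def)

lemma triv_mult: "triv g \<Longrightarrow> triv h \<Longrightarrow> triv (g * h)"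
  unfolding triv_def by (metis conn_mult conn_trans mult.right_neutral simil_mult)

lemma triv_cancel: assumes "triv g" "simil h" "triv (g * h)" shows "triv h"
proof -
  obtain c where c: "c \<noteq> 0" "star g * g = c *s 1" "simil g"
    using assms(1) by (auto simp: simil_def triv_def)
  let ?k = "(1/c) *s star g"
  have k: "simil ?k" using c simil_scale simil_star by simp
  have 1: "?k * g = 1" using c by simp
  have "conn (?k * 1) (?k * g)" "conn (?k * 1) (?k * (g * h))"
    using assms k conn_mult triv_def by blast+
  then have "conn 1 h" using 1 by (metis conn_sym conn_trans mult.assoc mult.left_neutral)
  then show ?thesis using assms by (simp add: triv_def)
qed

lemma triv_I:
  assumes "simil_path f0 f1 f2" "f0 = s *s 1" "s \<noteq> 0" "f0 + f1 + f2 = t *s g" "t \<noteq> 0" "simil g"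
  shows "triv g"
  using assms unfolding triv_def by (metis conn_linked linked_def simil_one)

text \<open>
  The multiplier of \<open>1 - r + rx\<close> is \<open>(1 - r)\<^sup>2 + r(1 - r)(x + x\<^sup>*) + r\<^sup>2 x\<^sup>* x\<close>, a scalar for each \<open>r\<close>.
\<close>

lemma triv_quadratic:
  assumes x: "x \<in> S" and tr: "x + star x = t *s 1" and n: "star x * x = m *s 1" and m: "m \<noteq> 0"
  shows "triv x"
proof -
  have sx: "star x = t *s 1 - x" using tr by (metis add_diff_cancel_left')
  have n': "x * star x = m *s 1" using n unfolding sx by (simp add: algebra_simps)
  define r where "r k = (if k = 0 then 1 else if k = 1 then t - 2 else if k = 2 then m - t + 1 else 0)" for k :: nat
  have 1: "star x * x - x - star x + 1 = (m - t + 1) *s 1"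
    using n tr by (simp add: algebra_simps)
  have r1: "x * star x - x - star x + 1 = (m - t + 1) *s 1"
    using n' tr by (simp add: algebra_simps)
  have 2: "x + star x - 2 = (t - 2) *s 1"
    unfolding tr by (simp add: algebra_simps) (metis one_add_one scale_left_distrib scale_one)
  have a: "poly_mult_scalar (star 1) (star (x - 1)) (star 0) 1 (x - 1) 0 r"
    using 1 2 by (simp add: poly_mult_scalar_def r_def algebra_simps)
  have b: "poly_mult_scalar 1 (x - 1) 0 (star 1) (star (x - 1)) (star 0) r"
    using r1 2 by (simp add: poly_mult_scalar_def r_def algebra_simps)
  have c: "r 0 \<noteq> 0" "r 0 + r 1 + r 2 + r 3 + r 4 \<noteq> 0"
    using m by (simp_all add: r_def algebra_simps)
  have "simil_path 1 (x - 1) 0"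
    unfolding simil_path_def using a b c x by blast
  moreover have "simil x" using x n n' m by (auto simp: simil_def)
  ultimately show ?thesis by (intro triv_I[of 1 "x - 1" 0 1 1]) auto
qed

end

section \<open>Hermitian geometry over a quaternion corner\<close>

text \<open>
  A symmetric idempotent \<open>e\<close> whose corner is the quaternion algebra \<open>(a, b)\<close> with the star as its canonical
  involution. The left ideal \<open>Se\<close> is then a right module over the corner, on which \<open>x\<^sup>* y\<close> is a hermitian form with values in the corner.
\<close>

locale quaternion_frame = star_algebra +
  fixes e i j :: 'b and a b :: 'a
  assumes two: "(2::'a) \<noteq> 0" and ab: "a \<noteq> 0" "b \<noteq> 0"
    and S_e [simp]: "e \<in> S" and S_i [simp]: "i \<in> S" and S_j [simp]: "j \<in> S"
    and star_e [simp]: "star e = e" and star_i [simp]: "star i = - i" and star_j [simp]: "star j = - j"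
    and ee [simp]: "e * e = e" and e_neq: "e \<noteq> 0"
    and ei [simp]: "e * i = i" "i * e = i" and ej [simp]: "e * j = j" "j * e = j"
    and ii: "i * i = a *s e" and jj: "j * j = b *s e" and ji: "j * i = - (i * j)"
    and corner: "s \<in> S \<Longrightarrow> \<exists>q0 q1 q2 q3. e * s * e = q0 *s e + q1 *s i + q2 *s j + q3 *s (i * j)"
begin

definition quat where "quat q \<longleftrightarrow> q \<in> S \<and> e * q = q \<and> q * e = q"
definition vec where "vec x \<longleftrightarrow> x \<in> S \<and> x * e = x"
definition nrm where "nrm x = (THE c. star x * x = c *s e)"
definition tr where "tr x = (THE c. x + star x = c *s e)"

lemma scale_e_inj [simp]: "c *s e = d *s e \<longleftrightarrow> c = d"
  using e_neq by simp

lemma nrm_eqI: "star x * x = c *s e \<Longrightarrow> nrm x = c"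
  unfolding nrm_def using e_neq by (intro the_equality) auto

lemma tr_eqI: "x + star x = c *s e \<Longrightarrow> tr x = c"
  unfolding tr_def using e_neq by (intro the_equality) auto

lemma quatD: "quat q \<Longrightarrow> q \<in> S" "quat q \<Longrightarrow> e * q = q" "quat q \<Longrightarrow> q * e = q"
  by (auto simp: quat_def)

lemma vecD: "vec q \<Longrightarrow> q \<in> S" "vec q \<Longrightarrow> q * e = q"
  by (auto simp: vec_def)

lemma vec_star [simp]: "vec x \<Longrightarrow> e * star x = star x"
  by (metis star_e star_mult vecD(2))

lemma vec_star_assoc [simp]: "vec x \<Longrightarrow> e * (star x * y) = star x * y"
  by (simp add: assoc_rule)

lemma quat_vec: "quat q \<Longrightarrow> vec q"
  by (auto simp: quat_def vec_def)

lemma quat_e [simp]: "quat e" and quat_i [simp]: "quat i" and quat_j [simp]: "quat j"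
  by (auto simp: quat_def)

lemma quat_add [simp]: "quat p \<Longrightarrow> quat q \<Longrightarrow> quat (p + q)"
  and quat_diff [simp]: "quat p \<Longrightarrow> quat q \<Longrightarrow> quat (p - q)"
  and quat_minus [simp]: "quat p \<Longrightarrow> quat (- p)"
  and quat_mult [simp]: "quat p \<Longrightarrow> quat q \<Longrightarrow> quat (p * q)"
  and quat_scale [simp]: "quat p \<Longrightarrow> quat (c *s p)"
  by (auto simp: quat_def algebra_simps assoc_rule[of e])

lemma quat_star [simp]: "quat p \<Longrightarrow> quat (star p)"
  unfolding quat_def by (metis S_star star_e star_mult)

lemma vec_add [simp]: "vec p \<Longrightarrow> vec q \<Longrightarrow> vec (p + q)"
  and vec_diff [simp]: "vec p \<Longrightarrow> vec q \<Longrightarrow> vec (p - q)"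
  and vec_minus [simp]: "vec p \<Longrightarrow> vec (- p)"
  and vec_scale [simp]: "vec p \<Longrightarrow> vec (c *s p)"
  and vec_mult [simp]: "g \<in> S \<Longrightarrow> vec p \<Longrightarrow> vec (g * p)"
  and vec_quat [simp]: "vec p \<Longrightarrow> quat q \<Longrightarrow> vec (p * q)"
  and quat_inner [simp]: "vec p \<Longrightarrow> vec q \<Longrightarrow> quat (star p * q)"
  by (auto simp: vec_def quat_def algebra_simps)

lemma quat_cases:
  assumes "quat q"
  obtains q0 q1 q2 q3 where "q = q0 *s e + q1 *s i + q2 *s j + q3 *s (i * j)"
  using corner[of q] assms by (auto simp: quat_def)

lemma ii' [simp]: "i * (i * x) = a *s (e * x)" and jj' [simp]: "j * (j * x) = b *s (e * x)"
  and ji' [simp]: "j * (i * x) = - (i * (j * x))" and ei' [simp]: "e * (i * x) = i * x"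
  and ie' [simp]: "i * (e * x) = i * x" and ej' [simp]: "e * (j * x) = j * x" and je' [simp]: "j * (e * x) = j * x"
  and ee' [simp]: "e * (e * x) = e * x"
  using assoc_rule[OF ii, of x] assoc_rule[OF jj, of x] assoc_rule[OF ji, of x] ei ej ee
  by (auto simp: mult.assoc[symmetric])

lemmas quat_simps = ii jj ji

lemma star_coords:
  "star (q0 *s e + q1 *s i + q2 *s j + q3 *s (i * j)) = q0 *s e - q1 *s i - q2 *s j - q3 *s (i * j)"
  by (simp add: quat_simps)

lemma tr_coords: "tr (q0 *s e + q1 *s i + q2 *s j + q3 *s (i * j)) = 2 * q0"
  by (rule tr_eqI, unfold star_coords) (simp add: algebra_simps flip: scale_left_distrib)

lemma mult_coords:
  "(p0 *s e + p1 *s i + p2 *s j + p3 *s (i * j)) * (q0 *s e + q1 *s i + q2 *s j + q3 *s (i * j)) =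
   (p0*q0 + a*p1*q1 + b*p2*q2 - a*b*p3*q3) *s e + (p0*q1 + p1*q0 - b*p2*q3 + b*p3*q2) *s i +
   (p0*q2 + p2*q0 + a*p1*q3 - a*p3*q1) *s j + (p0*q3 + p3*q0 + p1*q2 - p2*q1) *s (i * j)"
  by (simp add: quat_simps algebra_simps)

lemma nrm_coords:
  "star (q0 *s e + q1 *s i + q2 *s j + q3 *s (i * j)) * (q0 *s e + q1 *s i + q2 *s j + q3 *s (i * j))
    = (q0^2 - a*q1^2 - b*q2^2 + a*b*q3^2) *s e" (is ?A)
  "(q0 *s e + q1 *s i + q2 *s j + q3 *s (i * j)) * star (q0 *s e + q1 *s i + q2 *s j + q3 *s (i * j))
    = (q0^2 - a*q1^2 - b*q2^2 + a*b*q3^2) *s e" (is ?B)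
proof -
  have s: "star (q0 *s e + q1 *s i + q2 *s j + q3 *s (i * j)) = q0 *s e + (-q1) *s i + (-q2) *s j + (-q3) *s (i * j)"
    by (simp add: quat_simps)
  show ?A ?B unfolding s mult_coords
    by (simp_all add: algebra_simps power2_eq_square)
qed

lemma trace: "quat q \<Longrightarrow> q + star q = tr q *s e"
  by (elim quat_cases) (simp only: tr_coords, simp only: star_coords, simp add: algebra_simps flip: scale_left_distrib)

lemma quat_norm: "quat q \<Longrightarrow> star q * q = nrm q *s e" "quat q \<Longrightarrow> q * star q = nrm q *s e"
proof -
  assume "quat q"
  then obtain q0 q1 q2 q3 where q: "q = q0 *s e + q1 *s i + q2 *s j + q3 *s (i * j)"
    by (elim quat_cases)
  have "nrm q = q0^2 - a*q1^2 - b*q2^2 + a*b*q3^2"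
    unfolding q by (rule nrm_eqI) (rule nrm_coords)
  then show "star q * q = nrm q *s e" "q * star q = nrm q *s e"
    unfolding q by (simp_all only: nrm_coords)
qed

lemma star_trace: "quat q \<Longrightarrow> star q = tr q *s e - q"
  by (metis add_diff_cancel_left' trace)

text \<open>
  The canonical involution fixes only scalars. So hermitian squares are scalars, and the hermitian
  form is determined by a quadratic form, here \<open>nrm\<close>.
\<close>

lemma quat_symmetric: assumes "quat q" "star q = q" shows "q = (tr q / 2) *s e"
proof -
  have "(1/2) *s (q + q) = (tr q / 2) *s e" using trace[OF assms(1)] assms(2) by simp
  moreover have "(1/2) *s (q + q) = (1/2 + 1/2) *s q"
    by (simp only: scale_left_distrib scale_right_distrib)
  moreover have "1/2 + 1/2 = (1::'a)" using two by (simp flip: add_divide_distrib)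
  ultimately show ?thesis by simp
qed

lemma norm: assumes "vec x" shows "star x * x = nrm x *s e"
proof -
  have "star x * x = (tr (star x * x) / 2) *s e"
    by (rule quat_symmetric) (use assms in auto)
  then show ?thesis using nrm_eqI by metis
qed

lemma norm_assoc: "vec x \<Longrightarrow> star x * (x * y) = nrm x *s (e * y)"
  by (simp add: assoc_rule[OF norm])

lemma quat_norm_assoc: "quat x \<Longrightarrow> x * (star x * y) = nrm x *s (e * y)"
  by (simp add: assoc_rule[OF quat_norm(2)])

lemma nrm_vec_quat: "vec x \<Longrightarrow> quat q \<Longrightarrow> nrm (x * q) = nrm x * nrm q"
  by (rule nrm_eqI) (simp add: mult.assoc norm_assoc quatD quat_norm)

lemma nrm_star: "quat q \<Longrightarrow> nrm (star q) = nrm q"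
  by (rule nrm_eqI) (simp add: quat_norm)

lemma nrm_scale: "vec x \<Longrightarrow> nrm (c *s x) = c^2 * nrm x"
  by (rule nrm_eqI) (simp add: norm power2_eq_square)

lemma nrm_e [simp]: "nrm e = 1" by (rule nrm_eqI) simp
lemma nrm_i [simp]: "nrm i = - a" by (rule nrm_eqI) (simp add: ii)

lemma tr_comm: assumes "quat p" "quat q" shows "tr (p * q) = tr (q * p)"
proof -
  obtain p0 p1 p2 p3 where p: "p = p0 *s e + p1 *s i + p2 *s j + p3 *s (i * j)" using assms by (elim quat_cases)
  obtain q0 q1 q2 q3 where q: "q = q0 *s e + q1 *s i + q2 *s j + q3 *s (i * j)" using assms by (elim quat_cases)
  show ?thesis unfolding p q mult_coords tr_coords by (simp add: algebra_simps)
qed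

lemma tr_star: "quat q \<Longrightarrow> tr (star q) = tr q"
  by (rule tr_eqI) (simp add: trace add.commute)

lemma tr_diff: "quat p \<Longrightarrow> quat q \<Longrightarrow> tr (p - q) = tr p - tr q"
  by (rule tr_eqI) (use trace[of p] trace[of q] in \<open>simp add: algebra_simps\<close>)

text \<open>
  The operators \<open>c - u g u\<^sup>*\<close> with \<open>g\<close> in the corner are closed under multiplication.
\<close>

lemma rank_one_mult:
  assumes "vec u" "quat g" "quat h"
  shows "(c *s 1 - u * g * star u) * (d *s 1 - u * h * star u) =
    (c * d) *s 1 - u * (c *s h + d *s g - nrm u *s (g * h)) * star u"
  using assms by (simp add: algebra_simps norm_assoc quatD assoc_rule[OF quatD(2)])

lemma rank_one_sum:
  "(c *s 1 - u * P * star u) + (d *s 1 - u * Q * star u) = (c + d) *s 1 - u * (P + Q) * star u"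
  by (simp add: algebra_simps)

text \<open>
  With \<open>z = g + r h\<close> one has \<open>z + z\<^sup>* = r u\<^sup>* u\<close>, because \<open>g\<close> is pure. So \<open>N(z) - r u z\<^sup>* u\<^sup>*\<close> satisfies the condition
  for a similitude with multiplier \<open>N(z)\<^sup>2\<close>, for all \<open>r\<close>, and it is quadratic in \<open>r\<close> with the coefficients below.
\<close>

lemma rank_one_path:
  assumes u: "vec u" and g: "quat g" "quat h" and g1: "star g = - g" and h: "h + star h = nrm u *s e"
    and t: "star g * h + star h * g = t *s e"
  shows "poly_mult_scalar
     (nrm g *s 1 - u * 0 * star u) (t *s 1 - u * star g * star u) (nrm h *s 1 - u * star h * star u)
     (nrm g *s 1 - u * 0 * star u) (t *s 1 - u * g * star u) (nrm h *s 1 - u * h * star u)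
     (\<lambda>k. if k = 0 then nrm g * nrm g else if k = 1 then 2 * nrm g * t else
       if k = 2 then 2 * nrm g * nrm h + t * t else if k = 3 then 2 * t * nrm h else nrm h * nrm h)"
proof -
  have z: "quat 0" by (auto simp: quat_def)
  note M = rank_one_mult[OF u]
  note R = rank_one_sum
  have h': "star h = nrm u *s e - h" using h by (metis add_diff_cancel_left')
  have eg: "e * g = g" "g * e = g" "e * h = h" "h * e = h" using g by (auto simp: quatD)
  have gg: "g * g = - (nrm g *s e)" using quat_norm(2)[OF g(1)] g1 by (metis minus_minus mult_minus_right)
  have hh: "nrm u *s h - h * h = nrm h *s e" using quat_norm(1)[OF g(2)] unfolding h'
    by (simp add: algebra_simps eg)
  have t': "nrm u *s g - g * h - h * g = t *s e" using t unfolding h' g1 by (simp add: algebra_simps eg)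
  have q: "quat (star g)" "quat (star h)" using g by auto
  have X1: "nrm g *s g + t *s 0 - nrm u *s (0 * g) + (t *s 0 + nrm g *s star g - nrm u *s (star g * 0)) = 0"
    by (simp add: g1)
  have X2: "nrm g *s h + nrm h *s 0 - nrm u *s (0 * h) + (t *s g + t *s star g - nrm u *s (star g * g))
      + (nrm h *s 0 + nrm g *s star h - nrm u *s (star h * 0)) = 0"
    by (simp add: g1 gg h' algebra_simps)
  have X3: "t *s h + nrm h *s star g - nrm u *s (star g * h) + (nrm h *s g + t *s star h - nrm u *s (star h * g)) = 0"
  proof -
    have "t *s h + nrm h *s star g - nrm u *s (star g * h) + (nrm h *s g + t *s star h - nrm u *s (star h * g))
      = t *s (h + star h) + nrm h *s (g + star g) - nrm u *s (star g * h + star h * g)"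
      by (simp add: algebra_simps)
    then show ?thesis unfolding h t by (simp add: g1 algebra_simps)
  qed
  have X4: "nrm h *s h + nrm h *s star h - nrm u *s (star h * h) = 0"
  proof -
    have "nrm h *s h + nrm h *s star h - nrm u *s (star h * h) = nrm h *s (h + star h) - nrm u *s (star h * h)"
      by (simp only: scale_right_distrib)
    then show ?thesis unfolding h quat_norm(1)[OF g(2)] by (simp add: mult.commute)
  qed
  have c: "nrm g * t + t * nrm g = 2 * nrm g * t"
    "nrm g * nrm h + t * t + nrm h * nrm g = 2 * nrm g * nrm h + t * t"
    "t * nrm h + nrm h * t = 2 * t * nrm h" by Groebner_Basis.algebra+
  show ?thesis
    unfolding poly_mult_scalar_def M[OF z z] M[OF z g(1)] M[OF z g(2)] M[OF q(1) z] M[OF q(2) z]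
      M[OF q(1) g(1)] M[OF q(1) g(2)] M[OF q(2) g(1)] M[OF q(2) g(2)] R X1 X2 X3 X4 c
    by simp
qed

text \<open>
  For isotropic differences \<open>u = v - w\<close> the usual reflection does not exist; the quasi-reflection with the
  quaternion \<open>u\<^sup>* v\<close> of trace \<open>u\<^sup>* u\<close> does whenever this quaternion is invertible, and it moves \<open>v\<close> to \<open>w\<close>.
\<close>

definition reflection where
  "reflection u v = 1 - (1 / nrm (star u * v)) *s (u * star (star u * v) * star u)"

lemma reflection:
  assumes vw: "vec v" "vec w" "nrm v = nrm w" and p: "nrm (star (v - w) * v) \<noteq> 0"
  shows "triv (reflection (v - w) v)" "reflection (v - w) v * v = w"
    "star v * x = 0 \<Longrightarrow> star w * x = 0 \<Longrightarrow> reflection (v - w) v * x = x"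
proof -
  define u where "u = v - w"
  define p where "p = star u * v"
  \<comment> \<open>the curve moves the quaternion from the pure quaternion \<open>i\<close> at 0 to \<open>p = i + d\<close> at 1\<close>
  define d where "d = p - i"
  define t where "t = tr (star i * d)"
  have u: "vec u" using vw by (simp add: u_def)
  have qp: "quat p" unfolding p_def using u vw(1) by (rule quat_inner)
  have qd: "quat d" unfolding d_def using qp by simp
  have p0: "nrm p \<noteq> 0" using p by (simp add: p_def u_def)
  have r: "reflection (v - w) v = 1 - (1 / nrm p) *s (u * star p * star u)"
    by (simp add: reflection_def p_def u_def)
  have pu: "p + star p = nrm u *s e"
  proof -
    have "star v * v = star w * w" using vw by (simp add: norm)
    then have "p + star p = star u * u" unfolding p_def u_def by (simp add: algebra_simps)
    then show ?thesis using norm[OF u] by simp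
  qed
  have t: "star i * d + star d * i = t *s e" "i * star d + d * star i = t *s e"
  proof -
    show "star i * d + star d * i = t *s e"
      using trace[of "star i * d"] qd by (simp add: t_def)
    moreover have sd: "star d = nrm u *s e - d"
      using pu unfolding d_def by (simp add: algebra_simps)
    have "i * star d + d * star i = star i * d + star d * i"
      unfolding sd by (simp add: algebra_simps)
    ultimately show "i * star d + d * star i = t *s e" by simp
  qed
  have dp: "d + star d = nrm u *s e" using pu by (simp add: d_def)
  have np: "nrm p = nrm i + t + nrm d"
  proof (rule nrm_eqI)
    have "p = i + d" by (simp add: d_def)
    then show "star p * p = (nrm i + t + nrm d) *s e"
      using t(1) quat_norm(1)[OF quat_i] quat_norm(1)[OF qd] by (simp add: algebra_simps)
  qed
  let ?f0 = "nrm i *s 1 - u * 0 * star u" and ?f1 = "t *s 1 - u * star i * star u"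
    and ?f2 = "nrm d *s 1 - u * star d * star u"
  let ?m = "\<lambda>k::nat. if k = 0 then nrm i * nrm i else if k = 1 then 2 * nrm i * t else
       if k = 2 then 2 * nrm i * nrm d + t * t else if k = 3 then 2 * t * nrm d else nrm d * nrm d"
  have s: "star ?f0 = ?f0" "star ?f1 = t *s 1 - u * i * star u" "star ?f2 = nrm d *s 1 - u * d * star u"
    by (simp_all add: mult.assoc)
  have 1: "poly_mult_scalar ?f0 ?f1 ?f2 (star ?f0) (star ?f1) (star ?f2) ?m"
    unfolding s by (rule rank_one_path) (use u qd dp t in auto)
  have n: "nrm (star i) = nrm i" "nrm (star d) = nrm d" by (rule nrm_star[OF quat_i], rule nrm_star[OF qd])
  have 2: "poly_mult_scalar (star ?f0) (star ?f1) (star ?f2) ?f0 ?f1 ?f2 ?m"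
    unfolding s using rank_one_path[of u "star i" "star d" t] u qd dp t unfolding n by (simp add: add.commute)
  have S: "u \<in> S" "d \<in> S" using u qd by (auto simp: vecD quatD)
  have sum: "?f0 + ?f1 + ?f2 = nrm p *s reflection (v - w) v"
    unfolding r np[symmetric] using p0 by (simp add: scale_right_diff_distrib) (simp add: np d_def algebra_simps)
  have path: "simil_path ?f0 ?f1 ?f2"
  proof -
    have "?m 0 + ?m 1 + ?m 2 + ?m 3 + ?m 4 = nrm p * nrm p"
      unfolding np by (simp add: algebra_simps)
    then have m: "?m 0 + ?m 1 + ?m 2 + ?m 3 + ?m 4 \<noteq> 0" using p0 by simp
    have m0: "?m 0 \<noteq> 0" using ab by simp
    have fS: "?f0 \<in> S" "?f1 \<in> S" "?f2 \<in> S" using S by simp_all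
    show ?thesis unfolding simil_path_def
      by (intro conjI fS exI[of _ ?m] 1 2 m0 m)
  qed
  have sim: "simil (reflection (v - w) v)"
  proof -
    have R: "nrm p *s reflection (v - w) v = nrm p *s 1 - u * star p * star u"
      unfolding r using p0 by (simp add: scale_right_diff_distrib)
    have "star (nrm p *s 1 - u * star p * star u) * (nrm p *s 1 - u * star p * star u) = (nrm p * nrm p) *s 1"
      "(nrm p *s 1 - u * star p * star u) * star (nrm p *s 1 - u * star p * star u) = (nrm p * nrm p) *s 1"
    proof -
      have s: "star (nrm p *s 1 - u * star p * star u) = nrm p *s 1 - u * p * star u" by (simp add: mult.assoc)
      have "nrm p *s (p + star p) = nrm p *s (nrm u *s e)" unfolding pu ..
      then have "nrm p *s star p + nrm p *s p - nrm u *s (p * star p) = 0"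
         "nrm p *s p + nrm p *s star p - nrm u *s (star p * p) = 0"
        unfolding quat_norm[OF qp] by (simp_all add: scale_right_distrib algebra_simps)
      then show "star (nrm p *s 1 - u * star p * star u) * (nrm p *s 1 - u * star p * star u) = (nrm p * nrm p) *s 1"
      "(nrm p *s 1 - u * star p * star u) * star (nrm p *s 1 - u * star p * star u) = (nrm p * nrm p) *s 1"
        unfolding s using qp rank_one_mult[OF u, of p "star p"] rank_one_mult[OF u, of "star p" p] by simp_all
    qed
    then have "simil (nrm p *s reflection (v - w) v)" unfolding R simil_def
      using p0 S u qp by (intro conjI exI[of _ "nrm p * nrm p"]) (auto simp: vecD quatD)
    then show ?thesis using simil_scale[of _ "1 / nrm p"] p0 by fastforce
  qed
  show "triv (reflection (v - w) v)"
  proof (rule triv_I[OF path _ _ sum p0 sim])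
    show "?f0 = nrm i *s 1" "nrm i \<noteq> 0" using ab by auto
  qed
  show "reflection (v - w) v * v = w"
    unfolding r using p0 by (simp add: algebra_simps p_def[symmetric] quat_norm qp vecD[OF u]) (simp add: u_def)
  show "reflection (v - w) v * x = x" if "star v * x = 0" "star w * x = 0"
    using that unfolding r by (simp add: u_def algebra_simps)
qed

end

section \<open>Isometries are R-trivial\<close>

context quaternion_frame begin

text \<open>
  If \<open>(v - w)\<^sup>* v\<close> is invertible one quasi-reflection suffices. Otherwise a vector \<open>y\<close> of the same norm is needed
  that can be reached from \<open>v\<close> and from which \<open>w\<close> can be reached. This can be \<open>- w\<close>, unless \<open>(v + w)\<^sup>* v\<close> is not
  invertible either. In that remaining case \<open>\<beta> = w\<^sup>* v\<close> is a pure quaternion with \<open>\<beta>\<^sup>2 = n\<^sup>2\<close>, so that the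
  quaternions split, and \<open>y\<close> can be written down.
\<close>

lemma transport:
  assumes v: "vec v" and w: "vec w" and n: "nrm v = nrm w" and n0: "nrm w \<noteq> 0"
  obtains r where "triv r" "star r * r = 1" "r * v = w"
    "\<And>x. star v * x = 0 \<Longrightarrow> star w * x = 0 \<Longrightarrow> r * x = x"
proof -
  note goal = that
  have iso: "star r * r = 1" if rv: "triv r" "r * v = w" for r
  proof -
    obtain c where c: "star r * r = c *s 1" using rv unfolding triv_def simil_def by blast
    have "nrm w *s e = star (r * v) * (r * v)" using rv w by (simp add: norm)
    also have "\<dots> = (c * nrm w) *s e"
      using c v n by (simp add: mult.assoc assoc_rule[OF c] norm)
    finally show ?thesis using n0 c e_neq by simp
  qed
  have direct: "\<exists>r. triv r \<and> r * x = y \<and> (\<forall>z. star x * z = 0 \<longrightarrow> star y * z = 0 \<longrightarrow> r * z = z)"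
    if "vec x" "vec y" "nrm x = nrm y" "nrm (star (x - y) * x) \<noteq> 0" for x y
    using reflection[OF that] by blast
  have two_step: thesis if y: "vec y" "nrm y = nrm w" "nrm (star (v - y) * v) \<noteq> 0" "nrm (star (y - w) * y) \<noteq> 0"
     "\<And>x. star v * x = 0 \<Longrightarrow> star w * x = 0 \<Longrightarrow> star y * x = 0" for y
  proof -
    obtain r1 where r1: "triv r1" "r1 * v = y" "\<And>z. star v * z = 0 \<Longrightarrow> star y * z = 0 \<Longrightarrow> r1 * z = z"
      using direct[of v y] y v n by auto
    obtain r2 where r2: "triv r2" "r2 * y = w" "\<And>z. star y * z = 0 \<Longrightarrow> star w * z = 0 \<Longrightarrow> r2 * z = z"
      using direct[of y w] y w by auto
    have r: "triv (r2 * r1)" "r2 * r1 * v = w" using r1 r2 by (auto intro: triv_mult simp: mult.assoc)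
    show thesis by (rule goal[OF r(1) iso[OF r] r(2)]) (use r1 r2 y in \<open>auto simp: mult.assoc\<close>)
  qed
  define \<beta> where "\<beta> = star w * v"
  define n where "n = nrm w"
  have q\<beta>: "quat \<beta>" using v w by (simp add: \<beta>_def)
  have n0': "n \<noteq> 0" using n0 by (simp add: n_def)
  have vv: "star v * v = n *s e" "star w * w = n *s e" using v w n by (auto simp: n_def norm)
  have vw: "star v * w = star \<beta>" "star w * v = \<beta>" by (simp_all add: \<beta>_def)
  have d1: "star (v - w) * v = n *s e - \<beta>" by (simp add: algebra_simps vv vw)
  have d2: "star (v - - w) * v = n *s e + \<beta>" by (simp add: algebra_simps vv vw)
  have e\<beta>: "e * \<beta> = \<beta>" "\<beta> * e = \<beta>" "e * star \<beta> = star \<beta>" "star \<beta> * e = star \<beta>"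
    using q\<beta> quat_star[OF q\<beta>] by (auto simp: quatD)
  have trb: "star \<beta> = tr \<beta> *s e - \<beta>" using star_trace[OF q\<beta>] .
  have nd1: "nrm (n *s e - \<beta>) = n * n - n * tr \<beta> + nrm \<beta>"
  proof (rule nrm_eqI)
    have "star (n *s e - \<beta>) * (n *s e - \<beta>) = (n * n) *s e - n *s (\<beta> + star \<beta>) + star \<beta> * \<beta>"
      by (simp add: algebra_simps e\<beta>)
    then show "star (n *s e - \<beta>) * (n *s e - \<beta>) = (n * n - n * tr \<beta> + nrm \<beta>) *s e"
      unfolding trace[OF q\<beta>] quat_norm[OF q\<beta>] by (simp add: scale_left_distrib scale_left_diff_distrib)
  qed
  have nd2: "nrm (n *s e + \<beta>) = n * n + n * tr \<beta> + nrm \<beta>"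
  proof (rule nrm_eqI)
    have "star (n *s e + \<beta>) * (n *s e + \<beta>) = (n * n) *s e + n *s (\<beta> + star \<beta>) + star \<beta> * \<beta>"
      by (simp add: algebra_simps e\<beta>)
    then show "star (n *s e + \<beta>) * (n *s e + \<beta>) = (n * n + n * tr \<beta> + nrm \<beta>) *s e"
      unfolding trace[OF q\<beta>] quat_norm[OF q\<beta>] by (simp add: scale_left_distrib)
  qed
  have nw: "nrm (- w) = nrm w" using nrm_scale[OF w, of "-1"] by simp
  have "(4::'a) = 2 * 2" "(8::'a) = 2 * 2 * 2" by simp_all
  then have pow2: "(4::'a) \<noteq> 0" "(8::'a) \<noteq> 0" using two by (metis mult_eq_0_iff)+
  have four: "nrm (2 *s (n *s e)) \<noteq> 0"
    using nrm_scale[of e "2 * n"] pow2 n0' by (simp add: vec_def)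
  consider "nrm (n *s e - \<beta>) \<noteq> 0" | "nrm (n *s e + \<beta>) \<noteq> 0"
    | "nrm (n *s e - \<beta>) = 0" "nrm (n *s e + \<beta>) = 0" by blast
  then show thesis
  proof cases
    case 1
    then obtain r where r: "triv r" "r * v = w" "\<And>z. star v * z = 0 \<Longrightarrow> star w * z = 0 \<Longrightarrow> r * z = z"
      using direct[of v w] v w n d1 by auto
    then show thesis using goal iso by blast
  next
    case 2
    have "star (- w - w) * - w = 2 *s (n *s e)"
    proof -
      have "star (- w - w) * - w = star w * w + star w * w" by (simp add: algebra_simps)
      also have "\<dots> = (1 + 1) *s (n *s e)" unfolding vv scale_left_distrib by simp
      finally show ?thesis by simp
    qed
    then show thesis using two_step[of "- w"] 2 four w nw d2 by simp
  next
    case 3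
    have "n * tr \<beta> = 0"
    proof -
      have "2 * (n * tr \<beta>) = 0" using 3 unfolding nd1 nd2 by Groebner_Basis.algebra
      then show ?thesis using two by simp
    qed
    then have t0: "tr \<beta> = 0" using n0' by simp
    then have sb: "star \<beta> = - \<beta>" using trb by simp
    have "nrm \<beta> = - (n * n)" using 3 t0 unfolding nd1 by (simp add: eq_neg_iff_add_eq_0 add.commute)
    then have bb: "\<beta> * \<beta> = (n * n) *s e" using quat_norm[OF q\<beta>] unfolding sb by simp
    \<comment> \<open>this is \<open>- w + (v - w)(1 + \<beta>/n)\<close>; the factor \<open>1 + \<beta>/n\<close> is twice an idempotent of the split quaternions\<close>
    define y where "y = v + (1/n) *s (v * \<beta> - w * \<beta>) - (w + w)"
    have sy: "star y = star v + (1/n) *s (\<beta> * star w - \<beta> * star v) - (star w + star w)"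
      by (simp add: y_def sb)
    note R = vv vw sb bb e\<beta> assoc_rule[OF vv(1)] assoc_rule[OF vv(2)] assoc_rule[OF vw(1)] assoc_rule[OF vw(2)]
       assoc_rule[OF bb] vec_star[OF v] vec_star[OF w]
    have nn: "(1/n) * n = 1" "n * (1/n) = 1" "(1/n) * (n * n) = n" "inverse n * n = 1" using n0' by auto
    have yv: "star y * v = n *s e + n *s e - (\<beta> + \<beta> + \<beta>)"
      unfolding sy by (simp add: algebra_simps R n0')
    have yw: "star y * w = - (n *s e)"
      unfolding sy by (simp add: algebra_simps R n0')
    have wy: "star w * y = - (n *s e)" using arg_cong[OF yw, of star] by simp
    have yy: "star y * y = n *s e"
    proof -
      have "star y * y = star y * v + (1/n) *s (star y * v * \<beta> - star y * w * \<beta>) - (star y * w + star y * w)"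
        by (simp add: y_def algebra_simps)
      also have "\<dots> = n *s e" unfolding yv yw by (simp add: algebra_simps R n0')
      finally show ?thesis .
    qed
    have vy: "vec y" unfolding y_def using v w q\<beta> by simp
    have ny: "nrm y = n" using yy by (rule nrm_eqI)
    have A: "star (v - y) * v = \<beta> + \<beta> + \<beta> - n *s e" by (simp add: algebra_simps vv yv)
    have nA: "nrm (\<beta> + \<beta> + \<beta> - n *s e) = - (2 * 2 * 2 * (n * n))"
    proof (rule nrm_eqI)
      have "star (\<beta> + \<beta> + \<beta> - n *s e) * (\<beta> + \<beta> + \<beta> - n *s e) =
        - ((n*n) *s e)-(n*n) *s e-(n*n) *s e-(n*n) *s e-(n*n) *s e-(n*n) *s e-(n*n) *s e-(n*n) *s e"
        by (simp add: algebra_simps R)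
      also have "\<dots> = (- (n*n)-(n*n)-(n*n)-(n*n)-(n*n)-(n*n)-(n*n)-(n*n)) *s e"
        by (simp only: scale_left_diff_distrib scale_minus_left)
      also have "- (n*n)-(n*n)-(n*n)-(n*n)-(n*n)-(n*n)-(n*n)-(n*n) = - (2 * 2 * 2 * (n * n))" by Groebner_Basis.algebra
      finally show "star (\<beta> + \<beta> + \<beta> - n *s e) * (\<beta> + \<beta> + \<beta> - n *s e) = (- (2 * 2 * 2 * (n * n))) *s e" .
    qed
    have B: "star (y - w) * y = 2 *s (n *s e)"
    proof -
      have "star (y - w) * y = (1 + 1) *s (n *s e)" unfolding scale_left_distrib by (simp add: algebra_simps yy wy)
      then show ?thesis by simp
    qed
    show thesis
    proof (rule two_step[OF vy])
      show "nrm y = nrm w" using ny n_def by simp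
      show "nrm (star (v - y) * v) \<noteq> 0" unfolding A nA using pow2 n0' by simp
      show "nrm (star (y - w) * y) \<noteq> 0" unfolding B by (rule four)
      show "star y * x = 0" if "star v * x = 0" "star w * x = 0" for x
        unfolding sy using that by (simp add: algebra_simps)
    qed
  qed
qed

text \<open>
  An orthogonal basis; the last condition says that it spans.
\<close>

definition frame where
  "frame x1 x2 x3 x4 \<longleftrightarrow> vec x1 \<and> vec x2 \<and> vec x3 \<and> vec x4 \<and>
     nrm x1 \<noteq> 0 \<and> nrm x2 \<noteq> 0 \<and> nrm x3 \<noteq> 0 \<and> nrm x4 \<noteq> 0 \<and>
     star x1 * x2 = 0 \<and> star x1 * x3 = 0 \<and> star x1 * x4 = 0 \<and>
     star x2 * x3 = 0 \<and> star x2 * x4 = 0 \<and> star x3 * x4 = 0 \<and>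
     (1 / nrm x1) *s (x1 * star x1) + (1 / nrm x2) *s (x2 * star x2) +
     (1 / nrm x3) *s (x3 * star x3) + (1 / nrm x4) *s (x4 * star x4) = 1"

lemma orth_sym: "star x * y = 0 \<Longrightarrow> star y * x = 0"
  by (metis star_mult star_star star_zero)

lemma frame_swap23: "frame x1 x2 x3 x4 \<Longrightarrow> frame x1 x3 x2 x4"
  and frame_swap34: "frame x1 x2 x3 x4 \<Longrightarrow> frame x1 x2 x4 x3"
  by (auto simp: frame_def ac_simps orth_sym)

lemma frame_expand:
  assumes "frame x1 x2 x3 x4"
  shows "g = (1 / nrm x1) *s (x1 * (star x1 * g)) + (1 / nrm x2) *s (x2 * (star x2 * g)) +
     (1 / nrm x3) *s (x3 * (star x3 * g)) + (1 / nrm x4) *s (x4 * (star x4 * g))"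
proof -
  have "g = 1 * g" by simp
  also have "\<dots> = ((1 / nrm x1) *s (x1 * star x1) + (1 / nrm x2) *s (x2 * star x2) +
     (1 / nrm x3) *s (x3 * star x3) + (1 / nrm x4) *s (x4 * star x4)) * g"
    using assms by (simp only: frame_def)
  finally show ?thesis by (simp only: distrib_right scale_mult mult.assoc)
qed

definition multiplier where
  "multiplier g c \<longleftrightarrow> g \<in> S \<and> c \<noteq> 0 \<and> star g * g = c *s 1 \<and> g * star g = c *s 1"

lemma simil_iff: "simil g \<longleftrightarrow> (\<exists>c. multiplier g c)"
  by (auto simp: simil_def multiplier_def)

lemma multiplier_mult: "multiplier g c \<Longrightarrow> multiplier h d \<Longrightarrow> multiplier (g * h) (c * d)"
  unfolding multiplier_def
  apply (intro conjI; (elim conjE)?)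
     apply auto[2]
   apply (simp add: mult.assoc assoc_rule[of "star g" g])
  apply (simp add: mult.assoc assoc_rule[of h "star h"] mult.commute)
  done

text \<open>
  One step of the reduction of an isometry to the identity: \<open>F\<close> collects the basis vectors that are
  fixed already, and they stay fixed because they are orthogonal to \<open>w\<close> and to its image.
\<close>

lemma isometry_fix:
  assumes g: "multiplier g 1" and F: "\<And>x. x \<in> F \<Longrightarrow> g * x = x \<and> star x * w = 0" and w: "vec w" "nrm w \<noteq> 0"
  obtains r where "triv r" "multiplier (r * g) 1" "\<And>x. x \<in> insert w F \<Longrightarrow> r * g * x = x"
proof -
  have gS: "g \<in> S" and gg: "star g * g = 1" using g by (auto simp: multiplier_def)
  have v: "vec (g * w)" "nrm (g * w) = nrm w"
    using w gS by (auto intro!: nrm_eqI simp: mult.assoc assoc_rule[OF gg] norm)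
  obtain r where r: "triv r" "star r * r = 1" "r * (g * w) = w"
     "\<And>x. star (g * w) * x = 0 \<Longrightarrow> star w * x = 0 \<Longrightarrow> r * x = x"
    using transport[OF v(1) w(1) v(2) w(2)] by blast
  have "multiplier r 1" using r simil_iff[of r] unfolding multiplier_def triv_def by auto
  then have m: "multiplier (r * g) 1" using multiplier_mult[of r 1 g 1] g by simp
  have "r * g * x = x" if "x \<in> insert w F" for x
  proof (cases "x = w")
    case True then show ?thesis using r by (simp add: mult.assoc)
  next
    case False
    then have x: "g * x = x" "star w * x = 0" using F that orth_sym by auto
    have "star (g * w) * x = star (g * w) * (g * x)" using x by simp
    also have "\<dots> = star w * (star g * (g * x))" by (simp only: star_mult mult.assoc)
    also have "\<dots> = 0" using x(2) by (simp only: assoc_rule[OF gg] mult_1_left)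
    finally show ?thesis using r(4) x by (simp add: mult.assoc)
  qed
  then show thesis using that r m by blast
qed

lemma isometry_triv:
  assumes f: "frame x1 x2 x3 x4" and g: "multiplier g 1"
  shows "triv g"
proof -
  have x: "vec x1" "vec x2" "vec x3" "vec x4" "nrm x1 \<noteq> 0" "nrm x2 \<noteq> 0" "nrm x3 \<noteq> 0" "nrm x4 \<noteq> 0"
     "star x1 * x2 = 0" "star x1 * x3 = 0" "star x1 * x4 = 0"
     "star x2 * x3 = 0" "star x2 * x4 = 0" "star x3 * x4 = 0"
    using f by (auto simp: frame_def)
  obtain r1 where r1: "triv r1" "multiplier (r1 * g) 1" "\<And>x. x \<in> {x1} \<Longrightarrow> (r1 * g) * x = x"
    using isometry_fix[OF g, of "{}" x1] x by auto
  obtain r2 where r2: "triv r2" "multiplier (r2 * (r1 * g)) 1" "\<And>x. x \<in> {x2,x1} \<Longrightarrow> r2 * (r1 * g) * x = x"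
    using isometry_fix[OF r1(2), of "{x1}" x2] x r1 by auto
  obtain r3 where r3: "triv r3" "multiplier (r3 * (r2 * (r1 * g))) 1" "\<And>x. x \<in> {x3,x2,x1} \<Longrightarrow> r3 * (r2 * (r1 * g)) * x = x"
    using isometry_fix[OF r2(2), of "{x2,x1}" x3] x r2 by auto
  obtain r4 where r4: "triv r4" "multiplier (r4 * (r3 * (r2 * (r1 * g)))) 1" "\<And>x. x \<in> {x4,x3,x2,x1} \<Longrightarrow> r4 * (r3 * (r2 * (r1 * g))) * x = x"
    using isometry_fix[OF r3(2), of "{x3,x2,x1}" x4] x r3 by auto
  define h where "h = r4 * (r3 * (r2 * (r1 * g)))"
  have h: "h * x1 = x1" "h * x2 = x2" "h * x3 = x3" "h * x4 = x4" using r4(3) by (auto simp: h_def)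
  have sum: "(1 / nrm x1) *s (x1 * star x1) + (1 / nrm x2) *s (x2 * star x2) +
     (1 / nrm x3) *s (x3 * star x3) + (1 / nrm x4) *s (x4 * star x4) = 1" (is "?s = 1")
    using f by (simp only: frame_def)
  have "h = h * ?s" unfolding sum by simp
  also have "\<dots> = ?s"
    by (simp only: distrib_left mult_scale assoc_rule[OF h(1)] assoc_rule[OF h(2)] assoc_rule[OF h(3)] assoc_rule[OF h(4)])
  also note sum
  finally have "triv (r4 * (r3 * (r2 * (r1 * g))))" by (simp add: h_def)
  then show ?thesis
    using r1(1) r2(1) r3(1) r4(1) r1(2) r2(2) r3(2) g triv_cancel simil_iff by meson
qed

text \<open>
  Two similitudes with the same multiplier differ by an isometry.
\<close>

lemma triv_of_multiplier:
  assumes f: "frame x1 x2 x3 x4" and g: "multiplier g c" and h: "multiplier h c" "triv h"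
  shows "triv g"
proof -
  have c: "c \<noteq> 0" "h * star h = c *s 1" using h by (auto simp: multiplier_def)
  have "multiplier ((1/c) *s star h) (1/c)"
    using h(1) by (auto simp: multiplier_def)
  then have "multiplier ((1/c) *s star h * g) 1" using multiplier_mult[OF _ g] c(1) by fastforce
  then have "triv ((1/c) *s star h * g)" using isometry_triv f by blast
  then have "triv (h * ((1/c) *s star h * g))" using h triv_mult by blast
  also have "h * ((1/c) *s star h * g) = g" using c by (simp add: assoc_rule[OF c(2)])
  finally show ?thesis .
qed

end

section \<open>Similitudes are R-trivial\<close>

context quaternion_frame begin

lemma zero_assoc: "x * y = 0 \<Longrightarrow> x * (y * z) = (0::'b)"
  by (metis mult.assoc mult_zero_left)

lemma trace_commute: assumes "x + star x = t *s 1" shows "x * star x = star x * x"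
proof -
  have s: "star x = t *s 1 - x" using assms by (metis add_diff_cancel_left')
  show ?thesis unfolding s by (simp add: algebra_simps)
qed

text \<open>
  The similitude acts on the coordinates with respect to the frame by left multiplication by \<open>p\<close>.
\<close>

lemma scalar_triv:
  assumes f: "frame x1 x2 x3 x4" and p: "quat p" "nrm p \<noteq> 0"
  obtains Z where "triv Z" "multiplier Z (nrm p)"
proof -
  have x: "vec x1" "vec x2" "vec x3" "vec x4" "nrm x1 \<noteq> 0" "nrm x2 \<noteq> 0" "nrm x3 \<noteq> 0" "nrm x4 \<noteq> 0"
     and o: "star x1 * x2 = 0" "star x1 * x3 = 0" "star x1 * x4 = 0"
     "star x2 * x3 = 0" "star x2 * x4 = 0" "star x3 * x4 = 0"
     and sum: "(1 / nrm x1) *s (x1 * star x1) + (1 / nrm x2) *s (x2 * star x2) +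
     (1 / nrm x3) *s (x3 * star x3) + (1 / nrm x4) *s (x4 * star x4) = 1"
    using f by (auto simp: frame_def)
  note o' = o o[THEN orth_sym]
  note O = o' o'[THEN zero_assoc] norm[OF x(1)] norm[OF x(2)] norm[OF x(3)] norm[OF x(4)]
     norm_assoc[OF x(1)] norm_assoc[OF x(2)] norm_assoc[OF x(3)] norm_assoc[OF x(4)]
  define Z where "Z = (1 / nrm x1) *s (x1 * p * star x1) + (1 / nrm x2) *s (x2 * p * star x2) +
     (1 / nrm x3) *s (x3 * p * star x3) + (1 / nrm x4) *s (x4 * p * star x4)"
  have ZS: "Z \<in> S" using x p by (auto simp: Z_def vecD quatD)
  have tr1: "x * p * star x + x * star p * star x = tr p *s (x * star x)" if "vec x" for x
  proof -
    have "x * p * star x + x * star p * star x = x * (p + star p) * star x" by (simp add: algebra_simps)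
    then show ?thesis unfolding trace[OF p(1)] using that by (simp add: vecD)
  qed
  have "Z + star Z = (1 / nrm x1) *s (x1 * p * star x1 + x1 * star p * star x1) +
     (1 / nrm x2) *s (x2 * p * star x2 + x2 * star p * star x2) +
     (1 / nrm x3) *s (x3 * p * star x3 + x3 * star p * star x3) +
     (1 / nrm x4) *s (x4 * p * star x4 + x4 * star p * star x4)"
    by (simp add: Z_def algebra_simps)
  also have "\<dots> = tr p *s ((1 / nrm x1) *s (x1 * star x1) + (1 / nrm x2) *s (x2 * star x2) +
     (1 / nrm x3) *s (x3 * star x3) + (1 / nrm x4) *s (x4 * star x4))"
    unfolding tr1[OF x(1)] tr1[OF x(2)] tr1[OF x(3)] tr1[OF x(4)]
    by (simp only: scale_right_distrib scale_scale mult.commute)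
  finally have tr: "Z + star Z = tr p *s 1" unfolding sum .
  have pp: "e * (p * y) = p * y" "star p * (p * y) = nrm p *s (e * y)" for y
    using p by (simp_all add: assoc_rule[OF quatD(2)] assoc_rule[OF quat_norm(1)])
  have "star Z * Z = nrm p *s ((1 / nrm x1) *s (x1 * star x1) + (1 / nrm x2) *s (x2 * star x2) +
     (1 / nrm x3) *s (x3 * star x3) + (1 / nrm x4) *s (x4 * star x4))"
    using x by (simp add: Z_def distrib_left distrib_right mult.assoc O pp scale_right_distrib)
  then have n: "star Z * Z = nrm p *s 1" unfolding sum .
  have n': "Z * star Z = nrm p *s 1" using n trace_commute[OF tr] by simp
  show thesis
    by (rule that[of Z]) (use triv_quadratic[OF ZS tr n p(2)] ZS n n' p in \<open>auto simp: multiplier_def\<close>)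
qed

text \<open>
  In coordinates with respect to \<open>y, y'\<close> this is the matrix with rows \<open>pz, - (n(y')/n(y)) z\<^sup>*\<close> and
  \<open>z, p\<^sup>* z\<^sup>*\<close>. For \<open>z = 1\<close> it is the evident similitude of the plane with
  multiplier \<open>N(p) + n(y')/n(y)\<close>, whose trace depends on \<open>p\<close>; the factor \<open>z\<close> serves to adjust the trace.
\<close>

definition plane_op where
  "plane_op y y' p z = (1 / nrm y) *s (y * p * z * star y + y' * z * star y - y * star z * star y') +
     (1 / nrm y') *s (y' * star p * star z * star y')"

lemma plane_op:
  assumes y: "vec y" "vec y'" "nrm y \<noteq> 0" "nrm y' \<noteq> 0" and o: "star y * y' = 0"
    and q: "quat p" "quat z"
  defines "E \<equiv> (1 / nrm y) *s (y * star y) + (1 / nrm y') *s (y' * star y')"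
  shows "plane_op y y' p z + star (plane_op y y' p z) = tr (p * z) *s E" (is ?A)
    and "star (plane_op y y' p z) * plane_op y y' p z = ((nrm p + nrm y' / nrm y) * nrm z) *s E" (is ?B)
    and "plane_op y y' p z \<in> S"
proof -
  have 1: "x * p * z * star x + x * star z * star p * star x = tr (p * z) *s (x * star x)" if "vec x" for x
  proof -
    have "x * p * z * star x + x * star z * star p * star x = x * (p * z + star (p * z)) * star x"
      by (simp add: algebra_simps)
    also have "\<dots> = tr (p * z) *s (x * star x)"
      using that trace[OF quat_mult[OF q]] by (simp only: mult_scale scale_mult vecD)
    finally show ?thesis .
  qed
  have 2: "x * star p * star z * star x + x * z * p * star x = tr (p * z) *s (x * star x)" if "vec x" for x
  proof -
    have "x * star p * star z * star x + x * z * p * star x = x * (star (z * p) + star (star (z * p))) * star x"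
      by (simp add: algebra_simps)
    also have "\<dots> = tr (star (z * p)) *s (x * star x)"
      using that trace[of "star (z * p)"] q by (simp only: mult_scale scale_mult vecD quat_star quat_mult)
    finally show ?thesis using tr_star[OF quat_mult[OF q(2,1)]] tr_comm[OF q(2,1)] by simp
  qed
  have "plane_op y y' p z + star (plane_op y y' p z) =
    (1 / nrm y) *s (y * p * z * star y + y * star z * star p * star y) +
    (1 / nrm y') *s (y' * star p * star z * star y' + y' * z * p * star y')"
    by (simp add: plane_op_def algebra_simps)
  then show ?A unfolding 1[OF y(1)] 2[OF y(2)] E_def by (simp add: scale_right_distrib mult.commute)
  have o': "star y' * y = 0" using o orth_sym by blast
  have pp: "e * (p * w) = p * w" "e * (z * w) = z * w" "e * (star p * w) = star p * w" "e * (star z * w) = star z * w"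
     "star p * (p * w) = nrm p *s (e * w)" "p * (star p * w) = nrm p *s (e * w)"
     "star z * (z * w) = nrm z *s (e * w)" "z * (star z * w) = nrm z *s (e * w)" for w
    using q quat_star[OF q(1)] quat_star[OF q(2)]
    by (simp_all add: assoc_rule[OF quatD(2)] assoc_rule[OF quat_norm(1)] assoc_rule[OF quat_norm(2)])
  show ?B
    using y by (simp add: E_def plane_op_def algebra_simps o o' assoc_rule[OF o] assoc_rule[OF o'] norm norm_assoc pp)
  show "plane_op y y' p z \<in> S" using y q by (simp add: plane_op_def vecD quatD)
qed

lemma plane_op_orth:
  assumes "star x * y = 0" "star x * y' = 0" "star x' * y = 0" "star x' * y' = 0"
  shows "star (plane_op x x' p z) * plane_op y y' q w = 0"
  using assms by (simp add: plane_op_def algebra_simps zero_assoc)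

text \<open>
  The condition on the traces is what makes the sum of the two plane operators a quadratic element.
\<close>

lemma planes_triv:
  assumes f: "frame x1 x2 x3 x4" and q: "quat p1" "quat p2" "quat z" "nrm z \<noteq> 0"
    and c: "c = nrm p1 + nrm x2 / nrm x1" "c = nrm p2 + nrm x4 / nrm x3" "c \<noteq> 0"
    and t: "tr (p1 * z) = tr (p2 * z)"
  obtains M where "triv M" "multiplier M (c * nrm z)"
proof -
  have x: "vec x1" "vec x2" "vec x3" "vec x4" "nrm x1 \<noteq> 0" "nrm x2 \<noteq> 0" "nrm x3 \<noteq> 0" "nrm x4 \<noteq> 0"
     and o: "star x1 * x2 = 0" "star x1 * x3 = 0" "star x1 * x4 = 0"
     "star x2 * x3 = 0" "star x2 * x4 = 0" "star x3 * x4 = 0"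
     and sum: "(1 / nrm x1) *s (x1 * star x1) + (1 / nrm x2) *s (x2 * star x2) +
     (1 / nrm x3) *s (x3 * star x3) + (1 / nrm x4) *s (x4 * star x4) = 1"
    using f by (auto simp: frame_def)
  note A = plane_op[OF x(1,2,5,6) o(1) q(1,3)] and B = plane_op[OF x(3,4,7,8) o(6) q(2,3)]
  define P where "P = plane_op x1 x2 p1 z"
  define Q where "Q = plane_op x3 x4 p2 z"
  define E where "E = (1 / nrm x1) *s (x1 * star x1) + (1 / nrm x2) *s (x2 * star x2)"
  define F where "F = (1 / nrm x3) *s (x3 * star x3) + (1 / nrm x4) *s (x4 * star x4)"
  have EF: "E + F = 1" using sum by (simp add: E_def F_def add.assoc)
  have PQ: "star P * Q = 0" "star Q * P = 0"
    unfolding P_def Q_def using o o[THEN orth_sym] by (auto intro!: plane_op_orth)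
  have tr: "(P + Q) + star (P + Q) = tr (p1 * z) *s 1"
    using A(1) B(1) unfolding P_def[symmetric] Q_def[symmetric] E_def[symmetric] F_def[symmetric] t EF[symmetric]
    by (simp add: scale_right_distrib algebra_simps)
  have n: "star (P + Q) * (P + Q) = (c * nrm z) *s 1"
    using A(2) B(2) unfolding P_def[symmetric] Q_def[symmetric] E_def[symmetric] F_def[symmetric] c(1)[symmetric] c(2)[symmetric]
       EF[symmetric]
    by (simp add: scale_right_distrib algebra_simps PQ)
  have S: "P + Q \<in> S" using A(3) B(3) by (simp add: P_def Q_def)
  have n': "(P + Q) * star (P + Q) = (c * nrm z) *s 1"
    using n trace_commute[OF tr] by simp
  show thesis
    by (rule that[of "P + Q"]) (use triv_quadratic[OF S tr n] S n n' c q in \<open>auto simp: multiplier_def\<close>)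
qed

text \<open>
  A hyperplane of the quaternions contains an invertible element: the norm form is nondegenerate of
  dimension 4 and so cannot vanish on a subspace of dimension 3. The four cases give explicit elements.
\<close>

lemma unit_trace_zero:
  assumes d: "quat d"
  obtains z where "quat z" "nrm z \<noteq> 0" "tr (d * z) = 0"
proof -
  obtain d0 d1 d2 d3 where dd: "d = d0 *s e + d1 *s i + d2 *s j + d3 *s (i * j)"
    using d by (elim quat_cases)
  have ij: "quat (i * j)" by simp
  have Q: "quat (z0 *s e + z1 *s i + z2 *s j + z3 *s (i * j))" for z0 z1 z2 z3
    by simp
  have N: "nrm (z0 *s e + z1 *s i + z2 *s j + z3 *s (i * j)) = z0^2 - a*z1^2 - b*z2^2 + a*b*z3^2" for z0 z1 z2 z3
    by (rule nrm_eqI) (rule nrm_coords)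
  have T: "tr (d * (z0 *s e + z1 *s i + z2 *s j + z3 *s (i * j))) =
     2 * (d0*z0 + a*d1*z1 + b*d2*z2 - a*b*d3*z3)" for z0 z1 z2 z3
    unfolding dd mult_coords tr_coords ..
  note goal = that
  have good: thesis if "z0^2 - a*z1^2 - b*z2^2 + a*b*z3^2 \<noteq> 0" "d0*z0 + a*d1*z1 + b*d2*z2 - a*b*d3*z3 = 0"
    for z0 z1 z2 z3
  proof (rule goal[OF Q])
    show "nrm (z0 *s e + z1 *s i + z2 *s j + z3 *s (i * j)) \<noteq> 0" unfolding N by (rule that(1))
    show "tr (d * (z0 *s e + z1 *s i + z2 *s j + z3 *s (i * j))) = 0" unfolding T that(2) by simp
  qed
  consider "d0 = 0" | "a * d1^2 \<noteq> d0^2" | "b * d2^2 \<noteq> d0^2"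
    | "d0 \<noteq> 0" "a * d1^2 = d0^2" "b * d2^2 = d0^2" by blast
  then show thesis
  proof cases
    case 1
    then show thesis by (intro good[of 1 0 0 0]) auto
  next
    case 2
    have "(a*d1)^2 - a*(-d0)^2 = a * (a * d1^2 - d0^2)" by Groebner_Basis.algebra
    then show thesis using 2 ab by (intro good[of "a*d1" "-d0" 0 0]) auto
  next
    case 3
    have "(b*d2)^2 - b*(-d0)^2 = b * (b * d2^2 - d0^2)" by Groebner_Basis.algebra
    then show thesis using 3 ab by (intro good[of "b*d2" 0 "-d0" 0]) auto
  next
    case 4
    have "- (a*(b*d2)^2) - b*(-(a*d1))^2 = - (a * b * (b * d2^2 + a * d1^2))" by Groebner_Basis.algebra
    also have "\<dots> = - (a * b * (2 * d0^2))" using 4 by simp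
    also have "\<dots> \<noteq> 0" using two ab 4 by simp
    finally show thesis by (intro good[of 0 "b*d2" "-(a*d1)" 0]) auto
  qed
qed

text \<open>
  Gram-Schmidt in the plane of \<open>x\<^sub>2\<close> and \<open>x\<^sub>3\<close>, beginning with \<open>v\<close>. The second vector is taken from \<open>x\<^sub>3\<close> if \<open>q\<close> is
  invertible, and from \<open>x\<^sub>2\<close> otherwise.
\<close>

lemma pair_exchange:
  assumes f: "frame x1 x2 x3 x4" and q: "quat q" "quat r" and v: "v = x2 * q + x3 * r" and nv: "nrm v \<noteq> 0"
  shows "\<exists>y. frame x1 v y x4"
proof -
  have nrm2: "nrm (y2 * p + y3 * s) = nrm y2 * nrm p + nrm y3 * nrm s"
    if "vec y2" "vec y3" "star y2 * y3 = 0" "quat p" "quat s" for y2 y3 p s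
  proof (rule nrm_eqI)
    note o = that(3) orth_sym[OF that(3)]
    have "star (y2 * p + y3 * s) * (y2 * p + y3 * s) = (nrm y2 * nrm p + nrm y3 * nrm s) *s e"
      using that by (simp add: algebra_simps o o[THEN zero_assoc] norm_assoc quatD quat_norm)
    then show "star (y2 * p + y3 * s) * (y2 * p + y3 * s) = (nrm y2 * nrm p + nrm y3 * nrm s) *s e" .
  qed
  have *: "\<exists>y. frame x1 v y x4"
    if f: "frame x1 x2 x3 x4" and q: "quat q" "quat r" and v: "v = x2 * q + x3 * r" and nq: "nrm q \<noteq> 0"
    for x2 x3 q r
  proof -
    have x: "vec x1" "vec x2" "vec x3" "vec x4" "nrm x1 \<noteq> 0" "nrm x2 \<noteq> 0" "nrm x3 \<noteq> 0" "nrm x4 \<noteq> 0"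
     and o: "star x1 * x2 = 0" "star x1 * x3 = 0" "star x1 * x4 = 0"
     "star x2 * x3 = 0" "star x2 * x4 = 0" "star x3 * x4 = 0"
     and sum: "(1 / nrm x1) *s (x1 * star x1) + (1 / nrm x2) *s (x2 * star x2) +
     (1 / nrm x3) *s (x3 * star x3) + (1 / nrm x4) *s (x4 * star x4) = 1"
      using f by (auto simp: frame_def)
    define y where "y = (nrm x2 * nrm q) *s x3 - nrm x3 *s (x2 * (q * star r))"
    note o' = o o[THEN orth_sym]
    note O = o' o'[THEN zero_assoc]
    note nv2 = nrm2[OF x(2,3) o(4) q]
    have pp: "e * (p * w) = p * w" "star p * (p * w) = nrm p *s (e * w)" "p * (star p * w) = nrm p *s (e * w)"
      if "quat p" for p w
      using that by (simp_all add: assoc_rule[OF quatD(2)] assoc_rule[OF quat_norm(1)] assoc_rule[OF quat_norm(2)])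
    note P = pp[OF q(1)] pp[OF q(2)] pp[OF quat_star[OF q(1)]] pp[OF quat_star[OF q(2)]]
    have vy: "vec v" "vec y" using x q by (auto simp: v y_def)
    have ny: "nrm y = nrm x2 * nrm x3 * nrm q * nrm v"
    proof -
      have "y = x2 * (- (nrm x3 *s (q * star r))) + x3 * ((nrm x2 * nrm q) *s e)"
        using x by (simp add: y_def vecD)
      then have "nrm y = nrm x2 * nrm (- (nrm x3 *s (q * star r))) + nrm x3 * nrm ((nrm x2 * nrm q) *s e)"
        using nrm2[OF x(2,3) o(4), of "- (nrm x3 *s (q * star r))" "(nrm x2 * nrm q) *s e"] q by simp
      also have "- (nrm x3 *s (q * star r)) = (- nrm x3) *s (q * star r)" by simp
      also have "nrm ((- nrm x3) *s (q * star r)) = nrm x3 ^ 2 * (nrm q * nrm r)"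
        using nrm_scale[of "q * star r" "- nrm x3"] nrm_vec_quat[of q "star r"] q by (simp add: quat_vec nrm_star)
      also have "nrm ((nrm x2 * nrm q) *s e) = (nrm x2 * nrm q) ^ 2"
        using nrm_scale[of e "nrm x2 * nrm q"] by (simp add: quat_vec)
      finally show ?thesis unfolding v nv2 by (simp add: power2_eq_square algebra_simps)
    qed
    have orth: "star v * y = 0"
      using x by (simp add: v y_def algebra_simps O norm norm_assoc P quatD[OF q(1)] quatD[OF quat_star[OF q(2)]])
    have o1: "star x1 * v = 0" "star x1 * y = 0" "star v * x4 = 0" "star y * x4 = 0"
      by (simp_all add: v y_def algebra_simps O)
    define V where "V = nrm v"
    have V: "V = nrm x2 * nrm q + nrm x3 * nrm r" "V \<noteq> 0" using nv v nv2 by (auto simp: V_def)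
    define C where "C = x2 * (q * star r) * star x3"
    define D where "D = x3 * (r * star q) * star x2"
    define k where "k = nrm x2 * nrm q"
    have vv': "v * star v = nrm q *s (x2 * star x2) + nrm r *s (x3 * star x3) + C + D"
      using x by (simp add: v C_def D_def algebra_simps P)
    have yy': "y * star y = (nrm x3 ^ 2 * nrm q * nrm r) *s (x2 * star x2) + k ^ 2 *s (x3 * star x3)
       - (k * nrm x3) *s C - (k * nrm x3) *s D"
      using x by (simp add: y_def C_def D_def algebra_simps P power2_eq_square k_def)
    have c1: "nrm q / V + nrm x3 * nrm r / (nrm x2 * V) = 1 / nrm x2"
    proof -
      have "nrm q / V + nrm x3 * nrm r / (nrm x2 * V) = (nrm x2 * nrm q + nrm x3 * nrm r) / (nrm x2 * V)"
        using x by (simp add: add_divide_distrib)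
      then show ?thesis unfolding V(1)[symmetric] using V(2) by simp
    qed
    have c2: "nrm r / V + nrm x2 * nrm q / (nrm x3 * V) = 1 / nrm x3"
    proof -
      have "nrm r / V + nrm x2 * nrm q / (nrm x3 * V) = (nrm x2 * nrm q + nrm x3 * nrm r) / (nrm x3 * V)"
        using x by (simp add: add_divide_distrib)
      then show ?thesis unfolding V(1)[symmetric] using V(2) by simp
    qed
    have "(1 / V) *s (v * star v) + (1 / nrm y) *s (y * star y) =
      (nrm q / V + nrm x3 ^ 2 * nrm q * nrm r / nrm y) *s (x2 * star x2) +
      (nrm r / V + k ^ 2 / nrm y) *s (x3 * star x3) + (1 / V - k * nrm x3 / nrm y) *s C
      + (1 / V - k * nrm x3 / nrm y) *s D"
      by (simp only: vv' yy') (simp add: algebra_simps)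
    also have "nrm x3 ^ 2 * nrm q * nrm r / nrm y = nrm x3 * nrm r / (nrm x2 * V)"
      unfolding ny V_def[symmetric] using x nq V(2) by (simp add: field_simps power2_eq_square)
    also have "k ^ 2 / nrm y = nrm x2 * nrm q / (nrm x3 * V)"
      unfolding ny V_def[symmetric] k_def using x nq V(2) by (simp add: field_simps power2_eq_square)
    also have "1 / V - k * nrm x3 / nrm y = 0"
      unfolding ny V_def[symmetric] k_def using x nq V(2) by (simp add: field_simps)
    also note c1
    also note c2
    finally have vv: "(1 / nrm v) *s (v * star v) + (1 / nrm y) *s (y * star y) =
      (1 / nrm x2) *s (x2 * star x2) + (1 / nrm x3) *s (x3 * star x3)" by (simp add: V_def)
    have "(1 / nrm x1) *s (x1 * star x1) + (1 / nrm v) *s (v * star v) + (1 / nrm y) *s (y * star y) +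
       (1 / nrm x4) *s (x4 * star x4) = 1"
    proof -
      have "(1 / nrm x1) *s (x1 * star x1) + ((1 / nrm v) *s (v * star v) + (1 / nrm y) *s (y * star y)) +
       (1 / nrm x4) *s (x4 * star x4) = 1"
        unfolding vv using sum by (simp only: add.assoc)
      then show ?thesis by (simp only: add.assoc)
    qed
    then have "frame x1 v y x4"
      unfolding frame_def using x vy o o1 orth ny nv nq by simp
    then show ?thesis by blast
  qed
  have o: "vec x2" "vec x3" "star x2 * x3 = 0" using f by (auto simp: frame_def)
  have "nrm q \<noteq> 0 \<or> nrm r \<noteq> 0" using nv nrm2[OF o q] v by auto
  then show ?thesis
    using *[OF f q v] *[OF frame_swap23[OF f] q(2,1)] v by (auto simp: add.commute)
qed

text \<open>
  With \<open>A, B, C\<close> the norms of the three components, some sum of two of them is nonzero since \<open>A + B + C\<close> is.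
\<close>

lemma triple_exchange:
  assumes f: "frame x1 x2 x3 x4" and q: "quat q" "quat r" "quat s"
    and v: "v = x2 * q + x3 * r + x4 * s" and nv: "nrm v \<noteq> 0"
  shows "\<exists>y z. frame x1 v y z"
proof -
  have *: "\<exists>y z. frame x1 v y z"
    if f: "frame x1 x2 x3 x4" and q: "quat q" "quat r" "quat s"
      and v: "v = x2 * q + x3 * r + x4 * s" and n: "nrm (x2 * q + x3 * r) \<noteq> 0" for x2 x3 x4 q r s
  proof -
    obtain y where y: "frame x1 (x2 * q + x3 * r) y x4" using pair_exchange[OF f q(1,2) refl n] by blast
    have "vec (x2 * q + x3 * r)" using y by (simp add: frame_def)
    then have v': "v = (x2 * q + x3 * r) * e + x4 * s" using v by (simp add: vecD)
    show ?thesis using pair_exchange[OF frame_swap34[OF y] quat_e q(3) v' nv] by blast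
  qed
  have x: "vec x2" "vec x3" "vec x4"
     and o: "star x2 * x3 = 0" "star x2 * x4 = 0" "star x3 * x4 = 0" using f by (auto simp: frame_def)
  have nrm2: "nrm (y2 * p + y3 * s) = nrm y2 * nrm p + nrm y3 * nrm s"
    if "vec y2" "vec y3" "star y2 * y3 = 0" "quat p" "quat s" for y2 y3 p s
    using that orth_sym[OF that(3)]
    by (intro nrm_eqI) (simp add: algebra_simps zero_assoc norm_assoc quatD quat_norm)
  have n3: "nrm v = nrm x2 * nrm q + nrm x3 * nrm r + nrm x4 * nrm s"
    unfolding v using x o[THEN orth_sym] o q
    by (intro nrm_eqI) (simp add: algebra_simps zero_assoc norm_assoc quatD quat_norm)
  consider "nrm x2 * nrm q + nrm x3 * nrm r \<noteq> 0" | "nrm x2 * nrm q + nrm x4 * nrm s \<noteq> 0"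
    | "nrm x3 * nrm r + nrm x4 * nrm s \<noteq> 0"
  proof -
    have "\<not> (A + B = 0 \<and> A + C = 0 \<and> B + C = 0)" if "A + B + C \<noteq> 0" for A B C :: 'a
    proof
      assume h: "A + B = 0 \<and> A + C = 0 \<and> B + C = 0"
      then have "2 * (A + B + C) = 0" by Groebner_Basis.algebra
      then show False using two that by (metis mult_eq_0_iff)
    qed
    then show thesis using that nv n3 by metis
  qed
  then show ?thesis
  proof cases
    case 1
    then show ?thesis using *[OF f q v] nrm2 x o q by simp
  next
    case 2
    have "v = x2 * q + x4 * s + x3 * r" using v by (simp add: add_ac)
    then show ?thesis using *[OF frame_swap34[OF f] q(1,3,2)] 2 nrm2 x o q by simp
  next
    case 3
    have "v = x3 * r + x4 * s + x2 * q" using v by (simp add: add_ac)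
    then show ?thesis using *[OF frame_swap34[OF frame_swap23[OF f]] q(2,3,1)] 3 nrm2 x o q by simp
  qed
qed

lemma triv_inverse:
  assumes "triv g" "multiplier g c"
  shows "triv ((1/c) *s star g)" "multiplier ((1/c) *s star g) (1/c)"
proof -
  show m: "multiplier ((1/c) *s star g) (1/c)" using assms(2) by (auto simp: multiplier_def)
  have "g * ((1/c) *s star g) = 1" using assms(2) by (simp add: multiplier_def)
  then show "triv ((1/c) *s star g)" using triv_cancel[OF assms(1)] m simil_iff triv_one by metis
qed

lemma frame_scale4:
  assumes f: "frame x1 x2 x3 x4" and q: "quat q" "nrm q \<noteq> 0"
  shows "frame x1 x2 x3 (x4 * q)"
proof -
  have x4: "vec x4" "nrm x4 \<noteq> 0" using f by (auto simp: frame_def)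
  have n: "nrm (x4 * q) = nrm x4 * nrm q" by (rule nrm_vec_quat[OF x4(1) q(1)])
  have "(1 / nrm (x4 * q)) *s (x4 * q * star (x4 * q)) = (1 / nrm x4) *s (x4 * star x4)"
    using x4 q by (simp add: n mult.assoc quat_norm_assoc)
  then show ?thesis using f q n by (simp add: frame_def mult.assoc[symmetric])
qed

text \<open>
  It suffices to find one R-trivial similitude with the multiplier of \<open>g\<close>. The multiplier is read off first
  from the image of \<open>x\<^sub>1\<close> and then, after correction of \<open>g\<close> by an isometry, from the plane orthogonal to
  \<open>x\<^sub>1\<close> and \<open>v\<close>.
\<close>

theorem simil_triv:
  assumes f: "frame x1 x2 x3 x4" and g: "multiplier g c"
  shows "triv g"
proof -
  have x: "vec x1" "vec x2" "vec x3" "vec x4" "nrm x1 \<noteq> 0"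
     and o: "star x1 * x2 = 0" "star x1 * x3 = 0" "star x1 * x4 = 0" using f by (auto simp: frame_def)
  have gS: "g \<in> S" and c0: "c \<noteq> 0" and gg: "star g * g = c *s 1" using g by (auto simp: multiplier_def)
  have gxy: "star (g * v) * (g * w) = c *s (star v * w)" for v w
    by (simp add: mult.assoc assoc_rule[OF gg])
  define q where "q = (1 / nrm x1) *s (star x1 * (g * x1))"
  define v where "v = (1 / nrm x2) *s (x2 * (star x2 * (g * x1))) + (1 / nrm x3) *s (x3 * (star x3 * (g * x1)))
     + (1 / nrm x4) *s (x4 * (star x4 * (g * x1)))"
  have q: "quat q" using x gS by (simp add: q_def)
  have gx1: "g * x1 = x1 * q + v"
    using frame_expand[OF f, of "g * x1"] by (simp add: q_def v_def add.assoc)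
  have v: "vec v" using x gS by (simp add: v_def)
  have ov: "star x1 * v = 0" by (simp add: v_def algebra_simps zero_assoc o)
  have cn: "c * nrm x1 = nrm x1 * nrm q + nrm v"
  proof -
    have "(c * nrm x1) *s e = star (g * x1) * (g * x1)" by (simp only: gxy norm[OF x(1)] scale_scale)
    also have "\<dots> = (nrm x1 * nrm q + nrm v) *s e"
      unfolding gx1 using ov orth_sym[OF ov] x q v
      by (simp add: algebra_simps zero_assoc norm norm_assoc quatD quat_norm)
    finally show ?thesis using e_neq by simp
  qed
  show ?thesis
  proof (cases "nrm v = 0")
    case True
    then have "nrm q = c" using cn x(5) by simp
    then show ?thesis using scalar_triv[OF f q] triv_of_multiplier[OF f g] c0 by metis
  next
    case False
    have v3: "v = x2 * ((1 / nrm x2) *s (star x2 * (g * x1))) + x3 * ((1 / nrm x3) *s (star x3 * (g * x1)))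
      + x4 * ((1 / nrm x4) *s (star x4 * (g * x1)))" by (simp add: v_def)
    obtain y z where f2: "frame x1 v y z"
      using triple_exchange[OF f _ _ _ v3 False] x gS by auto
    have yz: "vec y" "vec z" "nrm y \<noteq> 0" "nrm z \<noteq> 0" "star y * z = 0"
      and o2: "star x1 * y = 0" "star x1 * z = 0" "star v * y = 0" "star v * z = 0"
      using f2 by (auto simp: frame_def)
    define k where "k = nrm v / nrm x1"
    have ck: "c = nrm q + k" using cn x(5) by (simp add: k_def field_simps)
    have kx: "k * nrm x1 = nrm v" using x(5) by (simp add: k_def)
    \<comment> \<open>the vector of the plane of \<open>x1\<close> and \<open>v\<close> orthogonal to \<open>g x1\<close>, scaled to the norm of \<open>g v\<close>\<close>
    define w where "w = v * star q - k *s x1"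
    have vw: "vec w" using v x q by (simp add: w_def)
    note ov' = ov orth_sym[OF ov]
    have nw: "nrm w = c * nrm v"
    proof (rule nrm_eqI)
      have "star w * w = (nrm v * nrm q + k * (k * nrm x1)) *s e"
        using ov' x v q by (simp add: w_def algebra_simps zero_assoc norm norm_assoc quatD[OF quat_star] quat_norm)
      then show "star w * w = (c * nrm v) *s e" by (simp add: kx ck algebra_simps)
    qed
    have xw: "star (g * x1) * w = 0"
      unfolding gx1 w_def using ov' x v q kx
      by (simp add: algebra_simps zero_assoc norm norm_assoc quatD[OF quat_star] )
    have nv: "nrm (g * v) = c * nrm v"
      by (rule nrm_eqI) (simp only: gxy norm[OF v], simp)
    obtain r where r: "triv r" "star r * r = 1" "r * (g * v) = w"
      "\<And>u. star (g * v) * u = 0 \<Longrightarrow> star w * u = 0 \<Longrightarrow> r * u = u"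
      using transport[of "g * v" w] v vw gS nv nw False c0 by auto
    \<comment> \<open>\<open>h\<close> preserves the plane of \<open>x1\<close> and \<open>v\<close>, hence its orthogonal complement\<close>
    define h where "h = r * g"
    have mr: "multiplier r 1" using r simil_iff[of r] unfolding multiplier_def triv_def by auto
    have mh: "multiplier h c" using multiplier_mult[OF mr g] by (simp add: h_def)
    have hS: "h \<in> S" and hh: "star h * h = c *s 1" using mh by (auto simp: multiplier_def)
    have hxy: "star (h * v) * (h * w) = c *s (star v * w)" for v w
      by (simp add: mult.assoc assoc_rule[OF hh])
    have hx1: "h * x1 = x1 * q + v"
    proof -
      have "star (g * v) * (g * x1) = 0" unfolding gxy using ov' by simp
      then have "r * (g * x1) = g * x1" using r(4) orth_sym[OF xw] by blast
      then show ?thesis by (simp add: h_def mult.assoc gx1)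
    qed
    have hv: "h * v = w" using r by (simp add: h_def mult.assoc)
    have x1_eq: "c *s x1 = h * x1 * star q - h * v"
      unfolding hx1 hv w_def using x q by (simp add: algebra_simps quat_norm vecD ck)
    have ho: "star (h * x1) * (h * y) = 0" "star (h * v) * (h * y) = 0" unfolding hxy using o2 by simp_all
    have "c *s (star x1 * (h * y)) = star (c *s x1) * (h * y)" by (simp add: mult.assoc)
    also have "\<dots> = q * (star (h * x1) * (h * y)) - star (h * v) * (h * y)"
      unfolding x1_eq by (simp add: algebra_simps)
    finally have x1y: "star x1 * (h * y) = 0" using c0 ho by simp
    have "v = h * x1 - x1 * q" by (simp add: hx1)
    then have "star v * (h * y) = star (h * x1 - x1 * q) * (h * y)" by simp
    also have "\<dots> = star (h * x1) * (h * y) - star q * (star x1 * (h * y))" by (simp add: algebra_simps)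
    finally have vy: "star v * (h * y) = 0" using ho x1y by simp
    define p where "p = (1 / nrm y) *s (star y * (h * y))"
    define s where "s = (1 / nrm z) *s (star z * (h * y))"
    have ps: "quat p" "quat s" using yz hS by (simp_all add: p_def s_def)
    have hy: "h * y = y * p + z * s"
      using frame_expand[OF f2, of "h * y"] by (simp add: p_def s_def x1y vy)
    have cy: "c * nrm y = nrm y * nrm p + nrm z * nrm s"
    proof -
      have "(c * nrm y) *s e = star (h * y) * (h * y)" by (simp only: hxy norm[OF yz(1)] scale_scale)
      also have "\<dots> = (nrm y * nrm p + nrm z * nrm s) *s e"
        unfolding hy using yz orth_sym[OF yz(5)] ps
        by (simp add: algebra_simps zero_assoc norm norm_assoc quatD quat_norm)
      finally show ?thesis using e_neq by simp
    qed
    show ?thesis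
    proof (cases "nrm s = 0")
      case True
      then have "nrm p = c" using cy yz by simp
      then show ?thesis using scalar_triv[OF f ps(1)] triv_of_multiplier[OF f g] c0 by metis
    next
      case False
      have f3: "frame x1 v y (z * s)" using frame_scale4[OF f2 ps(2) False] .
      have c2: "c = nrm p + nrm (z * s) / nrm y"
        using cy yz ps by (simp add: nrm_vec_quat field_simps)
      \<comment> \<open>equalizes the traces on the two planes\<close>
      obtain t where t: "quat t" "nrm t \<noteq> 0" "tr ((q - p) * t) = 0"
        using unit_trace_zero[of "q - p"] q ps by auto
      have tt: "tr (q * t) = tr (p * t)"
        using t q ps tr_diff[of "q * t" "p * t"] by (simp add: left_diff_distrib)
      obtain M where M: "triv M" "multiplier M (c * nrm t)"
        using planes_triv[OF f3 q ps(1) t(1,2) _ c2 c0 tt] ck k_def by blast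
      obtain Z where Z: "triv Z" "multiplier Z (nrm t)" using scalar_triv[OF f t(1,2)] by blast
      note I = triv_inverse[OF Z]
      have "multiplier (M * ((1 / nrm t) *s star Z)) c"
        using multiplier_mult[OF M(2) I(2)] t(2) by simp
      then show ?thesis using triv_of_multiplier[OF f g] triv_mult[OF M(1) I(1)] by blast
    qed
  qed
qed

end

section \<open>Central simple algebras of symplectic type\<close>

text \<open>
  Simplicity is stated through the two-sided ideal of \<open>x\<close>, which contains 1.
\<close>

locale central_simple_star = star_algebra +
  assumes simple: "x \<in> S \<Longrightarrow> x \<noteq> 0 \<Longrightarrow> \<exists>(n::nat) u v. (\<forall>k<n. u k \<in> S \<and> v k \<in> S) \<and> (\<Sum>k<n. u k * x * v k) = 1"
    and central: "z \<in> S \<Longrightarrow> (\<And>x. x \<in> S \<Longrightarrow> z * x = x * z) \<Longrightarrow> \<exists>c. z = c *s 1"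
    and fin: "\<exists>T. finite T \<and> S \<subseteq> span T"
begin

lemma prime:
  assumes "x \<in> S" "y \<in> S" "\<And>z. z \<in> S \<Longrightarrow> x * z * y = 0" "x \<noteq> 0"
  shows "y = 0"
proof -
  obtain n :: nat and u v where u: "\<And>k. k < n \<Longrightarrow> u k \<in> S \<and> v k \<in> S" "(\<Sum>k<n. u k * x * v k) = 1"
    using simple[OF assms(1,4)] by blast
  have "y = (\<Sum>k<n. u k * x * v k) * y" using u by simp
  also have "\<dots> = (\<Sum>k<n. u k * (x * v k * y))" by (simp add: sum_distrib_right mult.assoc)
  also have "\<dots> = 0" using u(1) by (intro sum.neutral) (simp add: assms(3))
  finally show ?thesis .
qed

text \<open>
  The center of a corner consists of scalars: if \<open>1 = \<Sum> u\<^sub>k f v\<^sub>k\<close> then \<open>\<Sum> u\<^sub>k z v\<^sub>k\<close> is central in the whole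
  algebra and restricts to \<open>z\<close>.
\<close>

lemma corner_center:
  assumes f: "f \<in> S" "f \<noteq> 0" and z: "z \<in> S" "f * z = z" "z * f = z"
    and comm: "\<And>x. x \<in> S \<Longrightarrow> z * (f * x * f) = f * x * f * z"
  shows "\<exists>c. z = c *s f"
proof -
  obtain n :: nat and u v where u: "\<And>k. k < n \<Longrightarrow> u k \<in> S \<and> v k \<in> S" and one: "(\<Sum>k<n. u k * f * v k) = 1"
    using simple[OF f] by blast
  define w where "w = (\<Sum>k<n. u k * z * v k)"
  have zc: "z * (y * f) = f * (y * z)" if "y \<in> S" for y
    using comm[OF that] z by (metis mult.assoc)
  have wS: "w \<in> S" using u z by (auto simp: w_def)
  have "w * x = x * w" if x: "x \<in> S" for x
  proof -
    have "w * x = (\<Sum>k<n. u k * z * v k) * x * (\<Sum>k<n. u k * f * v k)" by (simp add: w_def one)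
    also have "\<dots> = (\<Sum>k<n. \<Sum>l<n. u k * (z * (v k * x * u l * f)) * v l)"
      by (subst sum.swap) (simp add: sum_distrib_left sum_distrib_right mult.assoc)
    also have "\<dots> = (\<Sum>k<n. \<Sum>l<n. u k * (f * (v k * x * u l * z)) * v l)"
      using u x by (intro sum.cong refl) (simp add: zc)
    also have "\<dots> = (\<Sum>k<n. u k * f * v k) * x * (\<Sum>k<n. u k * z * v k)"
      by (subst sum.swap) (simp add: sum_distrib_left sum_distrib_right mult.assoc)
    finally show ?thesis by (simp add: w_def one)
  qed
  then obtain c where c: "w = c *s 1" using central wS by blast
  have "w * f = (\<Sum>k<n. u k * (z * (v k * f)))" by (simp add: w_def sum_distrib_right mult.assoc)
  also have "\<dots> = (\<Sum>k<n. u k * (f * (v k * z)))" using u by (intro sum.cong refl) (simp add: zc)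
  also have "\<dots> = (\<Sum>k<n. u k * f * v k) * z" by (simp add: sum_distrib_right mult.assoc)
  finally have "w * f = z" by (simp add: one)
  then show ?thesis using c by (intro exI[of _ c]) simp
qed

end

text \<open>
  The last assumption expresses the symplectic type, and the dimension the degree 8. For an idempotent \<open>f\<close> of rank
  at most 2 over a splitting field, symmetric elements \<open>s\<close> and \<open>t\<close> correspond to alternating forms on a plane and on its
  dual; these are unique up to scalars, and their product is a scalar.
\<close>

locale symplectic_csa = central_simple_star +
  assumes two: "(2::'a) \<noteq> 0"
    and dimS: "dim S = 64"
    and sympl: "f \<in> S \<Longrightarrow> f * f = f \<Longrightarrow>
      \<exists>q::nat \<Rightarrow> 'b. (\<forall>k<4. q k \<in> S) \<and> (\<forall>x\<in>S. \<exists>c. f * x * f = (\<Sum>k<4. c k *s q k)) \<Longrightarrow>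
      s \<in> S \<Longrightarrow> star s = s \<Longrightarrow> star f * s * f = s \<Longrightarrow> t \<in> S \<Longrightarrow> star t = t \<Longrightarrow> f * t * star f = t \<Longrightarrow>
      (\<forall>x\<in>S. t * s * (f * x * f) = f * x * f * (t * s)) \<and> (s \<noteq> 0 \<longrightarrow> t \<noteq> 0 \<longrightarrow> t * s \<noteq> 0)"
begin

text \<open>
  If \<open>x\<^sup>* x\<close> vanishes on \<open>pSf\<close> then \<open>x\<^sup>* y\<close> is skew-symmetric there, so that \<open>b\<^sup>* (x\<^sup>* y) = (x\<^sup>* y) b\<close> for \<open>b\<close> in the corner.
  Computing \<open>x\<^sup>* y d d'\<close> in two ways shows that the form annihilates commutators.
\<close>

lemma commutator_zero:
  assumes f: "f \<in> S" "p \<in> S" "f * f = f" "p \<noteq> 0" and pp: "p * p = p" and sp: "star p = p"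
    and iso: "\<And>x. x \<in> S \<Longrightarrow> x * f = x \<Longrightarrow> p * x = x \<Longrightarrow> star x * x = 0"
    and d: "d \<in> S" "f * d = d" "d * f = d" "d' \<in> S" "f * d' = d'" "d' * f = d'"
  shows "d * d' = d' * d"
proof (rule ccontr)
  assume c: "d * d' \<noteq> d' * d"
  define c where "c = d * d' - d' * d"
  note fd = d(2,3,5,6)
  have skew: "star x * y = - (star y * x)" if "x \<in> S" "x * f = x" "p * x = x" "y \<in> S" "y * f = y" "p * y = y" for x y
  proof -
    have "star (x + y) * (x + y) = 0" using that by (intro iso) (auto simp: algebra_simps)
    then have "star x * x + star x * y + star y * x + star y * y = 0" by (simp add: algebra_simps)
    then show ?thesis using iso[of x] iso[of y] that by (simp add: eq_neg_iff_add_eq_0)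
  qed
  have tw: "star b * (star x * y) = star x * y * b" if xy: "x \<in> S" "x * f = x" "p * x = x" "y \<in> S" "y * f = y" "p * y = y"
    and b: "b \<in> S" "b * f = b" for x y b
  proof -
    have xb: "x * b \<in> S" "x * b * f = x * b" "p * (x * b) = x * b"
      using xy b by (simp_all add: mult.assoc assoc_rule[OF xy(3)])
    have "star b * (star x * y) = star (x * b) * y" by (simp add: mult.assoc)
    also have "\<dots> = - (star y * (x * b))" using skew[OF xb xy(4-6)] .
    also have "\<dots> = (- (star y * x)) * b" by (simp add: mult.assoc)
    also have "\<dots> = star x * y * b" using skew[OF xy] by simp
    finally show ?thesis .
  qed
  have z: "star x * y * c = 0" if xy: "x \<in> S" "x * f = x" "p * x = x" "y \<in> S" "y * f = y" "p * y = y" for x y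
  proof -
    have "star x * y * (d * d') = star d * (star x * y) * d'" using tw[OF xy d(1) fd(2)] by (simp add: mult.assoc)
    also have "\<dots> = star d * (star d' * (star x * y))" using tw[OF xy d(4) fd(4)] by (simp add: mult.assoc)
    also have "\<dots> = star (d' * d) * (star x * y)" by (simp add: mult.assoc)
    also have "\<dots> = star x * y * (d' * d)" using tw[OF xy, of "d' * d"] d fd by (simp add: mult.assoc)
    finally show ?thesis by (simp add: c_def algebra_simps)
  qed
  have cS: "c \<in> S" "c \<noteq> 0" "f * c = c"
    using d c by (simp_all add: c_def right_diff_distrib assoc_rule[OF fd(1)] assoc_rule[OF fd(3)])
  have "star f * y * p * w * c = 0" if "y \<in> S" "w \<in> S" for y w
  proof -
    have "star (p * star y * f) * (p * w * f) * c = 0"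
      by (rule z) (use that f pp sp in \<open>simp_all add: mult.assoc assoc_rule[OF pp]\<close>)
    then show ?thesis using cS f sp by (simp add: mult.assoc assoc_rule[OF pp])
  qed
  then have "star f * y * p = 0" if "y \<in> S" for y
    using prime[of "star f * y * p" c] cS f that by blast
  then have "p = 0 \<or> star f = 0" using prime[of "star f" p] f by blast
  then have "f = 0" using f by (metis star_star star_zero)
  then show False using cS by auto
qed

end

section \<open>A quaternion corner\<close>

context symplectic_csa begin

lemma absorb: "p * q = q \<Longrightarrow> p * (q * x) = q * (x::'b)" "p * q = p \<Longrightarrow> p * (q * x) = p * (x::'b)"
  by (simp_all add: mult.assoc[symmetric])

definition small_corner where
  "small_corner f \<longleftrightarrow> (\<exists>q::nat \<Rightarrow> 'b. (\<forall>k<4. q k \<in> S) \<and> (\<forall>x\<in>S. \<exists>c. f * x * f = (\<Sum>k<4. c k *s q k)))"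

definition noncomm_corner where
  "noncomm_corner f \<longleftrightarrow> (\<exists>d\<in>S. \<exists>d'\<in>S. f * d = d \<and> d * f = d \<and> f * d' = d' \<and> d' * f = d' \<and> d * d' \<noteq> d' * d)"

lemma anisotropic_exists:
  assumes "f \<in> S" "p \<in> S" "f * f = f" "p \<noteq> 0" "p * p = p" "star p = p" "noncomm_corner f"
  obtains x where "x \<in> S" "x * f = x" "p * x = x" "star x * x \<noteq> 0"
  using commutator_zero[of f p] assms unfolding noncomm_corner_def by metis

lemma small_corner_symm:
  assumes f: "f \<in> S" "f * f = f" "small_corner f"
    and s: "s \<in> S" "star s = s" "star f * s * f = s" and t: "t \<in> S" "star t = t" "f * t * star f = t"
  shows "x \<in> S \<Longrightarrow> t * s * (f * x * f) = f * x * f * (t * s)" "s \<noteq> 0 \<Longrightarrow> t \<noteq> 0 \<Longrightarrow> t * s \<noteq> 0"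
  using sympl[OF f(1,2) f(3)[unfolded small_corner_def] s t] by blast+

text \<open>
  For anisotropic \<open>x\<close> in \<open>Sf\<close> put \<open>s = x\<^sup>* x\<close>, and likewise \<open>t\<close> for \<open>f\<^sup>*\<close>. Since \<open>ts\<close> is a nonzero multiple \<open>l f\<close>
  of \<open>f\<close>, the element \<open>l\<^sup>-\<^sup>1 x t x\<^sup>*\<close> is an idempotent, obviously symmetric and equivalent to \<open>f\<close>.
\<close>

lemma symmetric_idempotent_exists:
  assumes f: "f \<in> S" "f * f = f" "small_corner f" "noncomm_corner f"
  obtains e where "e \<in> S" "e * e = e" "star e = e" "small_corner e" "noncomm_corner e"
proof -
  obtain d d' where d: "d \<in> S" "d' \<in> S" "f * d = d" "d * f = d" "f * d' = d'" "d' * f = d'" "d * d' \<noteq> d' * d"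
    using f(4) unfolding noncomm_corner_def by blast
  have sff: "star f * star f = star f" using arg_cong[OF f(2), of star] by simp
  have nc: "noncomm_corner (star f)"
    unfolding noncomm_corner_def
  proof (intro bexI conjI)
    show "star f * star d = star d" "star f * star d' = star d'" "star d * star f = star d" "star d' * star f = star d'"
      using d by (simp_all flip: star_mult)
    show "star d * star d' \<noteq> star d' * star d" using d(7) by (metis star_mult star_star)
  qed (use d in auto)
  obtain x where x: "x \<in> S" "x * f = x" "star x * x \<noteq> 0"
    using anisotropic_exists[of f 1] f by auto
  obtain y where y: "y \<in> S" "y * star f = y" "star y * y \<noteq> 0"
    using anisotropic_exists[of "star f" 1] f nc sff by auto
  define s where "s = star x * x"
  define t where "t = star y * y"
  have fx: "star f * star x = star x" "f * star y = star y"
    using x y by (metis star_mult star_star)+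
  have s: "s \<in> S" "star s = s" "star f * s * f = s" "star f * s = s" "s * f = s" "s \<noteq> 0"
    using x fx by (simp_all add: s_def mult.assoc assoc_rule[OF fx(1)])
  have t: "t \<in> S" "star t = t" "f * t * star f = t" "f * t = t" "t * star f = t" "t \<noteq> 0"
    using y fx by (simp_all add: t_def mult.assoc assoc_rule[OF fx(2)])
  note C = small_corner_symm[OF f(1-3) s(1-3) t(1-3)]
  have f0: "f \<noteq> 0" using s by auto
  obtain l where l: "t * s = l *s f"
    using corner_center[OF f(1) f0, of "t * s"] C(1) s t by (auto simp: mult.assoc assoc_rule[OF t(4)])
  have l0: "l \<noteq> 0" using l C(2) s t by auto
  define e where "e = (1/l) *s (x * t * star x)"
  have tst: "t * (s * u) = l *s (f * u)" for u using assoc_rule[OF l, of u] by simp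
  have xtx: "t * (star x * (x * u)) = l *s (f * u)" for u
    using tst[of u] by (simp add: s_def mult.assoc)
  have ee: "e * e = e" using l0 t by (simp add: e_def mult.assoc xtx assoc_rule[OF t(4)])
  have se: "star e = e" using t by (simp add: e_def mult.assoc)
  have eS: "e \<in> S" using x t by (simp add: e_def)
  have small: "small_corner e"
  proof -
    obtain q where q: "\<And>k. k < 4 \<Longrightarrow> q k \<in> S" "\<And>z. z \<in> S \<Longrightarrow> \<exists>c. f * z * f = (\<Sum>k<(4::nat). c k *s q k)"
      using f(3) unfolding small_corner_def by blast
    show ?thesis unfolding small_corner_def
    proof (rule exI[of _ "\<lambda>k. x * (q k) * (t * star x)"], intro conjI allI impI ballI)
      show "x * (q k) * (t * star x) \<in> S" if "k < 4" for k using that q x t by simp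
      fix z assume z: "z \<in> S"
      obtain c where c: "f * (t * star x * z * x) * f = (\<Sum>k<4. c k *s q k)" using q(2) z x t by (meson S_mult S_star)
      have "e * z * e = ((1/l) * (1/l)) *s (x * (f * (t * star x * z * x) * f) * (t * star x))"
        using t by (simp add: e_def mult.assoc assoc_rule[OF x(2)] assoc_rule[OF t(4)])
      also have "\<dots> = (\<Sum>k<4. (((1/l) * (1/l)) * c k) *s (x * q k * (t * star x)))"
        unfolding c by (simp add: sum_distrib_left sum_distrib_right scale_sum_right mult.assoc)
      finally show "\<exists>c. e * z * e = (\<Sum>k<4. c k *s (x * q k * (t * star x)))"
        by (intro exI[of _ "\<lambda>k. (1/l) * (1/l) * c k"])
    qed
  qed
  have nce: "noncomm_corner e"
  proof -
    define E where "E u = x * u * t * star x" for u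
    have E: "E u \<in> S" "e * E u = E u" "E u * e = E u" if "u \<in> S" "f * u = u" "u * f = u" for u
      using that x t l0 by (simp_all add: E_def e_def mult.assoc xtx assoc_rule[OF that(2)] assoc_rule[OF that(3)] assoc_rule[OF t(4)])
    have EE: "E u * E v = l *s E (u * v)" if "f * v = v" for u v
      by (simp add: E_def mult.assoc xtx assoc_rule[OF that])
    have inj: "u = v" if "E u = E v" "u * f = u" "v * f = v" "f * u = u" "f * v = v" for u v
    proof -
      have "t * (star x * (E u * x)) = (l * l) *s u" if "u * f = u" "f * u = u" for u
        using that l by (simp add: E_def mult.assoc xtx s_def[symmetric] assoc_rule[OF that(2)])
      then have "(l * l) *s u = (l * l) *s v" using that by metis
      then show ?thesis using l0 by simp
    qed
    have "E d * E d' \<noteq> E d' * E d"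
    proof
      assume "E d * E d' = E d' * E d"
      then have "E (d * d') = E (d' * d)" using EE d l0 by simp
      then show False using inj[of "d * d'" "d' * d"] d by (simp add: mult.assoc absorb)
    qed
    then show ?thesis unfolding noncomm_corner_def
      using E[OF d(1,3,4)] E[OF d(2,5,6)] by blast
  qed
  show thesis using that eS ee se small nce by blast
qed

lemma symmetric_corner_scalar:
  assumes e: "e \<in> S" "e * e = e" "star e = e" "small_corner e"
    and q: "q \<in> S" "e * q = q" "q * e = q" "star q = q"
  shows "\<exists>c. q = c *s e"
proof (cases "e = 0")
  case True
  then have "q = 0" using q by auto
  then show ?thesis by (intro exI[of _ 0]) simp
next
  case False
  have "e * q * e = q" using q by simp
  then show ?thesis
    using small_corner_symm(1)[OF e(1,2,4) q(1,4) _ e(1,3)] corner_center[OF e(1) False q(1-3)] e q by simp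
qed

text \<open>
  Every element of the corner is half the sum of a scalar and a skew element, and squares and
  anticommutators of skew elements are scalars. If all skew elements (or those that anticommute
  with \<open>i\<close>) had square zero, then \<open>p z p = 0\<close> for each such \<open>p\<close> and all \<open>z\<close>, so that \<open>p = 0\<close>; and then the
  corner would be commutative.
\<close>

lemma quaternion_basis_exists:
  assumes e: "e \<in> S" "e * e = e" "star e = e" "small_corner e" "noncomm_corner e"
  obtains i j a b where "quaternion_frame scale star S e i j a b"
proof -
  define Q where "Q q \<longleftrightarrow> q \<in> S \<and> e * q = q \<and> q * e = q" for q
  define P where "P q \<longleftrightarrow> Q q \<and> star q = - q" for q
  note symm = symmetric_corner_scalar[OF e(1-4)]
  have QI: "Q (p + q)" "Q (p - q)" "Q (p * q)" "Q (- p)" if "Q p" "Q q" for p q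
    using that by (auto simp: Q_def algebra_simps absorb)
  have Qs: "Q (c *s p)" "Q (star p)" if "Q p" for p c
    using that e(3) by (auto simp: Q_def) (metis e(3) star_mult)+
  have Qe: "Q e" "Q (e * z * e)" if "z \<in> S" for z using e that by (auto simp: Q_def mult.assoc assoc_rule[OF e(2)])
  have e0: "e \<noteq> 0" using e(5) unfolding noncomm_corner_def by auto
  have QD: "q \<in> S" "e * q = q" "q * e = q" if "Q q" for q using that by (auto simp: Q_def)
  have PD: "q \<in> S" "e * q = q" "q * e = q" "star q = - q" "Q q" if "P q" for q using that by (auto simp: Q_def P_def)
  have PI: "P (p + q)" "P (p - q)" "P (c *s p)" if "P p" "P q" for p q c
    using that QI Qs by (auto simp: P_def)
  have anti: "\<exists>c. p * q + q * p = c *s e" if "P p" "P q" for p q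
    using symm[of "p * q + q * p"] PD[OF that(1)] PD[OF that(2)]
    by (simp add: algebra_simps absorb)
  have decomp: "\<exists>c r. 2 *s z = c *s e + r \<and> P r" if z: "Q z" for z
  proof -
    obtain c where c: "z + star z = c *s e" using symm[of "z + star z"] QD[OF z] QD[OF Qs(2)[OF z]]
      by (auto simp: algebra_simps)
    have "2 *s z = (z + star z) + (z - star z)"
      using scale_left_distrib[of 1 1 z] by simp
    moreover have "P (z - star z)" using z QI Qs by (simp add: P_def)
    ultimately show ?thesis using c by auto
  qed
  have nil: "p = 0" if "p \<in> S" "\<And>z. z \<in> S \<Longrightarrow> p * (2 *s (e * z * e)) * p = 0" "e * p = p" "p * e = p" for p
  proof (rule ccontr)
    assume "p \<noteq> 0"
    have "p * z * p = 0" if "z \<in> S" for z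
    proof -
      have "2 *s (p * z * p) = p * (2 *s (e * z * e)) * p"
        using \<open>e * p = p\<close> \<open>p * e = p\<close> by (simp add: mult.assoc assoc_rule[OF \<open>p * e = p\<close>])
      then show ?thesis using \<open>\<And>z. z \<in> S \<Longrightarrow> p * (2 *s (e * z * e)) * p = 0\<close> that two by simp
    qed
    then show False using prime[of p p] \<open>p \<in> S\<close> \<open>p \<noteq> 0\<close> by blast
  qed
  have noncomm: False if comm: "\<And>p q. P p \<Longrightarrow> P q \<Longrightarrow> p * q = q * p"
  proof -
    obtain d d' where d: "Q d" "Q d'" "d * d' \<noteq> d' * d"
      using e(5) unfolding noncomm_corner_def Q_def by blast
    obtain c r c' r' where r: "2 *s d = c *s e + r" "P r" "2 *s d' = c' *s e + r'" "P r'"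
      using decomp d by meson
    have "(2 *s d) * (2 *s d') = (2 *s d') * (2 *s d)"
      unfolding r(1,3) using comm[OF r(2,4)] PD[OF r(2)] PD[OF r(4)] e(2) by (simp add: algebra_simps)
    moreover have "(4::'a) = 2 * 2" by simp
    then have "(4::'a) \<noteq> 0" using two by (metis mult_eq_0_iff)
    ultimately show False using d by simp
  qed
  \<comment> \<open>an invertible skew element\<close>
  obtain i where i: "P i" "i * i \<noteq> 0"
  proof (rule ccontr)
    assume "\<not> thesis"
    then have sq: "p * p = 0" if "P p" for p using that \<open>\<And>i. P i \<Longrightarrow> i * i \<noteq> 0 \<Longrightarrow> thesis\<close> by blast
    have ac: "p * q = - (q * p)" if "P p" "P q" for p q
    proof -
      have "(p + q) * (p + q) = 0" using sq PI that by blast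
      then show ?thesis using sq that by (simp add: algebra_simps eq_neg_iff_add_eq_0)
    qed
    have "p = 0" if p: "P p" for p
    proof (rule nil)
      fix z assume "z \<in> S"
      then obtain c r where r: "2 *s (e * z * e) = c *s e + r" "P r" using decomp Qe by meson
      have "p * r * p = - (r * (p * p))" using ac[OF p r(2)] by (simp add: mult.assoc)
      then show "p * (2 *s (e * z * e)) * p = 0" unfolding r using sq[OF p] PD[OF p] by (simp add: algebra_simps)
    qed (use PD[OF p] in auto)
    then show False using noncomm by blast
  qed
  obtain a where a: "i * i = a *s e" using symm[of "i * i"] PD[OF i(1)] by (auto simp: mult.assoc absorb)
  have a0: "a \<noteq> 0" using a i by auto
  have split: "\<exists>\<beta> r'. r = \<beta> *s i + r' \<and> P r' \<and> r' * i = - (i * r')" if r: "P r" for r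
  proof -
    obtain c where c: "r * i + i * r = c *s e" using anti[OF r i(1)] by blast
    define \<beta> where "\<beta> = c / (2 * a)"
    have "P (r - \<beta> *s i)" using PI r i by blast
    moreover have "(r - \<beta> *s i) * i + i * (r - \<beta> *s i) = (r * i + i * r) - (2 * \<beta> * a) *s e"
      by (simp add: algebra_simps a) (simp flip: scale_left_distrib)
    then have "(r - \<beta> *s i) * i + i * (r - \<beta> *s i) = 0" unfolding c using a0 two by (simp add: \<beta>_def)
    ultimately show ?thesis by (intro exI[of _ \<beta>] exI[of _ "r - \<beta> *s i"]) (simp add: eq_neg_iff_add_eq_0)
  qed
  \<comment> \<open>an invertible skew element that anticommutes with \<open>i\<close>\<close>
  obtain j where j: "P j" "j * i = - (i * j)" "j * j \<noteq> 0"
  proof (rule ccontr)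
    assume nj: "\<not> thesis"
    have sq: "p * p = 0" if "P p" "p * i = - (i * p)" for p using that nj \<open>\<And>j. P j \<Longrightarrow> j * i = - (i * j) \<Longrightarrow> j * j \<noteq> 0 \<Longrightarrow> thesis\<close> by blast
    have z: "p = 0" if p: "P p" "p * i = - (i * p)" for p
    proof (rule nil)
      fix z assume "z \<in> S"
      then obtain c r where r: "2 *s (e * z * e) = c *s e + r" "P r" using decomp Qe by meson
      obtain \<beta> r' where r': "r = \<beta> *s i + r'" "P r'" "r' * i = - (i * r')" using split[OF r(2)] by blast
      have "(p + r') * (p + r') = 0" using sq[of "p + r'"] PI p r' by (simp add: algebra_simps)
      then have "p * r' = - (r' * p)" using sq p r' by (simp add: algebra_simps eq_neg_iff_add_eq_0)
      then have "p * r' * p = 0" using sq[OF p] by (simp add: mult.assoc)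
      moreover have "p * i * p = 0" using sq[OF p] p by (simp add: mult.assoc)
      ultimately show "p * (2 *s (e * z * e)) * p = 0" unfolding r r' using sq[OF p] PD[OF p(1)] by (simp add: algebra_simps)
    qed (use PD[OF p(1)] in auto)
    have "\<exists>\<beta>. r = \<beta> *s i" if "P r" for r using split[OF that] z by force
    then show False by (intro noncomm) (metis mult_scale scale_mult scale_left_commute)
  qed
  obtain b where b: "j * j = b *s e" using symm[of "j * j"] PD[OF j(1)] by (auto simp: mult.assoc absorb)
  have b0: "b \<noteq> 0" using b j by auto
  have "quaternion_frame scale star S e i j a b"
  proof
    fix z assume z: "z \<in> S"
    \<comment> \<open>what is left after subtracting the components along 1, i, j commutes with \<open>k\<close>, so its product with \<open>k\<close> is a scalar\<close>
    define k where "k = i * j"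
    have k: "e * k = k" "k * e = k" "star k = - k" "k * k = - (a * b) *s e" "k \<in> S" "k * i = - (i * k)"
    proof -
      show "e * k = k" "k * e = k" "k \<in> S" "star k = - k" "k * i = - (i * k)" using PD[OF i(1)] PD[OF j(1)] j(2)
        by (simp_all add: k_def mult.assoc absorb)
      show "k * k = - (a * b) *s e" using PD[OF j(1)]
        by (simp add: k_def mult.assoc assoc_rule[OF j(2)] assoc_rule[OF a] b e(2) mult.commute)
    qed
    obtain c r where r: "2 *s (e * z * e) = c *s e + r" "P r" using decomp Qe z by meson
    obtain \<beta> r' where r': "r = \<beta> *s i + r'" "P r'" "r' * i = - (i * r')" using split[OF r(2)] by blast
    obtain h where h: "r' * j + j * r' = h *s e" using anti[OF r'(2) j(1)] by blast
    define \<gamma> where "\<gamma> = h / (2 * b)"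
    define w where "w = r' - \<gamma> *s j"
    have w: "P w" using PI r' j by (simp add: w_def)
    have wi: "w * i = - (i * w)" using r'(3) j(2) by (simp add: w_def algebra_simps)
    have "w * j + j * w = (r' * j + j * r') - (2 * \<gamma> * b) *s e"
      by (simp add: w_def algebra_simps b) (simp flip: scale_left_distrib)
    then have wj: "w * j = - (j * w)" unfolding h using b0 two by (simp add: \<gamma>_def eq_neg_iff_add_eq_0)
    have wk: "w * k = k * w" by (simp add: k_def mult.assoc assoc_rule[OF wi] wj)
    obtain \<delta> where \<delta>: "w * k = \<delta> *s e"
      using symm[of "w * k"] PD[OF w] k wk by (auto simp: mult.assoc absorb)
    have "\<delta> *s k = w * (k * k)" using \<delta> k by (metis mult.assoc scale_mult)
    then have "\<delta> *s k = (- (a * b)) *s w" using k PD[OF w] by simp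
    then have "(- 1 / (a * b)) *s (\<delta> *s k) = (- 1 / (a * b)) *s ((- (a * b)) *s w)" by simp
    then have wk': "w = (- \<delta> / (a * b)) *s k" using a0 b0 by simp
    have "e * z * e = (1/2) *s (2 *s (e * z * e))" using two by simp
    also have "\<dots> = (c/2) *s e + (\<beta>/2) *s i + (\<gamma>/2) *s j + (- \<delta> / (a * b) / 2) *s k"
    proof -
      have "r' = \<gamma> *s j + (- \<delta> / (a * b)) *s k" using wk' w_def by (simp add: algebra_simps)
      then show ?thesis unfolding r(1) r'(1) by (simp add: scale_right_distrib scale_right_diff_distrib)
    qed
    finally show "\<exists>q0 q1 q2 q3. e * z * e = q0 *s e + q1 *s i + q2 *s j + q3 *s (i * j)"
      unfolding k_def by blast
  qed (use two a0 b0 e e0 PD[OF i(1)] PD[OF j(1)] a b j in auto)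
  then show thesis using that by blast
qed

end

section \<open>Orthogonal frames\<close>

lemma (in vector_space) independent_family:
  assumes "finite J" and ind: "\<And>c j. (\<Sum>j\<in>J. scale (c j) (f j)) = 0 \<Longrightarrow> j \<in> J \<Longrightarrow> c j = 0"
  shows "inj_on f J" "independent (f ` J)"
proof -
  show inj: "inj_on f J"
  proof (rule inj_onI, rule ccontr)
    fix x y assume xy: "x \<in> J" "y \<in> J" "f x = f y" "x \<noteq> y"
    have "(\<Sum>j\<in>J. scale (if j = x then 1 else if j = y then -1 else 0) (f j)) =
      (\<Sum>j\<in>J. (if j = x then f x else 0) - (if j = y then f y else 0))"
      using xy by (intro sum.cong) auto
    also have "\<dots> = 0" using xy assms(1) by (simp add: sum_subtractf)
    finally show False using ind[of "\<lambda>j. if j = x then 1 else if j = y then -1 else 0" x] xy by simp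
  qed
  show "independent (f ` J)"
  proof
    assume "dependent (f ` J)"
    then obtain u v where u: "v \<in> f ` J" "u v \<noteq> 0" "(\<Sum>v\<in>f ` J. scale (u v) v) = 0"
      using dependent_finite[of "f ` J"] assms(1) by auto
    have "(\<Sum>j\<in>J. scale (u (f j)) (f j)) = 0" using u(3) by (simp add: sum.reindex[OF inj] o_def)
    then show False using ind[of "\<lambda>j. u (f j)"] u by auto
  qed
qed

locale framed_csa = symplectic_csa + quaternion_frame
begin

lemma noncomm_e: "noncomm_corner e"
proof -
  have "i * j \<noteq> 0"
  proof
    assume "i * j = 0"
    then have "i * (i * j) = 0" by simp
    then show False using ab jj e_neq by simp
  qed
  then have "i * j \<noteq> j * i" using ji two
    by (metis add.right_inverse one_add_one scale_eq_0_iff scale_left_distrib scale_one)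
  then show ?thesis unfolding noncomm_corner_def
    by (intro bexI[of _ i] bexI[of _ j]) auto
qed

definition orth where
  "orth k x \<longleftrightarrow> (\<forall>r<(k::nat). vec (x r) \<and> nrm (x r) \<noteq> 0) \<and> (\<forall>r<k. \<forall>s<k. r \<noteq> s \<longrightarrow> star (x r) * x s = 0)"

definition proj where "proj k x = (\<Sum>r<(k::nat). (1 / nrm (x r)) *s (x r * star (x r)))"

lemma orthD: "orth k x \<Longrightarrow> r < k \<Longrightarrow> vec (x r)" "orth k x \<Longrightarrow> r < k \<Longrightarrow> nrm (x r) \<noteq> 0"
  "orth k x \<Longrightarrow> r < k \<Longrightarrow> s < k \<Longrightarrow> star (x r) * x s = (if r = s then nrm (x r) *s e else 0)"
  by (auto simp: orth_def norm)

lemma orth_S: "orth k x \<Longrightarrow> r < k \<Longrightarrow> x r \<in> S"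
  using vecD(1)[OF orthD(1)] .

lemma proj_S: assumes "orth k x" shows "proj k x \<in> S"
  unfolding proj_def by (intro S_sum S_scale S_mult S_star orth_S[OF assms]) auto

lemma proj_star: "star (proj k x) = proj k x"
  by (simp add: proj_def)

lemma proj_fix: assumes "orth k x" "s < k" shows "proj k x * x s = x s"
proof -
  have "proj k x * x s = (\<Sum>r<k. (1 / nrm (x r)) *s (x r * (star (x r) * x s)))"
    by (simp add: proj_def sum_distrib_right mult.assoc)
  also have "\<dots> = (\<Sum>r<k. if r = s then x s else 0)"
    using assms orthD(1,2)[OF assms] by (intro sum.cong refl) (auto simp: orthD(3) vecD)
  finally show ?thesis using assms by simp
qed

lemma proj_idem: assumes "orth k x" shows "proj k x * proj k x = proj k x"
proof -
  have "proj k x * proj k x = (\<Sum>r<k. (1 / nrm (x r)) *s (proj k x * x r * star (x r)))"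
    by (subst (2) proj_def) (simp add: sum_distrib_left mult.assoc)
  also have "\<dots> = (\<Sum>r<k. (1 / nrm (x r)) *s (x r * star (x r)))"
    using assms by (intro sum.cong refl) (simp add: proj_fix)
  finally show ?thesis by (simp add: proj_def)
qed

text \<open>
  The complement of an orthogonal family is again not totally isotropic, by \<open>commutator_zero\<close>.
\<close>

lemma orth_extend:
  assumes o: "orth k x" and p1: "proj k x \<noteq> 1"
  shows "\<exists>y. orth (Suc k) y"
proof -
  define p where "p = 1 - proj k x"
  have p: "p \<in> S" "p * p = p" "star p = p" "p \<noteq> 0"
    using proj_S[OF o] proj_idem[OF o] p1 by (auto simp: p_def proj_star algebra_simps)
  obtain y where y: "y \<in> S" "y * e = y" "p * y = y" "star y * y \<noteq> 0"
    using anisotropic_exists[of e p] p noncomm_e by auto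
  have vy: "vec y" "nrm y \<noteq> 0" using y norm[of y] by (auto simp: vec_def)
  have "star (x r) * y = 0" if "r < k" for r
  proof -
    have "star (x r) * p = 0"
      using arg_cong[OF proj_fix[OF o that], of star] by (simp add: p_def proj_star right_diff_distrib)
    then show ?thesis using y(3) by (metis mult.assoc mult_zero_left)
  qed
  then have "orth (Suc k) (x(k := y))"
    using o vy orth_sym by (auto simp: orth_def less_Suc_eq)
  then show ?thesis by blast
qed

definition unit where "unit m = (if m = 0 then e else if m = 1 then i else if m = 2 then j else i * j)" for m :: nat

lemma unit_sum: "(\<Sum>m<4. c m *s unit m) = c 0 *s e + c 1 *s i + c 2 *s j + c 3 *s (i * j)"
  by (simp add: unit_def eval_nat_numeral)

lemma unit_S: "unit m \<in> S" by (simp add: unit_def)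
lemma unit_e: "e * unit m = unit m" "unit m * e = unit m" by (simp_all add: unit_def mult.assoc)

lemma unit_independent: assumes "(\<Sum>m<4. c m *s unit m) = 0" "m < 4" shows "c m = 0"
proof -
  have z: "c 0 *s e + c 1 *s i + c 2 *s j + c 3 *s (i * j) = 0" using assms(1) by (simp only: unit_sum)
  have t0: "tr 0 = 0" by (rule tr_eqI) simp
  have c: "2 * (c 0 * q0 + a * c 1 * q1 + b * c 2 * q2 - a * b * c 3 * q3) = 0" for q0 q1 q2 q3
  proof -
    have "tr ((c 0 *s e + c 1 *s i + c 2 *s j + c 3 *s (i * j)) * (q0 *s e + q1 *s i + q2 *s j + q3 *s (i * j))) = 0"
      unfolding z by (simp add: t0)
    then show ?thesis unfolding mult_coords tr_coords .
  qed
  have "c 0 = 0" "c 1 = 0" "c 2 = 0" "c 3 = 0"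
    using c[of 1 0 0 0] c[of 0 1 0 0] c[of 0 0 1 0] c[of 0 0 0 1] two ab by simp_all
  then show ?thesis using assms(2) by (auto simp: less_Suc_eq eval_nat_numeral)
qed

definition idx where "idx k = {..<k} \<times> {..<4::nat} \<times> {..<k::nat}"
text \<open>
  The element \<open>x\<^sub>r q x\<^sub>s\<^sup>*\<close> with \<open>q\<close> in the standard basis of the quaternions, for the index \<open>(r, m, s)\<close> where \<open>m\<close> is the number of \<open>q\<close>.
\<close>

definition mat_unit where "mat_unit x p = x (fst p) * unit (fst (snd p)) * star (x (snd (snd p)))" for p :: "nat \<times> nat \<times> nat"

lemma mat_unit_independent:
  assumes o: "orth k x" and z: "(\<Sum>p\<in>idx k. c p *s mat_unit x p) = 0" and p: "p \<in> idx k"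
  shows "c p = 0"
proof -
  obtain r0 m0 s0 where p': "p = (r0, m0, s0)" "r0 < k" "m0 < 4" "s0 < k" using p by (auto simp: idx_def)
  have "0 = star (x r0) * (\<Sum>p\<in>idx k. c p *s mat_unit x p) * x s0" using z by simp
  also have "\<dots> = (\<Sum>p\<in>idx k. c p *s ((star (x r0) * x (fst p)) * unit (fst (snd p)) * (star (x (snd (snd p))) * x s0)))"
    by (simp add: sum_distrib_left sum_distrib_right mat_unit_def mult.assoc)
  also have "\<dots> = (\<Sum>r<k. \<Sum>m<4. \<Sum>s<k. c (r, m, s) *s ((star (x r0) * x r) * unit m * (star (x s) * x s0)))"
    unfolding idx_def by (simp add: sum.cartesian_product case_prod_unfold)
  also have "\<dots> = (\<Sum>r<k. \<Sum>m<4. \<Sum>s<k. if s = s0 then if r = r0 then (nrm (x r0) * nrm (x s0) * c (r0, m, s0)) *s unit m else 0 else 0)"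
    using o p' by (intro sum.cong refl) (auto simp: orthD(3) unit_e mult.assoc mult_ac)
  also have "\<dots> = (\<Sum>r<k. if r = r0 then \<Sum>m<4. (nrm (x r0) * nrm (x s0) * c (r0, m, s0)) *s unit m else 0)"
    using p' by (intro sum.cong refl) (simp)
  also have "\<dots> = (\<Sum>m<4. (nrm (x r0) * nrm (x s0) * c (r0, m, s0)) *s unit m)" using p' by simp
  finally have "nrm (x r0) * nrm (x s0) * c (r0, m0, s0) = 0"
    using unit_independent[of "\<lambda>m. nrm (x r0) * nrm (x s0) * c (r0, m, s0)" m0] p' by simp
  then show ?thesis using orthD(2)[OF o] p' by simp
qed

lemma mat_unit_S: "orth k x \<Longrightarrow> p \<in> idx k \<Longrightarrow> mat_unit x p \<in> S"
  by (auto simp: mat_unit_def idx_def unit_S orth_S)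

lemma mat_unit_family: assumes "orth k x"
  shows "inj_on (mat_unit x) (idx k)" "independent (mat_unit x ` idx k)" "card (mat_unit x ` idx k) = 4 * (k * k)"
proof -
  have f: "finite (idx k)" by (simp add: idx_def)
  show 1: "inj_on (mat_unit x) (idx k)" "independent (mat_unit x ` idx k)"
    using independent_family[OF f] mat_unit_independent[OF assms] by blast+
  show "card (mat_unit x ` idx k) = 4 * (k * k)"
    by (simp add: card_image[OF 1(1)]) (simp add: idx_def card_cartesian_product)
qed

lemma orth_bound: assumes "orth k x" shows "4 * (k * k) \<le> 64"
proof -
  obtain T where T: "finite T" "S \<subseteq> span T" using fin by blast
  obtain Bs where B: "Bs \<subseteq> S" "independent Bs" "S \<subseteq> span Bs" "card Bs = dim S" using basis_exists by blast
  have "finite Bs" using independent_span_bound[OF T(1) B(2)] B(1) T(2) by blast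
  then have "card (mat_unit x ` idx k) \<le> card Bs"
    using independent_span_bound[of Bs "mat_unit x ` idx k"] mat_unit_family[OF assms] mat_unit_S[OF assms] B(3) by blast
  then show ?thesis using B(4) mat_unit_family[OF assms] dimS by simp
qed

lemma mat_unit_span: assumes o: "orth k x" and p: "proj k x = 1" shows "S \<subseteq> span (mat_unit x ` idx k)"
proof
  fix y assume y: "y \<in> S"
  have "y = proj k x * y * proj k x" using p by simp
  also have "\<dots> = (\<Sum>r<k. \<Sum>s<k. (1 / nrm (x r)) *s (1 / nrm (x s)) *s (x r * (star (x r) * y * x s) * star (x s)))"
    by (simp add: proj_def sum_distrib_left sum_distrib_right mult.assoc scale_sum_right)
      (subst sum.swap, simp add: mult.commute)
  also have "\<dots> \<in> span (mat_unit x ` idx k)"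
  proof (intro span_sum span_scale)
    fix r s assume rs: "r \<in> {..<k}" "s \<in> {..<k}"
    then have v: "vec (x r)" "vec (x s)" using orthD[OF o] by auto
    have "quat (star (x r) * y * x s)" using v y by (simp add: mult.assoc)
    then obtain q0 q1 q2 q3 where q: "star (x r) * y * x s = q0 *s e + q1 *s i + q2 *s j + q3 *s (i * j)"
      by (elim quat_cases)
    define c where "c m = (if m = 0 then q0 else if m = 1 then q1 else if m = 2 then q2 else q3)" for m :: nat
    have "star (x r) * y * x s = (\<Sum>m<4. c m *s unit m)" unfolding unit_sum q by (simp add: c_def)
    then have "x r * (star (x r) * y * x s) * star (x s) = (\<Sum>m<4. c m *s mat_unit x (r, m, s))"
      by (simp add: mat_unit_def sum_distrib_left sum_distrib_right)
    also have "\<dots> \<in> span (mat_unit x ` idx k)"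
      by (intro span_sum span_scale span_base imageI) (use rs in \<open>auto simp: idx_def\<close>)
    finally show "x r * (star (x r) * y * x s) * star (x s) \<in> span (mat_unit x ` idx k)" .
  qed
  finally show "y \<in> span (mat_unit x ` idx k)" .
qed

text \<open>
  Orthogonal families of length \<open>k\<close> produce \<open>4k\<^sup>2\<close> independent elements, and a spanning one produces a basis; so
  the dimension 64 bounds the length and forces a maximal family to have length 4.
\<close>

lemma frame_exists: "\<exists>x1 x2 x3 x4. frame x1 x2 x3 x4"
proof -
  have "\<exists>k x. orth k x \<and> proj k x = 1"
  proof (rule ccontr)
    assume "\<not> ?thesis"
    then have "\<exists>x. orth k x" for k
    proof (induction k)
      case (Suc k)
      then obtain x where x: "orth k x" by blast
      then show ?case using orth_extend[OF x] \<open>\<not> (\<exists>k x. orth k x \<and> proj k x = 1)\<close> by blast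
    next
      case 0
      show ?case by (rule exI[of _ "\<lambda>_. 0"]) (simp add: orth_def)
    qed
    then obtain x where "orth 5 x" by blast
    then show False using orth_bound by fastforce
  qed
  then obtain k x where o: "orth k x" and p: "proj k x = 1" by blast
  have "card (mat_unit x ` idx k) = dim S"
    by (rule basis_card_eq_dim) (use mat_unit_S[OF o] mat_unit_span[OF o p] mat_unit_family[OF o] in auto)
  then have "k * k = 4 * 4" using mat_unit_family[OF o] dimS by simp
  then have k: "k = 4" by (metis power2_eq_square power2_eq_iff_nonneg zero_le)
  have "frame (x 0) (x 1) (x 2) (x 3)"
    unfolding frame_def using o p unfolding k orth_def proj_def by (simp add: eval_nat_numeral)
  then show ?thesis by blast
qed

end

theorem (in symplectic_csa) frame_of_small_corner:
  assumes "f \<in> S" "f * f = f" "small_corner f" "noncomm_corner f"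
  obtains e i j a b x1 x2 x3 x4 where "quaternion_frame scale star S e i j a b"
    "quaternion_frame.frame scale star S e x1 x2 x3 x4"
proof -
  obtain e where e: "e \<in> S" "e * e = e" "star e = e" "small_corner e" "noncomm_corner e"
    using symmetric_idempotent_exists[OF assms] .
  obtain i j a b where q: "quaternion_frame scale star S e i j a b" using quaternion_basis_exists[OF e] .
  interpret q: quaternion_frame scale star S e i j a b by (rule q)
  interpret framed_csa scale star S e i j a b ..
  show thesis using frame_exists that q by blast
qed

section \<open>Division corners and matrix units\<close>

lemma (in vector_space) subspace_eqI_dim:
  assumes VW: "subspace V" "V \<subseteq> W" and T: "finite T" "W \<subseteq> span T" and d: "dim W \<le> dim V"
  shows "V = W"
proof (rule ccontr)
  assume "V \<noteq> W"
  then obtain w where w: "w \<in> W" "w \<notin> V" using VW by blast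
  obtain Bs where B: "Bs \<subseteq> V" "independent Bs" "V \<subseteq> span Bs" "card Bs = dim V" using basis_exists by blast
  obtain C where C: "C \<subseteq> W" "independent C" "W \<subseteq> span C" "card C = dim W" using basis_exists by blast
  have fB: "finite Bs" using independent_span_bound[OF T(1) B(2)] B(1) VW(2) T(2) by blast
  have fC: "finite C" using independent_span_bound[OF T(1) C(2)] C(1) T(2) by blast
  have "w \<notin> span Bs" using w VW(1) B(1) span_minimal by blast
  then have "independent (insert w Bs)" "w \<notin> Bs" using B(2) independent_insert span_base by auto
  moreover have "insert w Bs \<subseteq> span C" using w B(1) VW(2) C(3) by blast
  ultimately have "card (insert w Bs) \<le> card C" "w \<notin> Bs" using independent_span_bound[OF fC] by blast+
  then show False using fB B C d by simp
qed

context central_simple_star begin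

lemma subspace_left_ideal: "subspace {x * a | x. x \<in> S}"
proof (rule subspaceI)
  show "0 \<in> {x * a | x. x \<in> S}" by (auto intro!: exI[of _ 0])
next
  fix x y assume "x \<in> {x * a | x. x \<in> S}" "y \<in> {x * a | x. x \<in> S}"
  then show "x + y \<in> {x * a | x. x \<in> S}" by (auto simp flip: distrib_right)
next
  fix c x assume "x \<in> {x * a | x. x \<in> S}"
  then show "c *s x \<in> {x * a | x. x \<in> S}" by (auto simp flip: scale_mult)
qed

text \<open>
  Left inverses in the corner make it a division algebra, because they have left inverses themselves.
\<close>

definition division_corner where
  "division_corner f \<longleftrightarrow> f \<in> S \<and> f \<noteq> 0 \<and> f * f = f \<and> (\<forall>q\<in>S. f * q * f \<noteq> 0 \<longrightarrow> (\<exists>b\<in>S. (f * b * f) * (f * q * f) = f))"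

lemma nonzero_product: "x \<in> S \<Longrightarrow> y \<in> S \<Longrightarrow> x \<noteq> 0 \<Longrightarrow> y \<noteq> 0 \<Longrightarrow> \<exists>z\<in>S. x * z * y \<noteq> 0"
  using prime by blast

text \<open>
  A nonzero left ideal of the form \<open>Sa\<close> of least dimension is minimal, and is generated by an idempotent.
\<close>

lemma division_corner_exists: "\<exists>f. division_corner f"
proof -
  define I where "I a = {x * a | x. x \<in> S}" for a
  obtain T where T: "finite T" "S \<subseteq> span T" using fin by blast
  have "\<exists>a. (a \<in> S \<and> a \<noteq> 0) \<and> (\<forall>b. (b \<in> S \<and> b \<noteq> 0) \<longrightarrow> dim (I a) \<le> dim (I b))"
    by (rule ex_has_least_nat[of _ 1]) auto
  then obtain a where a: "a \<in> S" "a \<noteq> 0" and min: "\<And>b. b \<in> S \<Longrightarrow> b \<noteq> 0 \<Longrightarrow> dim (I a) \<le> dim (I b)" by blast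
  have IS: "I b \<subseteq> S" if "b \<in> S" for b using that by (auto simp: I_def)
  have eq: "I x = I a" if x: "x \<in> I a" "x \<noteq> 0" for x
  proof (rule subspace_eqI_dim[OF _ _ T(1)])
    show "subspace (I x)" unfolding I_def by (rule subspace_left_ideal)
    show "I x \<subseteq> I a" using x unfolding I_def by (auto simp flip: mult.assoc)
    show "I a \<subseteq> span T" using IS a T by blast
    show "dim (I a) \<le> dim (I x)" using min x IS a by blast
  qed
  obtain z where z: "z \<in> S" "a * z * a \<noteq> 0" using nonzero_product a by blast
  define x where "x = z * a"
  have xI: "x \<in> I a" using z by (auto simp: x_def I_def)
  have ax: "a * x \<noteq> 0" using z by (simp add: x_def mult.assoc)
  have "a * x \<in> I a" using a z by (auto simp: I_def x_def intro!: exI[of _ "a * z"] simp flip: mult.assoc)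
  then have "x \<in> I (a * x)" using eq ax xI by blast
  then obtain w where w: "w \<in> S" "x = w * (a * x)" by (auto simp: I_def)
  define f where "f = w * a"
  have fx: "f * x = x" using w by (simp add: f_def mult.assoc)
  have fI: "f \<in> I a" using w by (auto simp: f_def I_def)
  have fS: "f \<in> S" using fI IS a by blast
  have ff: "f * f = f"
  proof (rule ccontr)
    assume n: "f * f \<noteq> f"
    have "f * f - f \<in> I a" unfolding I_def
    proof (intro CollectI exI conjI)
      show "f * f - f = (f * w - w) * a" by (simp add: f_def left_diff_distrib mult.assoc)
      show "f * w - w \<in> S" using fS w by blast
    qed
    then have "I (f * f - f) = I a" using eq n by simp
    moreover have "a \<in> I a" using S_one by (auto simp: I_def intro!: exI[of _ 1])
    ultimately obtain h where "a = h * (f * f - f)" by (auto simp: I_def)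
    then have "a * x = h * (f * (f * x) - f * x)" by (simp add: left_diff_distrib mult.assoc)
    then show False using ax fx by simp
  qed
  have f0: "f \<noteq> 0" using fx ax by auto
  have "\<exists>b\<in>S. (f * b * f) * (f * q * f) = f" if q: "q \<in> S" "f * q * f \<noteq> 0" for q
  proof -
    have "f * q * f \<in> I a" unfolding I_def using w q fS by (auto simp: f_def intro!: exI[of _ "f * q * w"] simp flip: mult.assoc)
    then have "I (f * q * f) = I a" using eq q by blast
    then obtain b where b: "b \<in> S" "f = b * (f * q * f)" using fI by (auto simp: I_def)
    have "(f * b * f) * (f * q * f) = f * (b * ((f * f) * q * f))" by (simp add: mult.assoc)
    also have "\<dots> = f * f" using b(2) by (simp add: ff)
    finally show ?thesis using b ff by auto
  qed
  then show ?thesis using fS f0 ff unfolding division_corner_def by blast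
qed

lemma division_cornerD: "division_corner f \<Longrightarrow> f \<in> S" "division_corner f \<Longrightarrow> f \<noteq> 0" "division_corner f \<Longrightarrow> f * f = f"
  by (auto simp: division_corner_def)

text \<open>
  Some product \<open>f z g w f\<close> is nonzero, hence invertible in the corner of \<open>f\<close>; so \<open>f\<close> embeds below \<open>g\<close>.
\<close>

lemma division_corner_equiv:
  assumes f: "division_corner f" and g: "g \<in> S" "g * g = g" "g \<noteq> 0"
  obtains u v where "u \<in> S" "v \<in> S" "f * u = u" "u * g = u" "g * v = v" "v * f = v" "u * v = f"
proof -
  note fD = division_cornerD[OF f]
  obtain z where z: "z \<in> S" "f * z * g \<noteq> 0" using nonzero_product fD g by blast
  obtain w where w: "w \<in> S" "f * z * g * w * f \<noteq> 0" using nonzero_product[of "f * z * g" f] fD g z by auto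
  have "f * (z * g * w) * f \<noteq> 0" using w by (simp add: mult.assoc)
  then obtain b where b: "b \<in> S" "(f * b * f) * (f * (z * g * w) * f) = f"
    using f z w g unfolding division_corner_def by (meson S_mult)
  show thesis
  proof (rule that[of "f * b * f * z * g" "g * w * f"])
    show "f * b * f * z * g * (g * w * f) = f"
      using b(2) by (simp add: mult.assoc assoc_rule[OF fD(3)] assoc_rule[OF g(2)])
  qed (use fD g b z w in \<open>simp_all add: mult.assoc assoc_rule[OF fD(3)] assoc_rule[OF g(2)]\<close>)
qed

lemma division_corners_equiv:
  assumes f: "division_corner f" and g: "division_corner g"
  obtains u v where "u \<in> S" "v \<in> S" "f * u = u" "u * g = u" "g * v = v" "v * f = v" "u * v = f" "v * u = g"
proof -
  note gD = division_cornerD[OF g]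
  obtain u v where uv: "u \<in> S" "v \<in> S" "f * u = u" "u * g = u" "g * v = v" "v * f = v" "u * v = f"
    using division_corner_equiv[OF f] gD by blast
  define h where "h = v * u"
  have hh: "h * h = h" using uv by (simp add: h_def mult.assoc assoc_rule[OF uv(7)] assoc_rule[OF uv(6)])
  have gh: "g * h * g = h" "g * h = h" using uv by (simp_all add: h_def mult.assoc assoc_rule[OF uv(5)])
  have "h \<noteq> 0"
  proof
    assume "h = 0"
    then have "u * h * v = 0" by simp
    moreover have "u * h * v = f" using uv division_cornerD(3)[OF f] by (simp add: h_def mult.assoc assoc_rule[OF uv(7)])
    ultimately show False using division_cornerD[OF f] by simp
  qed
  then obtain b where b: "b \<in> S" "(g * b * g) * h = g"
    using g gh uv unfolding division_corner_def h_def by (metis S_mult)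
  have "g * h = (g * b * g) * h * h" using b by simp
  also have "\<dots> = (g * b * g) * (h * h)" by (simp only: mult.assoc)
  also have "\<dots> = g" unfolding hh by (rule b(2))
  finally have "h = g" using gh by simp
  then show thesis using that uv h_def by blast
qed

definition matrix_units where
  "matrix_units f r u v \<longleftrightarrow> (\<forall>i<(r::nat). u i \<in> S \<and> v i \<in> S \<and> f * u i = u i \<and> v i * f = v i) \<and>
     (\<forall>i<r. \<forall>j<r. u i * v j = (if i = j then f else 0))"

lemma matrix_units_extend:
  assumes f: "division_corner f" and m: "matrix_units f r u v" and p1: "(\<Sum>i<r. v i * u i) \<noteq> 1"
  shows "\<exists>u v. matrix_units f (Suc r) u v"
proof -
  define p where "p = 1 - (\<Sum>i<r. v i * u i)"
  have mS: "u i \<in> S" "v i \<in> S" "f * u i = u i" "v i * f = v i" if "i < r" for i using m that by (auto simp: matrix_units_def)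
  have muv: "u i * v j = (if i = j then f else 0)" if "i < r" "j < r" for i j using m that by (auto simp: matrix_units_def)
  have pS: "p \<in> S" unfolding p_def by (intro S_diff S_one S_sum S_mult mS) auto
  have pv: "p * v j = 0" if "j < r" for j
  proof -
    have "(\<Sum>i<r. v i * u i) * v j = (\<Sum>i<r. if i = j then v j else 0)"
      unfolding sum_distrib_right by (intro sum.cong refl) (use that mS muv in \<open>auto simp: mult.assoc\<close>)
    then show ?thesis using that by (simp add: p_def left_diff_distrib)
  qed
  have up: "u j * p = 0" if "j < r" for j
  proof -
    have "u j * (\<Sum>i<r. v i * u i) = (\<Sum>i<r. if i = j then u j else 0)"
      unfolding sum_distrib_left by (intro sum.cong refl) (use that mS muv in \<open>auto simp: mult.assoc[symmetric]\<close>)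
    then show ?thesis using that by (simp add: p_def right_diff_distrib)
  qed
  have pp: "p * p = p"
  proof -
    have "p * (\<Sum>i<r. v i * u i) = 0" unfolding sum_distrib_left by (intro sum.neutral) (simp add: pv mult.assoc[symmetric])
    then show ?thesis by (subst (2) p_def) (simp add: right_diff_distrib)
  qed
  obtain a c where ac: "a \<in> S" "c \<in> S" "f * a = a" "a * p = a" "p * c = c" "c * f = c" "a * c = f"
    using division_corner_equiv[OF f pS pp] p1 by (auto simp: p_def)
  have "a * v j = 0" "u j * c = 0" if "j < r" for j
    using pv[OF that] up[OF that] ac by (metis mult.assoc mult_zero_left mult_zero_right)+
  then have "matrix_units f (Suc r) (u(r := a)) (v(r := c))"
    using m ac by (auto simp: matrix_units_def less_Suc_eq)
  then show ?thesis by blast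
qed

lemma matrix_units_bound:
  assumes f: "division_corner f" and m: "matrix_units f r u v" and T: "finite T" "S \<subseteq> span T"
  shows "r \<le> card T"
proof -
  have ind: "c j = 0" if s: "(\<Sum>i\<in>{..<r}. c i *s (v i * u i)) = 0" and j: "j \<in> {..<r}" for c j
  proof -
    have "0 = u j * (\<Sum>i\<in>{..<r}. c i *s (v i * u i)) * v j" using s by simp
    also have "\<dots> = (\<Sum>i<r. c i *s ((u j * v i) * (u i * v j)))"
      by (simp add: sum_distrib_left sum_distrib_right mult.assoc)
    also have "\<dots> = (\<Sum>i<r. if i = j then c j *s f else 0)"
      using m j division_cornerD(3)[OF f] by (intro sum.cong refl) (auto simp: matrix_units_def)
    finally have "c j *s f = 0" using j by simp
    then show ?thesis using division_cornerD(2)[OF f] by simp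
  qed
  have *: "inj_on (\<lambda>i. v i * u i) {..<r}" "independent ((\<lambda>i. v i * u i) ` {..<r})"
    using independent_family[of "{..<r}" "\<lambda>i. v i * u i"] ind by blast+
  have "(\<lambda>i. v i * u i) ` {..<r} \<subseteq> span T" using m T(2) by (auto simp: matrix_units_def)
  then have "card ((\<lambda>i. v i * u i) ` {..<r}) \<le> card T" using independent_span_bound[OF T(1) *(2)] by blast
  then show ?thesis by (simp add: card_image[OF *(1)])
qed

text \<open>
  While the idempotents \<open>v\<^sub>i u\<^sub>i\<close> do not add up to 1, a further copy of \<open>f\<close> fits below the complement.
\<close>

lemma matrix_units_exist:
  assumes f: "division_corner f"
  obtains r u v where "matrix_units f r u v" "(\<Sum>i<r. v i * u i) = 1"
proof -
  obtain T where T: "finite T" "S \<subseteq> span T" using fin by blast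
  have "\<exists>r u v. matrix_units f r u v \<and> (\<Sum>i<r. v i * u i) = 1"
  proof (rule ccontr)
    assume n: "\<not> ?thesis"
    have "\<exists>u v. matrix_units f k u v" for k
    proof (induction k)
      case 0 show ?case by (auto simp: matrix_units_def)
    next
      case (Suc k)
      then obtain u v where m: "matrix_units f k u v" by blast
      then show ?case using matrix_units_extend[OF f m] n by blast
    qed
    then obtain u v where "matrix_units f (Suc (card T)) u v" by blast
    then have "Suc (card T) \<le> card T" by (rule matrix_units_bound[OF f _ T])
    then show False by simp
  qed
  then show thesis using that by blast
qed

end

context symplectic_csa begin

text \<open>
  If the division corner is commutative it consists of scalars, and \<open>S\<close> is a matrix algebra over the field; then
  the sum of two matrix units \<open>v\<^sub>0 u\<^sub>0 + v\<^sub>1 u\<^sub>1\<close> has the full algebra of 2 by 2 matrices as its corner.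
\<close>

lemma noncomm_small_corner_exists:
  assumes f: "division_corner f" and small: "small_corner f"
  obtains g where "g \<in> S" "g * g = g" "small_corner g" "noncomm_corner g"
proof (cases "noncomm_corner f")
  case True
  then show thesis using that f small division_cornerD by blast
next
  case False
  note fD = division_cornerD[OF f]
  have sc: "\<exists>c. f * x * f = c *s f" if x: "x \<in> S" for x
  proof (rule corner_center[OF fD(1,2)])
    fix y assume y: "y \<in> S"
    have "f * (f * z * f) = f * z * f" "f * z * f * f = f * z * f" for z
      using fD by (simp_all add: mult.assoc assoc_rule[OF fD(3)])
    then show "f * x * f * (f * y * f) = f * y * f * (f * x * f)"
      using False[unfolded noncomm_corner_def, simplified, rule_format, of "f * x * f" "f * y * f"] x y fD(1) by blast
  qed (use x fD in \<open>simp_all add: mult.assoc assoc_rule[OF fD(3)]\<close>)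
  obtain r u v where m: "matrix_units f r u v" and one: "(\<Sum>i<r. v i * u i) = 1" using matrix_units_exist[OF f] .
  have mS: "u i \<in> S" "v i \<in> S" "f * u i = u i" "v i * f = v i" if "i < r" for i using m that by (auto simp: matrix_units_def)
  have muv: "u i * v j = (if i = j then f else 0)" if "i < r" "j < r" for i j using m that by (auto simp: matrix_units_def)
  have coef: "\<exists>c. u i * x * v j = c *s f" if "i < r" "j < r" "x \<in> S" for i j x
    using sc[of "u i * x * v j"] mS that by (simp add: mult.assoc assoc_rule[OF mS(3)[OF that(1)]])
  have "r \<noteq> 0"
  proof
    assume "r = 0"
    then show False using one by simp
  qed
  moreover have "r \<noteq> 1"
  proof
    assume r: "r = 1"
    have sub: "S \<subseteq> span {1}"
    proof
      fix x assume x: "x \<in> S"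
      obtain c where c: "u 0 * x * v 0 = c *s f" using coef[of 0 0 x] x r by auto
      have o: "v 0 * u 0 = 1" using one r by simp
      have "x = v 0 * u 0 * x * (v 0 * u 0)" by (simp add: o)
      also have "\<dots> = v 0 * (u 0 * x * v 0) * u 0" by (simp add: mult.assoc)
      also have "\<dots> = c *s (v 0 * u 0)" unfolding c using mS[of 0] r by (simp add: mult.assoc)
      finally have "x = c *s 1" by (simp only: o)
      moreover have "1 \<in> span {1::'b}" by (rule span_base) simp
      ultimately show "x \<in> span {1}" by (simp only: span_scale)
    qed
    obtain Bs where B: "Bs \<subseteq> S" "independent Bs" "S \<subseteq> span Bs" "card Bs = dim S" by (rule basis_exists)
    have "card Bs \<le> card {1::'b}"
      using independent_span_bound[of "{1}" Bs, OF _ B(2) subset_trans[OF B(1) sub]] by simp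
    then show False using dimS B by simp
  qed
  ultimately have r: "0 < r" "1 < r" by auto
  note One_nat_def [simp del]
  define g where "g = v 0 * u 0 + v 1 * u 1"
  have uv: "u 0 * v 0 = f" "u 1 * v 1 = f" "u 0 * v 1 = 0" "u 1 * v 0 = 0" using muv r by auto
  have zz: "u 0 * (v 1 * x) = 0" "u 1 * (v 0 * x) = 0" for x using uv by (metis mult.assoc mult_zero_left)+
  note M = uv zz assoc_rule[OF uv(1)] assoc_rule[OF uv(2)] mS[OF r(1)] mS[OF r(2)] assoc_rule[OF mS(3)[OF r(1)]] assoc_rule[OF mS(3)[OF r(2)]]
     assoc_rule[OF mS(4)[OF r(1)]] assoc_rule[OF mS(4)[OF r(2)]]
  have gS: "g \<in> S" using M by (simp add: g_def)
  have gg: "g * g = g" by (simp add: g_def algebra_simps M)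
  have small_g: "small_corner g" unfolding small_corner_def
  proof (rule exI[of _ "\<lambda>k. if k = 0 then v 0 * u 0 else if k = 1 then v 0 * u 1 else if k = 2 then v 1 * u 0 else v 1 * u 1"],
      intro conjI allI impI ballI)
    fix x assume x: "x \<in> S"
    obtain c0 where c0: "u 0 * x * v 0 = c0 *s f" using coef r x by blast
    obtain c1 where c1: "u 0 * x * v 1 = c1 *s f" using coef r x by blast
    obtain c2 where c2: "u 1 * x * v 0 = c2 *s f" using coef r x by blast
    obtain c3 where c3: "u 1 * x * v 1 = c3 *s f" using coef r x by blast
    have "g * x * g = v 0 * (u 0 * x * v 0) * u 0 + v 0 * (u 0 * x * v 1) * u 1 + v 1 * (u 1 * x * v 0) * u 0 + v 1 * (u 1 * x * v 1) * u 1"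
      by (simp add: g_def algebra_simps)
    also have "\<dots> = c0 *s (v 0 * u 0) + c1 *s (v 0 * u 1) + c2 *s (v 1 * u 0) + c3 *s (v 1 * u 1)"
      unfolding c0 c1 c2 c3 by (simp add: mult.assoc M)
    finally show "\<exists>c. g * x * g = (\<Sum>k<(4::nat). c k *s (if k = 0 then v 0 * u 0 else if k = 1 then v 0 * u 1 else if k = 2 then v 1 * u 0 else v 1 * u 1))"
      by (intro exI[of _ "\<lambda>k. if k = 0 then c0 else if k = 1 then c1 else if k = 2 then c2 else c3"]) (simp add: numeral_eq_Suc One_nat_def)
  qed (use M in auto)
  have "noncomm_corner g" unfolding noncomm_corner_def
  proof (intro bexI conjI)
    show "g * (v 0 * u 1) = v 0 * u 1" "v 0 * u 1 * g = v 0 * u 1" "g * (v 1 * u 0) = v 1 * u 0" "v 1 * u 0 * g = v 1 * u 0"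
      by (simp_all add: g_def algebra_simps M)
    have "u 0 * (v 0 * u 1 * (v 1 * u 0)) * v 0 = f" "u 0 * (v 1 * u 0 * (v 0 * u 1)) * v 0 = 0"
      using fD by (simp_all add: mult.assoc M)
    then show "v 0 * u 1 * (v 1 * u 0) \<noteq> v 1 * u 0 * (v 0 * u 1)" using fD by auto
  qed (use M in auto)
  then show thesis using that gS gg small_g by blast
qed

end

section \<open>Calculus in the scalar extension\<close>

lemma frag_extend_plus: "frag_extend (\<lambda>p. f p + g p) u = frag_extend f u + frag_extend g u"
  by (simp add: frag_extend_def frag_cmul_distrib2 sum.distrib)

lemma frag_extend_uminus: "frag_extend (\<lambda>p. - f p) u = - frag_extend f u"
  using frag_extend_plus[of "\<lambda>p. - f p" f u] by (simp add: frag_extend_eq_0 eq_neg_iff_add_eq_0)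

lemma frag_extend_minus_fun: "frag_extend (\<lambda>p. f p - g p) u = frag_extend f u - frag_extend g u"
  using frag_extend_plus[of f "\<lambda>p. - g p" u] by (simp add: frag_extend_uminus)

lemma frag_extend_zero_fun: "frag_extend (\<lambda>p. 0) u = 0"
  by (simp add: frag_extend_eq_0)

lemma frag_closed:
  assumes "Poly_Mapping.keys c \<subseteq> T" "P 0" "\<And>x. x \<in> T \<Longrightarrow> P (frag_of x)" "\<And>a b. P a \<Longrightarrow> P b \<Longrightarrow> P (a - b)"
  shows "P c"
  using assms by (rule frag_induction[of c T P])

lemma ring_cong:
  assumes "ring Q" "carrier R = carrier Q" "monoid.mult R = monoid.mult Q" "\<one>\<^bsub>R\<^esub> = \<one>\<^bsub>Q\<^esub>"
    "\<zero>\<^bsub>R\<^esub> = \<zero>\<^bsub>Q\<^esub>" "ring.add R = ring.add Q"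
  shows "ring R"
proof -
  interpret Q: ring Q by fact
  show ?thesis
  proof (rule ringI)
    show "abelian_group R"
    proof (rule abelian_groupI)
      show "\<exists>y\<in>carrier R. y \<oplus>\<^bsub>R\<^esub> x = \<zero>\<^bsub>R\<^esub>" if "x \<in> carrier R" for x
        using that assms Q.l_neg[of x] Q.a_inv_closed[of x] by auto
    qed (use assms in \<open>auto simp: Q.a_ac\<close>)
    show "Group.monoid R"
      by (rule Group.monoidI) (use assms in \<open>auto simp: Q.m_assoc\<close>)
  qed (use assms in \<open>auto simp: Q.l_distr Q.r_distr\<close>)
qed

locale algebra_over =
  fixes A :: "('k::field, 'a) module"
  assumes alg: "is_algebra A"
begin

sublocale A: ring A using alg by (simp add: is_algebra_def)
sublocale Amod: module "ring_of_type_algebra :: 'k ring" A using alg by (simp add: is_algebra_def)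

lemma smult_closed [simp]: "x \<in> carrier A \<Longrightarrow> c \<odot>\<^bsub>A\<^esub> x \<in> carrier A"
  using Amod.smult_closed[of c x] by (simp add: ring_of_type_algebra_def)

lemma smult_mult:
  "x \<in> carrier A \<Longrightarrow> y \<in> carrier A \<Longrightarrow> (c \<odot>\<^bsub>A\<^esub> x) \<otimes>\<^bsub>A\<^esub> y = c \<odot>\<^bsub>A\<^esub> (x \<otimes>\<^bsub>A\<^esub> y)"
  "x \<in> carrier A \<Longrightarrow> y \<in> carrier A \<Longrightarrow> x \<otimes>\<^bsub>A\<^esub> (c \<odot>\<^bsub>A\<^esub> y) = c \<odot>\<^bsub>A\<^esub> (x \<otimes>\<^bsub>A\<^esub> y)"
  using alg by (auto simp: is_algebra_def)

lemma smult_simps: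
  "x \<in> carrier A \<Longrightarrow> (c + d) \<odot>\<^bsub>A\<^esub> x = c \<odot>\<^bsub>A\<^esub> x \<oplus>\<^bsub>A\<^esub> d \<odot>\<^bsub>A\<^esub> x"
  "x \<in> carrier A \<Longrightarrow> y \<in> carrier A \<Longrightarrow> c \<odot>\<^bsub>A\<^esub> (x \<oplus>\<^bsub>A\<^esub> y) = c \<odot>\<^bsub>A\<^esub> x \<oplus>\<^bsub>A\<^esub> c \<odot>\<^bsub>A\<^esub> y"
  "x \<in> carrier A \<Longrightarrow> c \<odot>\<^bsub>A\<^esub> (d \<odot>\<^bsub>A\<^esub> x) = (c * d) \<odot>\<^bsub>A\<^esub> x"
  "x \<in> carrier A \<Longrightarrow> 1 \<odot>\<^bsub>A\<^esub> x = x"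
  using Amod.smult_l_distr[of c d x] Amod.smult_r_distr[of c x y] Amod.smult_assoc1[of c d x] Amod.smult_one[of x]
  by (simp_all add: ring_of_type_algebra_def)

lemma smult_zero [simp]: "x \<in> carrier A \<Longrightarrow> 0 \<odot>\<^bsub>A\<^esub> x = \<zero>\<^bsub>A\<^esub>" "c \<odot>\<^bsub>A\<^esub> \<zero>\<^bsub>A\<^esub> = \<zero>\<^bsub>A\<^esub>"
  using Amod.smult_l_null[of x] Amod.smult_r_null[of c] by (simp_all add: ring_of_type_algebra_def)

end

locale algebra_extension = algebra_over A for A :: "('k::field, 'a) module" +
  fixes \<iota> :: "'k \<Rightarrow> 'l::field"
  assumes ext: "field_extension \<iota>"
begin

lemma iota [simp]: "\<iota> (x + y) = \<iota> x + \<iota> y" "\<iota> (x * y) = \<iota> x * \<iota> y" "\<iota> 1 = 1"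
  using ext by (auto simp: field_extension_def ring_hom_def ring_of_type_algebra_def)

lemma iota_zero [simp]: "\<iota> 0 = 0"
  by (metis add_0_right add_left_cancel iota(1))

abbreviation F :: "(('a \<times> 'l) \<Rightarrow>\<^sub>0 int) ring" where "F \<equiv> formal_tensors A"
abbreviation B where "B \<equiv> base_change \<iota> A"
abbreviation pt where "pt \<equiv> pure_tensor \<iota> A"

lemma F_simps [simp]: "carrier F = {u. Poly_Mapping.keys u \<subseteq> carrier A \<times> UNIV}"
  "\<one>\<^bsub>F\<^esub> = frag_of (\<one>\<^bsub>A\<^esub>, 1)" "\<zero>\<^bsub>F\<^esub> = 0" "ring.add F = (+)"
  by (auto simp: formal_tensors_def)

lemma F_mult: "u \<otimes>\<^bsub>F\<^esub> v = frag_extend (\<lambda>p. frag_extend (\<lambda>q. frag_of (fst p \<otimes>\<^bsub>A\<^esub> fst q, snd p * snd q)) v) u"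
  by (simp add: formal_tensors_def case_prod_unfold)

lemma F_mult_of [simp]: "frag_of (a, l) \<otimes>\<^bsub>F\<^esub> frag_of (b, m) = frag_of (a \<otimes>\<^bsub>A\<^esub> b, l * m)"
  by (simp add: F_mult)

lemma F_mult_diff: "(u - v) \<otimes>\<^bsub>F\<^esub> w = u \<otimes>\<^bsub>F\<^esub> w - v \<otimes>\<^bsub>F\<^esub> w" "w \<otimes>\<^bsub>F\<^esub> (u - v) = w \<otimes>\<^bsub>F\<^esub> u - w \<otimes>\<^bsub>F\<^esub> v"
  and F_mult_add: "(u + v) \<otimes>\<^bsub>F\<^esub> w = u \<otimes>\<^bsub>F\<^esub> w + v \<otimes>\<^bsub>F\<^esub> w" "w \<otimes>\<^bsub>F\<^esub> (u + v) = w \<otimes>\<^bsub>F\<^esub> u + w \<otimes>\<^bsub>F\<^esub> v"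
  and F_mult_zero: "0 \<otimes>\<^bsub>F\<^esub> w = 0" "w \<otimes>\<^bsub>F\<^esub> 0 = 0"
  by (simp_all add: F_mult frag_extend_diff frag_extend_add frag_extend_minus_fun frag_extend_plus frag_extend_zero_fun)

lemma F_closed_induct [consumes 1, case_names zero of diff]:
  assumes "u \<in> carrier F" "P 0" "\<And>a l. a \<in> carrier A \<Longrightarrow> P (frag_of (a, l))" "\<And>a b. P a \<Longrightarrow> P b \<Longrightarrow> P (a - b)"
  shows "P u"
  by (rule frag_closed[of u "carrier A \<times> UNIV" P]) (use assms in auto)

lemma F_mem [simp]: "Poly_Mapping.keys (frag_of (a, l)) \<subseteq> carrier A \<times> UNIV \<longleftrightarrow> a \<in> carrier A"
  by (simp add: keys_frag_of)

lemma F_diff_closed: "u \<in> carrier F \<Longrightarrow> v \<in> carrier F \<Longrightarrow> u - v \<in> carrier F"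
  using keys_diff[of u v] by auto

lemma F_mult_closed: assumes "u \<in> carrier F" "v \<in> carrier F" shows "u \<otimes>\<^bsub>F\<^esub> v \<in> carrier F"
  using assms(1)
proof (induction rule: F_closed_induct)
  case zero show ?case by (simp add: F_mult_zero)
next
  case (of a l)
  from assms(2) show ?case
  proof (induction rule: F_closed_induct)
    case zero show ?case by (simp add: F_mult_zero)
  next
    case (of b m) then show ?case using \<open>a \<in> carrier A\<close> by (simp add: keys_frag_of)
  next
    case (diff x y) then show ?case unfolding F_mult_diff by (rule F_diff_closed)
  qed
next
  case (diff x y) then show ?case unfolding F_mult_diff by (rule F_diff_closed)
qed

lemma F_assoc: assumes "u \<in> carrier F" "v \<in> carrier F" "w \<in> carrier F"
  shows "(u \<otimes>\<^bsub>F\<^esub> v) \<otimes>\<^bsub>F\<^esub> w = u \<otimes>\<^bsub>F\<^esub> (v \<otimes>\<^bsub>F\<^esub> w)"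
  using assms(1)
proof (induction rule: F_closed_induct)
  case u: (of a l)
  from assms(2) show ?case
  proof (induction rule: F_closed_induct)
    case v: (of b m)
    from assms(3) show ?case
      by (induction rule: F_closed_induct) (use u v in \<open>auto simp: F_mult_zero F_mult_diff A.m_assoc mult.assoc\<close>)
  qed (auto simp: F_mult_zero F_mult_diff)
qed (auto simp: F_mult_zero F_mult_diff)

lemma F_ring: "ring F"
proof (rule ringI)
  show "abelian_group F"
  proof (rule abelian_groupI)
    show "x \<oplus>\<^bsub>F\<^esub> y \<in> carrier F" if "x \<in> carrier F" "y \<in> carrier F" for x y
      using that keys_add[of x y] by auto
    show "\<exists>y\<in>carrier F. y \<oplus>\<^bsub>F\<^esub> x = \<zero>\<^bsub>F\<^esub>" if "x \<in> carrier F" for x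
      by (rule bexI[of _ "- x"]) (use that in auto)
  qed (auto simp: ac_simps)
  show "Group.monoid F"
  proof (rule Group.monoidI)
    fix x assume x: "x \<in> carrier F"
    then show "\<one>\<^bsub>F\<^esub> \<otimes>\<^bsub>F\<^esub> x = x"
      by (induction rule: F_closed_induct) (auto simp: F_mult_zero F_mult_diff)
    from x show "x \<otimes>\<^bsub>F\<^esub> \<one>\<^bsub>F\<^esub> = x"
      by (induction rule: F_closed_induct) (auto simp: F_mult_zero F_mult_diff)
  qed (use F_mult_closed F_assoc in auto)
qed (auto simp: F_mult_add)

sublocale F: ring F by (rule F_ring)

abbreviation I where "I \<equiv> tensor_ideal \<iota> A"

lemma relations_closed: "tensor_relations \<iota> A \<subseteq> carrier F"
proof -
  have of: "frag_of (a, l) \<in> carrier F" if "a \<in> carrier A" for a l using that by simp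
  show ?thesis unfolding tensor_relations_def
    by (auto simp del: F_simps simp: F_diff_closed of)
qed

lemma I_ideal: "ideal I F"
  unfolding tensor_ideal_def by (rule F.genideal_ideal[OF relations_closed])

sublocale I: ideal I F by (rule I_ideal)

lemma relations_in_I: "tensor_relations \<iota> A \<subseteq> I"
  unfolding tensor_ideal_def by (rule F.genideal_self[OF relations_closed])

lemma I_minimal: "ideal J F \<Longrightarrow> tensor_relations \<iota> A \<subseteq> J \<Longrightarrow> I \<subseteq> J"
  unfolding tensor_ideal_def by (rule F.genideal_minimal)

lemma I_rel:
  "a \<in> carrier A \<Longrightarrow> b \<in> carrier A \<Longrightarrow> frag_of (a \<oplus>\<^bsub>A\<^esub> b, l) - frag_of (a, l) - frag_of (b, l) \<in> I"
  "a \<in> carrier A \<Longrightarrow> frag_of (a, l + m) - frag_of (a, l) - frag_of (a, m) \<in> I"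
  "a \<in> carrier A \<Longrightarrow> frag_of (c \<odot>\<^bsub>A\<^esub> a, l) - frag_of (a, \<iota> c * l) \<in> I"
  using relations_in_I unfolding tensor_relations_def by blast+

lemma F_uminus: "x \<in> carrier F \<Longrightarrow> \<ominus>\<^bsub>F\<^esub> x = - x"
  by (rule F.minus_equality) auto

lemma F_minus: "x \<in> carrier F \<Longrightarrow> y \<in> carrier F \<Longrightarrow> x \<ominus>\<^bsub>F\<^esub> y = x - y"
  by (simp only: a_minus_def F_uminus) simp

lemma I_minus: "x \<in> I \<Longrightarrow> - x \<in> I"
  using I.a_inv_closed F_uminus I.Icarr by metis

lemma I_diff: "x \<in> I \<Longrightarrow> y \<in> I \<Longrightarrow> x - y \<in> I"
  using I.a_closed[of x "- y"] I_minus by simp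

abbreviation cls where "cls \<equiv> tensor_class \<iota> A"

lemma cls_eq_iff: "u \<in> carrier F \<Longrightarrow> v \<in> carrier F \<Longrightarrow> cls u = cls v \<longleftrightarrow> u - v \<in> I"
  using F.quotient_eq_iff_same_a_r_cos[OF I_ideal, of u v] F_minus unfolding tensor_class_def by simp

lemma cls_eqI: "u \<in> carrier F \<Longrightarrow> v \<in> carrier F \<Longrightarrow> u - v \<in> I \<Longrightarrow> cls u = cls v"
  by (simp only: cls_eq_iff)

lemma mem_cls: assumes "u \<in> carrier F" shows "v \<in> cls u \<longleftrightarrow> v \<in> carrier F \<and> cls v = cls u"
proof -
  have "v \<in> cls u \<longleftrightarrow> (\<exists>h\<in>I. v = h + u)"
    unfolding tensor_class_def a_r_coset_def' by auto
  also have "\<dots> \<longleftrightarrow> v \<in> carrier F \<and> v - u \<in> I"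
  proof
    assume "\<exists>h\<in>I. v = h + u"
    then obtain h where h: "h \<in> I" "v = h + u" by blast
    then have "v \<in> carrier F" using F.a_closed[of h u] assms I.Icarr by simp
    with h show "v \<in> carrier F \<and> v - u \<in> I" by simp
  qed (auto intro!: bexI[of _ "v - u"])
  finally show ?thesis using cls_eq_iff assms by blast
qed

lemma B_carrier: "carrier B = cls ` carrier F"
  unfolding base_change_def Let_def FactRing_def A_RCOSETS_def' tensor_class_def by auto

lemma B_ring: "ring B"
  by (rule ring_cong[OF I.quotient_is_ring]) (auto simp: base_change_def Let_def)

sublocale B: ring B by (rule B_ring)

lemma cls_hom: "cls \<in> ring_hom F B"
  using I.rcos_ring_hom unfolding ring_hom_def tensor_class_def[abs_def]
  by (simp add: base_change_def Let_def)

lemma cls_closed: "u \<in> carrier F \<Longrightarrow> cls u \<in> carrier B"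
  by (auto simp: B_carrier)

lemma cls_mult: "u \<in> carrier F \<Longrightarrow> v \<in> carrier F \<Longrightarrow> cls u \<otimes>\<^bsub>B\<^esub> cls v = cls (u \<otimes>\<^bsub>F\<^esub> v)"
  and cls_add: "u \<in> carrier F \<Longrightarrow> v \<in> carrier F \<Longrightarrow> cls u \<oplus>\<^bsub>B\<^esub> cls v = cls (u + v)"
  and cls_one: "\<one>\<^bsub>B\<^esub> = cls (frag_of (\<one>\<^bsub>A\<^esub>, 1))"
  using ring_hom_memE[OF cls_hom] by auto

lemma cls_zero: "\<zero>\<^bsub>B\<^esub> = cls 0"
proof -
  have "cls 0 \<oplus>\<^bsub>B\<^esub> cls 0 = cls 0" using cls_add[of 0 0] by simp
  then show ?thesis using B.add.l_cancel_one[of "cls 0" "cls 0"] cls_closed[of 0] by simp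
qed

lemma pt_def: "pt a l = cls (frag_of (a, l))"
  by (simp add: pure_tensor_def)

lemma pt_closed [simp]: "a \<in> carrier A \<Longrightarrow> pt a l \<in> carrier B"
  unfolding pt_def by (rule cls_closed) simp

lemma pt_mult: "a \<in> carrier A \<Longrightarrow> b \<in> carrier A \<Longrightarrow> pt a l \<otimes>\<^bsub>B\<^esub> pt b m = pt (a \<otimes>\<^bsub>A\<^esub> b) (l * m)"
  unfolding pt_def by (subst cls_mult) auto

lemma pt_one: "pt \<one>\<^bsub>A\<^esub> 1 = \<one>\<^bsub>B\<^esub>"
  by (simp add: cls_one pt_def)

lemma pt_add_left: assumes "a \<in> carrier A" "b \<in> carrier A" shows "pt (a \<oplus>\<^bsub>A\<^esub> b) l = pt a l \<oplus>\<^bsub>B\<^esub> pt b l"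
proof -
  have "frag_of (a \<oplus>\<^bsub>A\<^esub> b, l) - frag_of (a, l) - frag_of (b, l) \<in> I"
    using assms relations_in_I unfolding tensor_relations_def by blast
  then have "cls (frag_of (a \<oplus>\<^bsub>A\<^esub> b, l)) = cls (frag_of (a, l) + frag_of (b, l))"
    by (intro cls_eqI) (use assms F.a_closed[of "frag_of (a, l)" "frag_of (b, l)"] in \<open>auto simp: diff_diff_eq\<close>)
  then show ?thesis unfolding pt_def using assms by (subst cls_add) auto
qed

lemma pt_add_right: assumes "a \<in> carrier A" shows "pt a (l + m) = pt a l \<oplus>\<^bsub>B\<^esub> pt a m"
proof -
  have "frag_of (a, l + m) - frag_of (a, l) - frag_of (a, m) \<in> I"
    using assms relations_in_I unfolding tensor_relations_def by blast
  then have "cls (frag_of (a, l + m)) = cls (frag_of (a, l) + frag_of (a, m))"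
    by (intro cls_eqI) (use assms F.a_closed[of "frag_of (a, l)" "frag_of (a, m)"] in \<open>auto simp: diff_diff_eq\<close>)
  then show ?thesis unfolding pt_def using assms by (subst cls_add) auto
qed

lemma pt_balanced: assumes "a \<in> carrier A" shows "pt (c \<odot>\<^bsub>A\<^esub> a) l = pt a (\<iota> c * l)"
proof -
  have "frag_of (c \<odot>\<^bsub>A\<^esub> a, l) - frag_of (a, \<iota> c * l) \<in> I"
    using assms relations_in_I unfolding tensor_relations_def by blast
  then show ?thesis unfolding pt_def using assms by (intro cls_eqI) auto
qed

lemma B_smult: "l \<odot>\<^bsub>B\<^esub> x = pt \<one>\<^bsub>A\<^esub> l \<otimes>\<^bsub>B\<^esub> x"
  by (simp add: base_change_def Let_def)

lemma smult_pt: "a \<in> carrier A \<Longrightarrow> l \<odot>\<^bsub>B\<^esub> pt a m = pt a (l * m)"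
  by (simp add: B_smult pt_mult)

lemma pt_zero: "a \<in> carrier A \<Longrightarrow> pt a 0 = \<zero>\<^bsub>B\<^esub>"
  using pt_add_right[of a 0 0] B.add.l_cancel_one[of "pt a 0" "pt a 0"] by simp

lemma pt_minus: "a \<in> carrier A \<Longrightarrow> pt a (- l) = \<ominus>\<^bsub>B\<^esub> pt a l"
  using pt_add_right[of a "- l" l] by (intro B.minus_equality[symmetric]) (auto simp: pt_zero)

text \<open>
  Sums of pure tensors exhaust the scalar extension; negatives are absorbed by the scalars.
\<close>

lemma B_induct [consumes 1, case_names zero pt add]:
  assumes x: "x \<in> carrier B" and z: "P \<zero>\<^bsub>B\<^esub>" and p: "\<And>a l. a \<in> carrier A \<Longrightarrow> P (pt a l)"
    and ad: "\<And>x y. x \<in> carrier B \<Longrightarrow> y \<in> carrier B \<Longrightarrow> P x \<Longrightarrow> P y \<Longrightarrow> P (x \<oplus>\<^bsub>B\<^esub> y)"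
  shows "P x"
proof -
  obtain u where u: "u \<in> carrier F" "x = cls u" using x by (auto simp: B_carrier)
  have "u \<in> carrier F \<and> P (cls u) \<and> P (\<ominus>\<^bsub>B\<^esub> cls u)" using u(1)
  proof (induction rule: F_closed_induct)
    case zero
    then show ?case using z by (simp add: cls_zero[symmetric])
  next
    case (of a l)
    then show ?case using p[of a l] p[of a "- l"] by (simp add: pt_def[symmetric] pt_minus)
  next
    case (diff u v)
    have c: "u - v \<in> carrier F" "cls u \<in> carrier B" "cls v \<in> carrier B"
      using diff F_diff_closed cls_closed by auto
    then have "cls (u - v) \<oplus>\<^bsub>B\<^esub> cls v = cls u" using cls_add[of "u - v" v] diff by simp
    then have "cls (u - v) = cls u \<oplus>\<^bsub>B\<^esub> \<ominus>\<^bsub>B\<^esub> cls v"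
      using c cls_closed[OF c(1)] by (metis a_minus_def B.add.inv_solve_right)
    moreover have "\<ominus>\<^bsub>B\<^esub> (cls u \<oplus>\<^bsub>B\<^esub> \<ominus>\<^bsub>B\<^esub> cls v) = cls v \<oplus>\<^bsub>B\<^esub> \<ominus>\<^bsub>B\<^esub> cls u"
      using c by (simp add: B.minus_add B.a_comm)
    ultimately show ?case using ad c diff by simp
  qed
  then show ?thesis using u by simp
qed

lemma ideal_of_kernel:
  assumes zero: "P 0" and diff: "\<And>u v. u \<in> carrier F \<Longrightarrow> v \<in> carrier F \<Longrightarrow> P u \<Longrightarrow> P v \<Longrightarrow> P (u - v)"
    and mult: "\<And>u v. u \<in> carrier F \<Longrightarrow> v \<in> carrier F \<Longrightarrow> P u \<Longrightarrow> P (u \<otimes>\<^bsub>F\<^esub> v) \<and> P (v \<otimes>\<^bsub>F\<^esub> u)"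
  shows "ideal {u \<in> carrier F. P u} F"
proof (rule idealI[OF F_ring])
  have m: "P (- u)" if "P u" "u \<in> carrier F" for u using diff[of 0 u] that zero by simp
  show "subgroup {u \<in> carrier F. P u} (add_monoid F)"
  proof (rule F.add.subgroupI)
    show "{u \<in> carrier F. P u} \<noteq> {}" using zero by (auto intro!: exI[of _ 0])
    show "\<ominus>\<^bsub>F\<^esub> u \<in> {u \<in> carrier F. P u}" if "u \<in> {u \<in> carrier F. P u}" for u
      using that m F.a_inv_closed[of u] F_uminus[of u] by (simp only: mem_Collect_eq)
    show "u \<oplus>\<^bsub>F\<^esub> v \<in> {u \<in> carrier F. P u}" if "u \<in> {u \<in> carrier F. P u}" "v \<in> {u \<in> carrier F. P u}" for u v
      using that m[of v] diff[of u "- v"] F.a_closed[of u v] by simp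
  qed auto
  show "u \<otimes>\<^bsub>F\<^esub> v \<in> {u \<in> carrier F. P u}" "v \<otimes>\<^bsub>F\<^esub> u \<in> {u \<in> carrier F. P u}"
    if "u \<in> {u \<in> carrier F. P u}" "v \<in> carrier F" for u v
    using that mult[of u v] F.m_closed[of u v] F.m_closed[of v u] by (simp_all only: mem_Collect_eq)
qed

lemma relation_cases:
  assumes "\<And>a b l. a \<in> carrier A \<Longrightarrow> b \<in> carrier A \<Longrightarrow> P (frag_of (a \<oplus>\<^bsub>A\<^esub> b, l) - frag_of (a, l) - frag_of (b, l))"
    and "\<And>a l m. a \<in> carrier A \<Longrightarrow> P (frag_of (a, l + m) - frag_of (a, l) - frag_of (a, m))"
    and "\<And>c a l. a \<in> carrier A \<Longrightarrow> P (frag_of (c \<odot>\<^bsub>A\<^esub> a, l) - frag_of (a, \<iota> c * l))"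
  shows "tensor_relations \<iota> A \<subseteq> {u \<in> carrier F. P u}"
proof
  fix u assume u: "u \<in> tensor_relations \<iota> A"
  then have "P u" using assms unfolding tensor_relations_def by blast
  then show "u \<in> {u \<in> carrier F. P u}" using u relations_closed by blast
qed

text \<open>
  The additive extension of a map on generators to the free abelian group.
\<close>

definition lin_ext :: "('a \<times> 'l \<Rightarrow> 'r::ring_1) \<Rightarrow> ('a \<times> 'l \<Rightarrow>\<^sub>0 int) \<Rightarrow> 'r" where
  "lin_ext f u = (\<Sum>p\<in>Poly_Mapping.keys u. of_int (Poly_Mapping.lookup u p) * f p)"

lemma lin_ext_superset:
  assumes "finite T" "Poly_Mapping.keys u \<subseteq> T"
  shows "lin_ext f u = (\<Sum>p\<in>T. of_int (Poly_Mapping.lookup u p) * f p)"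
  unfolding lin_ext_def by (rule sum.mono_neutral_left) (use assms in \<open>auto simp: in_keys_iff\<close>)

lemma lin_ext_diff: "lin_ext f (u - v) = lin_ext f u - lin_ext f v"
proof -
  let ?T = "Poly_Mapping.keys u \<union> Poly_Mapping.keys v"
  have "Poly_Mapping.keys (u - v) \<subseteq> ?T" by (rule keys_diff)
  then show ?thesis
    by (simp add: lin_ext_superset[of ?T] lookup_minus left_diff_distrib sum_subtractf)
qed

lemma lin_ext_zero [simp]: "lin_ext f 0 = 0"
  and lin_ext_of [simp]: "lin_ext f (frag_of p) = f p"
  by (auto simp: lin_ext_def)

text \<open>
  The universal property of the tensor product, for targets that are ring types: commuting images of the two factors
  that agree on the base field induce a homomorphism. The proof identifies the kernel on formal tensors.
\<close>

lemma hom_exists: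
  fixes f :: "'a \<Rightarrow> 'r::ring_1" and s :: "'l \<Rightarrow> 'r"
  assumes f_add: "\<And>a b. a \<in> carrier A \<Longrightarrow> b \<in> carrier A \<Longrightarrow> f (a \<oplus>\<^bsub>A\<^esub> b) = f a + f b"
    and f_mult: "\<And>a b. a \<in> carrier A \<Longrightarrow> b \<in> carrier A \<Longrightarrow> f (a \<otimes>\<^bsub>A\<^esub> b) = f a * f b"
    and s_add: "\<And>l m. s (l + m) = s l + s m" and s_mult: "\<And>l m. s (l * m) = s l * s m"
    and comm: "\<And>a l. a \<in> carrier A \<Longrightarrow> s l * f a = f a * s l"
    and bal: "\<And>a c. a \<in> carrier A \<Longrightarrow> f (c \<odot>\<^bsub>A\<^esub> a) = s (\<iota> c) * f a"
  obtains H where "\<And>x y. x \<in> carrier B \<Longrightarrow> y \<in> carrier B \<Longrightarrow> H (x \<oplus>\<^bsub>B\<^esub> y) = H x + H y"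
    "\<And>x y. x \<in> carrier B \<Longrightarrow> y \<in> carrier B \<Longrightarrow> H (x \<otimes>\<^bsub>B\<^esub> y) = H x * H y"
    "\<And>a l. a \<in> carrier A \<Longrightarrow> H (pt a l) = f a * s l"
proof -
  define \<Psi> where "\<Psi> = lin_ext (\<lambda>p. f (fst p) * s (snd p))"
  have \<Psi>_diff: "\<Psi> (u - v) = \<Psi> u - \<Psi> v" for u v by (simp add: \<Psi>_def lin_ext_diff)
  have \<Psi>_zero: "\<Psi> 0 = 0" by (simp add: \<Psi>_def)
  have \<Psi>_of: "\<Psi> (frag_of (a, l)) = f a * s l" for a l by (simp add: \<Psi>_def)
  have \<Psi>_add: "\<Psi> (u + v) = \<Psi> u + \<Psi> v" for u v using \<Psi>_diff[of "u + v" v] by (simp add: algebra_simps)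
  have \<Psi>_mult: "\<Psi> (u \<otimes>\<^bsub>F\<^esub> v) = \<Psi> u * \<Psi> v" if "u \<in> carrier F" "v \<in> carrier F" for u v
    using that(1)
  proof (induction rule: F_closed_induct)
    case (of a l)
    from that(2) show ?case
    proof (induction rule: F_closed_induct)
      case (of b m)
      have "f a * f b * (s l * s m) = f a * s l * (f b * s m)"
        using comm[of b l] of by (simp add: mult.assoc[symmetric]) (simp add: mult.assoc)
      then show ?case using of \<open>a \<in> carrier A\<close> by (simp add: \<Psi>_of f_mult s_mult)
    qed (auto simp: F_mult_zero F_mult_diff \<Psi>_diff \<Psi>_zero right_diff_distrib)
  qed (auto simp: F_mult_zero F_mult_diff \<Psi>_diff \<Psi>_zero left_diff_distrib)
  have "ideal {u \<in> carrier F. \<Psi> u = 0} F"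
    by (rule ideal_of_kernel) (auto simp: \<Psi>_zero \<Psi>_diff \<Psi>_mult simp del: F_simps)
  moreover have "tensor_relations \<iota> A \<subseteq> {u \<in> carrier F. \<Psi> u = 0}"
    by (rule relation_cases)
      (simp_all only: \<Psi>_diff \<Psi>_of f_add s_add s_mult bal comm distrib_left distrib_right mult.assoc, simp_all)
  ultimately have ker: "\<Psi> u = 0" if "u \<in> I" for u using I_minimal that by blast
  define H where "H x = \<Psi> (SOME u. u \<in> carrier F \<and> x = cls u)" for x
  have H: "H (cls u) = \<Psi> u" if u: "u \<in> carrier F" for u
  proof -
    define v where "v = (SOME v. v \<in> carrier F \<and> cls u = cls v)"
    have "v \<in> carrier F \<and> cls u = cls v" unfolding v_def by (rule someI[of _ u]) (use u in simp)
    then have "u - v \<in> I" using cls_eq_iff u by blast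
    then have "\<Psi> u = \<Psi> v" using ker \<Psi>_diff by fastforce
    then show ?thesis by (simp add: H_def v_def)
  qed
  show thesis
  proof (rule that[of H])
    fix x y assume "x \<in> carrier B" "y \<in> carrier B"
    then obtain u v where u: "u \<in> carrier F" "x = cls u" and v: "v \<in> carrier F" "y = cls v"
      by (auto simp: B_carrier)
    show "H (x \<oplus>\<^bsub>B\<^esub> y) = H x + H y"
      using F.a_closed[OF u(1) v(1)] u v by (simp only: cls_add H F_simps(4) \<Psi>_add)
    show "H (x \<otimes>\<^bsub>B\<^esub> y) = H x * H y"
      using F.m_closed[OF u(1) v(1)] u v by (simp only: cls_mult H \<Psi>_mult)
  next
    fix a l assume "a \<in> carrier A"
    then show "H (pt a l) = f a * s l" unfolding pt_def by (subst H) (auto simp: \<Psi>_of)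
  qed
qed

end

locale involution_extension = algebra_extension +
  fixes \<sigma> assumes inv: "involution A \<sigma>"
begin

lemma sigma [simp]:
  "x \<in> carrier A \<Longrightarrow> \<sigma> x \<in> carrier A"
  "x \<in> carrier A \<Longrightarrow> y \<in> carrier A \<Longrightarrow> \<sigma> (x \<oplus>\<^bsub>A\<^esub> y) = \<sigma> x \<oplus>\<^bsub>A\<^esub> \<sigma> y"
  "x \<in> carrier A \<Longrightarrow> y \<in> carrier A \<Longrightarrow> \<sigma> (x \<otimes>\<^bsub>A\<^esub> y) = \<sigma> y \<otimes>\<^bsub>A\<^esub> \<sigma> x"
  "x \<in> carrier A \<Longrightarrow> \<sigma> (c \<odot>\<^bsub>A\<^esub> x) = c \<odot>\<^bsub>A\<^esub> \<sigma> x"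
  "x \<in> carrier A \<Longrightarrow> \<sigma> (\<sigma> x) = x"
  using inv by (auto simp: involution_def)

abbreviation sF where "sF \<equiv> frag_extend (\<lambda>(a, l). frag_of (\<sigma> a, l))"

lemma sF_closed: "u \<in> carrier F \<Longrightarrow> sF u \<in> carrier F"
proof (induction rule: F_closed_induct)
  case (diff u v) then show ?case using F_diff_closed by (simp only: frag_extend_diff)
qed auto

lemma sF_mult: assumes "u \<in> carrier F" "v \<in> carrier F" shows "sF (u \<otimes>\<^bsub>F\<^esub> v) = sF v \<otimes>\<^bsub>F\<^esub> sF u"
  using assms(1)
proof (induction rule: F_closed_induct)
  case (of a l)
  from assms(2) show ?case
  by (induction rule: F_closed_induct)
    (use of in \<open>auto simp: F_mult_zero F_mult_diff frag_extend_diff mult.commute\<close>)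
qed (auto simp: F_mult_zero F_mult_diff frag_extend_diff)

lemma sF_I: assumes "u \<in> I" shows "sF u \<in> I"
proof -
  have "ideal {u \<in> carrier F. sF u \<in> I} F"
    by (rule ideal_of_kernel)
      (use I.zero_closed in \<open>auto simp del: F_simps(1) simp: frag_extend_diff I_diff sF_mult I.I_l_closed I.I_r_closed sF_closed\<close>)
  moreover have "tensor_relations \<iota> A \<subseteq> {u \<in> carrier F. sF u \<in> I}"
  proof (rule relation_cases)
    show "sF (frag_of (a \<oplus>\<^bsub>A\<^esub> b, l) - frag_of (a, l) - frag_of (b, l)) \<in> I" if "a \<in> carrier A" "b \<in> carrier A" for a b l
      using that I_rel(1)[of "\<sigma> a" "\<sigma> b" l] by (simp add: frag_extend_diff)
    show "sF (frag_of (a, l + m) - frag_of (a, l) - frag_of (a, m)) \<in> I" if "a \<in> carrier A" for a l m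
      using that I_rel(2)[of "\<sigma> a" l m] by (simp add: frag_extend_diff)
    show "sF (frag_of (c \<odot>\<^bsub>A\<^esub> a, l) - frag_of (a, \<iota> c * l)) \<in> I" if "a \<in> carrier A" for a c l
      using that I_rel(3)[of "\<sigma> a" c l] by (simp add: frag_extend_diff)
  qed
  ultimately show ?thesis using I_minimal assms by blast
qed

abbreviation bm where "bm \<equiv> base_change_map \<iota> A \<sigma>"

lemma bm_cls: assumes u: "u \<in> carrier F" shows "bm (cls u) = cls (sF u)"
proof -
  have "cls (sF v) = cls (sF u)" if "v \<in> cls u" for v
  proof -
    have v: "v \<in> carrier F" "cls v = cls u" using that mem_cls[OF u] by simp_all
    then have "v - u \<in> I" using cls_eq_iff[OF v(1) u] by simp
    then have "sF v - sF u \<in> I" using sF_I[of "v - u"] by (simp add: frag_extend_diff)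
    then show ?thesis by (rule cls_eqI[OF sF_closed[OF v(1)] sF_closed[OF u]])
  qed
  then have "bm (cls u) = (\<Union>v\<in>cls u. cls (sF u))" unfolding base_change_map_def by simp
  moreover have "u \<in> cls u" using mem_cls[OF u] u by simp
  ultimately show ?thesis by auto
qed

lemma bm_closed [simp]: "x \<in> carrier B \<Longrightarrow> bm x \<in> carrier B"
  unfolding B_carrier by (elim imageE, simp only: bm_cls, rule imageI, rule sF_closed)

lemma bm_pt [simp]: "a \<in> carrier A \<Longrightarrow> bm (pt a l) = pt (\<sigma> a) l"
  unfolding pt_def by (subst bm_cls) auto

lemma bm_add: assumes "x \<in> carrier B" "y \<in> carrier B" shows "bm (x \<oplus>\<^bsub>B\<^esub> y) = bm x \<oplus>\<^bsub>B\<^esub> bm y"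
proof -
  obtain u v where u: "u \<in> carrier F" "x = cls u" and v: "v \<in> carrier F" "y = cls v"
    using assms by (auto simp: B_carrier)
  show ?thesis unfolding u(2) v(2) using u(1) v(1) F.a_closed[OF u(1) v(1)] sF_closed
    by (simp add: cls_add bm_cls frag_extend_add del: F_simps(1))
qed

lemma bm_zero: "bm \<zero>\<^bsub>B\<^esub> = \<zero>\<^bsub>B\<^esub>"
  using bm_cls[of 0] by (simp add: cls_zero)

end

section \<open>A ring of operators containing every scalar extension\<close>

text \<open>
  The space of all sequences over \<open>L\<close> has room for algebras of every finite dimension.
\<close>

definition lin_op :: "((nat \<Rightarrow> 'l::field) \<Rightarrow> nat \<Rightarrow> 'l) \<Rightarrow> bool" where
  "lin_op f \<longleftrightarrow> (\<forall>v w. f (\<lambda>n. v n + w n) = (\<lambda>n. f v n + f w n)) \<and> (\<forall>c v. f (\<lambda>n. c * v n) = (\<lambda>n. c * f v n))"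

text \<open>
  A pair of linear operators, of which the second plays the part of the adjoint of the first: products are
  taken in the opposite order in the second component, and the star exchanges the components. This
  provides one ring type with a total star for each field \<open>L\<close>.
\<close>

typedef (overloaded) 'l starop = "{p :: ((nat \<Rightarrow> 'l::field) \<Rightarrow> nat \<Rightarrow> 'l) \<times> ((nat \<Rightarrow> 'l) \<Rightarrow> nat \<Rightarrow> 'l). lin_op (fst p) \<and> lin_op (snd p)}"
  by (rule exI[of _ "(id, id)"]) (simp add: lin_op_def)

abbreviation fop where "fop x \<equiv> fst (Rep_starop x)"
abbreviation sop where "sop x \<equiv> snd (Rep_starop x)"

lemma starop_eqI: "(\<And>v n. fop x v n = fop y v n) \<Longrightarrow> (\<And>v n. sop x v n = sop y v n) \<Longrightarrow> x = y"
  by (simp add: Rep_starop_inject[symmetric] prod_eq_iff fun_eq_iff)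

lemma starop_lin: "lin_op (fop x)" "lin_op (sop x)"
  using Rep_starop[of x] by auto

lemma op_add: "fop x (\<lambda>n. v n + w n) n = fop x v n + fop x w n" "sop x (\<lambda>n. v n + w n) n = sop x v n + sop x w n"
  using starop_lin[of x] by (auto simp: lin_op_def)

lemma op_scale: "fop x (\<lambda>n. c * v n) n = c * fop x v n" "sop x (\<lambda>n. c * v n) n = c * sop x v n"
  using starop_lin[of x] by (auto simp: lin_op_def)

lemma op_fun:
  "fop x (\<lambda>n. v n + w n) = (\<lambda>n. fop x v n + fop x w n)" "sop x (\<lambda>n. v n + w n) = (\<lambda>n. sop x v n + sop x w n)"
  "fop x (\<lambda>n. c * v n) = (\<lambda>n. c * fop x v n)" "sop x (\<lambda>n. c * v n) = (\<lambda>n. c * sop x v n)"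
  by (auto simp: op_add op_scale fun_eq_iff)

instantiation starop :: (field) ring_1
begin

definition "0 = Abs_starop ((\<lambda>v n. 0), (\<lambda>v n. 0))"
definition "1 = Abs_starop ((\<lambda>v. v), (\<lambda>v. v))"
definition "x + y = Abs_starop ((\<lambda>v n. fop x v n + fop y v n), (\<lambda>v n. sop x v n + sop y v n))"
definition "- x = Abs_starop ((\<lambda>v n. - fop x v n), (\<lambda>v n. - sop x v n))"
definition "x - (y::'a starop) = x + - y"
definition "x * y = Abs_starop ((\<lambda>v. fop x (fop y v)), (\<lambda>v. sop y (sop x v)))"

lemma rep_simps:
  "fop 0 v n = 0" "sop 0 v n = 0" "fop 1 v = v" "sop 1 v = v"
  "fop (x + y) v n = fop x v n + fop y v n" "sop (x + y) v n = sop x v n + sop y v n"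
  "fop (- x) v n = - fop x v n" "sop (- x) v n = - sop x v n"
  "fop (x * y) v = fop x (fop y v)" "sop (x * y) v = sop y (sop x v)"
  unfolding zero_starop_def one_starop_def plus_starop_def uminus_starop_def times_starop_def
  by (subst Abs_starop_inverse; auto simp: lin_op_def op_fun algebra_simps)+

instance
proof
  fix x y z :: "'a starop"
  have L: "fop x (\<lambda>n. v n + w n) = (\<lambda>n. fop x v n + fop x w n)" "sop x (\<lambda>n. v n + w n) = (\<lambda>n. sop x v n + sop x w n)" for x :: "'a starop" and v w
    by (auto simp: op_add fun_eq_iff)
  have E: "fop (x + y) v = (\<lambda>n. fop x v n + fop y v n)" "sop (x + y) v = (\<lambda>n. sop x v n + sop y v n)" for x y :: "'a starop" and v
    by (auto simp: rep_simps fun_eq_iff)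
  show "(x + y) * z = x * z + y * z" "x * (y + z) = x * y + x * z"
    by (rule starop_eqI; simp add: rep_simps E L)+
  show "(0::'a starop) \<noteq> 1"
  proof
    assume "(0::'a starop) = 1"
    then have "fop (0::'a starop) (\<lambda>n. 1) 0 = fop 1 (\<lambda>n. 1) 0" by simp
    then show False by (simp add: rep_simps)
  qed
  show "x - y = x + - y" by (simp add: minus_starop_def)
qed (rule starop_eqI; simp add: rep_simps ac_simps)+

end

definition sc_op :: "'l::field \<Rightarrow> 'l starop \<Rightarrow> 'l starop" where
  "sc_op c x = Abs_starop ((\<lambda>v n. c * fop x v n), (\<lambda>v n. c * sop x v n))"

definition star_op :: "'l::field starop \<Rightarrow> 'l starop" where
  "star_op x = Abs_starop (sop x, fop x)"

lemma sc_rep: "fop (sc_op c x) v n = c * fop x v n" "sop (sc_op c x) v n = c * sop x v n"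
  unfolding sc_op_def by (subst Abs_starop_inverse; auto simp: lin_op_def op_fun algebra_simps)+

lemma star_rep: "fop (star_op x) = sop x" "sop (star_op x) = fop x"
  unfolding star_op_def by (subst Abs_starop_inverse; auto simp: starop_lin)+

lemma star_algebra_starop:
  fixes S :: "'l::field starop set"
  assumes "1 \<in> S" "\<And>x y. x \<in> S \<Longrightarrow> y \<in> S \<Longrightarrow> x + y \<in> S" "\<And>x y. x \<in> S \<Longrightarrow> y \<in> S \<Longrightarrow> x * y \<in> S"
    "\<And>c x. x \<in> S \<Longrightarrow> sc_op c x \<in> S" "\<And>x. x \<in> S \<Longrightarrow> star_op x \<in> S"
  shows "star_algebra sc_op star_op S"
proof
  have E: "fop (sc_op c x) v = (\<lambda>n. c * fop x v n)" "sop (sc_op c x) v = (\<lambda>n. c * sop x v n)" for c and x :: "'l starop" and v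
    by (auto simp: fun_eq_iff sc_rep)
  show "sc_op c x * y = sc_op c (x * y)" "x * sc_op c y = sc_op c (x * y)" for c and x y :: "'l starop"
    by (rule starop_eqI; simp add: rep_simps E op_fun)+
qed (use assms in \<open>auto intro!: starop_eqI simp: rep_simps sc_rep star_rep algebra_simps\<close>)

interpretation R: star_algebra sc_op star_op "UNIV :: 'l::field starop set"
  by (rule star_algebra_starop) auto

primrec lincomb :: "('k, 'a) module \<Rightarrow> (nat \<Rightarrow> 'k) \<Rightarrow> (nat \<Rightarrow> 'a) \<Rightarrow> nat \<Rightarrow> 'a" where
  "lincomb A c b 0 = \<zero>\<^bsub>A\<^esub>"
| "lincomb A c b (Suc n) = c n \<odot>\<^bsub>A\<^esub> b n \<oplus>\<^bsub>A\<^esub> lincomb A c b n"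

lemma lincomb_cong: "(\<And>i. i < n \<Longrightarrow> c i = d i) \<Longrightarrow> (\<And>i. i < n \<Longrightarrow> b i = b' i) \<Longrightarrow> lincomb A c b n = lincomb A d b' n"
  by (induction n) auto

definition basis_of :: "('k::field, 'a) module \<Rightarrow> 'a set \<Rightarrow> nat \<Rightarrow> (nat \<Rightarrow> 'a) \<Rightarrow> bool" where
  "basis_of A E n b \<longleftrightarrow> (\<forall>i<n. b i \<in> carrier A) \<and> E = range (\<lambda>c. lincomb A c b n) \<and>
     (\<forall>c. lincomb A c b n = \<zero>\<^bsub>A\<^esub> \<longrightarrow> (\<forall>i<n. c i = 0))"

context algebra_over begin

lemma lincomb_closed [simp]: "(\<And>i. i < n \<Longrightarrow> b i \<in> carrier A) \<Longrightarrow> lincomb A c b n \<in> carrier A"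
  by (induction n) auto

lemma lincomb_add: "(\<And>i. i < n \<Longrightarrow> b i \<in> carrier A) \<Longrightarrow>
    lincomb A c b n \<oplus>\<^bsub>A\<^esub> lincomb A d b n = lincomb A (\<lambda>i. c i + d i) b n"
proof (induction n)
  case (Suc n)
  have c: "b n \<in> carrier A" "lincomb A c b n \<in> carrier A" "lincomb A d b n \<in> carrier A" using Suc.prems by auto
  have "lincomb A c b (Suc n) \<oplus>\<^bsub>A\<^esub> lincomb A d b (Suc n) =
     (c n \<odot>\<^bsub>A\<^esub> b n \<oplus>\<^bsub>A\<^esub> d n \<odot>\<^bsub>A\<^esub> b n) \<oplus>\<^bsub>A\<^esub> (lincomb A c b n \<oplus>\<^bsub>A\<^esub> lincomb A d b n)"
    using c by (simp add: A.a_ac)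
  also have "\<dots> = lincomb A (\<lambda>i. c i + d i) b (Suc n)" using Suc c by (simp add: smult_simps)
  finally show ?case .
qed simp

lemma lincomb_smult: "(\<And>i. i < n \<Longrightarrow> b i \<in> carrier A) \<Longrightarrow>
    s \<odot>\<^bsub>A\<^esub> lincomb A c b n = lincomb A (\<lambda>i. s * c i) b n"
  by (induction n) (auto simp: smult_simps)

lemma scalar_mult: "x \<in> carrier A \<Longrightarrow> (c \<odot>\<^bsub>A\<^esub> \<one>\<^bsub>A\<^esub>) \<otimes>\<^bsub>A\<^esub> x = c \<odot>\<^bsub>A\<^esub> x"
  by (simp add: smult_mult)

lemma lincomb_hom:
  fixes g :: "'a \<Rightarrow> 'r::comm_monoid_add"
  assumes "g \<zero>\<^bsub>A\<^esub> = 0" "\<And>x y. x \<in> carrier A \<Longrightarrow> y \<in> carrier A \<Longrightarrow> g (x \<oplus>\<^bsub>A\<^esub> y) = g x + g y"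
    and "\<And>i. i < n \<Longrightarrow> b i \<in> carrier A"
  shows "g (lincomb A c b n) = (\<Sum>i<n. g (c i \<odot>\<^bsub>A\<^esub> b i))"
  using assms(3) by (induction n) (auto simp: assms(1,2) add.commute)

lemma basis_exists:
  assumes "A.dimension n (scalars A) E"
  shows "\<exists>b. basis_of A E n b"
  using assms
proof (induction n "scalars A" E rule: A.dimension.induct)
  case zero_dim
  then show ?case by (auto simp: basis_of_def)
next
  case (Suc_dim v E n)
  then obtain b where b: "\<And>i. i < n \<Longrightarrow> b i \<in> carrier A" "E = range (\<lambda>c. lincomb A c b n)"
     "\<And>c i. lincomb A c b n = \<zero>\<^bsub>A\<^esub> \<Longrightarrow> i < n \<Longrightarrow> c i = 0"
    unfolding basis_of_def by blast
  let ?b = "b(n := v)"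
  have eq: "lincomb A c ?b n = lincomb A c b n" for c by (rule lincomb_cong) auto
  have bc: "?b i \<in> carrier A" if "i < Suc n" for i using that b(1) Suc_dim(1) by (cases "i = n") auto
  have "basis_of A (A.line_extension (scalars A) v E) (Suc n) ?b"
    unfolding basis_of_def
  proof (intro conjI allI impI)
    show "A.line_extension (scalars A) v E = range (\<lambda>c. lincomb A c ?b (Suc n))"
    proof (intro equalityI subsetI)
      fix u assume "u \<in> A.line_extension (scalars A) v E"
      then obtain k c where u: "u = (k \<odot>\<^bsub>A\<^esub> \<one>\<^bsub>A\<^esub>) \<otimes>\<^bsub>A\<^esub> v \<oplus>\<^bsub>A\<^esub> lincomb A c b n"
        unfolding A.line_extension_mem_iff scalars_def b(2) by blast
      have "lincomb A (c(n := k)) ?b (Suc n) = k \<odot>\<^bsub>A\<^esub> v \<oplus>\<^bsub>A\<^esub> lincomb A (c(n := k)) b n"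
        by (simp add: eq)
      also have "lincomb A (c(n := k)) b n = lincomb A c b n" by (rule lincomb_cong) auto
      finally have L: "lincomb A (c(n := k)) ?b (Suc n) = k \<odot>\<^bsub>A\<^esub> v \<oplus>\<^bsub>A\<^esub> lincomb A c b n" .
      have "u = lincomb A (c(n := k)) ?b (Suc n)" using u Suc_dim(1) by (simp only: L scalar_mult)
      then show "u \<in> range (\<lambda>c. lincomb A c ?b (Suc n))" by blast
    next
      fix u assume "u \<in> range (\<lambda>c. lincomb A c ?b (Suc n))"
      then obtain c where "u = c n \<odot>\<^bsub>A\<^esub> v \<oplus>\<^bsub>A\<^esub> lincomb A c b n" by (auto simp: eq)
      then have "u = (c n \<odot>\<^bsub>A\<^esub> \<one>\<^bsub>A\<^esub>) \<otimes>\<^bsub>A\<^esub> v \<oplus>\<^bsub>A\<^esub> lincomb A c b n" using Suc_dim(1) by (simp add: scalar_mult)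
      then show "u \<in> A.line_extension (scalars A) v E"
        unfolding A.line_extension_mem_iff scalars_def b(2) by blast
    qed
  next
    fix c i assume z: "lincomb A c ?b (Suc n) = \<zero>\<^bsub>A\<^esub>" and i: "i < Suc n"
    have v: "v \<in> carrier A" "lincomb A c b n \<in> carrier A" using Suc_dim(1) b(1) by auto
    have z': "c n \<odot>\<^bsub>A\<^esub> v \<oplus>\<^bsub>A\<^esub> lincomb A c b n = \<zero>\<^bsub>A\<^esub>" using z by (simp add: eq)
    have "c n = 0"
    proof (rule ccontr)
      assume c: "c n \<noteq> 0"
      have "lincomb A (\<lambda>i. (-1 / c n) * c i) b n = (-1 / c n) \<odot>\<^bsub>A\<^esub> lincomb A c b n"
        using b(1) by (simp only: lincomb_smult)
      also have "\<dots> = (-1 / c n) \<odot>\<^bsub>A\<^esub> lincomb A c b n \<oplus>\<^bsub>A\<^esub> ((-1 / c n) \<odot>\<^bsub>A\<^esub> (c n \<odot>\<^bsub>A\<^esub> v) \<oplus>\<^bsub>A\<^esub> v)"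
      proof -
        have "(-1 / c n) \<odot>\<^bsub>A\<^esub> (c n \<odot>\<^bsub>A\<^esub> v) \<oplus>\<^bsub>A\<^esub> v = (-1 / c n * c n + 1) \<odot>\<^bsub>A\<^esub> v"
          using v by (simp only: smult_simps smult_closed)
        also have "\<dots> = \<zero>\<^bsub>A\<^esub>" using c v by simp
        finally show ?thesis using v by simp
      qed
      also have "\<dots> = (-1 / c n) \<odot>\<^bsub>A\<^esub> (c n \<odot>\<^bsub>A\<^esub> v \<oplus>\<^bsub>A\<^esub> lincomb A c b n) \<oplus>\<^bsub>A\<^esub> v"
        using v by (simp only: smult_simps(2) smult_closed A.a_ac A.a_closed)
      finally have "lincomb A (\<lambda>i. (-1 / c n) * c i) b n = v" using v z' by simp
      then have "v \<in> E" unfolding b(2) by blast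
      then show False using Suc_dim by blast
    qed
    then show "c i = 0" using z' b(3)[of c i] i v by (cases "i = n") auto
  qed (use bc in auto)
  then show ?case by blast
qed

end

locale based_extension = involution_extension +
  fixes n :: nat and b
  assumes basis: "basis_of A (carrier A) n b" and n: "0 < n"
begin

lemma b_closed [simp]: "i < n \<Longrightarrow> b i \<in> carrier A"
  using basis unfolding basis_of_def by blast

definition coord where "coord x = (SOME c. x = lincomb A c b n)"

lemma coord: "x \<in> carrier A \<Longrightarrow> lincomb A (coord x) b n = x"
proof -
  assume "x \<in> carrier A"
  then have "\<exists>c. x = lincomb A c b n" using basis unfolding basis_of_def by blast
  then show ?thesis unfolding coord_def by (metis (mono_tags, lifting) someI_ex)
qed

lemma coord_unique: assumes "lincomb A c b n = lincomb A d b n" "i < n" shows "c i = d i"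
proof -
  let ?m = "lincomb A (\<lambda>i. (-1) * d i) b n"
  have "lincomb A (\<lambda>i. c i + (-1) * d i) b n = lincomb A c b n \<oplus>\<^bsub>A\<^esub> ?m"
    by (subst lincomb_add) auto
  also have "\<dots> = lincomb A (\<lambda>i. d i + (-1) * d i) b n"
    unfolding assms(1) by (subst lincomb_add) auto
  also have "\<dots> = lincomb A (\<lambda>i. 0 * d i) b n" by simp
  also have "\<dots> = 0 \<odot>\<^bsub>A\<^esub> lincomb A d b n" by (subst lincomb_smult) auto
  also have "\<dots> = \<zero>\<^bsub>A\<^esub>" by simp
  finally have "c i + (-1) * d i = 0" using basis assms(2) unfolding basis_of_def by blast
  then show ?thesis by simp
qed

lemma coord_eqI: "x = lincomb A c b n \<Longrightarrow> i < n \<Longrightarrow> coord x i = c i"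
  by (rule coord_unique) (auto simp: coord)

lemma coord_add: "x \<in> carrier A \<Longrightarrow> y \<in> carrier A \<Longrightarrow> i < n \<Longrightarrow> coord (x \<oplus>\<^bsub>A\<^esub> y) i = coord x i + coord y i"
  by (rule coord_eqI) (auto simp: coord simp flip: lincomb_add)

lemma coord_smult: "x \<in> carrier A \<Longrightarrow> i < n \<Longrightarrow> coord (c \<odot>\<^bsub>A\<^esub> x) i = c * coord x i"
  by (rule coord_eqI) (auto simp: coord simp flip: lincomb_smult)

lemma coord_zero: "i < n \<Longrightarrow> coord \<zero>\<^bsub>A\<^esub> i = 0"
  using coord_smult[of "\<zero>\<^bsub>A\<^esub>" i 0] by simp

lemma coord_mult: assumes "a \<in> carrier A" "x \<in> carrier A" "i < n"
  shows "coord (a \<otimes>\<^bsub>A\<^esub> x) i = (\<Sum>j<n. coord (a \<otimes>\<^bsub>A\<^esub> b j) i * coord x j)"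
proof -
  have "coord (a \<otimes>\<^bsub>A\<^esub> lincomb A (coord x) b n) i = (\<Sum>j<n. coord (a \<otimes>\<^bsub>A\<^esub> (coord x j \<odot>\<^bsub>A\<^esub> b j)) i)"
    by (rule lincomb_hom[of "\<lambda>y. coord (a \<otimes>\<^bsub>A\<^esub> y) i"]) (use assms in \<open>auto simp: coord_add coord_zero A.r_distr\<close>)
  then show ?thesis using assms by (simp add: coord smult_mult coord_smult mult.commute)
qed

lemma iota_sum: "\<iota> (sum f J) = (\<Sum>i\<in>J. \<iota> (f i))"
  by (induction J rule: infinite_finite_induct) auto

text \<open>
  Multiplication by \<open>a\<close> in the coordinates of the basis, with the sequence cut into blocks of length \<open>n\<close>: the position
  \<open>m\<close> is the coordinate \<open>m mod n\<close> in the block \<open>m div n\<close>.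
\<close>

definition act where
  "act a v m = (\<Sum>j<n. \<iota> (coord (a \<otimes>\<^bsub>A\<^esub> b j) (m mod n)) * v (m div n * n + j))"

lemma act_lin: "lin_op (act a)"
  by (auto simp: lin_op_def act_def fun_eq_iff algebra_simps sum.distrib sum_distrib_left)

lemma act_mult: assumes "a \<in> carrier A" "a' \<in> carrier A" shows "act (a \<otimes>\<^bsub>A\<^esub> a') v m = act a (act a' v) m"
proof -
  have m: "m mod n < n" using n by simp
  have "act a (act a' v) m = (\<Sum>j<n. \<iota> (coord (a \<otimes>\<^bsub>A\<^esub> b j) (m mod n)) *
     (\<Sum>k<n. \<iota> (coord (a' \<otimes>\<^bsub>A\<^esub> b k) j) * v (m div n * n + k)))"
    using n by (auto simp: act_def intro!: sum.cong)
  also have "\<dots> = (\<Sum>k<n. (\<Sum>j<n. \<iota> (coord (a \<otimes>\<^bsub>A\<^esub> b j) (m mod n)) * \<iota> (coord (a' \<otimes>\<^bsub>A\<^esub> b k) j)) * v (m div n * n + k))"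
    unfolding sum_distrib_left sum_distrib_right by (subst sum.swap) (simp add: mult.assoc)
  also have "\<dots> = (\<Sum>k<n. \<iota> (coord (a \<otimes>\<^bsub>A\<^esub> (a' \<otimes>\<^bsub>A\<^esub> b k)) (m mod n)) * v (m div n * n + k))"
  proof (intro sum.cong refl)
    fix k assume "k \<in> {..<n}"
    then show "(\<Sum>j<n. \<iota> (coord (a \<otimes>\<^bsub>A\<^esub> b j) (m mod n)) * \<iota> (coord (a' \<otimes>\<^bsub>A\<^esub> b k) j)) * v (m div n * n + k) =
      \<iota> (coord (a \<otimes>\<^bsub>A\<^esub> (a' \<otimes>\<^bsub>A\<^esub> b k)) (m mod n)) * v (m div n * n + k)"
      using coord_mult[of a "a' \<otimes>\<^bsub>A\<^esub> b k" "m mod n"] assms m by (simp only: A.m_closed b_closed lessThan_iff iota_sum iota(2))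
  qed
  finally show ?thesis using assms by (simp add: act_def A.m_assoc)
qed

lemma coord_basis: assumes "i < n" "j < n" shows "coord (b j) i = (if i = j then 1 else 0)"
proof (rule coord_eqI[OF _ assms(1)])
  have "lincomb A (\<lambda>i. if i = j then 1 else 0) b k = (if j < k then b j else \<zero>\<^bsub>A\<^esub>)" if "k \<le> n" for k
    using that by (induction k) (use assms(2) in \<open>auto simp: smult_simps less_Suc_eq\<close>)
  then show "b j = lincomb A (\<lambda>i. if i = j then 1 else 0) b n" using assms(2) by simp
qed

lemma act_one: "act \<one>\<^bsub>A\<^esub> v m = v m"
proof -
  have m: "m mod n < n" using n by simp
  have "act \<one>\<^bsub>A\<^esub> v m = (\<Sum>j<n. (if m mod n = j then v (m div n * n + j) else 0))"
    unfolding act_def using m by (intro sum.cong refl) (auto simp: coord_basis)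
  also have "\<dots> = v m" using m by simp
  finally show ?thesis .
qed

lemma act_add: "a \<in> carrier A \<Longrightarrow> a' \<in> carrier A \<Longrightarrow> act (a \<oplus>\<^bsub>A\<^esub> a') v m = act a v m + act a' v m"
  using n by (simp add: act_def A.l_distr coord_add sum.distrib distrib_right)

lemma act_smult: "a \<in> carrier A \<Longrightarrow> act (c \<odot>\<^bsub>A\<^esub> a) v m = \<iota> c * act a v m"
  using n by (simp add: act_def smult_mult coord_smult sum_distrib_left mult.assoc)

text \<open>
  The pair consists of the actions of \<open>a\<close> and \<open>\<sigma>(a)\<close>, so that the star corresponds to the involution.
\<close>

definition rho where "rho a = Abs_starop (act a, act (\<sigma> a))"

lemma rho_rep: "fop (rho a) = act a" "sop (rho a) = act (\<sigma> a)"
  unfolding rho_def by (subst Abs_starop_inverse; simp add: act_lin)+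

lemma sigma_one: "\<sigma> \<one>\<^bsub>A\<^esub> = \<one>\<^bsub>A\<^esub>"
  using sigma(3)[of "\<sigma> \<one>\<^bsub>A\<^esub>" "\<one>\<^bsub>A\<^esub>"] by simp

lemma rho_simps:
  "a \<in> carrier A \<Longrightarrow> a' \<in> carrier A \<Longrightarrow> rho (a \<oplus>\<^bsub>A\<^esub> a') = rho a + rho a'"
  "a \<in> carrier A \<Longrightarrow> a' \<in> carrier A \<Longrightarrow> rho (a \<otimes>\<^bsub>A\<^esub> a') = rho a * rho a'"
  "rho \<one>\<^bsub>A\<^esub> = 1"
  "a \<in> carrier A \<Longrightarrow> rho (c \<odot>\<^bsub>A\<^esub> a) = sc_op (\<iota> c) (rho a)"
  "a \<in> carrier A \<Longrightarrow> rho (\<sigma> a) = star_op (rho a)"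
  by (rule starop_eqI; simp add: rho_rep rep_simps sc_rep star_rep act_add act_mult act_one act_smult sigma_one fun_eq_iff)+

lemma act_unit:
  assumes "a \<in> carrier A" "m < n"
  shows "act a (\<lambda>m. \<iota> (coord \<one>\<^bsub>A\<^esub> m)) m = \<iota> (coord a m)"
proof -
  have "coord a m = (\<Sum>j<n. coord (a \<otimes>\<^bsub>A\<^esub> b j) m * coord \<one>\<^bsub>A\<^esub> j)"
    using coord_mult[of a "\<one>\<^bsub>A\<^esub>" m] assms by simp
  then have "\<iota> (coord a m) = (\<Sum>j<n. \<iota> (coord (a \<otimes>\<^bsub>A\<^esub> b j) m) * \<iota> (coord \<one>\<^bsub>A\<^esub> j))"
    by (simp only: iota_sum iota(2))
  then show ?thesis using assms by (simp add: act_def)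
qed

lemma rho_independent:
  assumes "(\<Sum>i<n. sc_op (l i) (rho (b i))) = 0" "i < n"
  shows "l i = 0"
proof -
  let ?u = "\<lambda>m. \<iota> (coord \<one>\<^bsub>A\<^esub> m)"
  have *: "fop (\<Sum>i<k. sc_op (l i) (rho (b i))) v m = (\<Sum>i<k. l i * act (b i) v m)" for v m k
    by (induction k) (auto simp: rep_simps sc_rep rho_rep)
  have "0 = (\<Sum>j<n. l j * act (b j) ?u i)" using assms(1) *[of n ?u i] by (simp add: rep_simps)
  also have "\<dots> = (\<Sum>j<n. if i = j then l j else 0)"
    using assms(2) by (intro sum.cong refl) (auto simp: act_unit coord_basis)
  finally show ?thesis using assms(2) by simp
qed

primrec lsum where
  "lsum l 0 = \<zero>\<^bsub>B\<^esub>"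
| "lsum l (Suc k) = pt (b k) (l k) \<oplus>\<^bsub>B\<^esub> lsum l k"

lemma lsum_closed [simp]: "k \<le> n \<Longrightarrow> lsum l k \<in> carrier B"
  by (induction k) auto

lemma lsum_add: "k \<le> n \<Longrightarrow> lsum l k \<oplus>\<^bsub>B\<^esub> lsum m k = lsum (\<lambda>i. l i + m i) k"
proof (induction k)
  case (Suc k)
  then have c: "pt (b k) (l k) \<in> carrier B" "pt (b k) (m k) \<in> carrier B" "lsum l k \<in> carrier B" "lsum m k \<in> carrier B"
    by auto
  have "lsum l (Suc k) \<oplus>\<^bsub>B\<^esub> lsum m (Suc k) = (pt (b k) (l k) \<oplus>\<^bsub>B\<^esub> pt (b k) (m k)) \<oplus>\<^bsub>B\<^esub> (lsum l k \<oplus>\<^bsub>B\<^esub> lsum m k)"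
    using c by (simp add: B.a_ac)
  then show ?case using Suc by (simp add: pt_add_right)
qed simp

lemma pt_zero_left: "pt \<zero>\<^bsub>A\<^esub> l = \<zero>\<^bsub>B\<^esub>"
  using pt_balanced[of "\<zero>\<^bsub>A\<^esub>" 0 l] by (simp add: pt_zero)

lemma B_span: assumes "x \<in> carrier B" shows "\<exists>l. x = lsum l n"
  using assms
proof (induction rule: B_induct)
  case zero
  have "lsum (\<lambda>_. 0) k = \<zero>\<^bsub>B\<^esub>" if "k \<le> n" for k using that by (induction k) (auto simp: pt_zero)
  then show ?case by (metis order_refl)
next
  case (pt a l)
  have "pt (lincomb A (coord a) b k) l = lsum (\<lambda>i. \<iota> (coord a i) * l) k" if "k \<le> n" for k
    using that by (induction k) (auto simp: pt_zero_left pt_add_left pt_balanced)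
  then have "pt a l = lsum (\<lambda>i. \<iota> (coord a i) * l) n" using coord[OF pt] by (metis order_refl)
  then show ?case by blast
next
  case (add x y) then show ?case using lsum_add[of n] by fastforce
qed

text \<open>
  The extension of \<open>rho\<close> to \<open>A \<otimes>\<^sub>K L\<close>. It is chosen by its properties; \<open>hat_inj\<close> shows that it is faithful.
\<close>

definition hat where
  "hat = (SOME H. (\<forall>x\<in>carrier B. \<forall>y\<in>carrier B. H (x \<oplus>\<^bsub>B\<^esub> y) = H x + H y \<and> H (x \<otimes>\<^bsub>B\<^esub> y) = H x * H y) \<and>
     (\<forall>a\<in>carrier A. \<forall>l. H (pt a l) = sc_op l (rho a)))"

lemma hat_ex: "\<exists>H. (\<forall>x\<in>carrier B. \<forall>y\<in>carrier B. H (x \<oplus>\<^bsub>B\<^esub> y) = H x + H y \<and> H (x \<otimes>\<^bsub>B\<^esub> y) = H x * H y) \<and>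
     (\<forall>a\<in>carrier A. \<forall>l. H (pt a l) = sc_op l (rho a))"
proof (rule hom_exists[of rho "\<lambda>l. sc_op l 1"])
  fix H
  assume h: "\<And>x y. x \<in> carrier B \<Longrightarrow> y \<in> carrier B \<Longrightarrow> H (x \<oplus>\<^bsub>B\<^esub> y) = H x + H y"
    "\<And>x y. x \<in> carrier B \<Longrightarrow> y \<in> carrier B \<Longrightarrow> H (x \<otimes>\<^bsub>B\<^esub> y) = H x * H y"
    "\<And>a l. a \<in> carrier A \<Longrightarrow> H (pt a l) = rho a * sc_op l 1"
  then show ?thesis by (intro exI[of _ H]) auto
qed (auto simp: rho_simps R.scale_left_distrib)

lemma hat:
  "x \<in> carrier B \<Longrightarrow> y \<in> carrier B \<Longrightarrow> hat (x \<oplus>\<^bsub>B\<^esub> y) = hat x + hat y"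
  "x \<in> carrier B \<Longrightarrow> y \<in> carrier B \<Longrightarrow> hat (x \<otimes>\<^bsub>B\<^esub> y) = hat x * hat y"
  "a \<in> carrier A \<Longrightarrow> hat (pt a l) = sc_op l (rho a)"
  using someI_ex[OF hat_ex] unfolding hat_def[symmetric] by blast+

lemma hat_one: "hat \<one>\<^bsub>B\<^esub> = 1"
  using hat(3)[of "\<one>\<^bsub>A\<^esub>" 1] by (simp add: pt_one rho_simps)

lemma hat_zero: "hat \<zero>\<^bsub>B\<^esub> = 0"
  using hat(3)[of "\<zero>\<^bsub>A\<^esub>" 0] by (simp add: pt_zero)

lemma hat_smult: "x \<in> carrier B \<Longrightarrow> hat (l \<odot>\<^bsub>B\<^esub> x) = sc_op l (hat x)"
  by (simp add: B_smult hat rho_simps)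

lemma hat_star: "x \<in> carrier B \<Longrightarrow> hat (bm x) = star_op (hat x)"
  by (induction rule: B_induct) (auto simp: bm_zero hat_zero hat bm_add rho_simps)

text \<open>
  The images of the basis elements are independent over \<open>L\<close>, as they take 1 to the basis itself.
\<close>

lemma hat_inj: "inj_on hat (carrier B)"
proof (rule inj_onI)
  fix x y assume xy: "x \<in> carrier B" "y \<in> carrier B" "hat x = hat y"
  obtain l m where l: "x = lsum l n" and m: "y = lsum m n" using B_span xy by blast
  have h: "hat (lsum l k) = (\<Sum>i<k. sc_op (l i) (rho (b i)))" if "k \<le> n" for l k
    using that by (induction k) (auto simp: hat_zero hat add.commute)
  have "(\<Sum>i<n. sc_op (l i - m i) (rho (b i))) = 0"
    using xy h[of n] unfolding l m by (simp add: R.scale_left_diff_distrib sum_subtractf)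
  then have "l i = m i" if "i < n" for i using rho_independent[of "\<lambda>i. l i - m i" i] that by simp
  then have "lsum l k = lsum m k" if "k \<le> n" for k using that by (induction k) auto
  then show "x = y" by (simp add: l m)
qed

lemma hat_star_algebra: "star_algebra sc_op star_op (hat ` carrier B)"
proof (rule star_algebra_starop)
  show "1 \<in> hat ` carrier B" using hat_one by force
  fix x y assume "x \<in> hat ` carrier B" "y \<in> hat ` carrier B"
  then obtain u v where u: "u \<in> carrier B" "v \<in> carrier B" "x = hat u" "y = hat v" by auto
  show "x + y \<in> hat ` carrier B" using hat(1)[OF u(1,2)] u by (metis B.a_closed imageI)
  show "x * y \<in> hat ` carrier B" using hat(2)[OF u(1,2)] u by (metis B.m_closed imageI)
  show "star_op x \<in> hat ` carrier B" using hat_star[OF u(1)] u by (metis bm_closed imageI)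
  show "sc_op c x \<in> hat ` carrier B" for c
    using hat_smult[OF u(1), of c] u by (metis B.m_closed B_smult pt_closed A.one_closed imageI)
qed

end

section \<open>Consequences of symplectic type over a splitting field\<close>

lemma (in vector_space) dependent_family:
  assumes T: "finite T" "f ` J \<subseteq> span T" and J: "finite J" "card T < card J"
  obtains c where "(\<Sum>j\<in>J. scale (c j) (f j)) = 0" "\<exists>j\<in>J. c j \<noteq> 0"
proof -
  have "\<exists>c. (\<Sum>j\<in>J. scale (c j) (f j)) = 0 \<and> (\<exists>j\<in>J. c j \<noteq> 0)"
  proof (rule ccontr)
    assume n: "\<not> ?thesis"
    have ind: "c j = 0" if "(\<Sum>j\<in>J. scale (c j) (f j)) = 0" "j \<in> J" for c j using n that by blast
    have fam: "inj_on f J" "independent (f ` J)" using independent_family[OF J(1), of f] ind by blast+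
    have "card (f ` J) \<le> card T" using independent_span_bound[OF T(1) fam(2) T(2)] by blast
    then show False using J card_image[OF fam(1)] by simp
  qed
  then show thesis using that by blast
qed

text \<open>
  A homogeneous linear system with more unknowns than equations.
\<close>

lemma nontrivial_solution:
  fixes l :: "nat \<Rightarrow> nat \<Rightarrow> 'm::field"
  assumes "k < m"
  obtains c where "\<And>q. q < k \<Longrightarrow> (\<Sum>p<m. c p * l p q) = 0" "\<exists>p<m. c p \<noteq> 0"
proof -
  interpret P: vector_space "smult :: 'm \<Rightarrow> 'm poly \<Rightarrow> 'm poly"
    by unfold_locales (simp_all add: smult_add_right smult_add_left)
  define f where "f p = (\<Sum>q<k. smult (l p q) (monom 1 q))" for p
  have sub: "f ` {..<m} \<subseteq> P.span (monom 1 ` {..<k})"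
    unfolding f_def
    by (rule image_subsetI, rule P.span_sum, rule P.span_scale, rule P.span_base) simp
  have "card (monom (1::'m) ` {..<k}) \<le> k" using card_image_le[of "{..<k}" "monom (1::'m)"] by simp
  then have "card (monom (1::'m) ` {..<k}) < card {..<m}" using assms by simp
  from P.dependent_family[OF _ sub _ this]
  obtain c where c: "(\<Sum>p<m. smult (c p) (f p)) = 0" "\<exists>j\<in>{..<m}. c j \<noteq> 0" by auto
  have "(\<Sum>p<m. c p * l p q) = 0" if "q < k" for q
  proof -
    have "coeff (f p) q = l p q" for p
    proof -
      have "coeff (f p) q = (\<Sum>q'<k. if q' = q then l p q else 0)"
        unfolding f_def coeff_sum by (intro sum.cong refl) auto
      then show ?thesis using that by simp
    qed
    then show ?thesis using arg_cong[OF c(1), of "\<lambda>p. coeff p q"] by (simp add: coeff_sum)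
  qed
  then show thesis using that c by auto
qed

lemma field_algebra_simps [simp]: "carrier field_algebra = UNIV" "x \<otimes>\<^bsub>field_algebra\<^esub> y = x * y"
  "x \<oplus>\<^bsub>field_algebra\<^esub> y = x + y" "\<zero>\<^bsub>field_algebra\<^esub> = 0" "\<one>\<^bsub>field_algebra\<^esub> = 1" "c \<odot>\<^bsub>field_algebra\<^esub> x = c * x"
  by (auto simp: field_algebra_def)

lemma field_algebra_monoid: "abelian_monoid (field_algebra :: ('l::field, 'l) module)"
  by (rule abelian_monoidI) (auto simp: algebra_simps)

lemma finsum_field_algebra:
  fixes f :: "'b \<Rightarrow> 'l::field"
  assumes "finite T" shows "finsum field_algebra f T = sum f T"
proof -
  interpret abelian_monoid "field_algebra :: ('l, 'l) module" by (rule field_algebra_monoid)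
  show ?thesis using assms by (induction T rule: finite_induct) auto
qed

lemma matrix_algebra_simps:
  "carrier (matrix_algebra n D) = ({..<n} \<times> {..<n}) \<rightarrow>\<^sub>E carrier D"
  "i < n \<Longrightarrow> j < n \<Longrightarrow> (M \<otimes>\<^bsub>matrix_algebra n D\<^esub> N) (i, j) = (\<Oplus>\<^bsub>D\<^esub>k\<in>{..<n}. M (i, k) \<otimes>\<^bsub>D\<^esub> N (k, j))"
  "i < n \<Longrightarrow> j < n \<Longrightarrow> \<one>\<^bsub>matrix_algebra n D\<^esub> (i, j) = (if i = j then \<one>\<^bsub>D\<^esub> else \<zero>\<^bsub>D\<^esub>)"
  "i < n \<Longrightarrow> j < n \<Longrightarrow> \<zero>\<^bsub>matrix_algebra n D\<^esub> (i, j) = \<zero>\<^bsub>D\<^esub>"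
  "i < n \<Longrightarrow> j < n \<Longrightarrow> (M \<oplus>\<^bsub>matrix_algebra n D\<^esub> N) (i, j) = M (i, j) \<oplus>\<^bsub>D\<^esub> N (i, j)"
  "i < n \<Longrightarrow> j < n \<Longrightarrow> (c \<odot>\<^bsub>matrix_algebra n D\<^esub> M) (i, j) = c \<odot>\<^bsub>D\<^esub> M (i, j)"
  by (auto simp: matrix_algebra_def Let_def)

text \<open>
  Dimension at most 2.
\<close>

definition dep3 :: "(nat \<Rightarrow> 'm::field) set \<Rightarrow> bool" where
  "dep3 W \<longleftrightarrow> (\<forall>x\<in>W. \<forall>y\<in>W. \<forall>z\<in>W. \<exists>\<alpha> \<beta> \<gamma>. (\<alpha>, \<beta>, \<gamma>) \<noteq> (0, 0, 0) \<and> (\<forall>i. \<alpha> * x i + \<beta> * y i + \<gamma> * z i = 0))"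

text \<open>
  An alternating form on a plane satisfies the three-term relation, since an alternating trilinear expression
  vanishes there.
\<close>

lemma plucker:
  assumes d: "dep3 W" and W: "x \<in> W" "y \<in> W" "z \<in> W"
    and add: "\<And>x y z r s. B (\<lambda>i. r * x i + s * y i) z = r * B x z + s * B y z"
             "\<And>x y z r s. B z (\<lambda>i. r * x i + s * y i) = r * B z x + s * B z y"
    and alt: "\<And>x. x \<in> W \<Longrightarrow> B x x = 0" and skew: "\<And>x y. x \<in> W \<Longrightarrow> y \<in> W \<Longrightarrow> B x y = - B y x"
  shows "B x y * z i + B y z * x i + B z x * y i = (0::'m::field)"
proof -
  have *: "B x y * z i + B y z * x i + B z x * y i = 0"
    if W: "x \<in> W" "y \<in> W" "z \<in> W" and r: "\<And>i. \<alpha> * x i + \<beta> * y i + \<gamma> * z i = 0" and g: "\<gamma> \<noteq> 0" for x y z \<alpha> \<beta> \<gamma>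
  proof -
    have z: "z = (\<lambda>i. (- \<alpha> / \<gamma>) * x i + (- \<beta> / \<gamma>) * y i)"
    proof
      fix i
      have "\<gamma> * z i = - \<alpha> * x i - \<beta> * y i" using r[of i] by (simp add: eq_neg_iff_add_eq_0 algebra_simps)
      then have "z i = (- \<alpha> * x i - \<beta> * y i) / \<gamma>" using g by (simp add: nonzero_eq_divide_eq mult.commute)
      then show "z i = (- \<alpha> / \<gamma>) * x i + (- \<beta> / \<gamma>) * y i" by (simp add: diff_divide_distrib)
    qed
    define p q where "p = - \<alpha> / \<gamma>" and "q = - \<beta> / \<gamma>"
    note z = z[folded p_def q_def]
    have "B y z = p * B y x" using W by (subst z, subst add) (simp add: alt)
    moreover have "B z x = q * B y x" using W by (subst z, subst add) (simp add: alt)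
    moreover have "z i = p * x i + q * y i" by (subst z) simp
    ultimately show ?thesis using skew[OF W(1,2)] by (simp add: algebra_simps)
  qed
  obtain \<alpha> \<beta> \<gamma> where r: "(\<alpha>, \<beta>, \<gamma>) \<noteq> (0, 0, 0)" "\<And>i. \<alpha> * x i + \<beta> * y i + \<gamma> * z i = 0"
    using d W unfolding dep3_def by meson
  then consider "\<gamma> \<noteq> 0" | "\<alpha> \<noteq> 0" | "\<beta> \<noteq> 0" by auto
  then show ?thesis
  proof cases
    case 1 then show ?thesis using *[OF W r(2)] by simp
  next
    case 2
    have "\<beta> * y i + \<gamma> * z i + \<alpha> * x i = 0" for i using r(2)[of i] by (simp add: algebra_simps)
    then show ?thesis using *[OF W(2,3,1), of \<beta> \<gamma> \<alpha>] 2 by (simp add: algebra_simps)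
  next
    case 3
    have "\<gamma> * z i + \<alpha> * x i + \<beta> * y i = 0" for i using r(2)[of i] by (simp add: algebra_simps)
    then show ?thesis using *[OF W(3,1,2), of \<gamma> \<alpha> \<beta>] 3 by (simp add: algebra_simps)
  qed
qed

text \<open>
  Three independent vectors of \<open>W\<close> would produce five independent operators \<open>v \<mapsto> v\<^sub>j w\<close> on \<open>W\<close>, while the space of
  these operators has dimension at most 4.
\<close>

lemma dep3_of_rank_one:
  fixes W :: "(nat \<Rightarrow> 'm::field) set"
  assumes sub: "\<And>x y r s. x \<in> W \<Longrightarrow> y \<in> W \<Longrightarrow> (\<lambda>i. r * x i + s * y i) \<in> W"
    and vanish: "\<And>x i. x \<in> W \<Longrightarrow> n \<le> i \<Longrightarrow> x i = 0"
    and span: "\<And>w j. w \<in> W \<Longrightarrow> j < n \<Longrightarrow> \<exists>l. \<forall>v\<in>W. \<forall>i. v j * w i = (\<Sum>k<(4::nat). l k * Q k v i)"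
  shows "dep3 W"
  unfolding dep3_def
proof (intro ballI, rule ccontr)
  fix x y z assume W: "x \<in> W" "y \<in> W" "z \<in> W"
    and n: "\<not> (\<exists>\<alpha> \<beta> \<gamma>. (\<alpha>, \<beta>, \<gamma>) \<noteq> (0, 0, 0) \<and> (\<forall>i. \<alpha> * x i + \<beta> * y i + \<gamma> * z i = 0))"
  have ind: "\<exists>i<n. \<alpha> * x i + \<beta> * y i + \<gamma> * z i \<noteq> 0" if "(\<alpha>, \<beta>, \<gamma>) \<noteq> (0, 0, 0)" for \<alpha> \<beta> \<gamma>
  proof (rule ccontr)
    assume "\<not> ?thesis"
    then have "\<alpha> * x i + \<beta> * y i + \<gamma> * z i = 0" for i
      using vanish[OF W(1), of i] vanish[OF W(2), of i] vanish[OF W(3), of i] by (cases "i < n") auto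
    then show False using n that by blast
  qed
  obtain i1 where i1: "i1 < n" "x i1 \<noteq> 0" using ind[of 1 0 0] by auto
  define y' where "y' = (\<lambda>i. 1 * y i + (- (y i1 / x i1)) * x i)"
  have y'W: "y' \<in> W" unfolding y'_def by (rule sub[OF W(2,1)])
  have y'1: "y' i1 = 0" using i1 by (simp add: y'_def)
  obtain i2 where i2: "i2 < n" "y' i2 \<noteq> 0" using ind[of "- (y i1 / x i1)" 1 0] by (auto simp: y'_def add.commute)
  define a where "a = - (z i1 / x i1)"
  define u where "u = (\<lambda>i. 1 * z i + a * x i)"
  define b where "b = - (u i2 / y' i2)"
  define z' where "z' = (\<lambda>i. 1 * u i + b * y' i)"
  have z'W: "z' \<in> W" unfolding z'_def u_def by (intro sub W y'W)
  have z'12: "z' i1 = 0" "z' i2 = 0" using i1 i2 y'1 by (simp_all add: z'_def u_def a_def b_def)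
  obtain i3 where i3: "i3 < n" "z' i3 \<noteq> 0"
    using ind[of "a - b * (y i1 / x i1)" b 1] by (auto simp: z'_def u_def y'_def algebra_simps)
  have tri: "\<alpha> = 0 \<and> \<beta> = 0 \<and> \<gamma> = 0" if "\<And>i. \<alpha> * x i + \<beta> * y' i + \<gamma> * z' i = 0" for \<alpha> \<beta> \<gamma>
  proof -
    have "\<alpha> = 0" using that[of i1] i1 y'1 z'12 by simp
    moreover from this have "\<beta> = 0" using that[of i2] i2 z'12 by simp
    ultimately show ?thesis using that[of i3] i3 by simp
  qed
  obtain l0 where l0: "\<And>v i. v \<in> W \<Longrightarrow> v i1 * x i = (\<Sum>k<4. l0 k * Q k v i)" using span[OF W(1) i1(1)] by blast
  obtain l1 where l1: "\<And>v i. v \<in> W \<Longrightarrow> v i1 * y' i = (\<Sum>k<4. l1 k * Q k v i)" using span[OF y'W i1(1)] by blast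
  obtain l2 where l2: "\<And>v i. v \<in> W \<Longrightarrow> v i1 * z' i = (\<Sum>k<4. l2 k * Q k v i)" using span[OF z'W i1(1)] by blast
  obtain l3 where l3: "\<And>v i. v \<in> W \<Longrightarrow> v i2 * x i = (\<Sum>k<4. l3 k * Q k v i)" using span[OF W(1) i2(1)] by blast
  obtain l4 where l4: "\<And>v i. v \<in> W \<Longrightarrow> v i2 * y' i = (\<Sum>k<4. l4 k * Q k v i)" using span[OF y'W i2(1)] by blast
  define l where "l p = (if p = 0 then l0 else if p = 1 then l1 else if p = 2 then l2 else if p = 3 then l3 else l4)" for p :: nat
  obtain c where c: "\<And>q. q < 4 \<Longrightarrow> (\<Sum>p<5. c p * l p q) = 0" "\<exists>p<5. c p \<noteq> 0"
    using nontrivial_solution[of 4 5 l] by auto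
  have S5: "(\<Sum>p<5. f p) = f 0 + f 1 + f 2 + f 3 + f 4" for f :: "nat \<Rightarrow> 'm"
    by (simp add: numeral_eq_Suc add_ac)
  have rel: "c 0 * (v i1 * x i) + c 1 * (v i1 * y' i) + c 2 * (v i1 * z' i) + c 3 * (v i2 * x i) + c 4 * (v i2 * y' i) = 0"
    if v: "v \<in> W" for v i
  proof -
    have "0 = (\<Sum>k<4. (\<Sum>p<5. c p * l p k) * Q k v i)" using c(1) by simp
    also have "\<dots> = (\<Sum>p<5. c p * (\<Sum>k<4. l p k * Q k v i))"
      by (simp only: sum_distrib_left sum_distrib_right mult.assoc) (rule sum.swap)
    also have "\<dots> = c 0 * (v i1 * x i) + c 1 * (v i1 * y' i) + c 2 * (v i1 * z' i) + c 3 * (v i2 * x i) + c 4 * (v i2 * y' i)"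
      unfolding S5 l0[OF v] l1[OF v] l2[OF v] l3[OF v] l4[OF v] by (simp add: l_def)
    finally show ?thesis by simp
  qed
  have "(c 3 * y' i2) * x i + (c 4 * y' i2) * y' i + 0 * z' i = 0" for i
    using rel[OF y'W, of i] y'1 by (simp add: algebra_simps)
  from tri[OF this] have c34: "c 3 = 0" "c 4 = 0" using i2 by auto
  have "(c 0 * x i1) * x i + (c 1 * x i1) * y' i + (c 2 * x i1) * z' i = 0" for i
    using rel[OF W(1), of i] c34 by (simp add: algebra_simps)
  from tri[OF this] have "c 0 = 0" "c 1 = 0" "c 2 = 0" using i1 by auto
  then show False using c(2) c34 by (auto simp: numeral_eq_Suc less_Suc_eq)
qed

context based_extension begin

lemma iota_inj: "\<iota> x = \<iota> y \<Longrightarrow> x = y"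
proof (rule ccontr)
  assume xy: "\<iota> x = \<iota> y" "x \<noteq> y"
  have "\<iota> (x - y) = 0" using iota(1)[of "x - y" y] xy by simp
  then have "\<iota> ((x - y) * inverse (x - y)) = 0" by (simp only: iota(2)) simp
  then show False using xy by simp
qed

lemma rho_inj: "inj_on rho (carrier A)"
proof (rule inj_onI)
  fix x y assume xy: "x \<in> carrier A" "y \<in> carrier A" "rho x = rho y"
  have "act x = act y" using rho_rep(1)[of x] rho_rep(1)[of y] xy by simp
  then have "coord x i = coord y i" if "i < n" for i using act_unit that xy iota_inj by metis
  then have "lincomb A (coord x) b n = lincomb A (coord y) b n" by (intro lincomb_cong) auto
  then show "x = y" using xy by (simp add: coord)
qed

text \<open>
  Over the splitting field let \<open>W\<close> be the image of \<open>f\<close>. Its operators are spanned by four, so it is at most a plane. For symmetric \<open>s\<close> the form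
  \<open>\<beta>(x, y) = b(x, sy)\<close> on \<open>W\<close> is alternating, because \<open>b\<close> is and 2 is invertible. For symmetric \<open>t\<close> the form
  \<open>\<beta>(x, tsy)\<close> is alternating as well, so on a plane it is a multiple of \<open>\<beta>\<close> if \<open>s \<noteq> 0\<close>, and \<open>ts\<close> acts as a scalar.
\<close>

lemma splitting_symm:
  fixes m :: nat and \<phi> and G :: "nat \<times> nat \<Rightarrow> 'c"
  assumes \<phi>: "\<phi> \<in> alg_iso B (matrix_algebra m field_algebra)"
    and alt: "\<And>x. gram_form m G x x = 0"
    and nondeg: "\<And>x. (\<And>y. gram_form m G x y = 0) \<Longrightarrow> (\<forall>i<m. x i = 0)"
    and adj: "\<And>a x y. a \<in> carrier B \<Longrightarrow> gram_form m G (mat_vec m (\<phi> a) x) y = gram_form m G x (mat_vec m (\<phi> (bm a)) y)"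
    and two: "(2::'c) \<noteq> 0"
    and f: "f \<in> carrier A" "f \<otimes>\<^bsub>A\<^esub> f = f"
    and q: "\<And>k. k < 4 \<Longrightarrow> q k \<in> carrier A" "\<And>x. x \<in> carrier A \<Longrightarrow> \<exists>c. f \<otimes>\<^bsub>A\<^esub> x \<otimes>\<^bsub>A\<^esub> f = lincomb A c q 4"
    and s: "s \<in> carrier A" "\<sigma> s = s" "\<sigma> f \<otimes>\<^bsub>A\<^esub> s \<otimes>\<^bsub>A\<^esub> f = s"
    and t: "t \<in> carrier A" "\<sigma> t = t" "f \<otimes>\<^bsub>A\<^esub> t \<otimes>\<^bsub>A\<^esub> \<sigma> f = t"
  shows "x \<in> carrier A \<Longrightarrow> t \<otimes>\<^bsub>A\<^esub> s \<otimes>\<^bsub>A\<^esub> (f \<otimes>\<^bsub>A\<^esub> x \<otimes>\<^bsub>A\<^esub> f) = f \<otimes>\<^bsub>A\<^esub> x \<otimes>\<^bsub>A\<^esub> f \<otimes>\<^bsub>A\<^esub> (t \<otimes>\<^bsub>A\<^esub> s)"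
    and "s \<noteq> \<zero>\<^bsub>A\<^esub> \<Longrightarrow> t \<noteq> \<zero>\<^bsub>A\<^esub> \<Longrightarrow> t \<otimes>\<^bsub>A\<^esub> s \<noteq> \<zero>\<^bsub>A\<^esub>"
proof -
  let ?M = "matrix_algebra m (field_algebra :: ('c, 'c) module)"
  have hom: "\<phi> \<in> ring_hom B ?M" and bij: "bij_betw \<phi> (carrier B) (carrier ?M)"
    and smul: "\<And>c x. x \<in> carrier B \<Longrightarrow> \<phi> (c \<odot>\<^bsub>B\<^esub> x) = c \<odot>\<^bsub>?M\<^esub> \<phi> x"
    using \<phi> by (auto simp: alg_iso_def ring_iso_def)
  define op where "op a x = (\<lambda>i. if i < m then mat_vec m (\<phi> a) x i else 0)" for a x
  define bil where "bil = gram_form m G"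
  have opE: "op a x i = (if i < m then \<Sum>j<m. \<phi> a (i, j) * x j else 0)" for a x i by (simp add: op_def mat_vec_def)
  have op_mult: "op (a \<otimes>\<^bsub>B\<^esub> b) x = op a (op b x)" if "a \<in> carrier B" "b \<in> carrier B" for a b x
  proof
    fix i
    show "op (a \<otimes>\<^bsub>B\<^esub> b) x i = op a (op b x) i"
    proof (cases "i < m")
      case True
      have "op (a \<otimes>\<^bsub>B\<^esub> b) x i = (\<Sum>j<m. (\<Sum>k<m. \<phi> a (i, k) * \<phi> b (k, j)) * x j)"
        using True that ring_hom_mult[OF hom] by (simp add: opE matrix_algebra_simps finsum_field_algebra)
      also have "\<dots> = (\<Sum>k<m. \<phi> a (i, k) * (\<Sum>j<m. \<phi> b (k, j) * x j))"
        by (simp only: sum_distrib_left sum_distrib_right mult.assoc) (rule sum.swap)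
      finally show ?thesis using True by (simp add: opE)
    qed (simp add: opE)
  qed
  have op_add: "op (a \<oplus>\<^bsub>B\<^esub> b) x i = op a x i + op b x i" if "a \<in> carrier B" "b \<in> carrier B" for a b x i
    using that ring_hom_add[OF hom that] by (simp add: opE matrix_algebra_simps distrib_right sum.distrib)
  have op_smult: "op (c \<odot>\<^bsub>B\<^esub> a) x i = c * op a x i" if "a \<in> carrier B" for a x i c
    using smul[OF that] by (simp add: opE matrix_algebra_simps sum_distrib_left mult.assoc)
  have op_lin: "op a (\<lambda>i. r * x i + s * y i) = (\<lambda>i. r * op a x i + s * op a y i)" for a x y r s
    by (rule HOL.ext) (simp add: opE algebra_simps sum.distrib sum_distrib_left)
  have bil_lin: "bil (\<lambda>i. r * x i + s * y i) z = r * bil x z + s * bil y z"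
     "bil z (\<lambda>i. r * x i + s * y i) = r * bil z x + s * bil z y" for x y z r s
    by (simp_all add: bil_def gram_form_def algebra_simps sum.distrib sum_distrib_left)
  have bil_skew: "bil x y = - bil y x" for x y
  proof -
    have "bil (\<lambda>i. 1 * x i + 1 * y i) (\<lambda>i. 1 * x i + 1 * y i) = 0" unfolding bil_def by (rule alt)
    then have "bil x x + bil x y + (bil y x + bil y y) = 0" unfolding bil_lin by (simp add: algebra_simps)
    then show ?thesis using alt by (simp add: bil_def eq_neg_iff_add_eq_0)
  qed
  have bil_low: "bil x y = bil x' y'" if "\<And>i. i < m \<Longrightarrow> x i = x' i" "\<And>i. i < m \<Longrightarrow> y i = y' i" for x y x' y'
    unfolding bil_def gram_form_def using that by (intro sum.cong refl) auto
  have adj': "bil (op a x) y = bil x (op (bm a) y)" if "a \<in> carrier B" for a x y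
  proof -
    have "bil (op a x) y = bil (mat_vec m (\<phi> a) x) y" by (rule bil_low) (auto simp: op_def)
    also have "\<dots> = bil x (mat_vec m (\<phi> (bm a)) y)" using adj[OF that] by (simp add: bil_def)
    also have "\<dots> = bil x (op (bm a) y)" by (rule bil_low) (auto simp: op_def)
    finally show ?thesis .
  qed
  have nd: "x = (\<lambda>i. 0)" if "\<And>i. m \<le> i \<Longrightarrow> x i = 0" "\<And>y. bil x y = 0" for x
  proof
    fix i show "x i = 0" using nondeg[of x] that unfolding bil_def by (cases "i < m") auto
  qed
  define P where "P a = op (pt a 1)" for a
  have P_mult: "P (a \<otimes>\<^bsub>A\<^esub> b) x = P a (P b x)" if "a \<in> carrier A" "b \<in> carrier A" for a b x
    using op_mult[of "pt a 1" "pt b 1"] that by (simp add: P_def pt_mult)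
  have P_lin: "P a (\<lambda>i. r * x i + s * y i) = (\<lambda>i. r * P a x i + s * P a y i)" for a x y r s
    by (simp add: P_def op_lin)
  have P_adj: "bil (P a x) y = bil x (P (\<sigma> a) y)" if "a \<in> carrier A" for a x y
    using adj'[of "pt a 1"] that by (simp add: P_def)
  have P_low: "P a x i = 0" if "m \<le> i" for a x i using that by (simp add: P_def opE)
  have faithful: "a = b" if "a \<in> carrier A" "b \<in> carrier A" "\<And>x. P a x = P b x" for a b
  proof -
    have e: "\<phi> (pt a 1) (i, k) = \<phi> (pt b 1) (i, k)" if ik: "i < m" "k < m" for i k
    proof -
      have "P c (\<lambda>j. if j = k then 1 else 0) i = \<phi> (pt c 1) (i, k)" for c
      proof -
        have "P c (\<lambda>j. if j = k then 1 else 0) i = (\<Sum>j<m. \<phi> (pt c 1) (i, j) * (if j = k then 1 else 0))"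
          using ik by (simp add: P_def opE)
        also have "\<dots> = (\<Sum>j<m. if j = k then \<phi> (pt c 1) (i, k) else 0)"
          by (intro sum.cong refl) auto
        finally show ?thesis using ik by simp
      qed
      then show ?thesis using \<open>\<And>x. P a x = P b x\<close> by metis
    qed
    have c: "\<phi> (pt a 1) \<in> carrier ?M" "\<phi> (pt b 1) \<in> carrier ?M"
      using that bij by (auto dest: bij_betwE)
    have "\<phi> (pt a 1) = \<phi> (pt b 1)"
      by (rule PiE_ext[OF c[unfolded matrix_algebra_simps]]) (use e in auto)
    then have "pt a 1 = pt b 1" using bij that by (auto simp: bij_betw_def inj_on_def)
    then have "rho a = rho b" using hat(3)[of a 1] hat(3)[of b 1] that by simp
    then show "a = b" using rho_inj that by (auto simp: inj_on_def)
  qed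
  have P_add: "P (a \<oplus>\<^bsub>A\<^esub> b) x i = P a x i + P b x i" if "a \<in> carrier A" "b \<in> carrier A" for a b x i
    using op_add[of "pt a 1" "pt b 1"] that by (simp add: P_def pt_add_left)
  have op_pt: "op (pt a r) x i = r * P a x i" if "a \<in> carrier A" for a r x i
    using op_smult[of "pt a 1" r x i] that smult_pt[of a r 1] by (simp add: P_def)
  have P_smult: "P (c \<odot>\<^bsub>A\<^esub> a) x i = \<iota> c * P a x i" if "a \<in> carrier A" for a c x i
    using op_pt[OF that, of "\<iota> c"] pt_balanced[OF that, of c 1] by (simp add: P_def)
  have P_zero: "P \<zero>\<^bsub>A\<^esub> x i = 0" for x i using P_smult[of "\<zero>\<^bsub>A\<^esub>" 0] by simp
  have op_zero: "op \<zero>\<^bsub>B\<^esub> x i = 0" for x i by (metis B.r_zero B.zero_closed add.right_neutral add_left_cancel op_add)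
  have sf: "\<sigma> f \<in> carrier A" using f by simp
  have spanB: "\<exists>l. \<forall>v i. op (pt f 1 \<otimes>\<^bsub>B\<^esub> x \<otimes>\<^bsub>B\<^esub> pt f 1) v i = (\<Sum>k<4. l k * P (q k) v i)" if "x \<in> carrier B" for x
    using that
  proof (induction rule: B_induct)
    case zero
    show ?case by (rule exI[of _ "\<lambda>_. 0"]) (use f in \<open>simp add: op_zero\<close>)
  next
    case (pt a r)
    obtain c where c: "f \<otimes>\<^bsub>A\<^esub> a \<otimes>\<^bsub>A\<^esub> f = lincomb A c q 4" using q(2) pt by blast
    have "P (lincomb A c q 4) v i = (\<Sum>k<4. \<iota> (c k) * P (q k) v i)" for v i
    proof -
      have "P (lincomb A c q 4) v i = (\<Sum>k<4. P (c k \<odot>\<^bsub>A\<^esub> q k) v i)"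
        by (rule lincomb_hom[of "\<lambda>a. P a v i"]) (use q(1) P_zero P_add in auto)
      then show ?thesis using q(1) by (simp add: P_smult)
    qed
    then have "op (pt (lincomb A c q 4) r) v i = (\<Sum>k<4. (r * \<iota> (c k)) * P (q k) v i)" for v i
      using q(1) by (simp add: op_pt sum_distrib_left mult.assoc)
    moreover have "pt f 1 \<otimes>\<^bsub>B\<^esub> pt a r \<otimes>\<^bsub>B\<^esub> pt f 1 = pt (lincomb A c q 4) r"
      using f pt by (simp add: pt_mult flip: c)
    ultimately show ?case by (intro exI[of _ "\<lambda>k. r * \<iota> (c k)"]) simp
  next
    case (add x y)
    obtain l l' where l: "\<And>v i. op (pt f 1 \<otimes>\<^bsub>B\<^esub> x \<otimes>\<^bsub>B\<^esub> pt f 1) v i = (\<Sum>k<4. l k * P (q k) v i)"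
      and l': "\<And>v i. op (pt f 1 \<otimes>\<^bsub>B\<^esub> y \<otimes>\<^bsub>B\<^esub> pt f 1) v i = (\<Sum>k<4. l' k * P (q k) v i)" using add by blast
    have "op (pt f 1 \<otimes>\<^bsub>B\<^esub> (x \<oplus>\<^bsub>B\<^esub> y) \<otimes>\<^bsub>B\<^esub> pt f 1) v i = (\<Sum>k<4. (l k + l' k) * P (q k) v i)" for v i
      using add f by (simp add: B.l_distr B.r_distr op_add l l' distrib_right sum.distrib)
    then show ?case by (intro exI[of _ "\<lambda>k. l k + l' k"] allI)
  qed
  define W where "W = {x. P f x = x}"
  have W_low: "x i = 0" if "x \<in> W" "m \<le> i" for x i using that P_low[of i f x] by (simp add: W_def)
  have WI: "P f x \<in> W" for x using P_mult[of f f x] f by (simp add: W_def)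
  have W_sub: "(\<lambda>i. r * x i + s * y i) \<in> W" if "x \<in> W" "y \<in> W" for x y r s
    using that by (simp add: W_def P_lin)
  have d3: "dep3 W"
  proof (rule dep3_of_rank_one[where n = m and Q = "\<lambda>k. P (q k)"])
    show "(\<lambda>i. r * x i + s * y i) \<in> W" if "x \<in> W" "y \<in> W" for x y r s using W_sub that .
    show "x i = 0" if "x \<in> W" "m \<le> i" for x i using W_low that .
    fix w j assume w: "w \<in> W" and j: "j < m"
    \<comment> \<open>the matrix of \<open>v \<mapsto> v\<^sub>j w\<close>, which is realized by an element of the algebra\<close>
    define X' where "X' = (\<lambda>(i, j')\<in>{..<m} \<times> {..<m}. if j' = j then w i else 0)"
    have "X' \<in> carrier ?M" by (auto simp: X'_def matrix_algebra_simps)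
    then have "X' \<in> \<phi> ` carrier B" using bij by (simp add: bij_betw_def)
    then obtain x0 where x0: "x0 \<in> carrier B" "\<phi> x0 = X'" by blast
    have o0: "op x0 v = (\<lambda>i. v j * w i)" for v
    proof
      fix i
      show "op x0 v i = v j * w i"
      proof (cases "i < m")
        case True
        have "op x0 v i = (\<Sum>j'<m. (if j' = j then w i else 0) * v j')"
          using True by (simp add: opE x0 X'_def)
        also have "\<dots> = (\<Sum>j'<m. if j' = j then v j * w i else 0)"
          by (intro sum.cong refl) auto
        finally show ?thesis using j by simp
      qed (use W_low[OF w] in \<open>simp add: opE\<close>)
    qed
    obtain l where l: "\<And>v i. op (pt f 1 \<otimes>\<^bsub>B\<^esub> x0 \<otimes>\<^bsub>B\<^esub> pt f 1) v i = (\<Sum>k<4. l k * P (q k) v i)"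
      using spanB[OF x0(1)] by blast
    have "v j * w i = (\<Sum>k<4. l k * P (q k) v i)" if v: "v \<in> W" for v i
    proof -
      have "op (pt f 1 \<otimes>\<^bsub>B\<^esub> x0 \<otimes>\<^bsub>B\<^esub> pt f 1) v = P f (op x0 (P f v))"
        using x0 f by (simp add: op_mult P_def)
      also have "\<dots> = P f (\<lambda>i. v j * w i + 0 * w i)" using v by (simp add: W_def o0)
      also have "\<dots> = (\<lambda>i. v j * w i)" using w unfolding P_lin by (simp add: W_def)
      finally show ?thesis using l[of v i] by simp
    qed
    then show "\<exists>l. \<forall>v\<in>W. \<forall>i. v j * w i = (\<Sum>k<(4::nat). l k * P (q k) v i)" by blast
  qed
  have symm_alt: "bil x (P a x) = 0" if "a \<in> carrier A" "\<sigma> a = a" for a x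
  proof -
    have "bil x (P a x) = - bil x (P a x)" using P_adj[OF that(1), of x x] bil_skew[of "P a x" x] that by simp
    then have "bil x (P a x) - (- bil x (P a x)) = 0" by (simp only: right_minus_eq)
    then have "2 * bil x (P a x) = 0" by (simp only: diff_minus_eq_add mult_2)
    then show ?thesis using two by simp
  qed
  define \<beta> where "\<beta> x y = bil x (P s y)" for x y
  have \<beta>_skew: "\<beta> x y = - \<beta> y x" for x y
    using P_adj[OF s(1), of x y] bil_skew[of "P s x" y] s(2) by (simp add: \<beta>_def)
  have \<beta>_alt: "\<beta> x x = 0" for x using symm_alt s by (simp add: \<beta>_def)
  have \<beta>_lin: "\<beta> (\<lambda>i. r * x i + u * y i) z = r * \<beta> x z + u * \<beta> y z"
     "\<beta> z (\<lambda>i. r * x i + u * y i) = r * \<beta> z x + u * \<beta> z y" for x y z r u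
    by (simp_all add: \<beta>_def P_lin bil_lin)
  have pl: "\<beta> x y * z i + \<beta> y z * x i + \<beta> z x * y i = 0" if "x \<in> W" "y \<in> W" "z \<in> W" for x y z i
    by (rule plucker[OF d3 that \<beta>_lin \<beta>_alt \<beta>_skew])
  have ft: "f \<otimes>\<^bsub>A\<^esub> t = t"
  proof -
    have "(f \<otimes>\<^bsub>A\<^esub> f) \<otimes>\<^bsub>A\<^esub> t \<otimes>\<^bsub>A\<^esub> \<sigma> f = f \<otimes>\<^bsub>A\<^esub> (f \<otimes>\<^bsub>A\<^esub> t \<otimes>\<^bsub>A\<^esub> \<sigma> f)"
      using f(1) t(1) sf by (simp only: A.m_assoc A.m_closed)
    then show ?thesis by (simp only: f(2) t(3))
  qed
  have sff: "s \<otimes>\<^bsub>A\<^esub> f = s"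
  proof -
    have "\<sigma> f \<otimes>\<^bsub>A\<^esub> s \<otimes>\<^bsub>A\<^esub> (f \<otimes>\<^bsub>A\<^esub> f) = (\<sigma> f \<otimes>\<^bsub>A\<^esub> s \<otimes>\<^bsub>A\<^esub> f) \<otimes>\<^bsub>A\<^esub> f"
      using f(1) s(1) sf by (simp only: A.m_assoc A.m_closed)
    then show ?thesis by (simp only: f(2) s(3))
  qed
  have sfs: "\<sigma> f \<otimes>\<^bsub>A\<^esub> s = s" using arg_cong[OF sff, of \<sigma>] s f by simp
  have tW: "P t x \<in> W" for x using P_mult[of f t x] f t ft by (simp add: W_def)
  define TS where "TS v = P t (P s v)" for v
  have TSW: "TS v \<in> W" for v by (simp add: TS_def tW)
  have TS_f: "TS (P f z) = TS z" for z using P_mult[OF s(1) f(1), of z] sff by (simp add: TS_def)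
  have TS_lin: "TS (\<lambda>i. r * x i + u * y i) = (\<lambda>i. r * TS x i + u * TS y i)" for r u x y
    by (simp add: TS_def P_lin)
  have \<beta>_TS: "\<beta> (TS x) y = \<beta> x (TS y)" for x y
    using P_adj[OF t(1), of "P s x" "P s y"] P_adj[OF s(1), of x "P t (P s y)"] t s by (simp add: \<beta>_def TS_def)
  have \<beta>_TS0: "\<beta> x (TS x) = 0" for x
    using P_adj[OF s(1), of x "P t (P s x)"] symm_alt[OF t(1,2), of "P s x"] s by (simp add: \<beta>_def TS_def)
  have nonzero: "\<exists>x\<in>W. \<exists>y\<in>W. \<beta> x y \<noteq> 0" if "s \<noteq> \<zero>\<^bsub>A\<^esub>"
  proof (rule ccontr)
    assume z: "\<not> ?thesis"
    have "P s y = (\<lambda>i. 0)" for y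
    proof (rule nd)
      fix x
      have "bil x (P s y) = bil x (P (\<sigma> f) (P s (P f y)))"
        using P_mult[OF sf s(1)] P_mult[OF s(1) f(1)] sff sfs by metis
      also have "\<dots> = \<beta> (P f x) (P f y)" using P_adj[OF f(1)] by (simp add: \<beta>_def)
      also have "\<dots> = 0" using z WI by blast
      finally show "bil (P s y) x = 0" using bil_skew[of "P s y" x] by simp
    qed (rule P_low)
    then have "s = \<zero>\<^bsub>A\<^esub>" by (intro faithful) (use s in \<open>auto simp: P_zero fun_eq_iff\<close>)
    then show False using that by simp
  qed
  have scalar: "\<exists>l. \<forall>v\<in>W. TS v = (\<lambda>i. l * v i)" if nz: "s \<noteq> \<zero>\<^bsub>A\<^esub>"
  proof -
    obtain v0 w0 where vw: "v0 \<in> W" "w0 \<in> W" "\<beta> v0 w0 \<noteq> 0" using nonzero[OF nz] by blast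
    define l where "l = \<beta> (TS v0) w0 / \<beta> v0 w0"
    have 1: "TS v0 i = l * v0 i" for i
    proof -
      have "\<beta> v0 w0 * TS v0 i = \<beta> (TS v0) w0 * v0 i"
        using pl[OF vw(1) TSW[of v0] vw(2), of i] \<beta>_TS0[of v0] \<beta>_skew[of w0 v0] by (simp add: algebra_simps)
      then show ?thesis using vw(3) by (simp add: l_def field_simps)
    qed
    have 2: "TS w0 i = l * w0 i" for i
    proof -
      have "\<beta> (TS w0) v0 = - \<beta> (TS v0) w0" using \<beta>_TS[of w0 v0] \<beta>_skew[of w0 "TS v0"] by simp
      then have "\<beta> v0 w0 * TS w0 i = \<beta> (TS v0) w0 * w0 i"
        using pl[OF vw(2) TSW[of w0] vw(1), of i] \<beta>_TS0[of w0] by (simp add: algebra_simps)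
      then show ?thesis using vw(3) by (simp add: l_def field_simps)
    qed
    have "TS v = (\<lambda>i. l * v i)" if v: "v \<in> W" for v
    proof -
      define p where "p = - \<beta> w0 v / \<beta> v0 w0"
      define p' where "p' = - \<beta> v v0 / \<beta> v0 w0"
      have "\<beta> v0 w0 * v i = - \<beta> w0 v * v0 i - \<beta> v v0 * w0 i" for i
        using pl[OF vw(1,2) v, of i] by (simp add: algebra_simps eq_neg_iff_add_eq_0)
      then have "v i = (- \<beta> w0 v * v0 i - \<beta> v v0 * w0 i) / \<beta> v0 w0" for i
        using vw(3) by (simp add: nonzero_eq_divide_eq mult.commute)
      then have ve: "v = (\<lambda>i. p * v0 i + p' * w0 i)" by (auto simp: p_def p'_def diff_divide_distrib)
      show ?thesis by (subst (1 2) ve) (simp add: TS_lin 1 2 algebra_simps)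
    qed
    then show ?thesis by blast
  qed
  have sz: "\<sigma> \<zero>\<^bsub>A\<^esub> = \<zero>\<^bsub>A\<^esub>" using sigma(4)[of "\<zero>\<^bsub>A\<^esub>" 0] by simp
  show "t \<otimes>\<^bsub>A\<^esub> s \<otimes>\<^bsub>A\<^esub> (f \<otimes>\<^bsub>A\<^esub> x \<otimes>\<^bsub>A\<^esub> f) = f \<otimes>\<^bsub>A\<^esub> x \<otimes>\<^bsub>A\<^esub> f \<otimes>\<^bsub>A\<^esub> (t \<otimes>\<^bsub>A\<^esub> s)" if x: "x \<in> carrier A"
  proof (cases "s = \<zero>\<^bsub>A\<^esub>")
    case True
    then show ?thesis using t f x by simp
  next
    case False
    obtain l where l: "\<And>v. v \<in> W \<Longrightarrow> TS v = (\<lambda>i. l * v i)" using scalar[OF False] by blast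
    show ?thesis
    proof (rule faithful)
      fix z
      define D where "D = f \<otimes>\<^bsub>A\<^esub> x \<otimes>\<^bsub>A\<^esub> f"
      have D: "D \<in> carrier A" "f \<otimes>\<^bsub>A\<^esub> D = D" "D \<otimes>\<^bsub>A\<^esub> f = D"
        using f x A.m_assoc[of f f "x \<otimes>\<^bsub>A\<^esub> f"] by (simp_all add: D_def A.m_assoc)
      have PD: "P D z \<in> W" using P_mult[OF f(1) D(1), of z] D by (simp add: W_def)
      have "P (t \<otimes>\<^bsub>A\<^esub> s \<otimes>\<^bsub>A\<^esub> D) z = TS (P D z)" using t s D by (simp add: P_mult TS_def)
      also have "\<dots> = (\<lambda>i. l * P D z i)" using l[OF PD] .
      also have "\<dots> = P D (\<lambda>i. l * P f z i + 0 * P f z i)"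
        unfolding P_lin using P_mult[OF D(1) f(1), of z] D(3) by simp
      also have "\<dots> = P D (TS z)" using l[OF WI[of z]] TS_f[of z] by simp
      also have "\<dots> = P (D \<otimes>\<^bsub>A\<^esub> (t \<otimes>\<^bsub>A\<^esub> s)) z" using t s D by (simp add: P_mult TS_def)
      finally show "P (t \<otimes>\<^bsub>A\<^esub> s \<otimes>\<^bsub>A\<^esub> (f \<otimes>\<^bsub>A\<^esub> x \<otimes>\<^bsub>A\<^esub> f)) z = P (f \<otimes>\<^bsub>A\<^esub> x \<otimes>\<^bsub>A\<^esub> f \<otimes>\<^bsub>A\<^esub> (t \<otimes>\<^bsub>A\<^esub> s)) z"
        by (simp add: D_def)
    qed (use f s t x in auto)
  qed
  show "t \<otimes>\<^bsub>A\<^esub> s \<noteq> \<zero>\<^bsub>A\<^esub>" if nz: "s \<noteq> \<zero>\<^bsub>A\<^esub>" "t \<noteq> \<zero>\<^bsub>A\<^esub>"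
  proof
    assume ts: "t \<otimes>\<^bsub>A\<^esub> s = \<zero>\<^bsub>A\<^esub>"
    then have st: "s \<otimes>\<^bsub>A\<^esub> t = \<zero>\<^bsub>A\<^esub>" using sigma(3)[OF t(1) s(1)] t s sz by simp
    obtain v0 w0 where vw: "v0 \<in> W" "w0 \<in> W" "\<beta> v0 w0 \<noteq> 0" using nonzero[OF nz(1)] by blast
    have "P t y i = 0" for y i
    proof -
      have z: "\<beta> x (P t y) = 0" for x
      proof -
        have "P s (P t y) = (\<lambda>i. 0 * P s y i + 0 * P s y i)" using P_mult[OF s(1) t(1), of y] st by (simp add: P_zero fun_eq_iff)
        then show ?thesis unfolding \<beta>_def by (simp only: bil_lin) simp
      qed
      then have "\<beta> v0 w0 * P t y i = 0" using pl[OF vw(1,2) tW[of y], of i] \<beta>_skew[of "P t y" v0] by simp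
      then show ?thesis using vw by simp
    qed
    then have "t = \<zero>\<^bsub>A\<^esub>" by (intro faithful) (use t in \<open>auto simp: P_zero fun_eq_iff\<close>)
    then show False using nz by simp
  qed
qed

end

section \<open>Dimensions of corners\<close>

context central_simple_star begin

definition corner_space where "corner_space f = {f * x * f | x. x \<in> S}"

lemma corner_space_S: "f \<in> S \<Longrightarrow> corner_space f \<subseteq> S"
  by (auto simp: corner_space_def)

lemma corner_space_absorb: "f * f = f \<Longrightarrow> x \<in> corner_space f \<Longrightarrow> f * x = x \<and> x * f = x"
  by (auto simp: corner_space_def mult.assoc assoc_rule[of f f f])

lemma finite_of_independent: assumes "independent Bs" "Bs \<subseteq> S" shows "finite Bs"
proof -
  obtain T where "finite T" "S \<subseteq> span T" using fin by blast
  then show ?thesis using independent_span_bound[of T Bs] assms by blast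
qed

text \<open>
  The map \<open>x \<mapsto> v x u\<close> carries the corner of \<open>f\<close> isomorphically to the corner of \<open>g\<close>.
\<close>

lemma corner_dim_le:
  assumes uv: "u \<in> S" "v \<in> S" "f * u = u" "u * g = u" "g * v = v" "v * f = v" "u * v = f" "v * u = g"
    and f: "f \<in> S" "f * f = f" and g: "g \<in> S" "g * g = g"
  shows "dim (corner_space g) = dim (corner_space f)"
proof -
  obtain Bs where B: "Bs \<subseteq> corner_space f" "independent Bs" "corner_space f \<subseteq> span Bs" "card Bs = dim (corner_space f)"
    by (rule basis_exists)
  have BS: "Bs \<subseteq> S" using B(1) corner_space_S f by blast
  have fB: "finite Bs" using finite_of_independent[OF B(2) BS] .
  have abs: "f * x = x" "x * f = x" if "x \<in> Bs" for x using corner_space_absorb[OF f(2)] B(1) that by auto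
  define h where "h x = v * x * u" for x
  have ind: "c x = 0" if s: "(\<Sum>x\<in>Bs. c x *s h x) = 0" and x: "x \<in> Bs" for c x
  proof -
    have "0 = u * (\<Sum>x\<in>Bs. c x *s h x) * v" using s by simp
    also have "\<dots> = (\<Sum>x\<in>Bs. c x *s (u * v * x * (u * v)))"
      by (simp add: h_def sum_distrib_left sum_distrib_right mult.assoc)
    also have "\<dots> = (\<Sum>x\<in>Bs. c x *s x)" unfolding uv(7) using abs by (intro sum.cong refl) simp
    finally have "(\<Sum>x\<in>Bs. c x *s x) = 0" by simp
    then show ?thesis using independentD[OF B(2) fB subset_refl] x by blast
  qed
  have fam: "inj_on h Bs" "independent (h ` Bs)"
    using independent_family[OF fB, of h] ind by blast+
  have sub: "h ` Bs \<subseteq> corner_space g"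
  proof
    fix y assume "y \<in> h ` Bs"
    then obtain x where x: "x \<in> Bs" "y = v * x * u" by (auto simp: h_def)
    have "y = g * (v * x * u) * g" using uv x by (simp add: mult.assoc assoc_rule[OF uv(5)])
    then show "y \<in> corner_space g" unfolding corner_space_def using x uv BS by blast
  qed
  have "corner_space g \<subseteq> span (h ` Bs)"
  proof
    fix y assume y: "y \<in> corner_space g"
    then have yS: "y \<in> S" and gy: "g * y = y" "y * g = y" using corner_space_S[OF g(1)] corner_space_absorb[OF g(2) y] by auto
    have "u * y * v = f * (u * y * v) * f" using uv by (simp add: mult.assoc assoc_rule[OF uv(3)])
    then have "u * y * v \<in> corner_space f" unfolding corner_space_def using uv yS by blast
    then have "u * y * v \<in> span Bs" using B(3) by blast
    then obtain r where r: "u * y * v = (\<Sum>x\<in>Bs. r x *s x)" using span_finite[OF fB] by auto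
    have "y = (v * u) * y * (v * u)" unfolding uv(8) using gy by simp
    also have "\<dots> = v * (u * y * v) * u" by (simp only: mult.assoc)
    also have "\<dots> = (\<Sum>x\<in>Bs. r x *s h x)" unfolding r by (simp add: h_def sum_distrib_left sum_distrib_right)
    also have "\<dots> \<in> span (h ` Bs)" by (intro span_sum span_scale span_base imageI)
    finally show "y \<in> span (h ` Bs)" .
  qed
  then have "card (h ` Bs) = dim (corner_space g)" using basis_card_eq_dim[OF sub] fam by blast
  then show ?thesis using B(4) card_image[OF fam(1)] by simp
qed

lemma division_corner_dim:
  assumes f: "division_corner f" and g: "division_corner g"
  shows "dim (corner_space f) = dim (corner_space g)"
proof -
  obtain u v where "u \<in> S" "v \<in> S" "f * u = u" "u * g = u" "g * v = v" "v * f = v" "u * v = f" "v * u = g"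
    using division_corners_equiv[OF f g] by blast
  from corner_dim_le[OF this] show ?thesis using division_cornerD f g by simp
qed

lemma division_corner_inverse:
  assumes f: "division_corner f" and x: "x \<in> corner_space f" "x \<noteq> 0"
  obtains y where "y \<in> corner_space f" "y * x = f" "x * y = f"
proof -
  note fD = division_cornerD[OF f]
  have left: "\<exists>y\<in>corner_space f. y * x = f" if "x \<in> corner_space f" "x \<noteq> 0" for x
  proof -
    obtain q where q: "q \<in> S" "x = f * q * f" using \<open>x \<in> corner_space f\<close> by (auto simp: corner_space_def)
    then obtain b where "b \<in> S" "(f * b * f) * (f * q * f) = f" using f \<open>x \<noteq> 0\<close> unfolding division_corner_def by blast
    then show ?thesis using q by (intro bexI[of _ "f * b * f"]) (auto simp: corner_space_def)
  qed
  obtain y where y: "y \<in> corner_space f" "y * x = f" using left x by blast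
  have "y \<noteq> 0" using y fD by auto
  then obtain z where z: "z \<in> corner_space f" "z * y = f" using left y by blast
  have "z = z * (y * x)" using y z corner_space_absorb[OF fD(3) z(1)] by simp
  also have "\<dots> = x" using z corner_space_absorb[OF fD(3) x(1)] by (simp add: mult.assoc[symmetric])
  finally show thesis using that y z by blast
qed

end

context symplectic_csa begin

lemma small_corner_of_dim:
  assumes f: "f \<in> S" and d: "dim (corner_space f) \<le> 4"
  shows "small_corner f"
proof -
  obtain Bs where B: "Bs \<subseteq> corner_space f" "independent Bs" "corner_space f \<subseteq> span Bs" "card Bs = dim (corner_space f)"
    by (rule basis_exists)
  have BS: "Bs \<subseteq> S" using B(1) corner_space_S f by blast
  have fB: "finite Bs" using finite_of_independent[OF B(2) BS] .
  obtain h where h: "bij_betw h {0..<card Bs} Bs" using ex_bij_betw_nat_finite[OF fB] by blast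
  define q where "q k = (if k < card Bs then h k else 0)" for k
  have "\<exists>c. f * x * f = (\<Sum>k<4. c k *s q k)" if "x \<in> S" for x
  proof -
    have "f * x * f \<in> span Bs" using B(3) that by (auto simp: corner_space_def)
    then obtain r where r: "f * x * f = (\<Sum>y\<in>Bs. r y *s y)" using span_finite[OF fB] by auto
    also have "\<dots> = (\<Sum>k\<in>{0..<card Bs}. r (h k) *s h k)" using sum.reindex_bij_betw[OF h, of "\<lambda>y. r y *s y"] by simp
    also have "\<dots> = (\<Sum>k<4. r (h k) *s q k)"
      by (rule sum.mono_neutral_cong_left) (use B(4) d in \<open>auto simp: q_def\<close>)
    finally show ?thesis by (intro exI[of _ "\<lambda>k. r (h k)"])
  qed
  moreover have "q k \<in> S" for k using bij_betwE[OF h] BS by (auto simp: q_def)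
  ultimately show ?thesis unfolding small_corner_def by blast
qed

lemma symplectic_frame_exists:
  assumes "\<And>f. division_corner f \<Longrightarrow> dim (corner_space f) \<le> 4"
  obtains e i j a b x1 x2 x3 x4 where "quaternion_frame scale star S e i j a b"
    "quaternion_frame.frame scale star S e x1 x2 x3 x4"
proof -
  obtain f where f: "division_corner f" using division_corner_exists by blast
  obtain g where "g \<in> S" "g * g = g" "small_corner g" "noncomm_corner g"
    using noncomm_small_corner_exists[OF f small_corner_of_dim[OF _ assms[OF f]]] f division_cornerD by blast
  from frame_of_small_corner[OF this] show thesis using that by blast
qed

end

section \<open>The algebra over its base field\<close>

lemma sum_lessThan_plus: "(\<Sum>k<n + (m::nat). f k) = (\<Sum>k<n. f k) + (\<Sum>k<m. f (n + k))"
  for f :: "nat \<Rightarrow> 'a::comm_monoid_add"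
  by (induction m) (auto simp: add.assoc)

lemma field_extension_id: "field_extension id"
  by (auto simp: field_extension_def ring_hom_def)

text \<open>
  The base field itself is treated as the extension along the identity, so that \<open>S\<close> below is a copy of \<open>A\<close>.
\<close>

locale csa_involution =
  fixes A :: "('k::field, 'a) module" and \<sigma> :: "'a \<Rightarrow> 'a" and n :: nat and b :: "nat \<Rightarrow> 'a"
  assumes cs: "central_simple A" and inv: "involution A \<sigma>" and basis: "basis_of A (carrier A) n b"
begin

lemma n_pos: "0 < n"
proof (rule ccontr)
  assume "\<not> 0 < n"
  then have "carrier A = {\<zero>\<^bsub>A\<^esub>}" using basis by (auto simp: basis_of_def)
  then show False using cs by (simp add: central_simple_def)
qed

sublocale E: based_extension A id \<sigma> n b
proof
  show "is_algebra A" using cs by (simp add: central_simple_def)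
qed (use field_extension_id inv basis n_pos in auto)

definition S where "S = E.rho ` carrier A"

lemma rho_S: "x \<in> carrier A \<Longrightarrow> E.rho x \<in> S" by (simp add: S_def)

lemma rho_eq: "x \<in> carrier A \<Longrightarrow> y \<in> carrier A \<Longrightarrow> E.rho x = E.rho y \<longleftrightarrow> x = y"
  using E.rho_inj by (auto simp: inj_on_def)

lemma rho_zero: "E.rho \<zero>\<^bsub>A\<^esub> = 0"
  using E.rho_simps(4)[of "\<zero>\<^bsub>A\<^esub>" 0] by simp

lemma rho_minus: "x \<in> carrier A \<Longrightarrow> E.rho (\<ominus>\<^bsub>A\<^esub> x) = - E.rho x"
  using E.rho_simps(1)[of "\<ominus>\<^bsub>A\<^esub> x" x] by (simp add: E.A.l_neg rho_zero eq_neg_iff_add_eq_0)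

lemma rho_lincomb: "(\<And>i. i < k \<Longrightarrow> c i \<in> carrier A) \<Longrightarrow> E.rho (lincomb A l c k) = (\<Sum>i<k. sc_op (l i) (E.rho (c i)))"
  using E.lincomb_hom[of E.rho k c l] by (simp add: rho_zero E.rho_simps)

lemma S_star_algebra: "star_algebra sc_op star_op S"
proof (rule star_algebra_starop)
  show "1 \<in> S" using E.rho_simps(3) rho_S[of "\<one>\<^bsub>A\<^esub>"] by simp
  fix x y assume "x \<in> S" "y \<in> S"
  then obtain u v where u: "u \<in> carrier A" "v \<in> carrier A" "x = E.rho u" "y = E.rho v" by (auto simp: S_def)
  show "x + y \<in> S" "x * y \<in> S" "star_op x \<in> S"
    using u rho_S[of "u \<oplus>\<^bsub>A\<^esub> v"] rho_S[of "u \<otimes>\<^bsub>A\<^esub> v"] rho_S[of "\<sigma> u"] by (simp_all add: E.rho_simps)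
  show "sc_op c x \<in> S" for c using u rho_S[of "c \<odot>\<^bsub>A\<^esub> u"] by (simp add: E.rho_simps)
qed

sublocale T: star_algebra sc_op star_op S by (rule S_star_algebra)

lemma span_basis: "S \<subseteq> R.span (E.rho ` b ` {..<n})"
proof
  fix x assume "x \<in> S"
  then obtain a where a: "a \<in> carrier A" "x = E.rho a" by (auto simp: S_def)
  have "E.rho a = (\<Sum>i<n. sc_op (E.coord a i) (E.rho (b i)))"
    using rho_lincomb[of n b "E.coord a"] a E.coord by simp
  then show "x \<in> R.span (E.rho ` b ` {..<n})" unfolding a(2)
    by simp (intro R.span_sum R.span_scale R.span_base, auto)
qed

lemma dim_S: "R.dim S = n"
proof -
  have eq: "E.rho ` b ` {..<n} = (\<lambda>i. E.rho (b i)) ` {..<n}" by auto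
  have f: "inj_on (\<lambda>i. E.rho (b i)) {..<n}" "R.independent ((\<lambda>i. E.rho (b i)) ` {..<n})"
    using vector_space.independent_family[OF R.vector_space_axioms, of "{..<n}" "\<lambda>i. E.rho (b i)"] E.rho_independent by auto
  have "card ((\<lambda>i. E.rho (b i)) ` {..<n}) = R.dim S"
    by (rule R.basis_card_eq_dim) (use span_basis f rho_S in \<open>auto simp: eq\<close>)
  then show ?thesis using f by (simp add: card_image)
qed

lemma S_simple:
  assumes x: "x \<in> S" "x \<noteq> 0"
  shows "\<exists>(N::nat) u v. (\<forall>k<N. u k \<in> S \<and> v k \<in> S) \<and> (\<Sum>k<N. u k * x * v k) = 1"
proof -
  define G where "G = {z. \<exists>(N::nat) u v. (\<forall>k<N. u k \<in> S \<and> v k \<in> S) \<and> (\<Sum>k<N. u k * x * v k) = z}"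
  have GI: "(\<Sum>k<N. u k * x * v k) \<in> G" if "\<And>k. k < (N::nat) \<Longrightarrow> u k \<in> S \<and> v k \<in> S" for N u v
    using that unfolding G_def by blast
  have G0: "0 \<in> G" using GI[of 0] by simp
  have GE: "\<exists>(N::nat) u v. (\<forall>k<N. u k \<in> S \<and> v k \<in> S) \<and> (\<Sum>k<N. u k * x * v k) = z" if "z \<in> G" for z
    using that by (simp only: G_def mem_Collect_eq)
  have Gadd: "y + z \<in> G" if "y \<in> G" "z \<in> G" for y z
  proof -
    from GE[OF that(1)] obtain N :: nat and u v where
      1: "\<forall>k<N. u k \<in> S \<and> v k \<in> S" "(\<Sum>k<N. u k * x * v k) = y" by (elim exE conjE)
    from GE[OF that(2)] obtain M :: nat and u' v' where
      2: "\<forall>k<M. u' k \<in> S \<and> v' k \<in> S" "(\<Sum>k<M. u' k * x * v' k) = z" by (elim exE conjE)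
    define p where "p k = (if k < N then u k else u' (k - N))" for k
    define q where "q k = (if k < N then v k else v' (k - N))" for k
    have "(\<Sum>k<N+M. p k * x * q k) \<in> G"
    proof (rule GI)
      fix k assume k: "k < N + M"
      show "p k \<in> S \<and> q k \<in> S"
      proof (cases "k < N")
        case True then show ?thesis using 1(1) by (simp add: p_def q_def)
      next
        case False
        then have "k - N < M" using k by simp
        then show ?thesis using 2(1) False by (simp add: p_def q_def)
      qed
    qed
    moreover have "(\<Sum>k<N+M. p k * x * q k) = y + z"
      unfolding sum_lessThan_plus 1(2)[symmetric] 2(2)[symmetric] by (simp add: p_def q_def)
    ultimately show ?thesis by simp
  qed
  have Gm: "w * y \<in> G" "y * w \<in> G" if "y \<in> G" "w \<in> S" for y w
  proof -
    from GE[OF that(1)] obtain N :: nat and u v where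
      1: "\<forall>k<N. u k \<in> S \<and> v k \<in> S" "(\<Sum>k<N. u k * x * v k) = y" by (elim exE conjE)
    have "(\<Sum>k<N. (w * u k) * x * v k) \<in> G" "(\<Sum>k<N. u k * x * (v k * w)) \<in> G"
      by (rule GI, use 1(1) that(2) in auto)+
    then show "w * y \<in> G" "y * w \<in> G"
      by (simp_all add: sum_distrib_left sum_distrib_right mult.assoc flip: 1(2))
  qed
  have xG: "x \<in> G" using GI[of 1 "\<lambda>_. 1" "\<lambda>_. 1"] by simp
  define I where "I = {a \<in> carrier A. E.rho a \<in> G}"
  have "ideal I A"
  proof (rule idealI)
    show "ring A" by (rule E.A.ring_axioms)
    show "subgroup I (add_monoid A)"
    proof (rule E.A.add.subgroupI)
      show "I \<noteq> {}" using G0 rho_zero by (auto simp: I_def intro!: exI[of _ "\<zero>\<^bsub>A\<^esub>"])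
      show "\<ominus>\<^bsub>A\<^esub> a \<in> I" if "a \<in> I" for a
        using that Gm(1)[of "E.rho a" "- 1"] by (simp add: I_def rho_minus)
      show "a \<oplus>\<^bsub>A\<^esub> c \<in> I" if "a \<in> I" "c \<in> I" for a c
        using that Gadd by (simp add: I_def E.rho_simps)
    qed (auto simp: I_def)
    show "c \<otimes>\<^bsub>A\<^esub> a \<in> I" "a \<otimes>\<^bsub>A\<^esub> c \<in> I" if "a \<in> I" "c \<in> carrier A" for a c
      using that Gm rho_S by (simp_all add: I_def E.rho_simps)
  qed
  moreover obtain a where a: "a \<in> carrier A" "x = E.rho a" using x(1) by (auto simp: S_def)
  then have "a \<in> I" "a \<noteq> \<zero>\<^bsub>A\<^esub>" using xG x rho_zero by (auto simp: I_def)
  ultimately have "I = carrier A" using cs by (auto simp: central_simple_def)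
  then have "\<one>\<^bsub>A\<^esub> \<in> I" using E.A.one_closed by simp
  then have "1 \<in> G" using E.rho_simps(3) by (simp add: I_def)
  then show ?thesis unfolding G_def by blast
qed

lemma S_central:
  assumes z: "z \<in> S" and comm: "\<And>x. x \<in> S \<Longrightarrow> z * x = x * z"
  shows "\<exists>c. z = sc_op c 1"
proof -
  obtain a where a: "a \<in> carrier A" "z = E.rho a" using z by (auto simp: S_def)
  have "a \<otimes>\<^bsub>A\<^esub> x = x \<otimes>\<^bsub>A\<^esub> a" if "x \<in> carrier A" for x
    using comm[OF rho_S[OF that]] that a rho_eq[of "a \<otimes>\<^bsub>A\<^esub> x" "x \<otimes>\<^bsub>A\<^esub> a"] by (simp add: E.rho_simps)
  then have "a \<in> scalars A" using cs a(1) unfolding central_simple_def by blast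
  then obtain c where "a = c \<odot>\<^bsub>A\<^esub> \<one>\<^bsub>A\<^esub>" by (auto simp: scalars_def)
  then show ?thesis using a by (auto simp: E.rho_simps)
qed

sublocale T: central_simple_star sc_op star_op S
proof
  show "\<exists>T. finite T \<and> S \<subseteq> R.span T" using span_basis by (intro exI[of _ "E.rho ` b ` {..<n}"]) auto
  show "\<exists>(n::nat) u v. (\<forall>k<n. u k \<in> S \<and> v k \<in> S) \<and> (\<Sum>k<n. u k * x * v k) = 1" if "x \<in> S" "x \<noteq> 0" for x
    using that by (rule S_simple)
  show "\<exists>c. z = sc_op c 1" if "z \<in> S" "\<And>x. x \<in> S \<Longrightarrow> z * x = x * z" for z
    using that by (rule S_central)
qed

end

section \<open>The index\<close>

context algebra_over begin

lemma scalars_subfield: assumes "\<one>\<^bsub>A\<^esub> \<noteq> \<zero>\<^bsub>A\<^esub>" shows "subfield (scalars A) A"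
proof -
  let ?K = "ring_of_type_algebra :: 'k ring"
  interpret K: field ?K by (rule field_from_type_algebra)
  interpret h: ring_hom_ring ?K A "\<lambda>c. c \<odot>\<^bsub>A\<^esub> \<one>\<^bsub>A\<^esub>"
  proof (rule ring_hom_ringI2)
    show "(\<lambda>c. c \<odot>\<^bsub>A\<^esub> \<one>\<^bsub>A\<^esub>) \<in> ring_hom ?K A"
      by (rule ring_hom_memI) (auto simp: ring_of_type_algebra_def smult_simps smult_mult mult.commute)
  qed (use cring.axioms(1)[OF cring_from_type_algebra] A.ring_axioms in auto)
  have "subfield ((\<lambda>c. c \<odot>\<^bsub>A\<^esub> \<one>\<^bsub>A\<^esub>) ` carrier ?K) A"
    by (rule h.img_is_subfield(2)[OF K.carrier_is_subfield assms])
  then show ?thesis by (simp add: scalars_def ring_of_type_algebra_def)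
qed

lemma lincomb_in_Span:
  assumes "\<And>i. i < k \<Longrightarrow> u i \<in> carrier A"
  shows "lincomb A c u k \<in> A.Span (scalars A) (map u (rev [0..<k]))"
  using assms
proof (induction k)
  case (Suc k)
  have "lincomb A c u (Suc k) = (c k \<odot>\<^bsub>A\<^esub> \<one>\<^bsub>A\<^esub>) \<otimes>\<^bsub>A\<^esub> u k \<oplus>\<^bsub>A\<^esub> lincomb A c u k"
    using Suc.prems by (simp add: scalar_mult)
  moreover have "lincomb A c u k \<in> A.Span (scalars A) (map u (rev [0..<k]))" using Suc by simp
  ultimately show ?case using A.line_extension_mem_iff by (auto simp: scalars_def)
qed simp

lemma finite_dimension_of_lincomb:
  assumes "\<one>\<^bsub>A\<^esub> \<noteq> \<zero>\<^bsub>A\<^esub>" "\<And>i. i < k \<Longrightarrow> u i \<in> carrier A" "\<And>x. x \<in> carrier A \<Longrightarrow> \<exists>c. x = lincomb A c u k"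
  shows "A.finite_dimension (scalars A) (carrier A)"
proof -
  have s: "scalars A \<subseteq> carrier A" by (auto simp: scalars_def)
  have U: "set (map u (rev [0..<k])) \<subseteq> carrier A" using assms(2) by auto
  have "A.Span (scalars A) (map u (rev [0..<k])) = carrier A"
  proof
    show "A.Span (scalars A) (map u (rev [0..<k])) \<subseteq> carrier A" by (rule A.Span_in_carrier[OF s U])
    show "carrier A \<subseteq> A.Span (scalars A) (map u (rev [0..<k]))"
    proof
      fix x assume "x \<in> carrier A"
      then obtain c where "x = lincomb A c u k" using assms(3) by blast
      then show "x \<in> A.Span (scalars A) (map u (rev [0..<k]))" using lincomb_in_Span assms(2) by blast
    qed
  qed
  then show ?thesis using A.Span_finite_dimension[OF scalars_subfield[OF assms(1)] U] by simp
qed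

lemma dim_eq: assumes "\<one>\<^bsub>A\<^esub> \<noteq> \<zero>\<^bsub>A\<^esub>" "A.dimension m (scalars A) (carrier A)"
  shows "A.dim (scalars A) (carrier A) = m"
  using A.dimI[OF scalars_subfield[OF assms(1)] assms(2)] by (simp add: over_def)

end

lemma central_simple_one: assumes "central_simple D" shows "\<one>\<^bsub>D\<^esub> \<noteq> \<zero>\<^bsub>D\<^esub>"
proof
  assume one: "\<one>\<^bsub>D\<^esub> = \<zero>\<^bsub>D\<^esub>"
  interpret ring D using assms by (simp add: central_simple_def is_algebra_def)
  have "x = \<zero>\<^bsub>D\<^esub>" if "x \<in> carrier D" for x using one that by (metis l_one l_null)
  then have "carrier D = {\<zero>\<^bsub>D\<^esub>}" using zero_closed by blast
  then show False using assms unfolding central_simple_def by blast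
qed

context csa_involution begin

text \<open>
  The matrix unit in position \<open>(0, 0)\<close> corresponds to an idempotent whose corner is a copy of \<open>D\<close>.
\<close>

lemma pair_dim:
  fixes D :: "('k, 'd) module"
  assumes D: "central_division D" and \<phi>: "\<phi> \<in> alg_iso A (matrix_algebra s D)"
  obtains g where "T.division_corner g" "R.dim (T.corner_space g) = ring.dim D (scalars D) (carrier D)"
proof -
  let ?M = "matrix_algebra s D"
  have csD: "central_simple D" and UD: "Units D = carrier D - {\<zero>\<^bsub>D\<^esub>}" using D by (auto simp: central_division_def)
  interpret D: algebra_over D by standard (use csD in \<open>simp add: central_simple_def\<close>)
  have one0: "\<one>\<^bsub>D\<^esub> \<noteq> \<zero>\<^bsub>D\<^esub>" by (rule central_simple_one[OF csD])
  have hom: "\<phi> \<in> ring_hom A ?M" and bij: "bij_betw \<phi> (carrier A) (carrier ?M)"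
    and smul: "\<And>c x. x \<in> carrier A \<Longrightarrow> \<phi> (c \<odot>\<^bsub>A\<^esub> x) = c \<odot>\<^bsub>?M\<^esub> \<phi> x"
    using \<phi> by (auto simp: alg_iso_def ring_iso_def)
  have s0: "0 < s"
  proof (rule ccontr)
    assume "\<not> 0 < s"
    then have "carrier ?M = {\<lambda>_. undefined}" by (auto simp: matrix_algebra_simps)
    then have "\<phi> \<one>\<^bsub>A\<^esub> = \<phi> \<zero>\<^bsub>A\<^esub>" using bij_betwE[OF bij] E.A.one_closed E.A.zero_closed by auto
    then have "\<one>\<^bsub>A\<^esub> = \<zero>\<^bsub>A\<^esub>" using bij E.A.one_closed E.A.zero_closed by (auto simp: bij_betw_def inj_on_def)
    then show False using central_simple_one[OF cs] by simp
  qed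
  have M_ext: "P = Q" if "P \<in> carrier ?M" "Q \<in> carrier ?M" "\<And>i j. i < s \<Longrightarrow> j < s \<Longrightarrow> P (i, j) = Q (i, j)" for P Q
    by (rule PiE_ext[OF that(1,2)[unfolded matrix_algebra_simps]]) (use that(3) in auto)
  have Mc: "P (i, j) \<in> carrier D" if "P \<in> carrier ?M" "i < s" "j < s" for P i j
    using that by (auto simp: matrix_algebra_simps)
  have \<phi>c: "\<phi> a \<in> carrier ?M" if "a \<in> carrier A" for a using bij_betwE[OF bij] that by blast
  have \<phi>_inj: "a = c" if "a \<in> carrier A" "c \<in> carrier A" "\<phi> a = \<phi> c" for a c
    using bij that by (auto simp: bij_betw_def inj_on_def)
  have \<phi>_ext: "a = c" if "a \<in> carrier A" "c \<in> carrier A" "\<And>i j. i < s \<Longrightarrow> j < s \<Longrightarrow> \<phi> a (i, j) = \<phi> c (i, j)" for a c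
    by (rule \<phi>_inj[OF that(1,2)], rule M_ext[OF \<phi>c[OF that(1)] \<phi>c[OF that(2)] that(3)])
  define E11 where "E11 w = (\<lambda>(i, j)\<in>{..<s} \<times> {..<s}. if i = 0 \<and> j = 0 then w else \<zero>\<^bsub>D\<^esub>)" for w
  have E11: "E11 w (i, j) = (if i = 0 \<and> j = 0 then w else \<zero>\<^bsub>D\<^esub>)" if "i < s" "j < s" for w i j
    using that by (simp add: E11_def)
  have E11c: "E11 w \<in> carrier ?M" if "w \<in> carrier D" for w using that by (auto simp: E11_def matrix_algebra_simps)
  define \<eta> where "\<eta> w = inv_into (carrier A) \<phi> (E11 w)" for w
  have \<eta>: "\<eta> w \<in> carrier A" "\<phi> (\<eta> w) = E11 w" if "w \<in> carrier D" for w
  proof -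
    have "E11 w \<in> \<phi> ` carrier A" using bij E11c[OF that] by (simp add: bij_betw_def)
    then show "\<eta> w \<in> carrier A" "\<phi> (\<eta> w) = E11 w" unfolding \<eta>_def by (rule inv_into_into, rule f_inv_into_f)
  qed
  have \<eta>_corner: "\<eta> \<one>\<^bsub>D\<^esub> \<otimes>\<^bsub>A\<^esub> x \<otimes>\<^bsub>A\<^esub> \<eta> \<one>\<^bsub>D\<^esub> = \<eta> (\<phi> x (0, 0))" if x: "x \<in> carrier A" for x
  proof (rule \<phi>_ext)
    have xc: "\<phi> x (0, 0) \<in> carrier D" using Mc[OF \<phi>c[OF x]] s0 by simp
    note c1 = \<eta>[OF D.A.one_closed]
    have e1: "(\<phi> (\<eta> \<one>\<^bsub>D\<^esub>) \<otimes>\<^bsub>?M\<^esub> \<phi> x) (i, j) = (if i = 0 then \<phi> x (0, j) else \<zero>\<^bsub>D\<^esub>)" if "i < s" "j < s" for i j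
    proof -
      have "(\<phi> (\<eta> \<one>\<^bsub>D\<^esub>) \<otimes>\<^bsub>?M\<^esub> \<phi> x) (i, j) = (\<Oplus>\<^bsub>D\<^esub>k\<in>{..<s}. E11 \<one>\<^bsub>D\<^esub> (i, k) \<otimes>\<^bsub>D\<^esub> \<phi> x (k, j))"
        using that c1 by (simp add: matrix_algebra_simps)
      also have "\<dots> = (\<Oplus>\<^bsub>D\<^esub>k\<in>{..<s}. if 0 = k then (if i = 0 then \<phi> x (k, j) else \<zero>\<^bsub>D\<^esub>) else \<zero>\<^bsub>D\<^esub>)"
        by (rule D.A.finsum_cong') (use that Mc[OF \<phi>c[OF x]] in \<open>auto simp: E11\<close>)
      also have "\<dots> = (if i = 0 then \<phi> x (0, j) else \<zero>\<^bsub>D\<^esub>)"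
        by (rule D.A.finsum_singleton) (use that s0 Mc[OF \<phi>c[OF x]] in auto)
      finally show ?thesis .
    qed
      fix i j assume ij: "i < s" "j < s"
      let ?Y = "\<phi> (\<eta> \<one>\<^bsub>D\<^esub>) \<otimes>\<^bsub>?M\<^esub> \<phi> x"
      have Y: "?Y = \<phi> (\<eta> \<one>\<^bsub>D\<^esub> \<otimes>\<^bsub>A\<^esub> x)" using ring_hom_mult[OF hom] c1 x by simp
      have Yc: "?Y (i, k) \<in> carrier D" if "k < s" for k unfolding Y using Mc[OF \<phi>c] c1 x ij that by simp
      have "\<phi> (\<eta> \<one>\<^bsub>D\<^esub> \<otimes>\<^bsub>A\<^esub> x \<otimes>\<^bsub>A\<^esub> \<eta> \<one>\<^bsub>D\<^esub>) (i, j) = (?Y \<otimes>\<^bsub>?M\<^esub> E11 \<one>\<^bsub>D\<^esub>) (i, j)"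
        using ring_hom_mult[OF hom] c1 x by simp
      also have "\<dots> = (\<Oplus>\<^bsub>D\<^esub>k\<in>{..<s}. ?Y (i, k) \<otimes>\<^bsub>D\<^esub> E11 \<one>\<^bsub>D\<^esub> (k, j))"
        using ij by (simp only: matrix_algebra_simps)
      also have "\<dots> = (\<Oplus>\<^bsub>D\<^esub>k\<in>{..<s}. if 0 = k then (if j = 0 then ?Y (i, k) else \<zero>\<^bsub>D\<^esub>) else \<zero>\<^bsub>D\<^esub>)"
        by (rule D.A.finsum_cong') (use ij Yc in \<open>auto simp: E11\<close>)
      also have "\<dots> = (if j = 0 then ?Y (i, 0) else \<zero>\<^bsub>D\<^esub>)"
        by (rule D.A.finsum_singleton) (use ij s0 Yc in auto)
      also have "\<dots> = \<phi> (\<eta> (\<phi> x (0, 0))) (i, j)" unfolding e1[OF ij(1) s0] using ij s0 xc by (simp add: \<eta> E11)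
      finally show "\<phi> (\<eta> \<one>\<^bsub>D\<^esub> \<otimes>\<^bsub>A\<^esub> x \<otimes>\<^bsub>A\<^esub> \<eta> \<one>\<^bsub>D\<^esub>) (i, j) = \<phi> (\<eta> (\<phi> x (0, 0))) (i, j)" .
  qed (use \<eta> x s0 Mc[OF \<phi>c[OF x]] in auto)
  have \<eta>00: "\<phi> (\<eta> w) (0, 0) = w" if "w \<in> carrier D" for w using \<eta>[OF that] s0 by (simp add: E11)
  have \<eta>_mult: "\<eta> w \<otimes>\<^bsub>A\<^esub> \<eta> w' = \<eta> (w \<otimes>\<^bsub>D\<^esub> w')" if w: "w \<in> carrier D" "w' \<in> carrier D" for w w'
  proof (rule \<phi>_ext)
    fix i j assume ij: "i < s" "j < s"
    have "\<phi> (\<eta> w \<otimes>\<^bsub>A\<^esub> \<eta> w') (i, j) = (E11 w \<otimes>\<^bsub>?M\<^esub> E11 w') (i, j)"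
      using ring_hom_mult[OF hom] \<eta> w by simp
    also have "\<dots> = (\<Oplus>\<^bsub>D\<^esub>k\<in>{..<s}. E11 w (i, k) \<otimes>\<^bsub>D\<^esub> E11 w' (k, j))" using ij by (simp only: matrix_algebra_simps)
    also have "\<dots> = (\<Oplus>\<^bsub>D\<^esub>k\<in>{..<s}. if 0 = k then (if i = 0 \<and> j = 0 then w \<otimes>\<^bsub>D\<^esub> w' else \<zero>\<^bsub>D\<^esub>) else \<zero>\<^bsub>D\<^esub>)"
      by (rule D.A.finsum_cong') (use ij w in \<open>auto simp: E11\<close>)
    also have "\<dots> = (if i = 0 \<and> j = 0 then w \<otimes>\<^bsub>D\<^esub> w' else \<zero>\<^bsub>D\<^esub>)"
      by (rule D.A.finsum_singleton) (use w s0 in auto)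
    finally show "\<phi> (\<eta> w \<otimes>\<^bsub>A\<^esub> \<eta> w') (i, j) = \<phi> (\<eta> (w \<otimes>\<^bsub>D\<^esub> w')) (i, j)" using w ij by (simp add: \<eta> E11)
  qed (use \<eta> w in auto)
  have \<eta>_add: "\<eta> (w \<oplus>\<^bsub>D\<^esub> w') = \<eta> w \<oplus>\<^bsub>A\<^esub> \<eta> w'" if w: "w \<in> carrier D" "w' \<in> carrier D" for w w'
  proof (rule \<phi>_ext)
    fix i j assume "i < s" "j < s"
    then show "\<phi> (\<eta> (w \<oplus>\<^bsub>D\<^esub> w')) (i, j) = \<phi> (\<eta> w \<oplus>\<^bsub>A\<^esub> \<eta> w') (i, j)"
      using w \<eta> ring_hom_add[OF hom, of "\<eta> w" "\<eta> w'"] by (simp add: matrix_algebra_simps(5) E11)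
  qed (use \<eta> w in auto)
  have \<eta>_smult: "\<eta> (c \<odot>\<^bsub>D\<^esub> w) = c \<odot>\<^bsub>A\<^esub> \<eta> w" if w: "w \<in> carrier D" for w c
  proof (rule \<phi>_ext)
    fix i j assume "i < s" "j < s"
    then show "\<phi> (\<eta> (c \<odot>\<^bsub>D\<^esub> w)) (i, j) = \<phi> (c \<odot>\<^bsub>A\<^esub> \<eta> w) (i, j)"
      using w \<eta> smul[of "\<eta> w" c] by (simp add: matrix_algebra_simps(6) E11)
  qed (use \<eta> w in auto)
  define h where "h w = E.rho (\<eta> w)" for w
  have h_add: "h (w \<oplus>\<^bsub>D\<^esub> w') = h w + h w'" and h_mult: "h (w \<otimes>\<^bsub>D\<^esub> w') = h w * h w'"
    if "w \<in> carrier D" "w' \<in> carrier D" for w w'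
    using that \<eta>(1) by (simp_all add: h_def \<eta>_add E.rho_simps flip: \<eta>_mult)
  have h_smult: "h (c \<odot>\<^bsub>D\<^esub> w) = sc_op c (h w)" if "w \<in> carrier D" for c w
    using that \<eta>(1) by (simp add: h_def \<eta>_smult E.rho_simps)
  have h_zero: "h \<zero>\<^bsub>D\<^esub> = 0" using h_smult[of "\<zero>\<^bsub>D\<^esub>" 0] by simp
  have h_inj: "w = w'" if "h w = h w'" "w \<in> carrier D" "w' \<in> carrier D" for w w'
    using that rho_eq \<eta> \<eta>00 unfolding h_def by metis
  define g where "g = h \<one>\<^bsub>D\<^esub>"
  have hS: "h w \<in> S" if "w \<in> carrier D" for w using \<eta>(1)[OF that] rho_S by (simp add: h_def)
  have gS: "g \<in> S" "g * g = g" "g \<noteq> 0"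
    using hS h_mult[of "\<one>\<^bsub>D\<^esub>" "\<one>\<^bsub>D\<^esub>"] h_inj[of "\<one>\<^bsub>D\<^esub>" "\<zero>\<^bsub>D\<^esub>"] h_zero one0 by (auto simp: g_def)
  have corner: "\<exists>w\<in>carrier D. g * q * g = h w" if q: "q \<in> S" for q
  proof -
    obtain x where x: "x \<in> carrier A" "q = E.rho x" using q by (auto simp: S_def)
    have "g * q * g = h (\<phi> x (0, 0))"
      using x \<eta>(1) E.rho_simps(2) \<eta>_corner[OF x(1)] by (simp add: g_def h_def flip: E.rho_simps(2))
    then show ?thesis using Mc[OF \<phi>c[OF x(1)]] s0 by blast
  qed
  have hg: "g * h w * g = h w" "h w * g = h w" if "w \<in> carrier D" for w
    using that by (simp_all add: g_def flip: h_mult)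
  have space: "T.corner_space g = h ` carrier D"
  proof
    show "T.corner_space g \<subseteq> h ` carrier D" using corner unfolding T.corner_space_def by blast
    show "h ` carrier D \<subseteq> T.corner_space g" unfolding T.corner_space_def
    proof (rule image_subsetI)
      fix w assume "w \<in> carrier D"
      then show "h w \<in> {g * x * g | x. x \<in> S}" using hg(1) hS by (intro CollectI exI[of _ "h w"]) auto
    qed
  qed
  have "T.division_corner g" unfolding T.division_corner_def
  proof (intro conjI gS ballI impI)
    fix q assume q: "q \<in> S" "g * q * g \<noteq> 0"
    then obtain w where w: "w \<in> carrier D" "g * q * g = h w" using corner by blast
    then have "w \<in> Units D" using q h_zero UD by auto
    then obtain w' where w': "w' \<in> carrier D" "w' \<otimes>\<^bsub>D\<^esub> w = \<one>\<^bsub>D\<^esub>" by (auto simp: Units_def)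
    have "(g * h w' * g) * (g * q * g) = g" unfolding w(2) hg(1)[OF w'(1)] using w w' by (simp add: g_def flip: h_mult)
    then show "\<exists>b\<in>S. (g * b * g) * (g * q * g) = g" using hS w' by blast
  qed
  moreover have "R.dim (T.corner_space g) = ring.dim D (scalars D) (carrier D)"
  proof -
    obtain m where m: "D.A.dimension m (scalars D) (carrier D)"
      using csD by (auto simp: central_simple_def D.A.finite_dimension_def)
    obtain c where c: "basis_of D (carrier D) m c" using D.basis_exists[OF m] by blast
    have cc: "c i \<in> carrier D" if "i < m" for i using c that unfolding basis_of_def by blast
    have hl: "h (lincomb D l c m) = (\<Sum>i<m. sc_op (l i) (h (c i)))" for l
      using D.lincomb_hom[of h m c l] cc by (simp add: h_zero h_add h_smult)
    have ind: "l i = 0" if "(\<Sum>i\<in>{..<m}. sc_op (l i) (h (c i))) = 0" "i \<in> {..<m}" for l i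
    proof -
      have "h (lincomb D l c m) = h \<zero>\<^bsub>D\<^esub>" using that hl h_zero by simp
      then have "lincomb D l c m = \<zero>\<^bsub>D\<^esub>" by (rule h_inj) (use cc in auto)
      then show ?thesis using c that(2) by (simp add: basis_of_def)
    qed
    have f: "inj_on (\<lambda>i. h (c i)) {..<m}" "R.independent ((\<lambda>i. h (c i)) ` {..<m})"
      using vector_space.independent_family[OF R.vector_space_axioms, of "{..<m}" "\<lambda>i. h (c i)"] ind by blast+
    have "card ((\<lambda>i. h (c i)) ` {..<m}) = R.dim (T.corner_space g)"
    proof (rule R.basis_card_eq_dim)
      show "(\<lambda>i. h (c i)) ` {..<m} \<subseteq> T.corner_space g" using cc by (auto simp: space)
      show "T.corner_space g \<subseteq> R.span ((\<lambda>i. h (c i)) ` {..<m})"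
      proof
        fix y assume "y \<in> T.corner_space g"
        then obtain w where w: "w \<in> carrier D" "y = h w" by (auto simp: space)
        then obtain l where "w = lincomb D l c m" using c unfolding basis_of_def by blast
        then have "y = (\<Sum>i<m. sc_op (l i) (h (c i)))" using w hl by simp
        also have "\<dots> \<in> R.span ((\<lambda>i. h (c i)) ` {..<m})" by (intro R.span_sum R.span_scale R.span_base imageI)
        finally show "y \<in> R.span ((\<lambda>i. h (c i)) ` {..<m})" .
      qed
    qed (rule f(2))
    then show ?thesis using card_image[OF f(1)] D.dim_eq[OF one0 m] by simp
  qed
  ultimately show thesis using that by blast
qed

end

lemma (in abelian_monoid) finsum_hom:
  fixes h :: "'a \<Rightarrow> 'r::comm_monoid_add"
  assumes "h \<zero> = 0" "\<And>x y. x \<in> carrier G \<Longrightarrow> y \<in> carrier G \<Longrightarrow> h (x \<oplus> y) = h x + h y"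
    and "finite T" "\<And>t. t \<in> T \<Longrightarrow> f t \<in> carrier G"
  shows "h (\<Oplus>t\<in>T. f t) = (\<Sum>t\<in>T. h (f t))"
  using assms(3,4)
proof (induction T rule: finite_induct)
  case (insert t T)
  then have "(\<Oplus>t\<in>insert t T. f t) = f t \<oplus> (\<Oplus>t\<in>T. f t)" by (intro finsum_insert) auto
  then show ?case using insert assms(2)[of "f t" "\<Oplus>t\<in>T. f t"] by simp
qed (simp add: assms(1))

text \<open>
  The corner \<open>eAe\<close>, described as the elements on which \<open>e\<close> acts as identity from both sides.
\<close>

definition corner_algebra :: "('k::field, 'a) module \<Rightarrow> 'a \<Rightarrow> ('k, 'a) module" where
  "corner_algebra A e = A\<lparr>carrier := {x \<in> carrier A. e \<otimes>\<^bsub>A\<^esub> x = x \<and> x \<otimes>\<^bsub>A\<^esub> e = x}, one := e\<rparr>"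

lemma corner_algebra_simps:
  "x \<in> carrier (corner_algebra A e) \<longleftrightarrow> x \<in> carrier A \<and> e \<otimes>\<^bsub>A\<^esub> x = x \<and> x \<otimes>\<^bsub>A\<^esub> e = x"
  "\<one>\<^bsub>corner_algebra A e\<^esub> = e" "\<zero>\<^bsub>corner_algebra A e\<^esub> = \<zero>\<^bsub>A\<^esub>"
  "x \<otimes>\<^bsub>corner_algebra A e\<^esub> y = x \<otimes>\<^bsub>A\<^esub> y" "x \<oplus>\<^bsub>corner_algebra A e\<^esub> y = x \<oplus>\<^bsub>A\<^esub> y"
  "c \<odot>\<^bsub>corner_algebra A e\<^esub> x = c \<odot>\<^bsub>A\<^esub> x"
  by (auto simp: corner_algebra_def)

lemma lincomb_corner: "lincomb (corner_algebra A e) c u k = lincomb A c u k"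
  by (induction k) (auto simp: corner_algebra_simps)

context algebra_over begin

lemma corner_is_algebra:
  assumes e: "e \<in> carrier A" "e \<otimes>\<^bsub>A\<^esub> e = e"
  shows "is_algebra (corner_algebra A e)"
proof -
  let ?D = "corner_algebra A e"
  note s = corner_algebra_simps
  have m1: "e \<otimes>\<^bsub>A\<^esub> (x \<otimes>\<^bsub>A\<^esub> y) = x \<otimes>\<^bsub>A\<^esub> y" if "x \<in> carrier A" "y \<in> carrier A" "e \<otimes>\<^bsub>A\<^esub> x = x" for x y
    using that e A.m_assoc[of e x y] by simp
  have m2: "x \<otimes>\<^bsub>A\<^esub> y \<otimes>\<^bsub>A\<^esub> e = x \<otimes>\<^bsub>A\<^esub> y" if "x \<in> carrier A" "y \<in> carrier A" "y \<otimes>\<^bsub>A\<^esub> e = y" for x y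
    using that e A.m_assoc[of x y e] by simp
  have ag: "abelian_group ?D"
  proof (rule abelian_groupI)
    show "\<exists>y\<in>carrier ?D. y \<oplus>\<^bsub>?D\<^esub> x = \<zero>\<^bsub>?D\<^esub>" if "x \<in> carrier ?D" for x
      by (rule bexI[of _ "\<ominus>\<^bsub>A\<^esub> x"]) (use that e in \<open>auto simp: s A.l_neg A.r_minus A.l_minus\<close>)
  qed (use e in \<open>auto simp: s A.r_distr A.l_distr A.a_ac\<close>)
  have "ring ?D"
  proof (rule ringI[OF ag])
    show "Group.monoid ?D" by (rule Group.monoidI) (use e in \<open>auto simp: s A.m_assoc m1 m2\<close>)
  qed (use e in \<open>auto simp: s A.r_distr A.l_distr\<close>)
  moreover have "module (ring_of_type_algebra :: 'k ring) ?D"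
    by (rule moduleI[OF cring_from_type_algebra ag])
      (use e in \<open>auto simp: s smult_simps smult_mult ring_of_type_algebra_def\<close>)
  ultimately show ?thesis unfolding is_algebra_def by (auto simp: s smult_mult)
qed

end

context csa_involution begin

text \<open>
  With matrix units \<open>u\<^sub>i, v\<^sub>j\<close> for \<open>f\<close>, the isomorphism takes \<open>a\<close> to the matrix with entries \<open>u\<^sub>i a v\<^sub>j\<close> in the corner of
  \<open>f\<close>; its inverse is \<open>N \<mapsto> \<Sum> v\<^sub>i N\<^sub>i\<^sub>j u\<^sub>j\<close>.
\<close>

lemma division_pair_exists:
  assumes f: "T.division_corner f"
  shows "\<exists>(D :: ('k, 'a) module) r. central_division D \<and> alg_iso A (matrix_algebra r D) \<noteq> {}"
proof -
  note fD = T.division_cornerD[OF f]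
  obtain F where F: "F \<in> carrier A" "f = E.rho F" using fD(1) by (auto simp: S_def)
  have FF: "F \<otimes>\<^bsub>A\<^esub> F = F" using fD(3) F rho_eq[of "F \<otimes>\<^bsub>A\<^esub> F" F] by (simp add: E.rho_simps)
  have rFF: "E.rho F * E.rho F = E.rho F" using fD(3) F by simp
  have F0: "F \<noteq> \<zero>\<^bsub>A\<^esub>" using fD(2) F rho_zero by auto
  define D where "D = corner_algebra A F"
  have s: "x \<in> carrier D \<longleftrightarrow> x \<in> carrier A \<and> F \<otimes>\<^bsub>A\<^esub> x = x \<and> x \<otimes>\<^bsub>A\<^esub> F = x"
    "\<one>\<^bsub>D\<^esub> = F" "\<zero>\<^bsub>D\<^esub> = \<zero>\<^bsub>A\<^esub>" "x \<otimes>\<^bsub>D\<^esub> y = x \<otimes>\<^bsub>A\<^esub> y" "x \<oplus>\<^bsub>D\<^esub> y = x \<oplus>\<^bsub>A\<^esub> y" "c \<odot>\<^bsub>D\<^esub> x = c \<odot>\<^bsub>A\<^esub> x" for x y c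
    by (auto simp: D_def corner_algebra_simps)
  interpret D: algebra_over D by standard (simp add: D_def E.corner_is_algebra F FF)
  have Dc: "x \<in> carrier D \<longleftrightarrow> x \<in> carrier A \<and> f * E.rho x = E.rho x \<and> E.rho x * f = E.rho x" for x
    using F rho_eq[of "F \<otimes>\<^bsub>A\<^esub> x" x] rho_eq[of "x \<otimes>\<^bsub>A\<^esub> F" x] by (auto simp: s E.rho_simps)
  have DA: "x \<in> carrier D \<Longrightarrow> x \<in> carrier A" for x by (simp add: s)
  have FD: "F \<in> carrier D" by (simp add: s F FF)
  have inv: "\<exists>y\<in>carrier D. y \<otimes>\<^bsub>D\<^esub> x = \<one>\<^bsub>D\<^esub> \<and> x \<otimes>\<^bsub>D\<^esub> y = \<one>\<^bsub>D\<^esub>" if x: "x \<in> carrier D" "x \<noteq> \<zero>\<^bsub>D\<^esub>" for x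
  proof -
    have xA: "x \<in> carrier A" using x DA by blast
    have "E.rho x = f * E.rho x * f" using x Dc by auto
    then have "E.rho x \<in> T.corner_space f" using rho_S[OF xA] unfolding T.corner_space_def by blast
    moreover have "E.rho x \<noteq> 0" using x xA rho_eq[of x "\<zero>\<^bsub>A\<^esub>"] rho_zero by (simp add: s)
    ultimately obtain y where y: "y \<in> T.corner_space f" "y * E.rho x = f" "E.rho x * y = f"
      using T.division_corner_inverse[OF f] by blast
    then have "y \<in> S" using T.corner_space_S fD by blast
    then obtain Y where Y: "Y \<in> carrier A" "y = E.rho Y" by (auto simp: S_def)
    have "Y \<in> carrier D" using Y T.corner_space_absorb[OF fD(3) y(1)] Dc by auto
    moreover have "Y \<otimes>\<^bsub>A\<^esub> x = F" "x \<otimes>\<^bsub>A\<^esub> Y = F"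
      using y Y F xA rho_eq[of "Y \<otimes>\<^bsub>A\<^esub> x" F] rho_eq[of "x \<otimes>\<^bsub>A\<^esub> Y" F] by (auto simp: E.rho_simps)
    ultimately show ?thesis by (auto simp: s)
  qed
  have units: "Units D = carrier D - {\<zero>\<^bsub>D\<^esub>}"
  proof (intro equalityI subsetI)
    fix x assume x: "x \<in> Units D"
    then obtain y where y: "y \<in> carrier D" "x \<in> carrier D" "y \<otimes>\<^bsub>D\<^esub> x = \<one>\<^bsub>D\<^esub>" by (auto simp: Units_def)
    then have "x \<noteq> \<zero>\<^bsub>D\<^esub>" using F0 D.A.r_null[OF y(1)] by (auto simp: s)
    then show "x \<in> carrier D - {\<zero>\<^bsub>D\<^esub>}" using y by blast
  next
    fix x assume "x \<in> carrier D - {\<zero>\<^bsub>D\<^esub>}"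
    then show "x \<in> Units D" using inv[of x] unfolding Units_def by blast
  qed
  have "central_simple D" unfolding central_simple_def
  proof (intro conjI allI impI)
    show "is_algebra D" by (rule D.alg)
    show "carrier D \<noteq> {\<zero>\<^bsub>D\<^esub>}" using FD F0 by (auto simp: s(3))
    show "D.A.finite_dimension (scalars D) (carrier D)"
    proof (rule D.finite_dimension_of_lincomb[of n "\<lambda>i. F \<otimes>\<^bsub>A\<^esub> b i \<otimes>\<^bsub>A\<^esub> F"])
      show "\<one>\<^bsub>D\<^esub> \<noteq> \<zero>\<^bsub>D\<^esub>" using F0 by (simp add: s)
      show c: "F \<otimes>\<^bsub>A\<^esub> b i \<otimes>\<^bsub>A\<^esub> F \<in> carrier D" if "i < n" for i
        using that F rFF by (simp add: Dc E.rho_simps mult.assoc assoc_rule[OF rFF])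
      fix x assume x: "x \<in> carrier D"
      define c where "c = E.coord x"
      have xc: "lincomb A c b n = x" using E.coord DA[OF x] by (simp add: c_def)
      have "E.rho x = f * E.rho x * f" using x Dc by auto
      also have "\<dots> = f * (\<Sum>i<n. sc_op (c i) (E.rho (b i))) * f"
        using rho_lincomb[of n b c] xc by simp
      also have "\<dots> = (\<Sum>i<n. sc_op (c i) (E.rho (F \<otimes>\<^bsub>A\<^esub> b i \<otimes>\<^bsub>A\<^esub> F)))"
        unfolding sum_distrib_left sum_distrib_right by (intro sum.cong refl) (use F in \<open>simp add: E.rho_simps\<close>)
      also have "\<dots> = E.rho (lincomb A c (\<lambda>i. F \<otimes>\<^bsub>A\<^esub> b i \<otimes>\<^bsub>A\<^esub> F) n)"
        by (rule rho_lincomb[symmetric]) (use F in auto)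
      finally have "x = lincomb A c (\<lambda>i. F \<otimes>\<^bsub>A\<^esub> b i \<otimes>\<^bsub>A\<^esub> F) n" using DA[OF x] F by (simp add: rho_eq)
      then show "\<exists>c. x = lincomb D c (\<lambda>i. F \<otimes>\<^bsub>A\<^esub> b i \<otimes>\<^bsub>A\<^esub> F) n" by (auto simp: D_def lincomb_corner)
    qed
    show "{z \<in> carrier D. \<forall>x\<in>carrier D. z \<otimes>\<^bsub>D\<^esub> x = x \<otimes>\<^bsub>D\<^esub> z} = scalars D"
    proof (intro equalityI subsetI)
      fix z assume "z \<in> {z \<in> carrier D. \<forall>x\<in>carrier D. z \<otimes>\<^bsub>D\<^esub> x = x \<otimes>\<^bsub>D\<^esub> z}"
      then have z: "z \<in> carrier D" and comm: "\<And>x. x \<in> carrier D \<Longrightarrow> z \<otimes>\<^bsub>A\<^esub> x = x \<otimes>\<^bsub>A\<^esub> z" by (auto simp: s)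
      have "\<exists>c. E.rho z = sc_op c f"
      proof (rule T.corner_center[OF fD(1,2)])
        show "E.rho z \<in> S" "f * E.rho z = E.rho z" "E.rho z * f = E.rho z" using z Dc rho_S by auto
        fix x assume "x \<in> S"
        then obtain x' where x': "x' \<in> carrier A" "x = E.rho x'" by (auto simp: S_def)
        have "F \<otimes>\<^bsub>A\<^esub> x' \<otimes>\<^bsub>A\<^esub> F \<in> carrier D"
          using x' F rFF by (simp add: Dc E.rho_simps mult.assoc assoc_rule[OF rFF])
        from arg_cong[OF comm[OF this], of E.rho] show "E.rho z * (f * x * f) = f * x * f * E.rho z"
          using x' F DA[OF z] by (simp add: E.rho_simps)
      qed
      then obtain c where "E.rho z = sc_op c f" by blast
      then have "z = c \<odot>\<^bsub>A\<^esub> F" using F DA[OF z] rho_eq[of z "c \<odot>\<^bsub>A\<^esub> F"] by (simp add: E.rho_simps)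
      then show "z \<in> scalars D" by (auto simp: scalars_def s(2,6))
    next
      fix z assume "z \<in> scalars D"
      then obtain c where "z = c \<odot>\<^bsub>D\<^esub> \<one>\<^bsub>D\<^esub>" by (auto simp: scalars_def)
      then show "z \<in> {z \<in> carrier D. \<forall>x\<in>carrier D. z \<otimes>\<^bsub>D\<^esub> x = x \<otimes>\<^bsub>D\<^esub> z}"
        by (simp add: D.smult_mult)
    qed
    fix I assume I: "ideal I D"
    interpret I: ideal I D by (rule I)
    show "I = {\<zero>\<^bsub>D\<^esub>} \<or> I = carrier D"
    proof (cases "I \<subseteq> {\<zero>\<^bsub>D\<^esub>}")
      case True
      then show ?thesis using I.zero_closed by blast
    next
      case False
      then obtain x where x: "x \<in> I" "x \<noteq> \<zero>\<^bsub>D\<^esub>" by blast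
      then obtain y where "y \<in> carrier D" "y \<otimes>\<^bsub>D\<^esub> x = \<one>\<^bsub>D\<^esub>" using inv[of x] I.Icarr by blast
      then have "\<one>\<^bsub>D\<^esub> \<in> I" using I.I_l_closed[of x y] x by simp
      then show ?thesis using I.one_imp_carrier by blast
    qed
  qed
  then have cd: "central_division D" using units by (simp add: central_division_def)
  obtain r u v where m: "T.matrix_units f r u v" and one: "(\<Sum>i<r. v i * u i) = 1" by (rule T.matrix_units_exist[OF f])
  have mS: "u i \<in> S" "v i \<in> S" "f * u i = u i" "v i * f = v i" if "i < r" for i
    using m that by (auto simp: T.matrix_units_def)
  have muv: "u i * v j = (if i = j then f else 0)" if "i < r" "j < r" for i j using m that by (auto simp: T.matrix_units_def)
  have "\<exists>x\<in>carrier A. E.rho x = y" if "y \<in> S" for y using that by (auto simp: S_def)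
  then obtain lift where lift: "\<And>y. y \<in> S \<Longrightarrow> lift y \<in> carrier A" "\<And>y. y \<in> S \<Longrightarrow> E.rho (lift y) = y" by metis
  let ?M = "matrix_algebra r D"
  define \<phi> where "\<phi> a = (\<lambda>(i, j)\<in>{..<r} \<times> {..<r}. lift (u i * E.rho a * v j))" for a
  have uvS: "u i * E.rho a * v j \<in> S" if "a \<in> carrier A" "i < r" "j < r" for a i j
    using that mS rho_S by simp
  have \<phi>: "\<phi> a (i, j) \<in> carrier D" "E.rho (\<phi> a (i, j)) = u i * E.rho a * v j" if "a \<in> carrier A" "i < r" "j < r" for a i j
  proof -
    show 1: "E.rho (\<phi> a (i, j)) = u i * E.rho a * v j" using that lift(2)[OF uvS[OF that]] by (simp add: \<phi>_def)
    have "\<phi> a (i, j) \<in> carrier A" using that lift(1)[OF uvS[OF that]] by (simp add: \<phi>_def)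
    then show "\<phi> a (i, j) \<in> carrier D" unfolding Dc 1 using mS that by (simp add: mult.assoc assoc_rule[OF mS(3)])
  qed
  have \<phi>c: "\<phi> a \<in> carrier ?M" if "a \<in> carrier A" for a
  proof -
    have "\<phi> a p \<in> carrier D" if "p \<in> {..<r} \<times> {..<r}" for p using that \<phi>(1)[OF \<open>a \<in> carrier A\<close>] by auto
    then show ?thesis unfolding matrix_algebra_simps by (auto simp: \<phi>_def)
  qed
  have M_eqI: "M = N" if "M \<in> carrier ?M" "N \<in> carrier ?M" "\<And>i j. i < r \<Longrightarrow> j < r \<Longrightarrow> E.rho (M (i, j)) = E.rho (N (i, j))" for M N
  proof (rule PiE_ext[OF that(1,2)[unfolded matrix_algebra_simps]])
    fix p assume p: "p \<in> {..<r} \<times> {..<r}"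
    then obtain i j where ij: "p = (i, j)" "i < r" "j < r" by auto
    have "M p \<in> carrier A" "N p \<in> carrier A" using that(1,2) p DA unfolding matrix_algebra_simps by blast+
    then show "M p = N p" using that(3)[OF ij(2,3)] ij rho_eq by auto
  qed
  have rho_finsum: "E.rho (\<Oplus>\<^bsub>D\<^esub>k\<in>{..<m}. g k) = (\<Sum>k<m. E.rho (g k))" if "\<And>k. k < m \<Longrightarrow> g k \<in> carrier D" for g and m :: nat
  proof (rule D.A.finsum_hom)
    show "E.rho \<zero>\<^bsub>D\<^esub> = 0" unfolding s(3) by (rule rho_zero)
    show "E.rho (x \<oplus>\<^bsub>D\<^esub> y) = E.rho x + E.rho y" if "x \<in> carrier D" "y \<in> carrier D" for x y
      unfolding s(5) by (rule E.rho_simps(1)) (use that DA in auto)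
  qed (use that in auto)
  have Mcar: "(\<lambda>p\<in>{..<r} \<times> {..<r}. g p) \<in> carrier ?M" if "\<And>i j. i < r \<Longrightarrow> j < r \<Longrightarrow> g (i, j) \<in> carrier D" for g
    using that by (auto simp: matrix_algebra_simps)
  have decomp: "(\<Sum>i<r. \<Sum>j<r. v i * (u i * a * v j) * u j) = a" for a
  proof -
    have "(\<Sum>i<r. \<Sum>j<r. v i * (u i * a * v j) * u j) = (\<Sum>i<r. v i * u i) * a * (\<Sum>j<r. v j * u j)"
      by (simp add: sum_distrib_left sum_distrib_right mult.assoc) (rule sum.swap)
    then show ?thesis by (simp add: one)
  qed
  have "\<phi> \<in> ring_hom A ?M"
  proof (rule ring_hom_memI)
    fix a c assume ac: "a \<in> carrier A" "c \<in> carrier A"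
    show "\<phi> (a \<otimes>\<^bsub>A\<^esub> c) = \<phi> a \<otimes>\<^bsub>?M\<^esub> \<phi> c"
    proof (rule M_eqI)
      show "\<phi> a \<otimes>\<^bsub>?M\<^esub> \<phi> c \<in> carrier ?M"
        using \<phi>(1) ac by (simp add: matrix_algebra_def Let_def case_prod_unfold PiE_iff D.A.finsum_closed)
      fix i j assume ij: "i < r" "j < r"
      have "E.rho ((\<phi> a \<otimes>\<^bsub>?M\<^esub> \<phi> c) (i, j)) = (\<Sum>k<r. E.rho (\<phi> a (i, k) \<otimes>\<^bsub>D\<^esub> \<phi> c (k, j)))"
        using ij ac \<phi>(1) by (subst matrix_algebra_simps(2)[OF ij], intro rho_finsum) auto
      also have "\<dots> = (\<Sum>k<r. u i * E.rho a * (v k * u k) * (E.rho c * v j))"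
        by (intro sum.cong refl) (use ij ac \<phi> DA in \<open>simp add: s(4) E.rho_simps mult.assoc\<close>)
      also have "\<dots> = u i * E.rho a * (\<Sum>k<r. v k * u k) * (E.rho c * v j)"
        by (simp only: sum_distrib_left sum_distrib_right)
      also have "\<dots> = E.rho (\<phi> (a \<otimes>\<^bsub>A\<^esub> c) (i, j))" using ij ac \<phi>(2) by (simp add: one E.rho_simps mult.assoc)
      finally show "E.rho (\<phi> (a \<otimes>\<^bsub>A\<^esub> c) (i, j)) = E.rho ((\<phi> a \<otimes>\<^bsub>?M\<^esub> \<phi> c) (i, j))" by simp
    qed (use ac in \<open>auto intro!: \<phi>c\<close>)
    show "\<phi> (a \<oplus>\<^bsub>A\<^esub> c) = \<phi> a \<oplus>\<^bsub>?M\<^esub> \<phi> c"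
    proof (rule M_eqI)
      show "\<phi> a \<oplus>\<^bsub>?M\<^esub> \<phi> c \<in> carrier ?M"
        using \<phi>(1) ac by (auto simp: matrix_algebra_def Let_def case_prod_unfold PiE_iff)
    qed (use ac \<phi> DA in \<open>auto intro!: \<phi>c simp: matrix_algebra_simps(5) s(5) E.rho_simps algebra_simps\<close>)
  next
    show "\<phi> \<one>\<^bsub>A\<^esub> = \<one>\<^bsub>?M\<^esub>"
    proof (rule M_eqI)
      show "\<one>\<^bsub>?M\<^esub> \<in> carrier ?M" by (auto simp: matrix_algebra_def Let_def)
    qed (use \<phi> muv F rho_zero in \<open>auto intro!: \<phi>c simp: matrix_algebra_simps(3) s(2,3) E.rho_simps\<close>)
  qed (rule \<phi>c)
  moreover have "bij_betw \<phi> (carrier A) (carrier ?M)"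
  proof (rule bij_betwI')
    fix a c assume ac: "a \<in> carrier A" "c \<in> carrier A"
    have "a = c" if eq: "\<phi> a = \<phi> c"
    proof -
      have *: "(\<Sum>i<r. \<Sum>j<r. v i * E.rho (\<phi> a (i, j)) * u j) = E.rho a" if "a \<in> carrier A" for a
        by (subst (2) decomp[symmetric], intro sum.cong refl) (use \<phi>(2) that in simp)
      have "E.rho a = E.rho c" using *[OF ac(1)] *[OF ac(2)] eq by simp
      then show ?thesis using rho_eq ac by blast
    qed
    then show "(\<phi> a = \<phi> c) = (a = c)" by blast
  next
    fix N assume N: "N \<in> carrier ?M"
    have Nc: "N (i, j) \<in> carrier D" if "i < r" "j < r" for i j using N that by (auto simp: matrix_algebra_simps)
    define y where "y = (\<Sum>i<r. \<Sum>j<r. v i * E.rho (N (i, j)) * u j)"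
    have yS: "y \<in> S" unfolding y_def by (intro T.S_sum T.S_mult mS rho_S DA Nc) auto
    have "N = \<phi> (lift y)"
    proof (rule M_eqI[OF N])
      show "\<phi> (lift y) \<in> carrier ?M" by (intro \<phi>c lift yS)
      fix i j assume ij: "i < r" "j < r"
      have "u i * y * v j = (\<Sum>i'<r. \<Sum>j'<r. (u i * v i') * E.rho (N (i', j')) * (u j' * v j))"
        by (simp add: y_def sum_distrib_left sum_distrib_right mult.assoc)
      also have "\<dots> = (\<Sum>i'<r. \<Sum>j'<r. if j' = j then if i = i' then f * E.rho (N (i', j')) * f else 0 else 0)"
        by (intro sum.cong refl) (use ij muv in auto)
      also have "\<dots> = (\<Sum>i'<r. if i = i' then f * E.rho (N (i', j)) * f else 0)"
        using ij by (intro sum.cong refl) simp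
      also have "\<dots> = f * E.rho (N (i, j)) * f" using ij by simp
      also have "\<dots> = E.rho (N (i, j))" using Nc[OF ij] Dc by auto
      finally show "E.rho (N (i, j)) = E.rho (\<phi> (lift y) (i, j))" using \<phi>(2)[OF _ ij] lift[OF yS] by simp
    qed
    then show "\<exists>a\<in>carrier A. N = \<phi> a" using lift yS by blast
  qed (rule \<phi>c)
  moreover have "\<phi> (c \<odot>\<^bsub>A\<^esub> a) = c \<odot>\<^bsub>?M\<^esub> \<phi> a" if a: "a \<in> carrier A" for c a
  proof (rule M_eqI)
    show "c \<odot>\<^bsub>?M\<^esub> \<phi> a \<in> carrier ?M"
      using \<phi>(1) a by (auto simp: matrix_algebra_def Let_def case_prod_unfold PiE_iff)
  qed (use a \<phi> DA in \<open>auto intro!: \<phi>c simp: matrix_algebra_simps(6) s(6) E.rho_simps\<close>)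
  ultimately have "\<phi> \<in> alg_iso A ?M" by (simp add: alg_iso_def ring_iso_def)
  then show ?thesis using cd by blast
qed

text \<open>
  Every representation of \<open>A\<close> as a matrix algebra over a division algebra \<open>D\<close> gives a division corner of the dimension of \<open>D\<close>, and
  all division corners have the same dimension; so the definite description of the index is legitimate.
\<close>

lemma alg_ind_eq:
  assumes f: "T.division_corner f"
  shows "alg_ind A = sqrt (real (R.dim (T.corner_space f)))"
proof -
  have eq: "alg_deg D = sqrt (real (R.dim (T.corner_space f)))"
    if "central_division D" "alg_iso A (matrix_algebra r D) \<noteq> {}" for D :: "('k, 'a) module" and r
  proof -
    obtain \<phi> where "\<phi> \<in> alg_iso A (matrix_algebra r D)" using \<open>alg_iso A (matrix_algebra r D) \<noteq> {}\<close> by blast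
    then obtain g where g: "T.division_corner g" "R.dim (T.corner_space g) = ring.dim D (scalars D) (carrier D)"
      using pair_dim[OF \<open>central_division D\<close>] by blast
    show ?thesis using T.division_corner_dim[OF f g(1)] g(2) by (simp add: alg_deg_def)
  qed
  show ?thesis unfolding alg_ind_def
  proof (rule the_equality)
    show "\<exists>(D :: ('k, 'a) module) r. central_division D \<and> alg_deg D = sqrt (real (R.dim (T.corner_space f))) \<and>
        alg_iso A (matrix_algebra r D) \<noteq> {}"
      using division_pair_exists[OF f] eq by blast
  qed (use eq in blast)
qed

lemma corner_dim_le_of_index:
  assumes "alg_ind A \<le> 2" "T.division_corner f"
  shows "R.dim (T.corner_space f) \<le> 4"
proof -
  have "sqrt (real (R.dim (T.corner_space f))) \<le> sqrt 4" using assms alg_ind_eq by simp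
  then show ?thesis by (simp only: real_sqrt_le_iff)
qed

end

section \<open>Orthogonal frames after scalar extension\<close>

lemma field_extension_two:
  assumes "field_extension (\<iota> :: 'k::field \<Rightarrow> 'l::field)" "(2::'k) \<noteq> 0"
  shows "(2::'l) \<noteq> 0"
proof
  assume z: "(2::'l) = 0"
  have add: "\<iota> (x + y) = \<iota> x + \<iota> y" and mul: "\<iota> (x * y) = \<iota> x * \<iota> y" and one: "\<iota> 1 = 1" for x y
    using assms(1) by (auto simp: field_extension_def ring_hom_def ring_of_type_algebra_def)
  have "\<iota> (1 + 1) = 0" using z unfolding add one by simp
  then have t: "\<iota> 2 = 0" by simp
  have "\<iota> (2 * inverse 2) = 0" unfolding mul t by simp
  moreover have "(2::'k) * inverse 2 = 1" using assms(2) by simp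
  ultimately show False using one by simp
qed

context csa_involution begin

lemma lift_exists: "\<exists>lift. (\<forall>y\<in>S. lift y \<in> carrier A \<and> E.rho (lift y) = y)"
proof (rule bchoice, rule ballI)
  fix y assume "y \<in> S"
  then obtain x where "x \<in> carrier A" "y = E.rho x" by (auto simp: S_def)
  then show "\<exists>x. x \<in> carrier A \<and> E.rho x = y" by blast
qed

lemma is_symplectic_csa:
  fixes \<kappa> :: "'k \<Rightarrow> 'm::field"
  assumes ext: "field_extension \<kappa>" and sy: "symplectic_over \<kappa> A \<sigma>" and two: "(2::'k) \<noteq> 0" and n: "n = 64"
  shows "symplectic_csa sc_op star_op S"
proof
  show "(2::'k) \<noteq> 0" by (rule two)
  show "R.dim S = 64" using dim_S n by simp
  interpret K: based_extension A \<kappa> \<sigma> n b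
    by unfold_locales (use ext inv basis n_pos in auto)
  obtain m \<phi> G where \<phi>: "\<phi> \<in> alg_iso (base_change \<kappa> A) (matrix_algebra m field_algebra)"
    and alt: "\<And>x. gram_form m G x x = 0"
    and nd: "\<And>x. (\<And>y. gram_form m G x y = 0) \<Longrightarrow> (\<forall>i<m. x i = 0)"
    and adj: "\<And>a x y. a \<in> carrier (base_change \<kappa> A) \<Longrightarrow> gram_form m G (mat_vec m (\<phi> a) x) y =
           gram_form m G x (mat_vec m (\<phi> (base_change_map \<kappa> A \<sigma> a)) y)"
    using sy unfolding symplectic_over_def by (elim exE conjE) metis
  obtain lift where lift: "\<And>y. y \<in> S \<Longrightarrow> lift y \<in> carrier A" "\<And>y. y \<in> S \<Longrightarrow> E.rho (lift y) = y"
    using lift_exists by blast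
  fix f s t
  assume f: "f \<in> S" "f * f = f" and q: "\<exists>q::nat \<Rightarrow> 'k starop. (\<forall>k<4. q k \<in> S) \<and> (\<forall>x\<in>S. \<exists>c. f * x * f = (\<Sum>k<4. sc_op (c k) (q k)))"
    and s: "s \<in> S" "star_op s = s" "star_op f * s * f = s" and t: "t \<in> S" "star_op t = t" "f * t * star_op f = t"
  obtain q where q: "\<And>k. k < (4::nat) \<Longrightarrow> q k \<in> S" "\<And>x. x \<in> S \<Longrightarrow> \<exists>c. f * x * f = (\<Sum>k<4. sc_op (c k) (q k))"
    using q by blast
  note lf = lift[OF f(1)] and ls = lift[OF s(1)] and lt = lift[OF t(1)]
  have lq: "lift (q k) \<in> carrier A" "E.rho (lift (q k)) = q k" if "k < 4" for k using lift q(1)[OF that] by auto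
  have AI: "x = y" if "x \<in> carrier A" "y \<in> carrier A" "E.rho x = E.rho y" for x y using rho_eq that by blast
  have span: "\<exists>c. lift f \<otimes>\<^bsub>A\<^esub> x \<otimes>\<^bsub>A\<^esub> lift f = lincomb A c (\<lambda>k. lift (q k)) 4" if x: "x \<in> carrier A" for x
  proof -
    obtain c where c: "f * E.rho x * f = (\<Sum>k<4. sc_op (c k) (q k))" using q(2)[OF rho_S[OF x]] by blast
    have "E.rho (lift f \<otimes>\<^bsub>A\<^esub> x \<otimes>\<^bsub>A\<^esub> lift f) = E.rho (lincomb A c (\<lambda>k. lift (q k)) 4)"
      using x lf lq c by (subst rho_lincomb) (auto simp: E.rho_simps)
    then show ?thesis using AI x lf lq by (intro exI[of _ c]) (auto intro!: AI)
  qed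
  note spl = K.splitting_symm[OF \<phi> alt nd adj field_extension_two[OF ext two], of "lift f" "\<lambda>k. lift (q k)" "lift s" "lift t"]
  have h: "lift f \<otimes>\<^bsub>A\<^esub> lift f = lift f" "\<sigma> (lift s) = lift s" "\<sigma> (lift f) \<otimes>\<^bsub>A\<^esub> lift s \<otimes>\<^bsub>A\<^esub> lift f = lift s"
    "\<sigma> (lift t) = lift t" "lift f \<otimes>\<^bsub>A\<^esub> lift t \<otimes>\<^bsub>A\<^esub> \<sigma> (lift f) = lift t"
    using lf ls lt f s t by (auto intro!: AI simp: E.rho_simps)
  show "(\<forall>x\<in>S. t * s * (f * x * f) = f * x * f * (t * s)) \<and> (s \<noteq> 0 \<longrightarrow> t \<noteq> 0 \<longrightarrow> t * s \<noteq> 0)"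
  proof (intro conjI ballI impI)
    fix x assume x: "x \<in> S"
    note lx = lift[OF x]
    have "lift t \<otimes>\<^bsub>A\<^esub> lift s \<otimes>\<^bsub>A\<^esub> (lift f \<otimes>\<^bsub>A\<^esub> lift x \<otimes>\<^bsub>A\<^esub> lift f) = lift f \<otimes>\<^bsub>A\<^esub> lift x \<otimes>\<^bsub>A\<^esub> lift f \<otimes>\<^bsub>A\<^esub> (lift t \<otimes>\<^bsub>A\<^esub> lift s)"
      by (rule spl(1)) (use lf ls lt lq lx h span in auto)
    from arg_cong[OF this, of E.rho] show "t * s * (f * x * f) = f * x * f * (t * s)"
      using lf ls lt lx by (simp add: E.rho_simps)
  next
    assume nz: "s \<noteq> 0" "t \<noteq> 0"
    have "lift t \<otimes>\<^bsub>A\<^esub> lift s \<noteq> \<zero>\<^bsub>A\<^esub>"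
    proof (rule spl(2))
      show "lift s \<noteq> \<zero>\<^bsub>A\<^esub>" "lift t \<noteq> \<zero>\<^bsub>A\<^esub>" using nz ls lt rho_zero by auto
    qed (use lf ls lt lq h span in auto)
    then show "t * s \<noteq> 0" using ls lt rho_eq[of "lift t \<otimes>\<^bsub>A\<^esub> lift s" "\<zero>\<^bsub>A\<^esub>"] rho_zero by (simp add: E.rho_simps)
  qed
qed

text \<open>
  The relations between \<open>e, i, j\<close> and the vectors of the frame are equations in \<open>A\<close>, hence hold for their images in \<open>A\<^sub>L\<close>. Only
  the statement that the corner is spanned by four elements needs an argument: it is linear, so pure tensors suffice.
\<close>

lemma extended_similitude_triv:
  fixes \<iota> :: "'k \<Rightarrow> 'l::field"
  assumes L: "based_extension A \<iota> \<sigma> n b"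
    and two: "(2::'k) \<noteq> 0"
    and fr: "quaternion_frame sc_op star_op S e i j \<alpha> \<beta>"
      "quaternion_frame.frame sc_op star_op S e x1 x2 x3 x4"
    and g: "star_algebra.simil sc_op star_op (based_extension.hat A \<iota> \<sigma> n b ` carrier (base_change \<iota> A)) g"
  shows "star_algebra.triv sc_op star_op (based_extension.hat A \<iota> \<sigma> n b ` carrier (base_change \<iota> A)) g"
proof -
  interpret L: based_extension A \<iota> \<sigma> n b by (rule L)
  define SL where "SL = L.hat ` carrier (base_change \<iota> A)"
  interpret Q: quaternion_frame sc_op star_op S e i j \<alpha> \<beta> by (rule fr(1))
  interpret LS: star_algebra sc_op star_op SL unfolding SL_def by (rule L.hat_star_algebra)
  obtain lift where lift: "\<And>y. y \<in> S \<Longrightarrow> lift y \<in> carrier A" "\<And>y. y \<in> S \<Longrightarrow> E.rho (lift y) = y"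
    using lift_exists by blast
  \<comment> \<open>the map \<open>a \<mapsto> a \<otimes> 1\<close> in terms of operators\<close>
  define \<tau> where "\<tau> y = L.rho (lift y)" for y
  have lift_eq: "lift y = x" if "y = E.rho x" "x \<in> carrier A" for x y
    using that lift[of y] rho_S[of x] rho_eq[of "lift y" x] by simp
  have \<tau>: "\<tau> (y + z) = \<tau> y + \<tau> z" "\<tau> (y * z) = \<tau> y * \<tau> z" if "y \<in> S" "z \<in> S" for y z
    using lift_eq[of "y + z" "lift y \<oplus>\<^bsub>A\<^esub> lift z"] lift_eq[of "y * z" "lift y \<otimes>\<^bsub>A\<^esub> lift z"] lift[OF that(1)] lift[OF that(2)]
    by (simp_all add: \<tau>_def E.rho_simps L.rho_simps)
  have \<tau>s: "\<tau> (sc_op c y) = sc_op (\<iota> c) (\<tau> y)" "\<tau> (star_op y) = star_op (\<tau> y)" if "y \<in> S" for y c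
    using lift_eq[of "sc_op c y" "c \<odot>\<^bsub>A\<^esub> lift y"] lift_eq[of "star_op y" "\<sigma> (lift y)"] lift[OF that]
    by (simp_all add: \<tau>_def E.rho_simps L.rho_simps)
  have \<tau>1: "\<tau> 1 = 1" using lift_eq[of 1 "\<one>\<^bsub>A\<^esub>"] by (simp add: \<tau>_def E.rho_simps L.rho_simps)
  have \<tau>0: "\<tau> 0 = 0" using \<tau>s(1)[of 1 0] T.S_one by simp
  have \<tau>m: "\<tau> (- y) = - \<tau> y" if "y \<in> S" for y
  proof -
    have "\<tau> y + \<tau> (- y) = \<tau> (y + - y)" using that by (intro \<tau>(1)[symmetric]) auto
    then have "\<tau> y + \<tau> (- y) = 0" using \<tau>0 by simp
    then show ?thesis by (simp add: eq_neg_iff_add_eq_0 add.commute)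
  qed
  have \<tau>_inj: "y = z" if "\<tau> y = \<tau> z" "y \<in> S" "z \<in> S" for y z
    using that lift[of y] lift[of z] L.rho_inj unfolding \<tau>_def inj_on_def by metis
  have \<tau>_nz: "\<tau> y \<noteq> 0" if "y \<in> S" "y \<noteq> 0" for y using \<tau>_inj[of y 0] that \<tau>0 T.S_zero by auto
  have \<tau>S: "\<tau> y \<in> SL" if "y \<in> S" for y
    using lift(1)[OF that] L.hat(3)[of "lift y" 1] unfolding SL_def \<tau>_def by (intro image_eqI[of _ _ "pure_tensor \<iota> A (lift y) 1"]) auto
  have i0: "\<iota> c \<noteq> 0" if "c \<noteq> 0" for c using L.iota_inj[of c 0] that by auto
  have eS: "e \<in> S" "i \<in> S" "j \<in> S" "i * j \<in> S" "i * i \<in> S" "j * j \<in> S" "j * i \<in> S" by auto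
  interpret LQ: quaternion_frame sc_op star_op SL "\<tau> e" "\<tau> i" "\<tau> j" "\<iota> \<alpha>" "\<iota> \<beta>"
  proof
    show "(2::'l) \<noteq> 0" by (rule field_extension_two[OF L.ext two])
    show "\<iota> \<alpha> \<noteq> 0" "\<iota> \<beta> \<noteq> 0" using i0 Q.ab by auto
    show "star_op (\<tau> e) = \<tau> e" "star_op (\<tau> i) = - \<tau> i" "star_op (\<tau> j) = - \<tau> j"
      using \<tau>s(2)[OF eS(1)] \<tau>s(2)[OF eS(2)] \<tau>s(2)[OF eS(3)] \<tau>m eS by simp_all
    show "\<tau> e \<noteq> 0" using \<tau>_nz Q.e_neq by simp
    show "\<tau> e * \<tau> e = \<tau> e" "\<tau> e * \<tau> i = \<tau> i" "\<tau> i * \<tau> e = \<tau> i" "\<tau> e * \<tau> j = \<tau> j" "\<tau> j * \<tau> e = \<tau> j"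
      by (simp_all flip: \<tau>(2))
    show "\<tau> i * \<tau> i = sc_op (\<iota> \<alpha>) (\<tau> e)" "\<tau> j * \<tau> j = sc_op (\<iota> \<beta>) (\<tau> e)"
      by (simp_all add: Q.ii Q.jj flip: \<tau>(2) \<tau>s)
    show "\<tau> j * \<tau> i = - (\<tau> i * \<tau> j)" using \<tau>m[OF eS(4)] Q.ji by (simp flip: \<tau>(2))
    fix s assume "s \<in> SL"
    then obtain x where x: "x \<in> carrier (base_change \<iota> A)" "s = L.hat x" by (auto simp: SL_def)
    have "\<exists>q0 q1 q2 q3. \<tau> e * L.hat x * \<tau> e = sc_op q0 (\<tau> e) + sc_op q1 (\<tau> i) + sc_op q2 (\<tau> j) + sc_op q3 (\<tau> i * \<tau> j)"
      using x(1)
    proof (induction rule: L.B_induct)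
      case zero
      show ?case by (intro exI[of _ 0]) (simp add: L.hat_zero)
    next
      case (pt a l)
      obtain q0 q1 q2 q3 where "e * E.rho a * e = sc_op q0 e + sc_op q1 i + sc_op q2 j + sc_op q3 (i * j)"
        using Q.corner[OF rho_S[OF pt]] by blast
      from arg_cong[OF this, of \<tau>] have "\<tau> e * \<tau> (E.rho a) * \<tau> e =
          sc_op (\<iota> q0) (\<tau> e) + sc_op (\<iota> q1) (\<tau> i) + sc_op (\<iota> q2) (\<tau> j) + sc_op (\<iota> q3) (\<tau> i * \<tau> j)"
        using rho_S[OF pt] by (simp add: \<tau> \<tau>s)
      moreover have "\<tau> (E.rho a) = L.rho a" using lift_eq[OF refl pt] by (simp add: \<tau>_def)
      ultimately show ?case using pt
        by (intro exI[of _ "l * \<iota> q0"] exI[of _ "l * \<iota> q1"] exI[of _ "l * \<iota> q2"] exI[of _ "l * \<iota> q3"])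
          (simp add: L.hat R.scale_right_distrib)
    next
      case (add x y)
      from add.IH obtain q0 q1 q2 q3 p0 p1 p2 p3 where
        "\<tau> e * L.hat x * \<tau> e = sc_op q0 (\<tau> e) + sc_op q1 (\<tau> i) + sc_op q2 (\<tau> j) + sc_op q3 (\<tau> i * \<tau> j)"
        "\<tau> e * L.hat y * \<tau> e = sc_op p0 (\<tau> e) + sc_op p1 (\<tau> i) + sc_op p2 (\<tau> j) + sc_op p3 (\<tau> i * \<tau> j)" by blast
      then show ?case using add.hyps
        by (intro exI[of _ "q0 + p0"] exI[of _ "q1 + p1"] exI[of _ "q2 + p2"] exI[of _ "q3 + p3"])
          (simp add: L.hat R.scale_left_distrib distrib_left distrib_right)
    qed
    then show "\<exists>q0 q1 q2 q3. \<tau> e * s * \<tau> e = sc_op q0 (\<tau> e) + sc_op q1 (\<tau> i) + sc_op q2 (\<tau> j) + sc_op q3 (\<tau> i * \<tau> j)"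
      by (simp add: x)
  qed (use eS \<tau>S in auto)
  have fr': "Q.vec x1" "Q.vec x2" "Q.vec x3" "Q.vec x4" "Q.nrm x1 \<noteq> 0" "Q.nrm x2 \<noteq> 0" "Q.nrm x3 \<noteq> 0" "Q.nrm x4 \<noteq> 0"
     "star_op x1 * x2 = 0" "star_op x1 * x3 = 0" "star_op x1 * x4 = 0" "star_op x2 * x3 = 0" "star_op x2 * x4 = 0" "star_op x3 * x4 = 0"
     "sc_op (1 / Q.nrm x1) (x1 * star_op x1) + sc_op (1 / Q.nrm x2) (x2 * star_op x2) +
     sc_op (1 / Q.nrm x3) (x3 * star_op x3) + sc_op (1 / Q.nrm x4) (x4 * star_op x4) = 1"
    using fr(2) unfolding Q.frame_def by simp_all
  note xS = Q.vecD(1)[OF fr'(1)] Q.vecD(1)[OF fr'(2)] Q.vecD(1)[OF fr'(3)] Q.vecD(1)[OF fr'(4)]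
  have vec: "LQ.vec (\<tau> x)" and nrm: "LQ.nrm (\<tau> x) = \<iota> (Q.nrm x)" if x: "Q.vec x" for x
  proof -
    note xS = Q.vecD(1)[OF x]
    show "LQ.vec (\<tau> x)" using \<tau>S xS Q.vecD(2)[OF x] by (simp add: LQ.vec_def flip: \<tau>(2))
    show "LQ.nrm (\<tau> x) = \<iota> (Q.nrm x)"
      by (rule LQ.nrm_eqI) (use Q.norm[OF x] xS in \<open>simp flip: \<tau>(2) \<tau>s\<close>)
  qed
  have i_div: "1 / \<iota> c = \<iota> (1 / c)" if "c \<noteq> 0" for c
    using i0[OF that] L.iota(2)[of "1 / c" c] that by (simp add: field_simps)
  have orth: "star_op (\<tau> x) * \<tau> y = 0" if "star_op x * y = 0" "x \<in> S" "y \<in> S" for x y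
    using that \<tau>0 by (simp flip: \<tau>(2) \<tau>s)
  have "LQ.frame (\<tau> x1) (\<tau> x2) (\<tau> x3) (\<tau> x4)" unfolding LQ.frame_def
  proof (intro conjI)
    have "sc_op (1 / \<iota> (Q.nrm x1)) (\<tau> x1 * star_op (\<tau> x1)) + sc_op (1 / \<iota> (Q.nrm x2)) (\<tau> x2 * star_op (\<tau> x2)) +
     sc_op (1 / \<iota> (Q.nrm x3)) (\<tau> x3 * star_op (\<tau> x3)) + sc_op (1 / \<iota> (Q.nrm x4)) (\<tau> x4 * star_op (\<tau> x4)) = \<tau> 1"
      unfolding fr'(15)[symmetric] i_div[OF fr'(5)] i_div[OF fr'(6)] i_div[OF fr'(7)] i_div[OF fr'(8)]
      using xS by (simp add: \<tau> \<tau>s)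
    then show "sc_op (1 / LQ.nrm (\<tau> x1)) (\<tau> x1 * star_op (\<tau> x1)) + sc_op (1 / LQ.nrm (\<tau> x2)) (\<tau> x2 * star_op (\<tau> x2)) +
     sc_op (1 / LQ.nrm (\<tau> x3)) (\<tau> x3 * star_op (\<tau> x3)) + sc_op (1 / LQ.nrm (\<tau> x4)) (\<tau> x4 * star_op (\<tau> x4)) = 1"
      by (simp only: nrm[OF fr'(1)] nrm[OF fr'(2)] nrm[OF fr'(3)] nrm[OF fr'(4)] \<tau>1)
  qed (intro vec fr' orth xS | simp only: nrm fr'(1-4), rule i0, rule fr')+
  moreover obtain c where "LQ.multiplier g c" using g LQ.simil_iff unfolding SL_def by blast
  ultimately show ?thesis using LQ.simil_triv unfolding SL_def by blast
qed

end

lemma csa_involution_exists: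
  assumes cs: "central_simple A" and inv: "involution A \<sigma>" and deg: "alg_deg A = 8"
  obtains b where "csa_involution A \<sigma> 64 b"
proof -
  interpret A: algebra_over A by standard (use cs in \<open>simp add: central_simple_def\<close>)
  obtain m where m: "A.A.dimension m (scalars A) (carrier A)"
    using cs by (auto simp: central_simple_def A.A.finite_dimension_def)
  have "sqrt (real m) = 8" using deg A.dim_eq[OF central_simple_one[OF cs] m] by (simp add: alg_deg_def)
  then have "(sqrt (real m))\<^sup>2 = 8\<^sup>2" by simp
  then have "m = 64" by simp
  then obtain b where "basis_of A (carrier A) 64 b" using A.basis_exists m by blast
  then have "csa_involution A \<sigma> 64 b" using cs inv by unfold_locales
  then show thesis using that by blast
qed

section \<open>Rational curves in the group of projective similitudes\<close>

lemma (in abelian_monoid) finsum_lessThan_add: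
  fixes f :: "nat \<Rightarrow> 'a"
  assumes "\<And>i. i < p + q \<Longrightarrow> f i \<in> carrier G"
  shows "(\<Oplus>i\<in>{..<p + q}. f i) = (\<Oplus>i\<in>{..<p}. f i) \<oplus> (\<Oplus>i\<in>{..<q}. f (p + i))"
  using assms
proof (induction q)
  case 0
  then have "(\<Oplus>i\<in>{..<p}. f i) \<in> carrier G" by (intro finsum_closed) auto
  then show ?case by simp
next
  case (Suc q)
  have c: "(\<Oplus>i\<in>{..<p}. f i) \<in> carrier G" "(\<Oplus>i\<in>{..<q}. f (p + i)) \<in> carrier G" "f (p + q) \<in> carrier G"
    using Suc.prems by (auto intro!: finsum_closed)
  have "(\<Oplus>i\<in>{..<p + Suc q}. f i) = f (p + q) \<oplus> (\<Oplus>i\<in>{..<p + q}. f i)"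
    using Suc.prems by (simp add: lessThan_Suc finsum_insert)
  moreover have "(\<Oplus>i\<in>{..<Suc q}. f (p + i)) = f (p + q) \<oplus> (\<Oplus>i\<in>{..<q}. f (p + i))"
    using Suc.prems by (simp add: lessThan_Suc finsum_insert)
  ultimately show ?case using Suc c by (simp add: a_ac)
qed

text \<open>
  Constants in the rational function field.
\<close>

definition const_fract :: "'l::field \<Rightarrow> 'l poly fract" where "const_fract l = Fract [:l:] 1"

lemma const_fract_simps: "const_fract (x + y) = const_fract x + const_fract y"
  "const_fract (x * y) = const_fract x * const_fract y" "const_fract 1 = 1"
  by (simp_all add: const_fract_def pCons_one mult.commute flip: One_fract_def)

lemma ratfun_embedding_eq: "ratfun_embedding \<iota> c = const_fract (\<iota> c)"
  by (simp add: ratfun_embedding_def const_fract_def)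

text \<open>
  The power \<open>t\<^sup>k\<close> of the coordinate of the affine line.
\<close>

definition tpow :: "nat \<Rightarrow> 'l::field poly fract" where "tpow k = Fract (monom 1 k) 1"

lemma tpow_simps: "tpow 0 = 1" "tpow i * tpow j = tpow (i + j)"
  by (simp_all add: tpow_def mult_monom flip: One_fract_def)

lemma ratfun_value_monomial: "ratfun_value (const_fract l * tpow k) c (c ^ k * l)"
  unfolding ratfun_value_def
  by (rule exI[of _ "smult l (monom 1 k)"], rule exI[of _ 1]) (simp add: const_fract_def tpow_def poly_monom)

text \<open>
  The multiplier of a curve is nonzero as a rational function since its value at 0 is.
\<close>

lemma quartic_nonzero:
  fixes m :: "nat \<Rightarrow> 'l::field"
  assumes "m 0 \<noteq> 0"
  shows "const_fract (m 0) + tpow 1 * const_fract (m 1) + tpow 2 * const_fract (m 2) + tpow 3 * const_fract (m 3)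
    + tpow 4 * const_fract (m 4) \<noteq> 0" (is "?M \<noteq> 0")
proof -
  define p where "p = [:m 0:] + monom 1 1 * [:m 1:] + monom 1 2 * [:m 2:] + monom 1 3 * [:m 3:] + monom 1 4 * [:m 4:]"
  have "?M = Fract p 1" by (simp add: p_def const_fract_def tpow_def)
  moreover have "poly p 0 = m 0" by (simp add: p_def poly_monom)
  then have "p \<noteq> 0" using assms by auto
  ultimately show ?thesis by (simp add: Zero_fract_def eq_fract)
qed

context algebra_extension begin

lemma tensor_value_zero: "tensor_value \<iota> A c \<zero>\<^bsub>base_change (ratfun_embedding \<iota>) A\<^esub> \<zero>\<^bsub>B\<^esub>"
  if "ring (base_change (ratfun_embedding \<iota> :: 'k \<Rightarrow> 'l poly fract) A)"
proof -
  interpret T: ring "base_change (ratfun_embedding \<iota> :: 'k \<Rightarrow> 'l poly fract) A" by fact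
  show ?thesis unfolding tensor_value_def by (intro exI[of _ "0::nat"]) simp
qed

lemma ratfun_field_extension: "field_extension (ratfun_embedding \<iota>)"
  by (auto simp: field_extension_def ring_hom_def ring_of_type_algebra_def ratfun_embedding_eq const_fract_simps)

lemma tensor_value_add:
  assumes "tensor_value \<iota> A c g h" "tensor_value \<iota> A c g' h'"
  shows "tensor_value \<iota> A c (g \<oplus>\<^bsub>base_change (ratfun_embedding \<iota>) A\<^esub> g') (h \<oplus>\<^bsub>B\<^esub> h')"
proof -
  interpret T: algebra_extension A "ratfun_embedding \<iota>" by unfold_locales (rule ratfun_field_extension)
  obtain p :: nat and a r v where 1: "\<And>i. i < p \<Longrightarrow> a i \<in> carrier A" "\<And>i. i < p \<Longrightarrow> ratfun_value (r i) c (v i)"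
    "g = (\<Oplus>\<^bsub>T.B\<^esub>i\<in>{..<p}. T.pt (a i) (r i))" "h = (\<Oplus>\<^bsub>B\<^esub>i\<in>{..<p}. pt (a i) (v i))"
    using assms(1) unfolding tensor_value_def by (elim exE conjE) blast
  obtain q :: nat and a' r' v' where 2: "\<And>i. i < q \<Longrightarrow> a' i \<in> carrier A" "\<And>i. i < q \<Longrightarrow> ratfun_value (r' i) c (v' i)"
    "g' = (\<Oplus>\<^bsub>T.B\<^esub>i\<in>{..<q}. T.pt (a' i) (r' i))" "h' = (\<Oplus>\<^bsub>B\<^esub>i\<in>{..<q}. pt (a' i) (v' i))"
    using assms(2) unfolding tensor_value_def by (elim exE conjE) blast
  define a'' where "a'' i = (if i < p then a i else a' (i - p))" for i
  define r'' where "r'' i = (if i < p then r i else r' (i - p))" for i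
  define v'' where "v'' i = (if i < p then v i else v' (i - p))" for i
  have c: "a'' i \<in> carrier A \<and> ratfun_value (r'' i) c (v'' i)" if "i < p + q" for i
    using that 1(1,2)[of i] 2(1,2)[of "i - p"] by (auto simp: a''_def r''_def v''_def)
  have "(\<Oplus>\<^bsub>T.B\<^esub>i\<in>{..<p + q}. T.pt (a'' i) (r'' i)) = (\<Oplus>\<^bsub>T.B\<^esub>i\<in>{..<p}. T.pt (a'' i) (r'' i)) \<oplus>\<^bsub>T.B\<^esub> (\<Oplus>\<^bsub>T.B\<^esub>i\<in>{..<q}. T.pt (a'' (p + i)) (r'' (p + i)))"
    by (rule T.B.finsum_lessThan_add) (use c in auto)
  also have "(\<Oplus>\<^bsub>T.B\<^esub>i\<in>{..<p}. T.pt (a'' i) (r'' i)) = g" unfolding 1(3)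
    by (rule T.B.finsum_cong') (use 1 in \<open>auto simp: a''_def r''_def\<close>)
  also have "(\<Oplus>\<^bsub>T.B\<^esub>i\<in>{..<q}. T.pt (a'' (p + i)) (r'' (p + i))) = g'" unfolding 2(3)
    by (rule T.B.finsum_cong') (use 2 in \<open>auto simp: a''_def r''_def\<close>)
  finally have G: "g \<oplus>\<^bsub>T.B\<^esub> g' = (\<Oplus>\<^bsub>T.B\<^esub>i\<in>{..<p + q}. T.pt (a'' i) (r'' i))" by simp
  have "(\<Oplus>\<^bsub>B\<^esub>i\<in>{..<p + q}. pt (a'' i) (v'' i)) = (\<Oplus>\<^bsub>B\<^esub>i\<in>{..<p}. pt (a'' i) (v'' i)) \<oplus>\<^bsub>B\<^esub> (\<Oplus>\<^bsub>B\<^esub>i\<in>{..<q}. pt (a'' (p + i)) (v'' (p + i)))"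
    by (rule B.finsum_lessThan_add) (use c in auto)
  also have "(\<Oplus>\<^bsub>B\<^esub>i\<in>{..<p}. pt (a'' i) (v'' i)) = h" unfolding 1(4)
    by (rule B.finsum_cong') (use 1 in \<open>auto simp: a''_def v''_def\<close>)
  also have "(\<Oplus>\<^bsub>B\<^esub>i\<in>{..<q}. pt (a'' (p + i)) (v'' (p + i))) = h'" unfolding 2(4)
    by (rule B.finsum_cong') (use 2 in \<open>auto simp: a''_def v''_def\<close>)
  finally have H: "h \<oplus>\<^bsub>B\<^esub> h' = (\<Oplus>\<^bsub>B\<^esub>i\<in>{..<p + q}. pt (a'' i) (v'' i))" by simp
  show ?thesis unfolding tensor_value_def
    by (rule exI[of _ "p + q"], rule exI[of _ a''], rule exI[of _ r''], rule exI[of _ v'']) (use c G H in blast)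
qed

lemma tensor_value_pt:
  assumes a: "a \<in> carrier A" and r: "ratfun_value r c v"
  shows "tensor_value \<iota> A c (pure_tensor (ratfun_embedding \<iota>) A a r) (pt a v)"
proof -
  interpret T: algebra_extension A "ratfun_embedding \<iota>" by unfold_locales (rule ratfun_field_extension)
  have *: "{..<Suc 0} = insert (0::nat) {}" by auto
  have "T.pt a r = (\<Oplus>\<^bsub>T.B\<^esub>i\<in>{..<Suc 0}. T.pt a r)" "pt a v = (\<Oplus>\<^bsub>B\<^esub>i\<in>{..<Suc 0}. pt a v)"
    unfolding * using a by (simp_all add: T.B.finsum_insert B.finsum_insert)
  then show ?thesis unfolding tensor_value_def
    by (intro exI[of _ "Suc 0"] exI[of _ "\<lambda>_. a"] exI[of _ "\<lambda>_. r"] exI[of _ "\<lambda>_. v"]) (use a r in auto)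
qed

definition scalar_class where "scalar_class x = {c \<odot>\<^bsub>B\<^esub> x | c. c \<noteq> 0}"

lemma B_smult_closed [simp]: "x \<in> carrier B \<Longrightarrow> c \<odot>\<^bsub>B\<^esub> x \<in> carrier B"
  by (simp add: B_smult)

lemma B_smult_one: "x \<in> carrier B \<Longrightarrow> 1 \<odot>\<^bsub>B\<^esub> x = x"
  by (simp add: B_smult pt_one)

lemma scalar_class_self: "x \<in> carrier B \<Longrightarrow> x \<in> scalar_class x"
  unfolding scalar_class_def by (intro CollectI exI[of _ 1]) (simp add: B_smult_one)

text \<open>
  The cosets of the scalars are the punctured lines through similitudes.
\<close>

lemma PSim_points_carrier: "carrier (PSim_points A \<sigma> \<iota>) = scalar_class ` similitudes B (base_change_map \<iota> A \<sigma>)"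
proof -
  have "{c \<odot>\<^bsub>B\<^esub> \<one>\<^bsub>B\<^esub> | c. c \<noteq> 0} #>\<^bsub>Sim B (base_change_map \<iota> A \<sigma>)\<^esub> x = scalar_class x" if "x \<in> carrier B" for x
  proof -
    have "(c \<odot>\<^bsub>B\<^esub> \<one>\<^bsub>B\<^esub>) \<otimes>\<^bsub>B\<^esub> x = c \<odot>\<^bsub>B\<^esub> x" for c using that by (simp add: B_smult)
    then show ?thesis unfolding r_coset_def scalar_class_def Sim_def units_of_def by auto
  qed
  moreover have "similitudes B (base_change_map \<iota> A \<sigma>) \<subseteq> carrier B" by (auto simp: similitudes_def Units_def)
  ultimately show ?thesis
    unfolding PSim_points_def PSim_def FactGroup_def RCOSETS_def by (auto simp: Sim_def)
qed

end

context based_extension begin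

abbreviation BS where "BS \<equiv> hat ` carrier B"

lemma hat_eq_iff: "x \<in> carrier B \<Longrightarrow> y \<in> carrier B \<Longrightarrow> hat x = hat y \<longleftrightarrow> x = y"
  using hat_inj by (auto simp: inj_on_def)

text \<open>
  In a similitude the inverse is a multiple of the adjoint, so the multiplier can be computed on either side.
\<close>

lemma similitudes_iff: "x \<in> similitudes B bm \<longleftrightarrow> x \<in> carrier B \<and> star_algebra.simil sc_op star_op BS (hat x)"
proof -
  interpret S: star_algebra sc_op star_op BS by (rule hat_star_algebra)
  show ?thesis
  proof
    assume "x \<in> similitudes B bm"
    then obtain y c where x: "x \<in> carrier B" and y: "y \<in> carrier B" "x \<otimes>\<^bsub>B\<^esub> y = \<one>\<^bsub>B\<^esub>" and c: "c \<noteq> 0" "bm x \<otimes>\<^bsub>B\<^esub> x = c \<odot>\<^bsub>B\<^esub> \<one>\<^bsub>B\<^esub>"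
      unfolding similitudes_def Units_def by auto
    have xy: "hat x * hat y = 1" using hat(2)[OF x y(1)] y hat_one by simp
    have sx: "star_op (hat x) * hat x = sc_op c 1" using hat(2)[of "bm x" x] x c hat_star[OF x] hat_one hat_smult[of "\<one>\<^bsub>B\<^esub>" c] by simp
    have "star_op (hat x) = star_op (hat x) * (hat x * hat y)" by (simp add: xy)
    also have "\<dots> = sc_op c (hat y)" unfolding mult.assoc[symmetric] sx by simp
    finally have "hat x * star_op (hat x) = sc_op c 1" by (simp add: xy)
    then show "x \<in> carrier B \<and> S.simil (hat x)" using x sx c unfolding S.simil_def by blast
  next
    assume a: "x \<in> carrier B \<and> S.simil (hat x)"
    then obtain c where x: "x \<in> carrier B" and c: "c \<noteq> 0" "star_op (hat x) * hat x = sc_op c 1" "hat x * star_op (hat x) = sc_op c 1"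
      unfolding S.simil_def by blast
    define y where "y = (1 / c) \<odot>\<^bsub>B\<^esub> bm x"
    have y: "y \<in> carrier B" using x by (simp add: y_def)
    have hy: "hat y = sc_op (1 / c) (star_op (hat x))" using x by (simp add: y_def hat_smult hat_star)
    have 1: "y \<otimes>\<^bsub>B\<^esub> x = \<one>\<^bsub>B\<^esub>" "x \<otimes>\<^bsub>B\<^esub> y = \<one>\<^bsub>B\<^esub>"
      using hat_eq_iff[of "y \<otimes>\<^bsub>B\<^esub> x" "\<one>\<^bsub>B\<^esub>"] hat_eq_iff[of "x \<otimes>\<^bsub>B\<^esub> y" "\<one>\<^bsub>B\<^esub>"] x y c by (simp_all add: hat hy hat_one)
    have 2: "bm x \<otimes>\<^bsub>B\<^esub> x = c \<odot>\<^bsub>B\<^esub> \<one>\<^bsub>B\<^esub>"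
      using hat_eq_iff[of "bm x \<otimes>\<^bsub>B\<^esub> x" "c \<odot>\<^bsub>B\<^esub> \<one>\<^bsub>B\<^esub>"] x c by (simp add: hat hat_one hat_smult hat_star)
    show "x \<in> similitudes B bm" unfolding similitudes_def Units_def using x y 1 2 c by blast
  qed
qed

text \<open>
  The curve is the point \<open>g = x\<^sub>0 + t x\<^sub>1 + t\<^sup>2 x\<^sub>2\<close> of \<open>A \<otimes> L(t)\<close>. Its multiplier is computed after the homomorphism \<open>H\<close>, which
  extends scalars from \<open>L\<close> to \<open>L(t)\<close>: coefficients of the multiplier that are scalars over \<open>L\<close> remain so.
\<close>

lemma path_directly_R_equivalent:
  assumes p: "star_algebra.simil_path sc_op star_op BS f0 f1 f2"
    and x: "x \<in> similitudes B bm" "s \<noteq> 0" "f0 = sc_op s (hat x)"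
    and y: "y \<in> similitudes B bm" "t \<noteq> 0" "f0 + f1 + f2 = sc_op t (hat y)"
  shows "(scalar_class x, scalar_class y) \<in> directly_R_equivalent A \<sigma> \<iota>"
proof -
  interpret S: star_algebra sc_op star_op BS by (rule hat_star_algebra)
  let ?e = "ratfun_embedding \<iota>"
  interpret T: based_extension A ?e \<sigma> n b
    by unfold_locales (use ratfun_field_extension inv basis n in auto)
  interpret TS: star_algebra sc_op star_op T.BS by (rule T.hat_star_algebra)
  have xB: "x \<in> carrier B" and yB: "y \<in> carrier B" using x y similitudes_iff by auto
  obtain m where m: "S.poly_mult_scalar (star_op f0) (star_op f1) (star_op f2) f0 f1 f2 m"
    "S.poly_mult_scalar f0 f1 f2 (star_op f0) (star_op f1) (star_op f2) m" "m 0 \<noteq> 0"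
    using p unfolding S.simil_path_def by blast
  obtain x0 x1 x2 where X: "x0 \<in> carrier B" "x1 \<in> carrier B" "x2 \<in> carrier B" "f0 = hat x0" "f1 = hat x1" "f2 = hat x2"
    using p unfolding S.simil_path_def by blast
  have "\<exists>H. (\<forall>x\<in>carrier B. \<forall>y\<in>carrier B. H (x \<oplus>\<^bsub>B\<^esub> y) = H x + H y \<and> H (x \<otimes>\<^bsub>B\<^esub> y) = H x * H y) \<and>
     (\<forall>a\<in>carrier A. \<forall>l. H (pt a l) = sc_op (const_fract l) (T.rho a))"
  proof (rule hom_exists[of T.rho "\<lambda>l. sc_op (const_fract l) 1"])
    fix H
    assume h: "\<And>x y. x \<in> carrier B \<Longrightarrow> y \<in> carrier B \<Longrightarrow> H (x \<oplus>\<^bsub>B\<^esub> y) = H x + H y"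
      "\<And>x y. x \<in> carrier B \<Longrightarrow> y \<in> carrier B \<Longrightarrow> H (x \<otimes>\<^bsub>B\<^esub> y) = H x * H y"
      "\<And>a l. a \<in> carrier A \<Longrightarrow> H (pt a l) = T.rho a * sc_op (const_fract l) 1"
    show ?thesis by (rule exI[of _ H]) (simp add: h)
  qed (auto simp: T.rho_simps R.scale_left_distrib const_fract_simps ratfun_embedding_eq)
  then obtain H where H: "\<And>x y. x \<in> carrier B \<Longrightarrow> y \<in> carrier B \<Longrightarrow> H (x \<oplus>\<^bsub>B\<^esub> y) = H x + H y"
    "\<And>x y. x \<in> carrier B \<Longrightarrow> y \<in> carrier B \<Longrightarrow> H (x \<otimes>\<^bsub>B\<^esub> y) = H x * H y"
    "\<And>a l. a \<in> carrier A \<Longrightarrow> H (pt a l) = sc_op (const_fract l) (T.rho a)" by blast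
  have H_zero: "H \<zero>\<^bsub>B\<^esub> = 0" using H(1)[of "\<zero>\<^bsub>B\<^esub>" "\<zero>\<^bsub>B\<^esub>"] by simp
  have H_star: "H (bm z) = star_op (H z)" if "z \<in> carrier B" for z
    using that by (induction rule: B_induct) (auto simp: bm_zero H_zero H bm_add T.rho_simps)
  have H_scalar: "H z = sc_op (const_fract c) 1" if z: "z \<in> carrier B" "hat z = sc_op c 1" for z c
  proof -
    have "z = pt \<one>\<^bsub>A\<^esub> c" using hat_eq_iff[of z "pt \<one>\<^bsub>A\<^esub> c"] z by (simp add: hat rho_simps)
    then show ?thesis by (simp add: H T.rho_simps)
  qed
  have curve: "\<exists>G\<in>carrier T.B. T.hat G = sc_op (tpow k) (H z) \<and> (\<forall>c. tensor_value \<iota> A c G (c ^ k \<odot>\<^bsub>B\<^esub> z))"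
    if "z \<in> carrier B" for z k
    using that
  proof (induction rule: B_induct)
    case zero
    have "c \<odot>\<^bsub>B\<^esub> \<zero>\<^bsub>B\<^esub> = \<zero>\<^bsub>B\<^esub>" for c by (simp add: B_smult)
    then show ?case
      by (intro bexI[of _ "\<zero>\<^bsub>T.B\<^esub>"]) (simp_all add: T.hat_zero H_zero tensor_value_zero T.B_ring)
  next
    case (pt a l)
    have "tensor_value \<iota> A c (T.pt a (const_fract l * tpow k)) (c ^ k \<odot>\<^bsub>B\<^esub> pt a l)" for c
      using tensor_value_pt[OF pt ratfun_value_monomial] pt by (simp add: smult_pt)
    then show ?case using pt
      by (intro bexI[of _ "T.pt a (const_fract l * tpow k)"]) (simp_all add: T.hat H mult.commute)
  next
    case (add z w)
    from add.IH obtain G G' where G: "G \<in> carrier T.B" "T.hat G = sc_op (tpow k) (H z)" "\<And>c. tensor_value \<iota> A c G (c ^ k \<odot>\<^bsub>B\<^esub> z)"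
      "G' \<in> carrier T.B" "T.hat G' = sc_op (tpow k) (H w)" "\<And>c. tensor_value \<iota> A c G' (c ^ k \<odot>\<^bsub>B\<^esub> w)" by blast
    have "c \<odot>\<^bsub>B\<^esub> (z \<oplus>\<^bsub>B\<^esub> w) = c \<odot>\<^bsub>B\<^esub> z \<oplus>\<^bsub>B\<^esub> c \<odot>\<^bsub>B\<^esub> w" for c using add.hyps by (simp add: B_smult B.r_distr)
    then show ?case using G add.hyps
      by (intro bexI[of _ "G \<oplus>\<^bsub>T.B\<^esub> G'"]) (simp_all add: T.hat H R.scale_right_distrib tensor_value_add)
  qed
  obtain G0 where G0: "G0 \<in> carrier T.B" "T.hat G0 = sc_op (tpow 0) (H x0)" "\<And>c. tensor_value \<iota> A c G0 (c ^ 0 \<odot>\<^bsub>B\<^esub> x0)"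
    using curve[OF X(1)] by blast
  obtain G1 where G1: "G1 \<in> carrier T.B" "T.hat G1 = sc_op (tpow 1) (H x1)" "\<And>c. tensor_value \<iota> A c G1 (c ^ 1 \<odot>\<^bsub>B\<^esub> x1)"
    using curve[OF X(2)] by blast
  obtain G2 where G2: "G2 \<in> carrier T.B" "T.hat G2 = sc_op (tpow 2) (H x2)" "\<And>c. tensor_value \<iota> A c G2 (c ^ 2 \<odot>\<^bsub>B\<^esub> x2)"
    using curve[OF X(3)] by blast
  define g where "g = G0 \<oplus>\<^bsub>T.B\<^esub> G1 \<oplus>\<^bsub>T.B\<^esub> G2"
  have gB: "g \<in> carrier T.B" using G0 G1 G2 by (simp add: g_def)
  have hg: "T.hat g = H x0 + sc_op (tpow 1) (H x1) + sc_op (tpow 2) (H x2)"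
    using G0 G1 G2 by (simp add: g_def T.hat tpow_simps)
  have val: "tensor_value \<iota> A c g (x0 \<oplus>\<^bsub>B\<^esub> c \<odot>\<^bsub>B\<^esub> x1 \<oplus>\<^bsub>B\<^esub> (c\<^sup>2) \<odot>\<^bsub>B\<^esub> x2)" for c
    using tensor_value_add[OF tensor_value_add[OF G0(3)[of c] G1(3)[of c]] G2(3)[of c]] X B_smult_one
    by (simp add: g_def)
  define M where "M = const_fract (m 0) + tpow 1 * const_fract (m 1) + tpow 2 * const_fract (m 2) + tpow 3 * const_fract (m 3)
    + tpow 4 * const_fract (m 4)"
  have M0: "M \<noteq> 0" unfolding M_def using m(3) by (rule quartic_nonzero)
  have prod: "(H z0 + sc_op (tpow 1) (H z1) + sc_op (tpow 2) (H z2)) * (H w0 + sc_op (tpow 1) (H w1) + sc_op (tpow 2) (H w2)) = sc_op M 1"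
    if z: "z0 \<in> carrier B" "z1 \<in> carrier B" "z2 \<in> carrier B" and w: "w0 \<in> carrier B" "w1 \<in> carrier B" "w2 \<in> carrier B"
      and pm: "S.poly_mult_scalar (hat z0) (hat z1) (hat z2) (hat w0) (hat w1) (hat w2) m" for z0 z1 z2 w0 w1 w2
  proof -
    have e: "H z0 * H w0 = sc_op (const_fract (m 0)) 1"
      "H z0 * H w1 + H z1 * H w0 = sc_op (const_fract (m 1)) 1"
      "H z0 * H w2 + H z1 * H w1 + H z2 * H w0 = sc_op (const_fract (m 2)) 1"
      "H z1 * H w2 + H z2 * H w1 = sc_op (const_fract (m 3)) 1"
      "H z2 * H w2 = sc_op (const_fract (m 4)) 1"
      using H_scalar[of "z0 \<otimes>\<^bsub>B\<^esub> w0" "m 0"] H_scalar[of "z0 \<otimes>\<^bsub>B\<^esub> w1 \<oplus>\<^bsub>B\<^esub> z1 \<otimes>\<^bsub>B\<^esub> w0" "m 1"]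
        H_scalar[of "z0 \<otimes>\<^bsub>B\<^esub> w2 \<oplus>\<^bsub>B\<^esub> z1 \<otimes>\<^bsub>B\<^esub> w1 \<oplus>\<^bsub>B\<^esub> z2 \<otimes>\<^bsub>B\<^esub> w0" "m 2"]
        H_scalar[of "z1 \<otimes>\<^bsub>B\<^esub> w2 \<oplus>\<^bsub>B\<^esub> z2 \<otimes>\<^bsub>B\<^esub> w1" "m 3"] H_scalar[of "z2 \<otimes>\<^bsub>B\<^esub> w2" "m 4"] pm z w
      unfolding S.poly_mult_scalar_def by (simp_all add: H hat)
    have "(H z0 + sc_op (tpow 1) (H z1) + sc_op (tpow 2) (H z2)) * (H w0 + sc_op (tpow 1) (H w1) + sc_op (tpow 2) (H w2)) =
      H z0 * H w0 + sc_op (tpow 1) (H z0 * H w1 + H z1 * H w0) + sc_op (tpow 2) (H z0 * H w2 + H z1 * H w1 + H z2 * H w0) +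
      sc_op (tpow 3) (H z1 * H w2 + H z2 * H w1) + sc_op (tpow 4) (H z2 * H w2)"
      by (simp add: algebra_simps tpow_simps numeral_eq_Suc)
    also have "\<dots> = sc_op M 1" unfolding e M_def by (simp add: R.scale_left_distrib)
    finally show ?thesis .
  qed
  have star_g: "star_op (T.hat g) = H (bm x0) + sc_op (tpow 1) (H (bm x1)) + sc_op (tpow 2) (H (bm x2))"
    using X by (simp add: hg H_star)
  have "T.hat g * star_op (T.hat g) = sc_op M 1"
    unfolding star_g unfolding hg by (rule prod) (use X m(2) in \<open>auto simp: hat_star\<close>)
  moreover have "star_op (T.hat g) * T.hat g = sc_op M 1"
    unfolding star_g unfolding hg by (rule prod) (use X m(1) in \<open>auto simp: hat_star\<close>)
  ultimately have "TS.simil (T.hat g)" using M0 gB unfolding TS.simil_def by blast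
  then have gs: "g \<in> similitudes T.B T.bm" using T.similitudes_iff gB by blast
  have x0: "x0 = s \<odot>\<^bsub>B\<^esub> x" using hat_eq_iff[of x0 "s \<odot>\<^bsub>B\<^esub> x"] x(3) X xB by (simp add: hat_smult)
  have y0: "x0 \<oplus>\<^bsub>B\<^esub> x1 \<oplus>\<^bsub>B\<^esub> x2 = t \<odot>\<^bsub>B\<^esub> y"
    using hat_eq_iff[of "x0 \<oplus>\<^bsub>B\<^esub> x1 \<oplus>\<^bsub>B\<^esub> x2" "t \<odot>\<^bsub>B\<^esub> y"] y(3) X yB by (simp add: hat hat_smult)
  have "tensor_value \<iota> A 0 g (s \<odot>\<^bsub>B\<^esub> x)" unfolding x0[symmetric] using val[of 0] X by (simp add: B_smult pt_zero)
  moreover have "tensor_value \<iota> A 1 g (t \<odot>\<^bsub>B\<^esub> y)" using val[of 1] X by (simp add: B_smult_one flip: y0)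
  moreover have "s \<odot>\<^bsub>B\<^esub> x \<in> scalar_class x" "t \<odot>\<^bsub>B\<^esub> y \<in> scalar_class y" using x y by (auto simp: scalar_class_def)
  moreover have "g \<in> T.scalar_class g" using gB by (rule T.scalar_class_self)
  ultimately have "PSim_map_value A \<sigma> \<iota> (T.scalar_class g) 0 (scalar_class x) \<and>
     PSim_map_value A \<sigma> \<iota> (T.scalar_class g) 1 (scalar_class y)"
    unfolding PSim_map_value_def T.PSim_points_carrier PSim_points_carrier using gs x(1) y(1) by blast
  then show ?thesis unfolding directly_R_equivalent_def by blast
qed

lemma singleton_of_triv:
  assumes triv: "\<And>g. star_algebra.simil sc_op star_op BS g \<Longrightarrow> star_algebra.triv sc_op star_op BS g"
  shows "is_singleton (carrier (PSim_points A \<sigma> \<iota>) // R_equivalence A \<sigma> \<iota>)"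
proof -
  interpret S: star_algebra sc_op star_op BS by (rule hat_star_algebra)
  let ?C = "carrier (PSim_points A \<sigma> \<iota>)"
  have one: "\<one>\<^bsub>B\<^esub> \<in> similitudes B bm" using similitudes_iff hat_one S.simil_one by simp
  have all: "(scalar_class \<one>\<^bsub>B\<^esub>, scalar_class x) \<in> E"
    if E: "equiv ?C E" "directly_R_equivalent A \<sigma> \<iota> \<subseteq> E" and x: "x \<in> similitudes B bm" for E x
  proof -
    have step: "(scalar_class z, scalar_class w) \<in> E"
      if l: "S.linked (hat z) (hat w)" and zw: "z \<in> carrier B" "w \<in> carrier B" for z w
    proof -
      from l obtain f0 f1 f2 s t where f: "S.simil (hat z)" "S.simil (hat w)" "S.simil_path f0 f1 f2" "s \<noteq> 0" "t \<noteq> 0"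
        "f0 = sc_op s (hat z)" "f0 + f1 + f2 = sc_op t (hat w)" unfolding S.linked_def by blast
      then show ?thesis using path_directly_R_equivalent[OF f(3), of z s w t] similitudes_iff zw E(2) by blast
    qed
    have conn: "S.conn 1 (hat x)" using triv[of "hat x"] x similitudes_iff S.triv_def by blast
    have "\<exists>y\<in>carrier B. hat y = g \<and> (scalar_class \<one>\<^bsub>B\<^esub>, scalar_class y) \<in> E" if "S.conn 1 g" for g
      using that unfolding S.conn_def
    proof (induction rule: rtranclp_induct)
      case base
      have "scalar_class \<one>\<^bsub>B\<^esub> \<in> ?C" using one by (simp add: PSim_points_carrier)
      then have "(scalar_class \<one>\<^bsub>B\<^esub>, scalar_class \<one>\<^bsub>B\<^esub>) \<in> E" using E(1) by (simp add: equiv_def refl_on_def)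
      then show ?case using hat_one B.one_closed by blast
    next
      case (step g h)
      then obtain y where y: "y \<in> carrier B" "hat y = g" "(scalar_class \<one>\<^bsub>B\<^esub>, scalar_class y) \<in> E" by blast
      have "h \<in> BS" using step(2) S.similD unfolding symclp_def S.linked_def by blast
      then obtain w where w: "w \<in> carrier B" "hat w = h" by blast
      have "(scalar_class y, scalar_class w) \<in> E"
        using step(2) unfolding symclp_def
      proof
        assume "S.linked g h" then show ?thesis using \<open>\<And>z w. S.linked (hat z) (hat w) \<Longrightarrow> z \<in> carrier B \<Longrightarrow> w \<in> carrier B \<Longrightarrow> (scalar_class z, scalar_class w) \<in> E\<close> y w by blast
      next
        assume "S.linked h g"
        then have "(scalar_class w, scalar_class y) \<in> E" using \<open>\<And>z w. S.linked (hat z) (hat w) \<Longrightarrow> z \<in> carrier B \<Longrightarrow> w \<in> carrier B \<Longrightarrow> (scalar_class z, scalar_class w) \<in> E\<close> y w by blast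
        then show ?thesis using E(1) by (meson equiv_def symD)
      qed
      then have "(scalar_class \<one>\<^bsub>B\<^esub>, scalar_class w) \<in> E" using y(3) E(1) by (meson equiv_def transD)
      then show ?case using w by blast
    qed
    from this[OF conn] obtain y where "y \<in> carrier B" "hat y = hat x" "(scalar_class \<one>\<^bsub>B\<^esub>, scalar_class y) \<in> E" by blast
    then show ?thesis using hat_eq_iff x similitudes_iff by blast
  qed
  have R: "R_equivalence A \<sigma> \<iota> = ?C \<times> ?C"
  proof
    have "equiv ?C (?C \<times> ?C)" by (auto simp: equiv_def refl_on_def sym_def trans_def)
    moreover have "directly_R_equivalent A \<sigma> \<iota> \<subseteq> ?C \<times> ?C"
      by (auto simp: directly_R_equivalent_def PSim_map_value_def)
    ultimately show "R_equivalence A \<sigma> \<iota> \<subseteq> ?C \<times> ?C" unfolding R_equivalence_def by blast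
    show "?C \<times> ?C \<subseteq> R_equivalence A \<sigma> \<iota>" unfolding R_equivalence_def
    proof (intro subsetI InterI)
      fix p E assume p: "p \<in> ?C \<times> ?C" and E: "E \<in> {E. equiv ?C E \<and> directly_R_equivalent A \<sigma> \<iota> \<subseteq> E}"
      obtain x y where xy: "p = (scalar_class x, scalar_class y)" "x \<in> similitudes B bm" "y \<in> similitudes B bm"
        using p by (auto simp: PSim_points_carrier)
      have "(scalar_class \<one>\<^bsub>B\<^esub>, scalar_class x) \<in> E" "(scalar_class \<one>\<^bsub>B\<^esub>, scalar_class y) \<in> E" using all E xy by auto
      moreover have "sym E" "trans E" using E by (auto simp: equiv_def)
      ultimately show "p \<in> E" unfolding xy(1) by (meson symD transD)
    qed
  qed
  have "scalar_class \<one>\<^bsub>B\<^esub> \<in> ?C" using one by (simp add: PSim_points_carrier)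
  then have "?C // R_equivalence A \<sigma> \<iota> = {?C}" unfolding R quotient_def by auto
  then show ?thesis by simp
qed

end

theorem theorem3p2:
  fixes A :: "('k::field, 'a) module"
    and \<sigma> :: "'a \<Rightarrow> 'a"
    and \<kappa> :: "'k \<Rightarrow> 'm::field"
  assumes "CHAR('k) \<noteq> 2"
    and "algebra_with_symplectic_involution \<kappa> A \<sigma>"
    and "alg_deg A = 8"
    and "alg_ind A \<le> 2"
  shows "PSim_R_trivial TYPE('l::field) A \<sigma>"
proof -
  have two: "(2::'k) \<noteq> 0"
  proof
    assume "(2::'k) = 0"
    then have "of_nat 2 = (0::'k)" by simp
    then have "CHAR('k) dvd 2" by (simp only: of_nat_eq_0_iff_char_dvd)
    then have "CHAR('k) = 1 \<or> CHAR('k) = 2" using two_is_prime_nat prime_nat_iff by blast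
    then show False using assms(1) CHAR_not_1' by auto
  qed
  have cs: "central_simple A" and inv: "involution A \<sigma>" and ext: "field_extension \<kappa>" and so: "symplectic_over \<kappa> A \<sigma>"
    using assms(2) by (auto simp: algebra_with_symplectic_involution_def)
  obtain b where b: "csa_involution A \<sigma> 64 b" using csa_involution_exists[OF cs inv assms(3)] .
  interpret C: csa_involution A \<sigma> 64 b by (rule b)
  interpret P: symplectic_csa sc_op star_op C.S by (rule C.is_symplectic_csa[OF ext so two refl])
  obtain e i j \<alpha> \<beta> x1 x2 x3 x4 where q: "quaternion_frame sc_op star_op C.S e i j \<alpha> \<beta>"
    "quaternion_frame.frame sc_op star_op C.S e x1 x2 x3 x4"
    using P.symplectic_frame_exists C.corner_dim_le_of_index[OF assms(4)] by blast
  show ?thesis unfolding PSim_R_trivial_def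
  proof (intro allI impI)
    fix \<iota> :: "'k \<Rightarrow> 'l" assume ext: "field_extension \<iota>"
    interpret L: based_extension A \<iota> \<sigma> 64 b
      by unfold_locales (use ext C.inv C.basis in auto)
    show "is_singleton (carrier (PSim_points A \<sigma> \<iota>) // R_equivalence A \<sigma> \<iota>)"
      by (rule L.singleton_of_triv[OF C.extended_similitude_triv[OF L.based_extension_axioms two q]])
  qed
qed

end
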